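(* Let $\mathcal K$ be a 2-category which admits Eilenberg-Moore constructions for both monads and comonads and in which idempotent 2-cells split. Then the pseudo-functors $$\mathrm{Entw}^w(\mathcal K)\xrightarrow{A}\mathrm{Cmd}(\mathrm{Mnd}^\iota(\mathcal K))\xrightarrow{\mathrm{Cmd}(Q)}\mathrm{Cmd}(\mathcal K)\xrightarrow{J_*}\mathcal K$$ and $$\mathrm{Entw}^w(\mathcal K)\xrightarrow{B}\mathrm{Mnd}(\mathrm{Cmd}^\pi(\mathcal K))\xrightarrow{\mathrm{Mnd}(Q_* )}\mathrm{Mnd}(\mathcal K)\xrightarrow{J}\mathcal K$$ are pseudo-naturally equivalent. In particular, for any weak entwining structure $((t,\mu,\eta),(c,\delta,\varepsilon),\psi)$ in $\mathcal K$, the monad $\mathrm{Mnd}(Q_* )((t,\psi):c\to c,\ \mu,\eta)$ and the comonad $\mathrm{Cmd}(Q)((c,\psi):t\to t,\ \delta,\varepsilon)$ in $\mathcal K$ possess equivalent Eilenberg-Moore objects.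
   Context: In a 2-category $\mathcal K$, horizontal composition is written by juxtaposition and vertical composition by $\ast$ (with $\beta\ast\alpha$ meaning "first $\alpha$, then $\beta$"); a 0-cell also denotes its identity 1-cell and a 1-cell also denotes its identity 2-cell. $\mathcal K_*$ denotes the vertical opposite of $\mathcal K$ (2-cells reversed). Idempotent 2-cells split in $\mathcal K$ if for any $\Theta:V\Rightarrow V$ with $\Theta\ast\Theta=\Theta$ there are a 1-cell $\widehat V$ and 2-cells $\pi:V\Rightarrow\widehat V$, $\iota:\widehat V\Rightarrow V$ with $\pi\ast\iota=\widehat V$ and $\iota\ast\pi=\Theta$. $\mathrm{Mnd}(\mathcal K)$ is Street's 2-category of monads: 0-cells are monads $(t:k\to k,\mu,\eta)$; 1-cells $t\to t'$ are pairs $(V:k\to k',\ \psi:t'V\Rightarrow Vt)$ with $V\mu\ast\psi t\ast t'\psi=\psi\ast\mu'V$ and $\psi\ast\eta'V=V\eta$; 2-cells $(V,\psi)\Rightarrow(W,\phi)$ are 2-cells $\omega:V\Rightarrow W$ with $\omega t\ast\psi=\phi\ast t'\omega$. $\mathrm{Cmd}(\mathcal K):=\mathrm{Mnd}(\mathcal K_* )_*$: 0-cells are comonads $(c,\delta,\varepsilon)$; 1-cells $c\to c'$ are pairs $(V,\ \psi:Vc\Rightarrow c'V)$ with $\delta'V\ast\psi=c'\psi\ast\psi c\ast V\delta$ and $\varepsilon'V\ast\psi=V\varepsilon$; 2-cells $(V,\psi)\Rightarrow(W,\phi)$ are 2-cells $\omega$ with $\phi\ast\omega c=c'\omega\ast\psi$.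 $I:\mathcal K\to\mathrm{Mnd}(\mathcal K)$ is the inclusion 2-functor $k\mapsto(k,k,k)$ (identity monad), $V\mapsto(V,V)$, $\omega\mapsto\omega$; $I_*:\mathcal K\to\mathrm{Cmd}(\mathcal K)$ is the analogous inclusion. $\mathcal K$ admits Eilenberg-Moore constructions for monads (resp. comonads) if $I$ has a right 2-adjoint $J$ (resp. $I_*$ has a right 2-adjoint $J_*$); the Eilenberg-Moore object of a monad $t$ is $J(t)$, that of a comonad $c$ is $J_*(c)$. Each monad $t$ on $k$ has a canonical adjunction $(f:k\to J(t),\ v:J(t)\to k,\ \epsilon:fv\Rightarrow J(t),\ \eta:k\Rightarrow vf)$ with $(t,\mu,\eta)=(vf,v\epsilon f,\eta)$; for a monad $t'$ it is denoted $(f',v',\epsilon',\eta')$, etc. $\mathrm{Mnd}^\iota(\mathcal K)$ is the following 2-category: 0-cells are monads in $\mathcal K$; 1-cells $t\to t'$ are pairs $(V:k\to k',\ \psi:t'V\Rightarrow Vt)$ with $V\mu\ast\psi t\ast t'\psi=\psi\ast\mu'V$; 2-cells $(V,\psi)\Rightarrow(W,\phi)$ are 2-cells $\omega:V\Rightarrow W$ with $\omega t\ast\psi=W\mu\ast\phi t\ast t'\omega t\ast t'\psi\ast t'\eta'V$; compositions are as in $\mathcal K$ (composite of 1-cells: $(V',\psi')(V,\psi)=(V'V,V'\psi\ast\psi'V)$; identity $(k,t)$). $\mathrm{Cmd}^\pi(\mathcal K):=\mathrm{Mnd}^\iota(\mathcal K_* )_*$: 0-cells are comonads; 1-cells $c\to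 c'$ are pairs $(V,\ \psi:Vc\Rightarrow c'V)$ with $\delta'V\ast\psi=c'\psi\ast\psi c\ast V\delta$; 2-cells $(V,\psi)\Rightarrow(W,\phi)$ are $\omega:V\Rightarrow W$ with $\phi\ast\omega c=c'\varepsilon'W\ast c'\phi\ast c'\omega c\ast\psi c\ast V\delta$. The pseudo-functor $Q:\mathrm{Mnd}^\iota(\mathcal K)\to\mathcal K$ (defined when $J$ exists and idempotent 2-cells split): $Q(t)=J(t)$. For each 1-cell $(V,\psi):t\to t'$ choose a splitting $Vv\overset{\pi}{\Rightarrow}v'Q(V,\psi)\overset{\iota}{\Rightarrow}Vv$ of the idempotent 2-cell $Vv\epsilon\ast\psi v\ast\eta'Vv:Vv\Rightarrow Vv$ (the trivial splitting if this 2-cell is an identity), where $Q(V,\psi):J(t)\to J(t')$ is the unique 1-cell whose composite with $v'$ is the chosen splitting object and which satisfies $v'\epsilon'Q(V,\psi)=\pi\ast Vv\epsilon\ast\psi v\ast t'\iota$. For a 2-cell $\omega:(V,\psi)\Rightarrow(W,\phi)$, $Q(\omega)$ is the unique 2-cell with $v'Q(\omega)=\pi\ast\omega v\ast\iota$. The coherence isomorphism $\gamma:Q((V',\psi')(V,\psi))\Rightarrow Q(V',\psi')Q(V,\psi)$ is the unique 2-cell with $v''\gamma=\pi Q(V,\psi)\ast V'\pi\ast\iota$; $Q$ strictly preserves identity 1-cells, and restricted to $\mathrm{Mnd}(\mathcal K)$ it equals $J$. It is known that $Q$ is a pseudo-functor, independent of the choices up to pseudo-natural isomorphism. $Q_*:\mathrm{Cmd}^\pi(\mathcal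 K)\to\mathcal K$ is the pseudo-functor obtained by performing this construction in $\mathcal K_*$ (and taking vertical opposites); it extends $J_*$. A pseudo-functor $F:\mathcal A\to\mathcal B$ of 2-categories induces a pseudo-functor $\mathrm{Cmd}(F):\mathrm{Cmd}(\mathcal A)\to\mathrm{Cmd}(\mathcal B)$: a comonad $(c:a\to a,\delta,\varepsilon)$ goes to $F(c)$ with comultiplication $F(c)\Rightarrow F(cc)\cong F(c)F(c)$ and counit $F(c)\Rightarrow F(1_a)\cong 1_{F(a)}$; a 1-cell $(V,\psi)$ goes to $F(V)$ with $F(V)F(c)\cong F(Vc)\xrightarrow{F(\psi)}F(c'V)\cong F(c')F(V)$; a 2-cell $\omega$ goes to $F(\omega)$; coherence isomorphisms are those of $F$. $\mathrm{Mnd}(F)$ is defined dually. A weak entwining structure in $\mathcal K$ is a triple of a monad $(t:k\to k,\mu,\eta)$, a comonad $(c:k\to k,\delta,\varepsilon)$ and a 2-cell $\psi:tc\Rightarrow ct$ with $\psi\ast\mu c=c\mu\ast\psi t\ast t\psi$, $\ \delta t\ast\psi=c\psi\ast\psi c\ast t\delta$, $\ \psi\ast\eta c=c\varepsilon t\ast c\psi\ast c\eta c\ast\delta$, $\ \varepsilon t\ast\psi=\mu\ast t\varepsilon t\ast t\psi\ast t\eta c$. Equivalently, $((c,\psi):t\to t,\delta,\varepsilon)$ is a comonad in $\mathrm{Mnd}^\iota(\mathcal K)$ and $((t,\psi):c\to c,\mu,\eta)$ is a monad in $\mathrm{Cmd}^\pi(\mathcal K)$. $\mathrm{Entw}^w(\mathcal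 K)$ is the 2-category whose 0-cells are weak entwining structures $(t,c,\psi)$; whose 1-cells $(t,c,\psi)\to(t',c',\psi')$ are triples $(W:k\to k',\ \alpha:t'W\Rightarrow Wt,\ \beta:Wc\Rightarrow c'W)$ such that $((W,\alpha),\beta)$ is a 1-cell $((c,\psi),\delta,\varepsilon)\to((c',\psi'),\delta',\varepsilon')$ in $\mathrm{Cmd}(\mathrm{Mnd}^\iota(\mathcal K))$ and $((W,\beta),\alpha)$ is a 1-cell $((t,\psi),\mu,\eta)\to((t',\psi'),\mu',\eta')$ in $\mathrm{Mnd}(\mathrm{Cmd}^\pi(\mathcal K))$; whose 2-cells are 2-cells $\omega:W\Rightarrow W'$ of $\mathcal K$ that are 2-cells both $((W,\alpha),\beta)\Rightarrow((W',\alpha'),\beta')$ in $\mathrm{Cmd}(\mathrm{Mnd}^\iota(\mathcal K))$ and $((W,\beta),\alpha)\Rightarrow((W',\beta'),\alpha')$ in $\mathrm{Mnd}(\mathrm{Cmd}^\pi(\mathcal K))$; compositions are as in $\mathcal K$. $A:\mathrm{Entw}^w(\mathcal K)\to\mathrm{Cmd}(\mathrm{Mnd}^\iota(\mathcal K))$ is the 2-functor $(t,c,\psi)\mapsto((c,\psi):t\to t,\delta,\varepsilon)$, $(W,\alpha,\beta)\mapsto((W,\alpha),\beta)$, $\omega\mapsto\omega$. $B:\mathrm{Entw}^w(\mathcal K)\to\mathrm{Mnd}(\mathrm{Cmd}^\pi(\mathcal K))$ is the 2-functor $(t,c,\psi)\mapsto((t,\psi):c\to c,\mu,\eta)$, $(W,\alpha,\beta)\mapsto((W,\beta),\alpha)$,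 $\omega\mapsto\omega$. *)

theory Defs
  imports Main
begin

text \<open>
  Strict 2-categories are given by carrier sets of 0-, 1- and 2-cells; every 1-cell and every
  2-cell determines its source and target.  Juxtaposition of 1-cells is \<open>\<cdot>\<close>,
  vertical composition is \<open>\<ast>\<close> (\<open>\<beta> \<ast> \<alpha>\<close>: first \<open>\<alpha>\<close>, then \<open>\<beta>\<close>), horizontal composition of
  2-cells is \<open>\<star>\<close>; in all cases the cell applied last is written on the left.
\<close>

section \<open>2-categories\<close>

record ('o, 'm, 'c) two_cat =
  obs :: "'o set"
  ones :: "'m set"
  twos :: "'c set"
  s1 :: "'m \<Rightarrow> 'o"
  t1 :: "'m \<Rightarrow> 'o"
  s2 :: "'c \<Rightarrow> 'm"
  t2 :: "'c \<Rightarrow> 'm"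
  id1 :: "'o \<Rightarrow> 'm"
  id2 :: "'m \<Rightarrow> 'c"
  cmp1 :: "'m \<Rightarrow> 'm \<Rightarrow> 'm"  (infixr \<open>\<cdot>\<index>\<close> 75)
  vcmp :: "'c \<Rightarrow> 'c \<Rightarrow> 'c"  (infixr \<open>\<ast>\<index>\<close> 60)
  hcmp :: "'c \<Rightarrow> 'c \<Rightarrow> 'c"  (infixr \<open>\<star>\<index>\<close> 70)

definition hom1 :: "('o, 'm, 'c) two_cat \<Rightarrow> 'o \<Rightarrow> 'o \<Rightarrow> 'm set" where
  "hom1 K a b = {f \<in> ones K. s1 K f = a \<and> t1 K f = b}"

definition hom2 :: "('o, 'm, 'c) two_cat \<Rightarrow> 'm \<Rightarrow> 'm \<Rightarrow> 'c set" where
  "hom2 K f g = {\<alpha> \<in> twos K. s2 K \<alpha> = f \<and> t2 K \<alpha> = g}"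

definition lwhisk :: "('o, 'm, 'c) two_cat \<Rightarrow> 'm \<Rightarrow> 'c \<Rightarrow> 'c"  (infixr \<open>\<triangleright>\<index>\<close> 65) where
  "g \<triangleright>\<^bsub>K\<^esub> \<alpha> = id2 K g \<star>\<^bsub>K\<^esub> \<alpha>"

definition rwhisk :: "('o, 'm, 'c) two_cat \<Rightarrow> 'c \<Rightarrow> 'm \<Rightarrow> 'c"  (infixl \<open>\<triangleleft>\<index>\<close> 66) where
  "\<alpha> \<triangleleft>\<^bsub>K\<^esub> f = \<alpha> \<star>\<^bsub>K\<^esub> id2 K f"

locale two_category =
  fixes K :: "('o, 'm, 'c) two_cat" (structure)
  assumes src_trg1: "f \<in> ones K \<Longrightarrow> s1 K f \<in> obs K \<and> t1 K f \<in> obs K"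
    and src_trg2: "\<alpha> \<in> twos K \<Longrightarrow> s2 K \<alpha> \<in> ones K \<and> t2 K \<alpha> \<in> ones K"
    and parallel: "\<alpha> \<in> twos K \<Longrightarrow> s1 K (s2 K \<alpha>) = s1 K (t2 K \<alpha>) \<and> t1 K (s2 K \<alpha>) = t1 K (t2 K \<alpha>)"
    and id1_hom: "a \<in> obs K \<Longrightarrow> id1 K a \<in> hom1 K a a"
    and cmp1_hom: "\<lbrakk>f \<in> hom1 K a b; g \<in> hom1 K b c\<rbrakk> \<Longrightarrow> g \<cdot> f \<in> hom1 K a c"
    and cmp1_assoc: "\<lbrakk>f \<in> hom1 K a b; g \<in> hom1 K b c; h \<in> hom1 K c d\<rbrakk> \<Longrightarrow> (h \<cdot> g) \<cdot> f = h \<cdot> (g \<cdot> f)"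
    and cmp1_id: "f \<in> hom1 K a b \<Longrightarrow> f \<cdot> id1 K a = f \<and> id1 K b \<cdot> f = f"
    and id2_hom: "f \<in> ones K \<Longrightarrow> id2 K f \<in> hom2 K f f"
    and vcmp_hom: "\<lbrakk>\<alpha> \<in> hom2 K f g; \<beta> \<in> hom2 K g h\<rbrakk> \<Longrightarrow> \<beta> \<ast> \<alpha> \<in> hom2 K f h"
    and vcmp_assoc: "\<lbrakk>\<alpha> \<in> hom2 K f g; \<beta> \<in> hom2 K g h; \<gamma> \<in> hom2 K h k\<rbrakk>
          \<Longrightarrow> (\<gamma> \<ast> \<beta>) \<ast> \<alpha> = \<gamma> \<ast> (\<beta> \<ast> \<alpha>)"
    and vcmp_id: "\<alpha> \<in> hom2 K f g \<Longrightarrow> \<alpha> \<ast> id2 K f = \<alpha> \<and> id2 K g \<ast> \<alpha> = \<alpha>"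
    and hcmp_hom: "\<lbrakk>f \<in> hom1 K a b; g \<in> hom1 K b c; \<alpha> \<in> hom2 K f f'; \<beta> \<in> hom2 K g g'\<rbrakk>
          \<Longrightarrow> \<beta> \<star> \<alpha> \<in> hom2 K (g \<cdot> f) (g' \<cdot> f')"
    and hcmp_assoc: "\<lbrakk>f \<in> hom1 K a b; g \<in> hom1 K b c; h \<in> hom1 K c d;
          \<alpha> \<in> hom2 K f f'; \<beta> \<in> hom2 K g g'; \<gamma> \<in> hom2 K h h'\<rbrakk>
          \<Longrightarrow> (\<gamma> \<star> \<beta>) \<star> \<alpha> = \<gamma> \<star> (\<beta> \<star> \<alpha>)"
    and hcmp_id: "\<lbrakk>f \<in> hom1 K a b; \<alpha> \<in> hom2 K f f'\<rbrakk>
          \<Longrightarrow> \<alpha> \<star> id2 K (id1 K a) = \<alpha> \<and> id2 K (id1 K b) \<star> \<alpha> = \<alpha>"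
    and hcmp_id2: "\<lbrakk>f \<in> hom1 K a b; g \<in> hom1 K b c\<rbrakk> \<Longrightarrow> id2 K g \<star> id2 K f = id2 K (g \<cdot> f)"
    and interchange: "\<lbrakk>f \<in> hom1 K a b; g \<in> hom1 K b c;
          \<alpha> \<in> hom2 K f f'; \<alpha>' \<in> hom2 K f' f''; \<beta> \<in> hom2 K g g'; \<beta>' \<in> hom2 K g' g''\<rbrakk>
          \<Longrightarrow> (\<beta>' \<ast> \<beta>) \<star> (\<alpha>' \<ast> \<alpha>) = (\<beta>' \<star> \<alpha>') \<ast> (\<beta> \<star> \<alpha>)"

definition vop :: "('o, 'm, 'c) two_cat \<Rightarrow> ('o, 'm, 'c) two_cat" where
  "vop K = K\<lparr>s2 := t2 K, t2 := s2 K, vcmp := (\<lambda>\<beta> \<alpha>. \<alpha> \<ast>\<^bsub>K\<^esub> \<beta>)\<rparr>"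

definition inverse_2cells :: "('o, 'm, 'c) two_cat \<Rightarrow> 'c \<Rightarrow> 'c \<Rightarrow> bool" where
  "inverse_2cells K \<alpha> \<beta> \<longleftrightarrow> \<alpha> \<in> twos K \<and> \<beta> \<in> hom2 K (t2 K \<alpha>) (s2 K \<alpha>)
     \<and> \<beta> \<ast>\<^bsub>K\<^esub> \<alpha> = id2 K (s2 K \<alpha>) \<and> \<alpha> \<ast>\<^bsub>K\<^esub> \<beta> = id2 K (t2 K \<alpha>)"

definition invertible_2cell :: "('o, 'm, 'c) two_cat \<Rightarrow> 'c \<Rightarrow> bool" where
  "invertible_2cell K \<alpha> \<longleftrightarrow> (\<exists>\<beta>. inverse_2cells K \<alpha> \<beta>)"

definition inv2 :: "('o, 'm, 'c) two_cat \<Rightarrow> 'c \<Rightarrow> 'c" where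
  "inv2 K \<alpha> = (THE \<beta>. inverse_2cells K \<alpha> \<beta>)"

definition equivalence_1cell :: "('o, 'm, 'c) two_cat \<Rightarrow> 'm \<Rightarrow> bool" where
  "equivalence_1cell K f \<longleftrightarrow> f \<in> ones K \<and>
     (\<exists>g \<in> hom1 K (t1 K f) (s1 K f).
        (\<exists>\<alpha> \<in> hom2 K (id1 K (s1 K f)) (g \<cdot>\<^bsub>K\<^esub> f). invertible_2cell K \<alpha>) \<and>
        (\<exists>\<beta> \<in> hom2 K (f \<cdot>\<^bsub>K\<^esub> g) (id1 K (t1 K f)). invertible_2cell K \<beta>))"

definition equivalent_objects :: "('o, 'm, 'c) two_cat \<Rightarrow> 'o \<Rightarrow> 'o \<Rightarrow> bool" where
  "equivalent_objects K a b \<longleftrightarrow> (\<exists>f \<in> hom1 K a b. equivalence_1cell K f)"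


section \<open>Pseudo-functors and pseudo-natural transformations\<close>

text \<open>The coherence 2-cells point as \<open>pcmp F g f : F (g f) \<Rightarrow> F g F f\<close> and \<open>punt F a : F 1\<^sub>a \<Rightarrow> 1\<^sub>F\<^sub>a\<close>.\<close>

record ('o, 'm, 'c, 'o1, 'm1, 'c1) psfun =
  on0 :: "'o \<Rightarrow> 'o1"
  on1 :: "'m \<Rightarrow> 'm1"
  on2 :: "'c \<Rightarrow> 'c1"
  pcmp :: "'m \<Rightarrow> 'm \<Rightarrow> 'c1"
  punt :: "'o \<Rightarrow> 'c1"

locale pseudo_functor = A: two_category A + B: two_category B
  for A :: "('o, 'm, 'c) two_cat"
    and B :: "('o1, 'm1, 'c1) two_cat" (structure)
    and F :: "('o, 'm, 'c, 'o1, 'm1, 'c1) psfun" +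
  assumes on0: "a \<in> obs A \<Longrightarrow> on0 F a \<in> obs B"
    and on1: "f \<in> hom1 A a b \<Longrightarrow> on1 F f \<in> hom1 B (on0 F a) (on0 F b)"
    and on2: "\<alpha> \<in> hom2 A f g \<Longrightarrow> on2 F \<alpha> \<in> hom2 B (on1 F f) (on1 F g)"
    and on2_id: "f \<in> ones A \<Longrightarrow> on2 F (id2 A f) = id2 B (on1 F f)"
    and on2_vcmp: "\<lbrakk>\<alpha> \<in> hom2 A f g; \<beta> \<in> hom2 A g h\<rbrakk>
          \<Longrightarrow> on2 F (\<beta> \<ast>\<^bsub>A\<^esub> \<alpha>) = on2 F \<beta> \<ast> on2 F \<alpha>"
    and pcmp: "\<lbrakk>f \<in> hom1 A a b; g \<in> hom1 A b c\<rbrakk>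
          \<Longrightarrow> pcmp F g f \<in> hom2 B (on1 F (g \<cdot>\<^bsub>A\<^esub> f)) (on1 F g \<cdot> on1 F f)
              \<and> invertible_2cell B (pcmp F g f)"
    and punt: "a \<in> obs A \<Longrightarrow> punt F a \<in> hom2 B (on1 F (id1 A a)) (id1 B (on0 F a))
              \<and> invertible_2cell B (punt F a)"
    and pcmp_natural: "\<lbrakk>f \<in> hom1 A a b; g \<in> hom1 A b c; \<alpha> \<in> hom2 A f f'; \<beta> \<in> hom2 A g g'\<rbrakk>
          \<Longrightarrow> pcmp F g' f' \<ast> on2 F (\<beta> \<star>\<^bsub>A\<^esub> \<alpha>) = (on2 F \<beta> \<star> on2 F \<alpha>) \<ast> pcmp F g f"
    and pcmp_assoc: "\<lbrakk>f \<in> hom1 A a b; g \<in> hom1 A b c; h \<in> hom1 A c d\<rbrakk>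
          \<Longrightarrow> (pcmp F h g \<triangleleft> on1 F f) \<ast> pcmp F (h \<cdot>\<^bsub>A\<^esub> g) f
              = (on1 F h \<triangleright> pcmp F g f) \<ast> pcmp F h (g \<cdot>\<^bsub>A\<^esub> f)"
    and pcmp_unit_right: "f \<in> hom1 A a b
          \<Longrightarrow> (on1 F f \<triangleright> punt F a) \<ast> pcmp F f (id1 A a) = id2 B (on1 F f)"
    and pcmp_unit_left: "f \<in> hom1 A a b
          \<Longrightarrow> (punt F b \<triangleleft> on1 F f) \<ast> pcmp F (id1 A b) f = id2 B (on1 F f)"

locale two_functor = pseudo_functor +
  assumes strict_cmp: "\<lbrakk>f \<in> hom1 A a b; g \<in> hom1 A b c\<rbrakk>
          \<Longrightarrow> on1 F (g \<cdot>\<^bsub>A\<^esub> f) = on1 F g \<cdot> on1 F f \<and> pcmp F g f = id2 B (on1 F (g \<cdot>\<^bsub>A\<^esub> f))"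
    and strict_id: "a \<in> obs A
          \<Longrightarrow> on1 F (id1 A a) = id1 B (on0 F a) \<and> punt F a = id2 B (on1 F (id1 A a))"

definition strict_psfun ::
  "('o, 'm, 'c) two_cat \<Rightarrow> ('o1, 'm1, 'c1) two_cat \<Rightarrow> ('o \<Rightarrow> 'o1) \<Rightarrow> ('m \<Rightarrow> 'm1) \<Rightarrow> ('c \<Rightarrow> 'c1)
     \<Rightarrow> ('o, 'm, 'c, 'o1, 'm1, 'c1) psfun" where
  "strict_psfun A B F0 F1 F2 =
     \<lparr>on0 = F0, on1 = F1, on2 = F2,
      pcmp = (\<lambda>g f. id2 B (F1 (g \<cdot>\<^bsub>A\<^esub> f))), punt = (\<lambda>a. id2 B (F1 (id1 A a)))\<rparr>"

definition id_psfun :: "('o, 'm, 'c) two_cat \<Rightarrow> ('o, 'm, 'c, 'o, 'm, 'c) psfun" where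
  "id_psfun A = strict_psfun A A (\<lambda>a. a) (\<lambda>f. f) (\<lambda>\<alpha>. \<alpha>)"

text \<open>Composition \<open>G F\<close>; the first argument is the codomain of \<open>G\<close>.\<close>

definition comp_psfun ::
  "('o2, 'm2, 'c2) two_cat \<Rightarrow> ('o1, 'm1, 'c1, 'o2, 'm2, 'c2) psfun
     \<Rightarrow> ('o, 'm, 'c, 'o1, 'm1, 'c1) psfun \<Rightarrow> ('o, 'm, 'c, 'o2, 'm2, 'c2) psfun" where
  "comp_psfun C G F =
     \<lparr>on0 = (\<lambda>a. on0 G (on0 F a)), on1 = (\<lambda>f. on1 G (on1 F f)), on2 = (\<lambda>\<alpha>. on2 G (on2 F \<alpha>)),
      pcmp = (\<lambda>g f. pcmp G (on1 F g) (on1 F f) \<ast>\<^bsub>C\<^esub> on2 G (pcmp F g f)),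
      punt = (\<lambda>a. punt G (on0 F a) \<ast>\<^bsub>C\<^esub> on2 G (punt F a))\<rparr>"

text \<open>A pseudo-functor \<open>A \<rightarrow> B\<close> regarded as one \<open>vop A \<rightarrow> vop B\<close>: the coherence cells get inverted
  in order to point in the standard direction again.\<close>

definition vop_psfun ::
  "('o1, 'm1, 'c1) two_cat \<Rightarrow> ('o, 'm, 'c, 'o1, 'm1, 'c1) psfun \<Rightarrow> ('o, 'm, 'c, 'o1, 'm1, 'c1) psfun" where
  "vop_psfun B F = F\<lparr>pcmp := (\<lambda>g f. inv2 B (pcmp F g f)), punt := (\<lambda>a. inv2 B (punt F a))\<rparr>"

locale pseudo_natural = F: pseudo_functor A B F + G: pseudo_functor A B G
  for A :: "('o, 'm, 'c) two_cat"
    and B :: "('o1, 'm1, 'c1) two_cat" (structure)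
    and F G :: "('o, 'm, 'c, 'o1, 'm1, 'c1) psfun" +
  fixes \<sigma>0 :: "'o \<Rightarrow> 'm1" and \<sigma>1 :: "'m \<Rightarrow> 'c1"
  assumes comp0: "a \<in> obs A \<Longrightarrow> \<sigma>0 a \<in> hom1 B (on0 F a) (on0 G a)"
    and comp1: "f \<in> hom1 A a b
          \<Longrightarrow> \<sigma>1 f \<in> hom2 B (on1 G f \<cdot> \<sigma>0 a) (\<sigma>0 b \<cdot> on1 F f) \<and> invertible_2cell B (\<sigma>1 f)"
    and natural: "\<lbrakk>f \<in> hom1 A a b; \<alpha> \<in> hom2 A f g\<rbrakk>
          \<Longrightarrow> (\<sigma>0 b \<triangleright> on2 F \<alpha>) \<ast> \<sigma>1 f = \<sigma>1 g \<ast> (on2 G \<alpha> \<triangleleft> \<sigma>0 a)"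
    and coherent_cmp: "\<lbrakk>f \<in> hom1 A a b; g \<in> hom1 A b c\<rbrakk>
          \<Longrightarrow> (\<sigma>0 c \<triangleright> pcmp F g f) \<ast> \<sigma>1 (g \<cdot>\<^bsub>A\<^esub> f)
              = (\<sigma>1 g \<triangleleft> on1 F f) \<ast> (on1 G g \<triangleright> \<sigma>1 f) \<ast> (pcmp G g f \<triangleleft> \<sigma>0 a)"
    and coherent_id: "a \<in> obs A
          \<Longrightarrow> (\<sigma>0 a \<triangleright> punt F a) \<ast> \<sigma>1 (id1 A a) = punt G a \<triangleleft> \<sigma>0 a"

definition pseudo_naturally_equivalent ::
  "('o, 'm, 'c) two_cat \<Rightarrow> ('o1, 'm1, 'c1) two_cat \<Rightarrow> ('o, 'm, 'c, 'o1, 'm1, 'c1) psfun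
     \<Rightarrow> ('o, 'm, 'c, 'o1, 'm1, 'c1) psfun \<Rightarrow> bool" where
  "pseudo_naturally_equivalent A B F G \<longleftrightarrow>
     pseudo_functor A B F \<and> pseudo_functor A B G \<and>
     (\<exists>\<sigma>0 \<sigma>1. pseudo_natural A B F G \<sigma>0 \<sigma>1 \<and> (\<forall>a \<in> obs A. equivalence_1cell B (\<sigma>0 a)))"

definition two_natural ::
  "('o, 'm, 'c) two_cat \<Rightarrow> ('o1, 'm1, 'c1) two_cat \<Rightarrow> ('o, 'm, 'c, 'o1, 'm1, 'c1) psfun
     \<Rightarrow> ('o, 'm, 'c, 'o1, 'm1, 'c1) psfun \<Rightarrow> ('o \<Rightarrow> 'm1) \<Rightarrow> bool" where
  "two_natural A B F G \<sigma> \<longleftrightarrow>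
     (\<forall>a \<in> obs A. \<sigma> a \<in> hom1 B (on0 F a) (on0 G a)) \<and>
     (\<forall>a b. \<forall>f \<in> hom1 A a b. on1 G f \<cdot>\<^bsub>B\<^esub> \<sigma> a = \<sigma> b \<cdot>\<^bsub>B\<^esub> on1 F f) \<and>
     (\<forall>a b f g. \<forall>\<alpha> \<in> hom2 A f g. f \<in> hom1 A a b
        \<longrightarrow> on2 G \<alpha> \<triangleleft>\<^bsub>B\<^esub> \<sigma> a = \<sigma> b \<triangleright>\<^bsub>B\<^esub> on2 F \<alpha>)"

text \<open>\<open>G\<close> is right 2-adjoint to \<open>F\<close>, with unit \<open>u : 1 \<Rightarrow> G F\<close> and counit \<open>e : F G \<Rightarrow> 1\<close>.\<close>

definition two_adjunction ::
  "('o, 'm, 'c) two_cat \<Rightarrow> ('o1, 'm1, 'c1) two_cat \<Rightarrow> ('o, 'm, 'c, 'o1, 'm1, 'c1) psfun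
     \<Rightarrow> ('o1, 'm1, 'c1, 'o, 'm, 'c) psfun \<Rightarrow> ('o \<Rightarrow> 'm) \<Rightarrow> ('o1 \<Rightarrow> 'm1) \<Rightarrow> bool" where
  "two_adjunction A B F G u e \<longleftrightarrow>
     two_functor A B F \<and> two_functor B A G \<and>
     two_natural A A (id_psfun A) (comp_psfun A G F) u \<and>
     two_natural B B (comp_psfun B F G) (id_psfun B) e \<and>
     (\<forall>a \<in> obs A. e (on0 F a) \<cdot>\<^bsub>B\<^esub> on1 F (u a) = id1 B (on0 F a)) \<and>
     (\<forall>b \<in> obs B. on1 G (e b) \<cdot>\<^bsub>A\<^esub> u (on0 G b) = id1 A (on0 G b))"


section \<open>The 2-categories of monads and of comonads\<close>

datatype ('o, 'm, 'c) mon = Mon (mob: 'o) (mcar: 'm) (mmult: 'c) (munit: 'c)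

datatype ('o, 'm, 'c) mon1 =
  Mon1 (src1: "('o, 'm, 'c) mon") (trg1: "('o, 'm, 'c) mon") (und1: 'm) (str1: 'c)

datatype ('o, 'm, 'c) mon2 =
  Mon2 (src2: "('o, 'm, 'c) mon1") (trg2: "('o, 'm, 'c) mon1") (und2: 'c)

definition is_monad :: "('o, 'm, 'c) two_cat \<Rightarrow> ('o, 'm, 'c) mon \<Rightarrow> bool" where
  "is_monad K T \<longleftrightarrow> (case T of Mon k t \<mu> \<eta> \<Rightarrow>
     k \<in> obs K \<and> t \<in> hom1 K k k \<and> \<mu> \<in> hom2 K (t \<cdot>\<^bsub>K\<^esub> t) t \<and> \<eta> \<in> hom2 K (id1 K k) t \<and>
     \<mu> \<ast>\<^bsub>K\<^esub> (t \<triangleright>\<^bsub>K\<^esub> \<mu>) = \<mu> \<ast>\<^bsub>K\<^esub> (\<mu> \<triangleleft>\<^bsub>K\<^esub> t) \<and>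
     \<mu> \<ast>\<^bsub>K\<^esub> (t \<triangleright>\<^bsub>K\<^esub> \<eta>) = id2 K t \<and> \<mu> \<ast>\<^bsub>K\<^esub> (\<eta> \<triangleleft>\<^bsub>K\<^esub> t) = id2 K t)"

text \<open>Comonads in \<open>K\<close> are monads in \<open>vop K\<close>: \<open>Mon k c \<delta> \<epsilon>\<close>.\<close>

abbreviation is_comonad :: "('o, 'm, 'c) two_cat \<Rightarrow> ('o, 'm, 'c) mon \<Rightarrow> bool" where
  "is_comonad K \<equiv> is_monad (vop K)"

context
  fixes K :: "('o, 'm, 'c) two_cat" (structure)
begin

text \<open>1-cells of \<open>Mnd\<^sup>\<iota>\<close>: only compatibility with the multiplications is required.\<close>

definition is_mndi1 :: "('o, 'm, 'c) mon1 \<Rightarrow> bool" where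
  "is_mndi1 X \<longleftrightarrow> (case X of Mon1 T T' V \<psi> \<Rightarrow>
     is_monad K T \<and> is_monad K T' \<and> V \<in> hom1 K (mob T) (mob T') \<and>
     \<psi> \<in> hom2 K (mcar T' \<cdot> V) (V \<cdot> mcar T) \<and>
     (V \<triangleright> mmult T) \<ast> (\<psi> \<triangleleft> mcar T) \<ast> (mcar T' \<triangleright> \<psi>) = \<psi> \<ast> (mmult T' \<triangleleft> V))"

definition is_mnd1 :: "('o, 'm, 'c) mon1 \<Rightarrow> bool" where
  "is_mnd1 X \<longleftrightarrow> is_mndi1 X \<and> (case X of Mon1 T T' V \<psi> \<Rightarrow>
     \<psi> \<ast> (munit T' \<triangleleft> V) = V \<triangleright> munit T)"

definition is_mnd2 :: "('o, 'm, 'c) mon2 \<Rightarrow> bool" where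
  "is_mnd2 x \<longleftrightarrow> (case x of Mon2 X Y \<omega> \<Rightarrow>
     is_mnd1 X \<and> is_mnd1 Y \<and> src1 X = src1 Y \<and> trg1 X = trg1 Y \<and>
     \<omega> \<in> hom2 K (und1 X) (und1 Y) \<and>
     (\<omega> \<triangleleft> mcar (src1 X)) \<ast> str1 X = str1 Y \<ast> (mcar (trg1 X) \<triangleright> \<omega>))"

definition is_mndi2 :: "('o, 'm, 'c) mon2 \<Rightarrow> bool" where
  "is_mndi2 x \<longleftrightarrow> (case x of Mon2 X Y \<omega> \<Rightarrow>
     is_mndi1 X \<and> is_mndi1 Y \<and> src1 X = src1 Y \<and> trg1 X = trg1 Y \<and>
     \<omega> \<in> hom2 K (und1 X) (und1 Y) \<and>
     (let t = mcar (src1 X); t' = mcar (trg1 X) in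
      (\<omega> \<triangleleft> t) \<ast> str1 X =
        (und1 Y \<triangleright> mmult (src1 X)) \<ast> (str1 Y \<triangleleft> t) \<ast> (t' \<triangleright> \<omega> \<triangleleft> t) \<ast> (t' \<triangleright> str1 X)
          \<ast> (t' \<triangleright> munit (trg1 X) \<triangleleft> und1 X)))"

definition id_mon1 :: "('o, 'm, 'c) mon \<Rightarrow> ('o, 'm, 'c) mon1" where
  "id_mon1 T = Mon1 T T (id1 K (mob T)) (id2 K (mcar T))"

definition cmp_mon1 :: "('o, 'm, 'c) mon1 \<Rightarrow> ('o, 'm, 'c) mon1 \<Rightarrow> ('o, 'm, 'c) mon1" where
  "cmp_mon1 Y X = Mon1 (src1 X) (trg1 Y) (und1 Y \<cdot> und1 X)
     ((und1 Y \<triangleright> str1 X) \<ast> (str1 Y \<triangleleft> und1 X))"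

text \<open>All compositions of 2-cells are as in \<open>K\<close>; the 2-category \<open>Mnd\<close> and its variant \<open>Mnd\<^sup>\<iota>\<close>
  differ in their sets of 1- and 2-cells only.\<close>

definition mnd_like ::
  "('o, 'm, 'c) mon1 set \<Rightarrow> ('o, 'm, 'c) mon2 set
     \<Rightarrow> (('o, 'm, 'c) mon, ('o, 'm, 'c) mon1, ('o, 'm, 'c) mon2) two_cat" where
  "mnd_like C1 C2 =
     \<lparr>obs = {T. is_monad K T}, ones = C1, twos = C2,
      s1 = src1, t1 = trg1, s2 = src2, t2 = trg2,
      id1 = id_mon1, id2 = (\<lambda>X. Mon2 X X (id2 K (und1 X))),
      cmp1 = cmp_mon1,
      vcmp = (\<lambda>y x. Mon2 (src2 x) (trg2 y) (und2 y \<ast> und2 x)),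
      hcmp = (\<lambda>y x. Mon2 (cmp_mon1 (src2 y) (src2 x)) (cmp_mon1 (trg2 y) (trg2 x))
                      (und2 y \<star> und2 x))\<rparr>"

definition mnd :: "(('o, 'm, 'c) mon, ('o, 'm, 'c) mon1, ('o, 'm, 'c) mon2) two_cat" where
  "mnd = mnd_like {X. is_mnd1 X} {x. is_mnd2 x}"

definition mndi :: "(('o, 'm, 'c) mon, ('o, 'm, 'c) mon1, ('o, 'm, 'c) mon2) two_cat" where
  "mndi = mnd_like {X. is_mndi1 X} {x. is_mndi2 x}"

end

text \<open>
  \<open>Cmd(K) = Mnd(K\<^sub>*)\<^sub>*\<close> and \<open>Cmd\<^sup>\<pi>(K) = Mnd\<^sup>\<iota>(K\<^sub>*)\<^sub>*\<close>.  Here \<open>Mon2 Y X \<omega>\<close> is a 2-cell \<open>Y \<Rightarrow> X\<close> of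
  \<open>Mnd(K\<^sub>*)\<close>, hence a 2-cell \<open>X \<Rightarrow> Y\<close> of \<open>Cmd(K)\<close>: the function \<open>Cmd2\<close> takes the source and the
  target in the order of \<open>Cmd(K)\<close>.
\<close>

definition cmd ::
  "('o, 'm, 'c) two_cat \<Rightarrow> (('o, 'm, 'c) mon, ('o, 'm, 'c) mon1, ('o, 'm, 'c) mon2) two_cat" where
  "cmd K = vop (mnd (vop K))"

definition cmdp ::
  "('o, 'm, 'c) two_cat \<Rightarrow> (('o, 'm, 'c) mon, ('o, 'm, 'c) mon1, ('o, 'm, 'c) mon2) two_cat" where
  "cmdp K = vop (mndi (vop K))"

abbreviation Cmd2 :: "('o, 'm, 'c) mon1 \<Rightarrow> ('o, 'm, 'c) mon1 \<Rightarrow> 'c \<Rightarrow> ('o, 'm, 'c) mon2" where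
  "Cmd2 X Y \<omega> \<equiv> Mon2 Y X \<omega>"

lemma is_comonad_iff:
  "is_comonad K (Mon k c \<delta> \<epsilon>) \<longleftrightarrow>
     k \<in> obs K \<and> c \<in> hom1 K k k \<and> \<delta> \<in> hom2 K c (c \<cdot>\<^bsub>K\<^esub> c) \<and> \<epsilon> \<in> hom2 K c (id1 K k) \<and>
     (c \<triangleright>\<^bsub>K\<^esub> \<delta>) \<ast>\<^bsub>K\<^esub> \<delta> = (\<delta> \<triangleleft>\<^bsub>K\<^esub> c) \<ast>\<^bsub>K\<^esub> \<delta> \<and>
     (c \<triangleright>\<^bsub>K\<^esub> \<epsilon>) \<ast>\<^bsub>K\<^esub> \<delta> = id2 K c \<and> (\<epsilon> \<triangleleft>\<^bsub>K\<^esub> c) \<ast>\<^bsub>K\<^esub> \<delta> = id2 K c"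
  by (auto simp: is_monad_def vop_def hom1_def hom2_def lwhisk_def rwhisk_def)

lemma cmdp_1cell_iff:
  "Mon1 C C' V \<psi> \<in> ones (cmdp K) \<longleftrightarrow>
     is_comonad K C \<and> is_comonad K C' \<and> V \<in> hom1 K (mob C) (mob C') \<and>
     \<psi> \<in> hom2 K (V \<cdot>\<^bsub>K\<^esub> mcar C) (mcar C' \<cdot>\<^bsub>K\<^esub> V) \<and>
     (mmult C' \<triangleleft>\<^bsub>K\<^esub> V) \<ast>\<^bsub>K\<^esub> \<psi>
       = ((mcar C' \<triangleright>\<^bsub>K\<^esub> \<psi>) \<ast>\<^bsub>K\<^esub> (\<psi> \<triangleleft>\<^bsub>K\<^esub> mcar C)) \<ast>\<^bsub>K\<^esub> (V \<triangleright>\<^bsub>K\<^esub> mmult C)"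
  by (auto simp: cmdp_def mndi_def mnd_like_def is_mndi1_def vop_def hom1_def hom2_def
      lwhisk_def rwhisk_def)

lemma cmd_1cell_iff:
  "Mon1 C C' V \<psi> \<in> ones (cmd K) \<longleftrightarrow>
     Mon1 C C' V \<psi> \<in> ones (cmdp K) \<and> (munit C' \<triangleleft>\<^bsub>K\<^esub> V) \<ast>\<^bsub>K\<^esub> \<psi> = V \<triangleright>\<^bsub>K\<^esub> munit C"
  by (auto simp: cmdp_def cmd_def mndi_def mnd_def mnd_like_def is_mnd1_def vop_def lwhisk_def
      rwhisk_def)

lemma cmd_2cell_iff:
  "Cmd2 (Mon1 C C' V \<psi>) (Mon1 D D' W \<phi>) \<omega> \<in> twos (cmd K) \<longleftrightarrow>
     Mon1 C C' V \<psi> \<in> ones (cmd K) \<and> Mon1 D D' W \<phi> \<in> ones (cmd K) \<and> C = D \<and> C' = D' \<and>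
     \<omega> \<in> hom2 K V W \<and> \<phi> \<ast>\<^bsub>K\<^esub> (\<omega> \<triangleleft>\<^bsub>K\<^esub> mcar C) = (mcar C' \<triangleright>\<^bsub>K\<^esub> \<omega>) \<ast>\<^bsub>K\<^esub> \<psi>"
  by (auto simp: cmd_def mnd_def mnd_like_def is_mnd2_def vop_def hom2_def lwhisk_def rwhisk_def)

lemma cmdp_2cell_iff:
  "Cmd2 (Mon1 C C' V \<psi>) (Mon1 D D' W \<phi>) \<omega> \<in> twos (cmdp K) \<longleftrightarrow>
     Mon1 C C' V \<psi> \<in> ones (cmdp K) \<and> Mon1 D D' W \<phi> \<in> ones (cmdp K) \<and> C = D \<and> C' = D' \<and>
     \<omega> \<in> hom2 K V W \<and>
     \<phi> \<ast>\<^bsub>K\<^esub> (\<omega> \<triangleleft>\<^bsub>K\<^esub> mcar C)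
       = ((((mcar C' \<triangleright>\<^bsub>K\<^esub> munit C' \<triangleleft>\<^bsub>K\<^esub> W) \<ast>\<^bsub>K\<^esub> (mcar C' \<triangleright>\<^bsub>K\<^esub> \<phi>))
            \<ast>\<^bsub>K\<^esub> (mcar C' \<triangleright>\<^bsub>K\<^esub> \<omega> \<triangleleft>\<^bsub>K\<^esub> mcar C)) \<ast>\<^bsub>K\<^esub> (\<psi> \<triangleleft>\<^bsub>K\<^esub> mcar C)) \<ast>\<^bsub>K\<^esub> (V \<triangleright>\<^bsub>K\<^esub> mmult C)"
  by (auto simp: cmdp_def mndi_def mnd_like_def is_mndi2_def vop_def hom2_def lwhisk_def rwhisk_def
      Let_def)

text \<open>The action of a pseudo-functor \<open>F : A \<rightarrow> B\<close> on monads and on comonads.\<close>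

definition mnd_psfun ::
  "('o, 'm, 'c) two_cat \<Rightarrow> ('o1, 'm1, 'c1) two_cat \<Rightarrow> ('o, 'm, 'c, 'o1, 'm1, 'c1) psfun
     \<Rightarrow> (('o, 'm, 'c) mon, ('o, 'm, 'c) mon1, ('o, 'm, 'c) mon2,
         ('o1, 'm1, 'c1) mon, ('o1, 'm1, 'c1) mon1, ('o1, 'm1, 'c1) mon2) psfun" where
  "mnd_psfun A B F =
     (let
        F0 = (\<lambda>T. Mon (on0 F (mob T)) (on1 F (mcar T))
               (on2 F (mmult T) \<ast>\<^bsub>B\<^esub> inv2 B (pcmp F (mcar T) (mcar T)))
               (on2 F (munit T) \<ast>\<^bsub>B\<^esub> inv2 B (punt F (mob T))));
        F1 = (\<lambda>X. Mon1 (F0 (src1 X)) (F0 (trg1 X)) (on1 F (und1 X))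
               (pcmp F (und1 X) (mcar (src1 X)) \<ast>\<^bsub>B\<^esub> on2 F (str1 X)
                  \<ast>\<^bsub>B\<^esub> inv2 B (pcmp F (mcar (trg1 X)) (und1 X))))
      in \<lparr>on0 = F0, on1 = F1,
          on2 = (\<lambda>x. Mon2 (F1 (s2 (mnd A) x)) (F1 (t2 (mnd A) x)) (on2 F (und2 x))),
          pcmp = (\<lambda>Y X. Mon2 (F1 (Y \<cdot>\<^bsub>mnd A\<^esub> X)) (F1 Y \<cdot>\<^bsub>mnd B\<^esub> F1 X) (pcmp F (und1 Y) (und1 X))),
          punt = (\<lambda>T. Mon2 (F1 (id1 (mnd A) T)) (id1 (mnd B) (F0 T)) (punt F (mob T)))\<rparr>)"

definition cmd_psfun ::
  "('o, 'm, 'c) two_cat \<Rightarrow> ('o1, 'm1, 'c1) two_cat \<Rightarrow> ('o, 'm, 'c, 'o1, 'm1, 'c1) psfun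
     \<Rightarrow> (('o, 'm, 'c) mon, ('o, 'm, 'c) mon1, ('o, 'm, 'c) mon2,
         ('o1, 'm1, 'c1) mon, ('o1, 'm1, 'c1) mon1, ('o1, 'm1, 'c1) mon2) psfun" where
  "cmd_psfun A B F =
     (let
        F0 = (\<lambda>C. Mon (on0 F (mob C)) (on1 F (mcar C))
               (pcmp F (mcar C) (mcar C) \<ast>\<^bsub>B\<^esub> on2 F (mmult C))
               (punt F (mob C) \<ast>\<^bsub>B\<^esub> on2 F (munit C)));
        F1 = (\<lambda>X. Mon1 (F0 (src1 X)) (F0 (trg1 X)) (on1 F (und1 X))
               (pcmp F (mcar (trg1 X)) (und1 X) \<ast>\<^bsub>B\<^esub> on2 F (str1 X)
                  \<ast>\<^bsub>B\<^esub> inv2 B (pcmp F (und1 X) (mcar (src1 X)))))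
      in \<lparr>on0 = F0, on1 = F1,
          on2 = (\<lambda>x. Cmd2 (F1 (s2 (cmd A) x)) (F1 (t2 (cmd A) x)) (on2 F (und2 x))),
          pcmp = (\<lambda>Y X. Cmd2 (F1 (Y \<cdot>\<^bsub>cmd A\<^esub> X)) (F1 Y \<cdot>\<^bsub>cmd B\<^esub> F1 X) (pcmp F (und1 Y) (und1 X))),
          punt = (\<lambda>C. Cmd2 (F1 (id1 (cmd A) C)) (id1 (cmd B) (F0 C)) (punt F (mob C)))\<rparr>)"


section \<open>Eilenberg-Moore constructions\<close>

context
  fixes K :: "('o, 'm, 'c) two_cat" (structure)
begin

definition triv_monad :: "'o \<Rightarrow> ('o, 'm, 'c) mon" where
  "triv_monad k = Mon k (id1 K k) (id2 K (id1 K k)) (id2 K (id1 K k))"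

definition triv_mon1 :: "'m \<Rightarrow> ('o, 'm, 'c) mon1" where
  "triv_mon1 V = Mon1 (triv_monad (s1 K V)) (triv_monad (t1 K V)) V (id2 K V)"

definition incl_mnd ::
  "('o, 'm, 'c, ('o, 'm, 'c) mon, ('o, 'm, 'c) mon1, ('o, 'm, 'c) mon2) psfun" where
  "incl_mnd = strict_psfun K (mnd K) triv_monad triv_mon1
     (\<lambda>\<omega>. Mon2 (triv_mon1 (s2 K \<omega>)) (triv_mon1 (t2 K \<omega>)) \<omega>)"

definition incl_cmd ::
  "('o, 'm, 'c, ('o, 'm, 'c) mon, ('o, 'm, 'c) mon1, ('o, 'm, 'c) mon2) psfun" where
  "incl_cmd = strict_psfun K (cmd K) triv_monad triv_mon1
     (\<lambda>\<omega>. Cmd2 (triv_mon1 (s2 K \<omega>)) (triv_mon1 (t2 K \<omega>)) \<omega>)"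

end

lemma incl_cmd_eq: "incl_cmd K = incl_mnd (vop K)"
  by (simp add: incl_cmd_def incl_mnd_def strict_psfun_def cmd_def vop_def mnd_def mnd_like_def
      id_mon1_def triv_mon1_def triv_monad_def fun_eq_iff)

text \<open>A chosen right 2-adjoint of the inclusion, together with the unit and counit.\<close>

datatype ('o, 'm, 'c) em = EM
  (emJ: "(('o, 'm, 'c) mon, ('o, 'm, 'c) mon1, ('o, 'm, 'c) mon2, 'o, 'm, 'c) psfun")
  (em_unit: "'o \<Rightarrow> 'm")
  (em_counit: "('o, 'm, 'c) mon \<Rightarrow> ('o, 'm, 'c) mon1")

definition em_for_monads :: "('o, 'm, 'c) two_cat \<Rightarrow> ('o, 'm, 'c) em \<Rightarrow> bool" where
  "em_for_monads K E \<longleftrightarrow>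
     two_adjunction K (mnd K) (incl_mnd K) (emJ E) (em_unit E) (em_counit E)"

definition em_for_comonads :: "('o, 'm, 'c) two_cat \<Rightarrow> ('o, 'm, 'c) em \<Rightarrow> bool" where
  "em_for_comonads K E \<longleftrightarrow>
     two_adjunction K (cmd K) (incl_cmd K) (emJ E) (em_unit E) (em_counit E)"

context
  fixes K :: "('o, 'm, 'c) two_cat" (structure) and E :: "('o, 'm, 'c) em"
begin

text \<open>
  The canonical adjunction of a monad \<open>T\<close> on \<open>k\<close>.  The counit of the 2-adjunction at \<open>T\<close> is a 1-cell
  \<open>I (J T) \<rightarrow> T\<close>, i.e. \<open>v : J T \<rightarrow> k\<close> with an action \<open>t v \<Rightarrow> v\<close>.  The 1-cell \<open>f\<close> is the transpose
  of \<open>(t, \<mu>) : I k \<rightarrow> T\<close>, and \<open>\<epsilon> : f v \<Rightarrow> J T\<close> is the transpose of the action \<open>t v \<Rightarrow> v\<close>,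
  seen as a 2-cell \<open>counit (I (f v)) \<Rightarrow> counit\<close>; so \<open>v \<epsilon>\<close> is that action.
\<close>

definition em_v :: "('o, 'm, 'c) mon \<Rightarrow> 'm" where
  "em_v T = und1 (em_counit E T)"

definition em_f :: "('o, 'm, 'c) mon \<Rightarrow> 'm" where
  "em_f T = on1 (emJ E) (Mon1 (triv_monad K (mob T)) T (mcar T) (mmult T)) \<cdot> em_unit E (mob T)"

definition em_eps :: "('o, 'm, 'c) mon \<Rightarrow> 'c" where
  "em_eps T =
     on2 (emJ E)
       (Mon2 (em_counit E T \<cdot>\<^bsub>mnd K\<^esub> on1 (incl_mnd K) (em_f T \<cdot> em_v T)) (em_counit E T)
         (str1 (em_counit E T)))
     \<triangleleft> em_unit E (on0 (emJ E) T)"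

end


section \<open>The pseudo-functors \<open>Q\<close> and \<open>Q\<^sub>*\<close>\<close>

datatype ('m, 'c) splitting = Splitting (split_ob: 'm) (split_pr: 'c) (split_in: 'c)

definition is_splitting :: "('o, 'm, 'c) two_cat \<Rightarrow> 'c \<Rightarrow> ('m, 'c) splitting \<Rightarrow> bool" where
  "is_splitting K \<theta> S \<longleftrightarrow> (case S of Splitting W \<pi> \<iota> \<Rightarrow>
     W \<in> ones K \<and> \<pi> \<in> hom2 K (s2 K \<theta>) W \<and> \<iota> \<in> hom2 K W (s2 K \<theta>) \<and>
     \<pi> \<ast>\<^bsub>K\<^esub> \<iota> = id2 K W \<and> \<iota> \<ast>\<^bsub>K\<^esub> \<pi> = \<theta>)"

definition idempotent_2cells_split :: "('o, 'm, 'c) two_cat \<Rightarrow> bool" where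
  "idempotent_2cells_split K \<longleftrightarrow>
     (\<forall>V \<in> ones K. \<forall>\<theta> \<in> hom2 K V V. \<theta> \<ast>\<^bsub>K\<^esub> \<theta> = \<theta> \<longrightarrow> (\<exists>S. is_splitting K \<theta> S))"

context
  fixes K :: "('o, 'm, 'c) two_cat" (structure)
    and E :: "('o, 'm, 'c) em"
    and S :: "('o, 'm, 'c) mon1 \<Rightarrow> ('m, 'c) splitting"
begin

definition Q_idem :: "('o, 'm, 'c) mon1 \<Rightarrow> 'c" where
  "Q_idem X = (let V = und1 X; v = em_v E (src1 X) in
     (V \<cdot> v \<triangleright> em_eps K E (src1 X)) \<ast> (str1 X \<triangleleft> v) \<ast> (munit (trg1 X) \<triangleleft> V \<cdot> v))"

definition splitting_choice :: bool where
  "splitting_choice \<longleftrightarrow> (\<forall>X \<in> ones (mndi K).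
     is_splitting K (Q_idem X) (S X) \<and>
     (let Vv = und1 X \<cdot> em_v E (src1 X) in
      Q_idem X = id2 K Vv \<longrightarrow> S X = Splitting Vv (id2 K Vv) (id2 K Vv)))"

definition Q1 :: "('o, 'm, 'c) mon1 \<Rightarrow> 'm" where
  "Q1 X = (let T = src1 X; T' = trg1 X; V = und1 X; v = em_v E T; v' = em_v E T' in
     THE q. q \<in> hom1 K (on0 (emJ E) T) (on0 (emJ E) T') \<and>
       v' \<cdot> q = split_ob (S X) \<and>
       v' \<triangleright> em_eps K E T' \<triangleleft> q =
         split_pr (S X) \<ast> (V \<cdot> v \<triangleright> em_eps K E T) \<ast> (str1 X \<triangleleft> v) \<ast> (mcar T' \<triangleright> split_in (S X)))"

definition Q2 :: "('o, 'm, 'c) mon2 \<Rightarrow> 'c" where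
  "Q2 x = (let X = src2 x; Y = trg2 x in
     THE w. w \<in> hom2 K (Q1 X) (Q1 Y) \<and>
       em_v E (trg1 X) \<triangleright> w = split_pr (S Y) \<ast> (und2 x \<triangleleft> em_v E (src1 X)) \<ast> split_in (S X))"

definition Q_cmp :: "('o, 'm, 'c) mon1 \<Rightarrow> ('o, 'm, 'c) mon1 \<Rightarrow> 'c" where
  "Q_cmp Y X =
     (THE g. g \<in> hom2 K (Q1 (Y \<cdot>\<^bsub>mndi K\<^esub> X)) (Q1 Y \<cdot> Q1 X) \<and>
       em_v E (trg1 Y) \<triangleright> g =
         (split_pr (S Y) \<triangleleft> Q1 X) \<ast> (und1 Y \<triangleright> split_pr (S X)) \<ast> split_in (S (Y \<cdot>\<^bsub>mndi K\<^esub> X)))"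

definition Q ::
  "(('o, 'm, 'c) mon, ('o, 'm, 'c) mon1, ('o, 'm, 'c) mon2, 'o, 'm, 'c) psfun" where
  "Q = \<lparr>on0 = on0 (emJ E), on1 = Q1, on2 = Q2, pcmp = Q_cmp,
        punt = (\<lambda>T. id2 K (id1 K (on0 (emJ E) T)))\<rparr>"

end

text \<open>A right 2-adjoint of \<open>incl_cmd K\<close> is, with the same data, a right 2-adjoint of
  \<open>incl_mnd (vop K)\<close>, so that \<open>Q\<close> can be formed in \<open>vop K\<close>.\<close>

definition Q_star ::
  "('o, 'm, 'c) two_cat \<Rightarrow> ('o, 'm, 'c) em \<Rightarrow> (('o, 'm, 'c) mon1 \<Rightarrow> ('m, 'c) splitting)
     \<Rightarrow> (('o, 'm, 'c) mon, ('o, 'm, 'c) mon1, ('o, 'm, 'c) mon2, 'o, 'm, 'c) psfun" where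
  "Q_star K E S = vop_psfun (vop K) (Q (vop K) E S)"


section \<open>Weak entwining structures\<close>

datatype ('o, 'm, 'c) entw0 =
  Entw0 (ent_mon: "('o, 'm, 'c) mon") (ent_com: "('o, 'm, 'c) mon") (ent_law: 'c)

datatype ('o, 'm, 'c) entw1 =
  Entw1 (esrc1: "('o, 'm, 'c) entw0") (etrg1: "('o, 'm, 'c) entw0")
    (eund1: 'm) (ealpha: 'c) (ebeta: 'c)

datatype ('o, 'm, 'c) entw2 =
  Entw2 (esrc2: "('o, 'm, 'c) entw1") (etrg2: "('o, 'm, 'c) entw1") (eund2: 'c)

context
  fixes K :: "('o, 'm, 'c) two_cat" (structure)
begin

definition weak_entwining ::
  "('o, 'm, 'c) mon \<Rightarrow> ('o, 'm, 'c) mon \<Rightarrow> 'c \<Rightarrow> bool" where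
  "weak_entwining T C \<psi> \<longleftrightarrow>
     (let t = mcar T; \<mu> = mmult T; \<eta> = munit T; c = mcar C; \<delta> = mmult C; \<epsilon> = munit C in
      is_monad K T \<and> is_comonad K C \<and> mob T = mob C \<and> \<psi> \<in> hom2 K (t \<cdot> c) (c \<cdot> t) \<and>
      \<psi> \<ast> (\<mu> \<triangleleft> c) = (c \<triangleright> \<mu>) \<ast> (\<psi> \<triangleleft> t) \<ast> (t \<triangleright> \<psi>) \<and>
      (\<delta> \<triangleleft> t) \<ast> \<psi> = (c \<triangleright> \<psi>) \<ast> (\<psi> \<triangleleft> c) \<ast> (t \<triangleright> \<delta>) \<and>
      \<psi> \<ast> (\<eta> \<triangleleft> c) = (c \<triangleright> \<epsilon> \<triangleleft> t) \<ast> (c \<triangleright> \<psi>) \<ast> (c \<triangleright> \<eta> \<triangleleft> c) \<ast> \<delta> \<and>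
      (\<epsilon> \<triangleleft> t) \<ast> \<psi> = \<mu> \<ast> (t \<triangleright> \<epsilon> \<triangleleft> t) \<ast> (t \<triangleright> \<psi>) \<ast> (t \<triangleright> \<eta> \<triangleleft> c))"

text \<open>The comonad \<open>((c, \<psi>) : t \<rightarrow> t, \<delta>, \<epsilon>)\<close> in \<open>mndi K\<close> and the monad \<open>((t, \<psi>) : c \<rightarrow> c, \<mu>, \<eta>)\<close> in
  \<open>cmdp K\<close> corresponding to a weak entwining structure, and the analogous reading of 1- and
  2-cells.\<close>

definition A0 :: "('o, 'm, 'c) entw0
    \<Rightarrow> (('o, 'm, 'c) mon, ('o, 'm, 'c) mon1, ('o, 'm, 'c) mon2) mon" where
  "A0 x = (case x of Entw0 T C \<psi> \<Rightarrow>
     let X = Mon1 T T (mcar C) \<psi> in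
     Mon T X (Mon2 X (X \<cdot>\<^bsub>mndi K\<^esub> X) (mmult C)) (Mon2 X (id1 (mndi K) T) (munit C)))"

definition A1 :: "('o, 'm, 'c) entw1
    \<Rightarrow> (('o, 'm, 'c) mon, ('o, 'm, 'c) mon1, ('o, 'm, 'c) mon2) mon1" where
  "A1 f = (case f of Entw1 x x' W \<alpha> \<beta> \<Rightarrow>
     let X = Mon1 (ent_mon x) (ent_mon x') W \<alpha> in
     Mon1 (A0 x) (A0 x') X
       (Mon2 (X \<cdot>\<^bsub>mndi K\<^esub> mcar (A0 x)) (mcar (A0 x') \<cdot>\<^bsub>mndi K\<^esub> X) \<beta>))"

definition A2 :: "('o, 'm, 'c) entw2
    \<Rightarrow> (('o, 'm, 'c) mon, ('o, 'm, 'c) mon1, ('o, 'm, 'c) mon2) mon2" where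
  "A2 w = (case w of Entw2 f g \<omega> \<Rightarrow>
     Cmd2 (A1 f) (A1 g) (Mon2 (und1 (A1 f)) (und1 (A1 g)) \<omega>))"

definition B0 :: "('o, 'm, 'c) entw0
    \<Rightarrow> (('o, 'm, 'c) mon, ('o, 'm, 'c) mon1, ('o, 'm, 'c) mon2) mon" where
  "B0 x = (case x of Entw0 T C \<psi> \<Rightarrow>
     let X = Mon1 C C (mcar T) \<psi> in
     Mon C X (Cmd2 (X \<cdot>\<^bsub>cmdp K\<^esub> X) X (mmult T)) (Cmd2 (id1 (cmdp K) C) X (munit T)))"

definition B1 :: "('o, 'm, 'c) entw1
    \<Rightarrow> (('o, 'm, 'c) mon, ('o, 'm, 'c) mon1, ('o, 'm, 'c) mon2) mon1" where
  "B1 f = (case f of Entw1 x x' W \<alpha> \<beta> \<Rightarrow>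
     let X = Mon1 (ent_com x) (ent_com x') W \<beta> in
     Mon1 (B0 x) (B0 x') X
       (Cmd2 (mcar (B0 x') \<cdot>\<^bsub>cmdp K\<^esub> X) (X \<cdot>\<^bsub>cmdp K\<^esub> mcar (B0 x)) \<alpha>))"

definition B2 :: "('o, 'm, 'c) entw2
    \<Rightarrow> (('o, 'm, 'c) mon, ('o, 'm, 'c) mon1, ('o, 'm, 'c) mon2) mon2" where
  "B2 w = (case w of Entw2 f g \<omega> \<Rightarrow>
     Mon2 (B1 f) (B1 g) (Cmd2 (und1 (B1 f)) (und1 (B1 g)) \<omega>))"

definition cmp_entw1 :: "('o, 'm, 'c) entw1 \<Rightarrow> ('o, 'm, 'c) entw1 \<Rightarrow> ('o, 'm, 'c) entw1" where
  "cmp_entw1 g f = Entw1 (esrc1 f) (etrg1 g) (eund1 g \<cdot> eund1 f)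
     ((eund1 g \<triangleright> ealpha f) \<ast> (ealpha g \<triangleleft> eund1 f))
     ((ebeta g \<triangleleft> eund1 f) \<ast> (eund1 g \<triangleright> ebeta f))"

definition is_entw0 :: "('o, 'm, 'c) entw0 \<Rightarrow> bool" where
  "is_entw0 x \<longleftrightarrow> weak_entwining (ent_mon x) (ent_com x) (ent_law x)"

definition is_entw1 :: "('o, 'm, 'c) entw1 \<Rightarrow> bool" where
  "is_entw1 f \<longleftrightarrow> is_entw0 (esrc1 f) \<and> is_entw0 (etrg1 f) \<and>
     A1 f \<in> ones (cmd (mndi K)) \<and> B1 f \<in> ones (mnd (cmdp K))"

definition is_entw2 :: "('o, 'm, 'c) entw2 \<Rightarrow> bool" where
  "is_entw2 w \<longleftrightarrow> is_entw1 (esrc2 w) \<and> is_entw1 (etrg2 w) \<and>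
     esrc1 (esrc2 w) = esrc1 (etrg2 w) \<and> etrg1 (esrc2 w) = etrg1 (etrg2 w) \<and>
     A2 w \<in> twos (cmd (mndi K)) \<and> B2 w \<in> twos (mnd (cmdp K))"

definition entw ::
  "(('o, 'm, 'c) entw0, ('o, 'm, 'c) entw1, ('o, 'm, 'c) entw2) two_cat" where
  "entw =
     \<lparr>obs = {x. is_entw0 x}, ones = {f. is_entw1 f}, twos = {w. is_entw2 w},
      s1 = esrc1, t1 = etrg1, s2 = esrc2, t2 = etrg2,
      id1 = (\<lambda>x. Entw1 x x (id1 K (mob (ent_mon x)))
                    (id2 K (mcar (ent_mon x))) (id2 K (mcar (ent_com x)))),
      id2 = (\<lambda>f. Entw2 f f (id2 K (eund1 f))),
      cmp1 = cmp_entw1,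
      vcmp = (\<lambda>y x. Entw2 (esrc2 x) (etrg2 y) (eund2 y \<ast> eund2 x)),
      hcmp = (\<lambda>y x. Entw2 (cmp_entw1 (esrc2 y) (esrc2 x)) (cmp_entw1 (etrg2 y) (etrg2 x))
                      (eund2 y \<star> eund2 x))\<rparr>"

definition A_fun ::
  "(('o, 'm, 'c) entw0, ('o, 'm, 'c) entw1, ('o, 'm, 'c) entw2,
    (('o, 'm, 'c) mon, ('o, 'm, 'c) mon1, ('o, 'm, 'c) mon2) mon,
    (('o, 'm, 'c) mon, ('o, 'm, 'c) mon1, ('o, 'm, 'c) mon2) mon1,
    (('o, 'm, 'c) mon, ('o, 'm, 'c) mon1, ('o, 'm, 'c) mon2) mon2) psfun" where
  "A_fun = strict_psfun entw (cmd (mndi K)) A0 A1 A2"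

definition B_fun ::
  "(('o, 'm, 'c) entw0, ('o, 'm, 'c) entw1, ('o, 'm, 'c) entw2,
    (('o, 'm, 'c) mon, ('o, 'm, 'c) mon1, ('o, 'm, 'c) mon2) mon,
    (('o, 'm, 'c) mon, ('o, 'm, 'c) mon1, ('o, 'm, 'c) mon2) mon1,
    (('o, 'm, 'c) mon, ('o, 'm, 'c) mon1, ('o, 'm, 'c) mon2) mon2) psfun" where
  "B_fun = strict_psfun entw (mnd (cmdp K)) B0 B1 B2"

end

end

theory Submission
  imports Defs
begin

text \<open>
  A weak entwined module consists of a 1-cell \<open>M\<close>, an action \<open>r : t M \<Rightarrow> M\<close> and a coaction
  \<open>k : M \<Rightarrow> c M\<close> with \<open>k \<ast> r = c r \<ast> \<psi> M \<ast> t k\<close>.  The object assigned to \<open>(t, c, \<psi>)\<close> by the first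
  composite represents these: a comodule over the induced comonad on \<open>J(t)\<close> is a \<open>t\<close>-module with a
  coaction valued in the retract of \<open>c M\<close> that splits the idempotent \<open>c r \<ast> \<psi> M \<ast> \<eta> c M\<close>, and composing
  the equation for \<open>k \<ast> r\<close> with \<open>\<eta> M\<close> shows that \<open>k\<close> factors through that retract.  A 1-cell
  \<open>(W, \<alpha>, \<beta>)\<close> strictly respects units and counits, because membership in \<open>Cmd(Mnd\<^sup>\<iota>)\<close> contributes
  the counit law of \<open>\<beta>\<close> and membership in \<open>Mnd(Cmd\<^sup>\<pi>)\<close> the unit law of \<open>\<alpha>\<close>; so \<open>Q\<close> agrees with \<open>J\<close> on it and
  the composite is a strict 2-functor acting on modules by \<open>M \<mapsto> W M\<close>.  The second composite is the first
  one formed in the vertical opposite, with monad and comonad exchanged, and weak entwined modules are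
  invariant under this duality.  Two representing objects are isomorphic, strictly naturally.
\<close>

section \<open>2-categories\<close>

text \<open>The obstacle is that 1-cells of \<open>Mnd\<^sup>\<iota>\<close> ignore units, so they
  carry a unital module to one on which the unit acts by a mere idempotent. The calculus is
  therefore set up for modules without unit law and for morphisms up to these idempotents
  (\<open>wmor\<close>). A cell is a 2-cell of \<open>mndi K\<close> exactly if it is such a
  morphism on the free module, which yields closure under composition. Passing to the retract
  restores the unit law, and there the universal property of J(t) applies. Equations between cells
  built from \<open>Q\<close> are checked after whiskering with v, which is faithful on 2-cells, and
  after composing with the inclusions \<iota>, which are split monomorphisms and stay so under
  whiskering; they then become laws of the entwining structure itself. Pseudo-functoriality of both
  composites comes out of representability as well. \<open>Q_star\<close> carries inverted coherence
  cells, and \<open>mnd_psfun\<close> inverts where \<open>cmd_psfun\<close> does not; hence, formed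
  in the opposite 2-category, the second composite assigns literally the same cells as the
  first.\<close>

lemma hom1_iff: "f \<in> hom1 K a b \<longleftrightarrow> f \<in> ones K \<and> s1 K f = a \<and> t1 K f = b"
  by (simp add: hom1_def)

lemma hom2_iff: "x \<in> hom2 K f g \<longleftrightarrow> x \<in> twos K \<and> s2 K x = f \<and> t2 K x = g"
  by (simp add: hom2_def)

section \<open>Typing, whiskering and naturality as rewrite rules\<close>

context two_category
begin

lemma one_obs: assumes "f \<in> ones K" shows "s1 K f \<in> obs K" "t1 K f \<in> obs K"
  using src_trg1 assms by auto

lemma hom1_obs: assumes "f \<in> hom1 K a b" shows "a \<in> obs K" "b \<in> obs K"
  using src_trg1 assms by (auto simp: hom1_def)

lemma hom2_ones: assumes "x \<in> hom2 K f g"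
  shows "f \<in> ones K" "g \<in> ones K" "s1 K f = s1 K g" "t1 K f = t1 K g"
  using src_trg2 parallel assms by (auto simp: hom2_def)

lemma two_ones [simp]: assumes "x \<in> twos K"
  shows "s2 K x \<in> ones K" "t2 K x \<in> ones K"
  using src_trg2 assms by auto

text \<open>Typing is expressed by membership together with source and target equations instead of
  hom-sets, so that the simplifier can discharge side conditions without having to guess the objects
  and 1-cells involved.\<close>

lemma cmp1_typ [simp]:
  assumes "f \<in> ones K" "g \<in> ones K" "s1 K g = t1 K f"
  shows "g \<cdot> f \<in> ones K" "s1 K (g \<cdot> f) = s1 K f" "t1 K (g \<cdot> f) = t1 K g"
  using cmp1_hom[of f "s1 K f" "t1 K f" g "t1 K g"] assms by (auto simp: hom1_def)

lemma cmp1_assoc' [simp]: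
  assumes "f \<in> ones K" "g \<in> ones K" "h \<in> ones K" "s1 K g = t1 K f" "s1 K h = t1 K g"
  shows "(h \<cdot> g) \<cdot> f = h \<cdot> g \<cdot> f"
  using cmp1_assoc[of f "s1 K f" "t1 K f" g "t1 K g" h "t1 K h"] assms by (auto simp: hom1_def)

lemma id1_typ [simp]:
  assumes "a \<in> obs K"
  shows "id1 K a \<in> ones K" "s1 K (id1 K a) = a" "t1 K (id1 K a) = a"
  using id1_hom assms by (auto simp: hom1_def)

lemma cmp1_id1 [simp]:
  assumes "f \<in> ones K"
  shows "s1 K f = a \<Longrightarrow> f \<cdot> id1 K a = f" "t1 K f = b \<Longrightarrow> id1 K b \<cdot> f = f"
  using cmp1_id[of f "s1 K f" "t1 K f"] assms by (auto simp: hom1_def)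

lemma id2_typ [simp]:
  assumes "f \<in> ones K"
  shows "id2 K f \<in> twos K" "s2 K (id2 K f) = f" "t2 K (id2 K f) = f"
  using id2_hom assms by (auto simp: hom2_def)

lemma vcmp_typ [simp]:
  assumes "\<alpha> \<in> twos K" "\<beta> \<in> twos K" "s2 K \<beta> = t2 K \<alpha>"
  shows "\<beta> \<ast> \<alpha> \<in> twos K" "s2 K (\<beta> \<ast> \<alpha>) = s2 K \<alpha>" "t2 K (\<beta> \<ast> \<alpha>) = t2 K \<beta>"
  using vcmp_hom[of \<alpha> "s2 K \<alpha>" "t2 K \<alpha>" \<beta> "t2 K \<beta>"] assms by (auto simp: hom2_def)

lemma vcmp_assoc' [simp]:
  assumes "\<alpha> \<in> twos K" "\<beta> \<in> twos K" "\<gamma> \<in> twos K" "s2 K \<beta> = t2 K \<alpha>" "s2 K \<gamma> = t2 K \<beta>"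
  shows "(\<gamma> \<ast> \<beta>) \<ast> \<alpha> = \<gamma> \<ast> \<beta> \<ast> \<alpha>"
  using vcmp_assoc[of \<alpha> "s2 K \<alpha>" "t2 K \<alpha>" \<beta> "t2 K \<beta>" \<gamma> "t2 K \<gamma>"] assms by (auto simp: hom2_def)

lemma vcmp_id2 [simp]:
  assumes "\<alpha> \<in> twos K"
  shows "s2 K \<alpha> = f \<Longrightarrow> \<alpha> \<ast> id2 K f = \<alpha>" "t2 K \<alpha> = g \<Longrightarrow> id2 K g \<ast> \<alpha> = \<alpha>"
  using vcmp_id[of \<alpha> "s2 K \<alpha>" "t2 K \<alpha>"] assms by (auto simp: hom2_def)

lemma parallel': assumes "\<alpha> \<in> twos K"
  shows "s1 K (t2 K \<alpha>) = s1 K (s2 K \<alpha>)" "t1 K (t2 K \<alpha>) = t1 K (s2 K \<alpha>)"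
  using parallel assms by auto

lemma hcmp_typ:
  assumes "\<alpha> \<in> twos K" "\<beta> \<in> twos K" "s1 K (s2 K \<beta>) = t1 K (s2 K \<alpha>)"
  shows "\<beta> \<star> \<alpha> \<in> twos K" "s2 K (\<beta> \<star> \<alpha>) = s2 K \<beta> \<cdot> s2 K \<alpha>" "t2 K (\<beta> \<star> \<alpha>) = t2 K \<beta> \<cdot> t2 K \<alpha>"
  using hcmp_hom[of "s2 K \<alpha>" "s1 K (s2 K \<alpha>)" "t1 K (s2 K \<alpha>)" "s2 K \<beta>" "t1 K (s2 K \<beta>)" \<alpha> "t2 K \<alpha>" \<beta> "t2 K \<beta>"]
    assms by (auto simp: hom2_def hom1_def)

lemma lwhisk_typ [simp]:
  assumes "\<alpha> \<in> twos K" "g \<in> ones K" "s1 K g = t1 K (s2 K \<alpha>)"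
  shows "g \<triangleright> \<alpha> \<in> twos K" "s2 K (g \<triangleright> \<alpha>) = g \<cdot> s2 K \<alpha>" "t2 K (g \<triangleright> \<alpha>) = g \<cdot> t2 K \<alpha>"
  using assms by (auto simp: lwhisk_def hcmp_typ)

lemma rwhisk_typ [simp]:
  assumes "\<alpha> \<in> twos K" "f \<in> ones K" "s1 K (s2 K \<alpha>) = t1 K f"
  shows "\<alpha> \<triangleleft> f \<in> twos K" "s2 K (\<alpha> \<triangleleft> f) = s2 K \<alpha> \<cdot> f" "t2 K (\<alpha> \<triangleleft> f) = t2 K \<alpha> \<cdot> f"
  using assms by (auto simp: rwhisk_def hcmp_typ)

lemma interchange':
  assumes "\<alpha> \<in> twos K" "\<alpha>' \<in> twos K" "\<beta> \<in> twos K" "\<beta>' \<in> twos K"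
    "s2 K \<alpha>' = t2 K \<alpha>" "s2 K \<beta>' = t2 K \<beta>" "s1 K (s2 K \<beta>) = t1 K (s2 K \<alpha>)"
  shows "(\<beta>' \<ast> \<beta>) \<star> (\<alpha>' \<ast> \<alpha>) = (\<beta>' \<star> \<alpha>') \<ast> (\<beta> \<star> \<alpha>)"
  using interchange[of "s2 K \<alpha>" "s1 K (s2 K \<alpha>)" "t1 K (s2 K \<alpha>)" "s2 K \<beta>" "t1 K (s2 K \<beta>)" \<alpha> "t2 K \<alpha>" \<alpha>' "t2 K \<alpha>'"
      \<beta> "t2 K \<beta>" \<beta>' "t2 K \<beta>'"]
    assms by (auto simp: hom2_def hom1_def)

lemma lwhisk_vcmp [simp]:
  assumes "\<alpha> \<in> twos K" "\<beta> \<in> twos K" "s2 K \<beta> = t2 K \<alpha>" "g \<in> ones K" "s1 K g = t1 K (s2 K \<alpha>)"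
  shows "g \<triangleright> (\<beta> \<ast> \<alpha>) = (g \<triangleright> \<beta>) \<ast> (g \<triangleright> \<alpha>)"
  using interchange'[of \<alpha> \<beta> "id2 K g" "id2 K g"] assms by (simp add: lwhisk_def)

lemma rwhisk_vcmp [simp]:
  assumes "\<alpha> \<in> twos K" "\<beta> \<in> twos K" "s2 K \<beta> = t2 K \<alpha>" "f \<in> ones K" "s1 K (s2 K \<alpha>) = t1 K f"
  shows "(\<beta> \<ast> \<alpha>) \<triangleleft> f = (\<beta> \<triangleleft> f) \<ast> (\<alpha> \<triangleleft> f)"
  using interchange'[of "id2 K f" "id2 K f" \<alpha> \<beta>] assms by (simp add: rwhisk_def)

lemma hcmp_assoc':
  assumes "\<alpha> \<in> twos K" "\<beta> \<in> twos K" "\<gamma> \<in> twos K"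
     "s1 K (s2 K \<beta>) = t1 K (s2 K \<alpha>)" "s1 K (s2 K \<gamma>) = t1 K (s2 K \<beta>)"
  shows "(\<gamma> \<star> \<beta>) \<star> \<alpha> = \<gamma> \<star> \<beta> \<star> \<alpha>"
  using hcmp_assoc[of "s2 K \<alpha>" "s1 K (s2 K \<alpha>)" "t1 K (s2 K \<alpha>)" "s2 K \<beta>" "t1 K (s2 K \<beta>)" "s2 K \<gamma>" "t1 K (s2 K \<gamma>)" \<alpha> "t2 K \<alpha>" \<beta> "t2 K \<beta>" \<gamma> "t2 K \<gamma>"]
    assms by (auto simp: hom2_def hom1_def)

lemma id2_hcmp_id2 [simp]:
  assumes "f \<in> ones K" "g \<in> ones K" "s1 K g = t1 K f"
  shows "id2 K g \<star> id2 K f = id2 K (g \<cdot> f)"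
  using hcmp_id2[of f "s1 K f" "t1 K f" g "t1 K g"] assms by (auto simp: hom1_def)

lemma lwhisk_id2 [simp]:
  assumes "f \<in> ones K" "g \<in> ones K" "s1 K g = t1 K f"
  shows "g \<triangleright> id2 K f = id2 K (g \<cdot> f)" "id2 K g \<triangleleft> f = id2 K (g \<cdot> f)"
  using assms by (simp_all add: lwhisk_def rwhisk_def)

lemma lwhisk_lwhisk [simp]:
  assumes "\<alpha> \<in> twos K" "g \<in> ones K" "h \<in> ones K" "s1 K g = t1 K (s2 K \<alpha>)" "s1 K h = t1 K g"
  shows "(h \<cdot> g) \<triangleright> \<alpha> = h \<triangleright> g \<triangleright> \<alpha>"
  using hcmp_assoc'[of \<alpha> "id2 K g" "id2 K h"] assms by (simp add: lwhisk_def)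

lemma rwhisk_rwhisk [simp]:
  assumes "\<alpha> \<in> twos K" "g \<in> ones K" "f \<in> ones K" "s1 K (s2 K \<alpha>) = t1 K g" "s1 K g = t1 K f"
  shows "(\<alpha> \<triangleleft> g) \<triangleleft> f = \<alpha> \<triangleleft> g \<cdot> f"
  using hcmp_assoc'[of "id2 K f" "id2 K g" \<alpha>] assms by (simp add: rwhisk_def)

lemma rwhisk_lwhisk [simp]:
  assumes "\<alpha> \<in> twos K" "g \<in> ones K" "f \<in> ones K" "s1 K (s2 K \<alpha>) = t1 K f" "s1 K g = t1 K (s2 K \<alpha>)"
  shows "(g \<triangleright> \<alpha>) \<triangleleft> f = g \<triangleright> \<alpha> \<triangleleft> f"
  using hcmp_assoc'[of "id2 K f" \<alpha> "id2 K g"] assms by (simp add: rwhisk_def lwhisk_def)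

lemma whisk_id1 [simp]:
  assumes "\<alpha> \<in> twos K"
  shows "t1 K (s2 K \<alpha>) = b \<Longrightarrow> id1 K b \<triangleright> \<alpha> = \<alpha>" "s1 K (s2 K \<alpha>) = a \<Longrightarrow> \<alpha> \<triangleleft> id1 K a = \<alpha>"
  using hcmp_id[of "s2 K \<alpha>" "s1 K (s2 K \<alpha>)" "t1 K (s2 K \<alpha>)" \<alpha> "t2 K \<alpha>"] assms
  by (auto simp: lwhisk_def rwhisk_def hom1_def hom2_def)

lemma hcmp_eq:
  assumes "\<alpha> \<in> twos K" "\<beta> \<in> twos K" "s1 K (s2 K \<beta>) = t1 K (s2 K \<alpha>)"
  shows "\<beta> \<star> \<alpha> = (\<beta> \<triangleleft> t2 K \<alpha>) \<ast> (s2 K \<beta> \<triangleright> \<alpha>)"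
  using interchange'[of \<alpha> "id2 K (t2 K \<alpha>)" "id2 K (s2 K \<beta>)" \<beta>] assms
  by (simp add: rwhisk_def lwhisk_def parallel')

text \<open>Both sides are the horizontal composite \<open>\<beta> \<star> \<alpha>\<close>,
  expanded by interchange with identities inserted in the two possible ways.\<close>

lemma naturality:
  assumes "\<alpha> \<in> twos K" "\<beta> \<in> twos K" "s1 K (s2 K \<beta>) = t1 K (s2 K \<alpha>)"
    "s2 K \<beta> = g" "t2 K \<beta> = g'" "s2 K \<alpha> = f" "t2 K \<alpha> = f'"
  shows "(\<beta> \<triangleleft> f') \<ast> (g \<triangleright> \<alpha>) = (g' \<triangleright> \<alpha>) \<ast> (\<beta> \<triangleleft> f)"
  using interchange'[of \<alpha> "id2 K (t2 K \<alpha>)" "id2 K (s2 K \<beta>)" \<beta>]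
    interchange'[of "id2 K (s2 K \<alpha>)" \<alpha> \<beta> "id2 K (t2 K \<beta>)"] assms(1-3)
  unfolding assms(4-7)[symmetric] by (simp add: rwhisk_def lwhisk_def parallel')

text \<open>Instances of naturality in the normal form of the simplifier, where whiskering by a composite
  is split into successive whiskerings.\<close>

lemma naturality0:
  assumes "\<beta> \<in> twos K" "\<alpha> \<in> twos K" "s2 K \<beta> = id1 K (t1 K (s2 K \<alpha>))"
    "t2 K \<beta> = g'" "s2 K \<alpha> = f" "t2 K \<alpha> = f'"
  shows "(\<beta> \<triangleleft> f') \<ast> \<alpha> = (g' \<triangleright> \<alpha>) \<ast> (\<beta> \<triangleleft> f)"
  using naturality[of \<alpha> \<beta>, OF assms(2,1) _ assms(3-6)] assms one_obs[of "s2 K \<alpha>"] two_ones[of \<alpha>] by simp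

lemma naturality1:
  assumes "\<beta> \<in> twos K" "\<alpha> \<in> twos K" "s1 K (s2 K \<beta>) = t1 K (s2 K \<alpha>)"
    "s2 K \<beta> = g" "t2 K \<beta> = g'" "s2 K \<alpha> = f" "t2 K \<alpha> = f'"
  shows "(\<beta> \<triangleleft> f') \<ast> (g \<triangleright> \<alpha>) = (g' \<triangleright> \<alpha>) \<ast> (\<beta> \<triangleleft> f)"
  using naturality assms by blast

lemma naturality2:
  assumes "\<beta> \<in> twos K" "\<alpha> \<in> twos K" "s1 K (s2 K \<beta>) = t1 K (s2 K \<alpha>)"
    "s2 K \<beta> = g \<cdot> h" "t2 K \<beta> = g'" "s2 K \<alpha> = f" "t2 K \<alpha> = f'"
    "g \<in> ones K" "h \<in> ones K" "s1 K g = t1 K h" "s1 K h = t1 K (s2 K \<alpha>)"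
  shows "(\<beta> \<triangleleft> f') \<ast> (g \<triangleright> h \<triangleright> \<alpha>) = (g' \<triangleright> \<alpha>) \<ast> (\<beta> \<triangleleft> f)"
  using naturality[of \<alpha> \<beta>, OF assms(2,1,3-7)] assms by simp

text \<open>Vertical composites are normalised to the right, so an equation for
  \<open>a \<ast> b\<close> does not rewrite inside \<open>a \<ast> b \<ast> x\<close>. Attached
  with \<open>THEN\<close>, this rule and its companions below turn a known equation into the
  instance that occurs at the head of a longer chain or under whiskering.\<close>

lemma reassoc2:
  assumes "a \<ast> b = y" "a \<in> twos K" "b \<in> twos K" "s2 K a = t2 K b" "x \<in> twos K" "s2 K b = t2 K x"
  shows "a \<ast> b \<ast> x = y \<ast> x"
  using assms vcmp_assoc'[of x b a] by simp

lemma reassoc3: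
  assumes "a \<ast> b \<ast> c = y" "a \<in> twos K" "b \<in> twos K" "c \<in> twos K" "s2 K a = t2 K b"
    "s2 K b = t2 K c" "x \<in> twos K" "s2 K c = t2 K x"
  shows "a \<ast> b \<ast> c \<ast> x = y \<ast> x"
  using assms by (simp flip: assms(1))

lemma lwhisk2:
  assumes "a \<ast> b = y" "a \<in> twos K" "b \<in> twos K" "s2 K a = t2 K b" "p \<in> ones K" "s1 K p = t1 K (s2 K b)"
  shows "(p \<triangleright> a) \<ast> (p \<triangleright> b) = p \<triangleright> y"
  using assms by (simp flip: assms(1))

lemma lwhisk3:
  assumes "a \<ast> b \<ast> c = y" "a \<in> twos K" "b \<in> twos K" "c \<in> twos K" "s2 K a = t2 K b"
    "s2 K b = t2 K c" "p \<in> ones K" "s1 K p = t1 K (s2 K c)"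
  shows "(p \<triangleright> a) \<ast> (p \<triangleright> b) \<ast> (p \<triangleright> c) = p \<triangleright> y"
  using assms by (simp flip: assms(1))

lemma rwhisk2:
  assumes "a \<ast> b = y" "a \<in> twos K" "b \<in> twos K" "s2 K a = t2 K b" "p \<in> ones K" "s1 K (s2 K b) = t1 K p"
  shows "(a \<triangleleft> p) \<ast> (b \<triangleleft> p) = y \<triangleleft> p"
  using assms by (simp flip: assms(1))

lemma rwhisk3:
  assumes "a \<ast> b \<ast> c = y" "a \<in> twos K" "b \<in> twos K" "c \<in> twos K" "s2 K a = t2 K b"
    "s2 K b = t2 K c" "p \<in> ones K" "s1 K (s2 K c) = t1 K p"
  shows "(a \<triangleleft> p) \<ast> (b \<triangleleft> p) \<ast> (c \<triangleleft> p) = y \<triangleleft> p"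
  using assms by (simp flip: assms(1))

end

section \<open>Modules without unit law and their morphisms\<close>

lemma is_monad_iff: "is_monad K T \<longleftrightarrow> mob T \<in> obs K \<and> mcar T \<in> hom1 K (mob T) (mob T) \<and>
     mmult T \<in> hom2 K (mcar T \<cdot>\<^bsub>K\<^esub> mcar T) (mcar T) \<and> munit T \<in> hom2 K (id1 K (mob T)) (mcar T) \<and>
     mmult T \<ast>\<^bsub>K\<^esub> (mcar T \<triangleright>\<^bsub>K\<^esub> mmult T) = mmult T \<ast>\<^bsub>K\<^esub> (mmult T \<triangleleft>\<^bsub>K\<^esub> mcar T) \<and>
     mmult T \<ast>\<^bsub>K\<^esub> (mcar T \<triangleright>\<^bsub>K\<^esub> munit T) = id2 K (mcar T) \<and>
     mmult T \<ast>\<^bsub>K\<^esub> (munit T \<triangleleft>\<^bsub>K\<^esub> mcar T) = id2 K (mcar T)"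
  by (cases T) (simp add: is_monad_def)

lemma is_mndi1_iff: "is_mndi1 K X \<longleftrightarrow> is_monad K (src1 X) \<and> is_monad K (trg1 X) \<and>
     und1 X \<in> hom1 K (mob (src1 X)) (mob (trg1 X)) \<and>
     str1 X \<in> hom2 K (mcar (trg1 X) \<cdot>\<^bsub>K\<^esub> und1 X) (und1 X \<cdot>\<^bsub>K\<^esub> mcar (src1 X)) \<and>
     (und1 X \<triangleright>\<^bsub>K\<^esub> mmult (src1 X)) \<ast>\<^bsub>K\<^esub> (str1 X \<triangleleft>\<^bsub>K\<^esub> mcar (src1 X)) \<ast>\<^bsub>K\<^esub> (mcar (trg1 X) \<triangleright>\<^bsub>K\<^esub> str1 X)
       = str1 X \<ast>\<^bsub>K\<^esub> (mmult (trg1 X) \<triangleleft>\<^bsub>K\<^esub> und1 X)"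
  by (cases X) (simp add: is_mndi1_def)

text \<open>Modules without unit law: \<open>idem\<close> is the idempotent by which the unit acts, \<open>umod\<close> are the
  unital modules, and a \<open>wmor\<close> is a module morphism up to these idempotents.\<close>

definition nmod :: "('o, 'm, 'c) two_cat \<Rightarrow> ('o, 'm, 'c) mon \<Rightarrow> 'm \<Rightarrow> 'c \<Rightarrow> bool" where
  "nmod K T M r \<longleftrightarrow> M \<in> ones K \<and> t1 K M = mob T \<and> r \<in> hom2 K (mcar T \<cdot>\<^bsub>K\<^esub> M) M \<and>
     r \<ast>\<^bsub>K\<^esub> (mcar T \<triangleright>\<^bsub>K\<^esub> r) = r \<ast>\<^bsub>K\<^esub> (mmult T \<triangleleft>\<^bsub>K\<^esub> M)"

definition idem :: "('o, 'm, 'c) two_cat \<Rightarrow> ('o, 'm, 'c) mon \<Rightarrow> 'm \<Rightarrow> 'c \<Rightarrow> 'c" where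
  "idem K T M r = r \<ast>\<^bsub>K\<^esub> (munit T \<triangleleft>\<^bsub>K\<^esub> M)"

definition umod :: "('o, 'm, 'c) two_cat \<Rightarrow> ('o, 'm, 'c) mon \<Rightarrow> 'm \<Rightarrow> 'c \<Rightarrow> bool" where
  "umod K T M r \<longleftrightarrow> nmod K T M r \<and> idem K T M r = id2 K M"

definition wmor :: "('o, 'm, 'c) two_cat \<Rightarrow> ('o, 'm, 'c) mon \<Rightarrow> 'm \<Rightarrow> 'c \<Rightarrow> 'm \<Rightarrow> 'c \<Rightarrow> 'c \<Rightarrow> bool" where
  "wmor K T M r N s g \<longleftrightarrow> g \<in> hom2 K M N \<and>
     g \<ast>\<^bsub>K\<^esub> r = s \<ast>\<^bsub>K\<^esub> (mcar T \<triangleright>\<^bsub>K\<^esub> (g \<ast>\<^bsub>K\<^esub> idem K T M r))"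

text \<open>A 1-cell of \<open>mndi\<close> transports modules from its source monad to its target
  monad: the target monad acts on \<open>V M\<close> by \<psi> followed by the action on
  \<open>M\<close>. Since \<psi> need not respect units, the result is in general only an
  \<open>nmod\<close>, even for a unital \<open>M\<close>.\<close>

definition act :: "('o, 'm, 'c) two_cat \<Rightarrow> ('o, 'm, 'c) mon1 \<Rightarrow> 'm \<Rightarrow> 'c \<Rightarrow> 'c" where
  "act K X M r = (und1 X \<triangleright>\<^bsub>K\<^esub> r) \<ast>\<^bsub>K\<^esub> (str1 X \<triangleleft>\<^bsub>K\<^esub> M)"

context two_category
begin

lemma monad_ty:
  assumes "is_monad K T"
  shows "mob T \<in> obs K" "mcar T \<in> ones K" "s1 K (mcar T) = mob T" "t1 K (mcar T) = mob T"
    "mmult T \<in> twos K" "s2 K (mmult T) = mcar T \<cdot> mcar T" "t2 K (mmult T) = mcar T"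
    "munit T \<in> twos K" "s2 K (munit T) = id1 K (mob T)" "t2 K (munit T) = mcar T"
  using assms by (auto simp: is_monad_iff hom1_iff hom2_iff)

lemma monad_at:
  assumes "is_monad K T" "N \<in> ones K" "t1 K N = mob T"
  shows "(mmult T \<triangleleft> N) \<ast> (mcar T \<triangleright> mmult T \<triangleleft> N) = (mmult T \<triangleleft> N) \<ast> (mmult T \<triangleleft> mcar T \<cdot> N)"
    "(mmult T \<triangleleft> N) \<ast> (mcar T \<triangleright> munit T \<triangleleft> N) = id2 K (mcar T \<cdot> N)"
    "(mmult T \<triangleleft> N) \<ast> (munit T \<triangleleft> mcar T \<cdot> N) = id2 K (mcar T \<cdot> N)"
  using assms[unfolded is_monad_iff] monad_ty[OF assms(1)]
    rwhisk2[of "mmult T" "mcar T \<triangleright> mmult T" _ N]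
    rwhisk2[of "mmult T" "mcar T \<triangleright> munit T" _ N]
    rwhisk2[of "mmult T" "munit T \<triangleleft> mcar T" _ N] by simp_all

lemma mndi1_ty:
  assumes "is_mndi1 K X"
  shows "is_monad K (src1 X)" "is_monad K (trg1 X)" "und1 X \<in> ones K"
    "s1 K (und1 X) = mob (src1 X)" "t1 K (und1 X) = mob (trg1 X)" "str1 X \<in> twos K"
    "s2 K (str1 X) = mcar (trg1 X) \<cdot> und1 X" "t2 K (str1 X) = und1 X \<cdot> mcar (src1 X)"
  using assms by (auto simp: is_mndi1_iff hom1_iff hom2_iff)

lemmas mndi1_tys = mndi1_ty monad_ty[OF mndi1_ty(1)] monad_ty[OF mndi1_ty(2)]

lemma mndi1_at:
  assumes X: "is_mndi1 K X" "N \<in> ones K" "t1 K N = mob (src1 X)"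
  shows "(und1 X \<triangleright> mmult (src1 X) \<triangleleft> N) \<ast> (str1 X \<triangleleft> mcar (src1 X) \<cdot> N) \<ast> (mcar (trg1 X) \<triangleright> str1 X \<triangleleft> N)
       = (str1 X \<triangleleft> N) \<ast> (mmult (trg1 X) \<triangleleft> und1 X \<cdot> N)"
proof -
  note ty = mndi1_tys[OF X(1)]
  show ?thesis
    using assms(2,3) ty rwhisk3[of "und1 X \<triangleright> mmult (src1 X)" "str1 X \<triangleleft> mcar (src1 X)" "mcar (trg1 X) \<triangleright> str1 X" _ N]
      X(1)[unfolded is_mndi1_iff] by simp
qed

lemma nmod_ty:
  assumes "nmod K T M r"
  shows "M \<in> ones K" "t1 K M = mob T" "r \<in> twos K" "s2 K r = mcar T \<cdot> M" "t2 K r = M"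
  using assms by (auto simp: nmod_def hom2_iff)

lemma nmod_assoc: "nmod K T M r \<Longrightarrow> r \<ast> (mcar T \<triangleright> r) = r \<ast> (mmult T \<triangleleft> M)"
  by (simp add: nmod_def)

text \<open>Associativity of the action turns two successive actions into one multiplication, after
  which a unit law of the monad applies; when the idempotent stands on the left, naturality of the
  unit first moves it past \<open>r\<close>. Thus \<open>r\<close> absorbs the idempotent on either
  side.\<close>

lemma nmod_idem:
  assumes T: "is_monad K T" and M: "nmod K T M r"
  shows "idem K T M r \<in> hom2 K M M" "idem K T M r \<ast> r = r" "r \<ast> (mcar T \<triangleright> idem K T M r) = r"
    "idem K T M r \<ast> idem K T M r = idem K T M r"
proof -
  note ty = monad_ty[OF T] nmod_ty[OF M]
  note a = nmod_assoc[OF M]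
  show "idem K T M r \<in> hom2 K M M"
    using ty by (simp add: idem_def hom2_iff)
  show 1: "idem K T M r \<ast> r = r" and "r \<ast> (mcar T \<triangleright> idem K T M r) = r"
    using ty by (simp_all add: idem_def monad_at[OF T] naturality0[of "munit T"] a[THEN reassoc2])
  show "idem K T M r \<ast> idem K T M r = idem K T M r" using reassoc2[OF 1, of "munit T \<triangleleft> M"] ty
    by (simp add: idem_def)
qed

lemma idem_ty:
  assumes "is_monad K T" "nmod K T M r"
  shows "idem K T M r \<in> twos K" "s2 K (idem K T M r) = M" "t2 K (idem K T M r) = M"
  using nmod_idem(1)[OF assms] by (simp_all add: hom2_iff)

lemma umod_nmod: "umod K T M r \<Longrightarrow> nmod K T M r"
  by (simp add: umod_def)

lemma wmor_ty:
  assumes "wmor K T M r N s g"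
  shows "g \<in> twos K" "s2 K g = M" "t2 K g = N"
  using assms by (auto simp: wmor_def hom2_iff)

lemma wmor_eq: "wmor K T M r N s g \<Longrightarrow> g \<ast> r = s \<ast> (mcar T \<triangleright> (g \<ast> idem K T M r))"
  by (simp add: wmor_def)

text \<open>By the law of \<open>g\<close>, the cell \<open>g \<ast> r\<close> factors through the
  action \<open>s\<close>, and \<open>s\<close> absorbs the idempotent of its own module.\<close>

lemma wmor_idem:
  assumes T: "is_monad K T" and M: "nmod K T M r" and N: "nmod K T N s" and g: "wmor K T M r N s g"
  shows "idem K T N s \<ast> g \<ast> r = g \<ast> r" "idem K T N s \<ast> g \<ast> idem K T M r = g \<ast> idem K T M r"
proof -
  note ty = monad_ty[OF T] nmod_ty[OF M] nmod_ty[OF N] wmor_ty[OF g] idem_ty[OF T M] idem_ty[OF T N]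
  have "idem K T N s \<ast> g \<ast> r = idem K T N s \<ast> s \<ast> (mcar T \<triangleright> (g \<ast> idem K T M r))"
    using wmor_eq[OF g] by simp
  also have "... = s \<ast> (mcar T \<triangleright> (g \<ast> idem K T M r))"
    using ty by (subst nmod_idem(2)[OF T N, THEN reassoc2]) simp_all
  finally show 2: "idem K T N s \<ast> g \<ast> r = g \<ast> r" using wmor_eq[OF g] by simp
  show "idem K T N s \<ast> g \<ast> idem K T M r = g \<ast> idem K T M r"
    using ty 2[THEN reassoc3, of "munit T \<triangleleft> M"] by (simp add: idem_def[of K T M])
qed

text \<open>The law of \<open>h\<close> introduces the idempotent of the middle module. It is
  harmless, because \<open>g\<close> preceded by the idempotent of \<open>M\<close> already lands in
  the image of the middle one.\<close>

lemma wmor_cmp: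
  assumes T: "is_monad K T" and M: "nmod K T M r" and N: "nmod K T N s" and P: "nmod K T P u"
    and g: "wmor K T M r N s g" and h: "wmor K T N s P u h"
  shows "wmor K T M r P u (h \<ast> g)"
proof -
  note ty = monad_ty[OF T] nmod_ty[OF M] nmod_ty[OF N] nmod_ty[OF P] wmor_ty[OF g] wmor_ty[OF h]
    idem_ty[OF T M] idem_ty[OF T N]
  have "(h \<ast> g) \<ast> r = (h \<ast> s) \<ast> (mcar T \<triangleright> (g \<ast> idem K T M r))"
    using ty by (simp add: wmor_eq[OF g])
  also have "... = u \<ast> (mcar T \<triangleright> (h \<ast> idem K T N s \<ast> g \<ast> idem K T M r))"
    unfolding wmor_eq[OF h] using ty by simp
  also have "... = u \<ast> (mcar T \<triangleright> ((h \<ast> g) \<ast> idem K T M r))"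
    using ty by (simp only: wmor_idem[OF T M N g]) simp
  finally show ?thesis using ty by (simp add: wmor_def hom2_iff)
qed

text \<open>For a genuine module morphism the extra idempotent can be moved next to
  \<open>r\<close>, which absorbs it.\<close>

lemma wmor_of_strict:
  assumes T: "is_monad K T" and M: "nmod K T M r" and N: "nmod K T N s" and g: "g \<in> hom2 K M N"
    and e: "g \<ast> r = s \<ast> (mcar T \<triangleright> g)"
  shows "wmor K T M r N s g"
proof -
  note ty = monad_ty[OF T] nmod_ty[OF M] nmod_ty[OF N] g[unfolded hom2_iff] idem_ty[OF T M]
  have "s \<ast> (mcar T \<triangleright> (g \<ast> idem K T M r)) = (g \<ast> r) \<ast> (mcar T \<triangleright> idem K T M r)" using ty by (simp add: e)
  also have "... = g \<ast> r" using ty by (simp add: nmod_idem(3)[OF T M])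
  finally show ?thesis using ty by (simp add: wmor_def hom2_iff)
qed

lemma wmor_id2: assumes T: "is_monad K T" and M: "nmod K T M r" shows "wmor K T M r M r (id2 K M)"
  using nmod_ty[OF M] monad_ty[OF T] by (intro wmor_of_strict[OF T M M]) (simp_all add: hom2_iff)

lemma nmod_free:
  assumes T: "is_monad K T" "M \<in> ones K" "t1 K M = mob T"
  shows "umod K T (mcar T \<cdot> M) (mmult T \<triangleleft> M)"
  using monad_ty[OF T(1)] monad_at[OF assms] T by (simp add: umod_def nmod_def hom2_iff idem_def)

text \<open>Naturality of \<psi> brings its two occurrences together, so that the multiplicativity
  of \<psi> and the associativity of \<open>r\<close> can be applied.\<close>

lemma nmod_act:
  assumes X: "is_mndi1 K X" and M: "nmod K (src1 X) M r"
  shows "nmod K (trg1 X) (und1 X \<cdot> M) (act K X M r)"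
proof -
  note ty = mndi1_tys[OF X] nmod_ty[OF M]
  have "act K X M r \<ast> (mcar (trg1 X) \<triangleright> act K X M r) = act K X M r \<ast> (mmult (trg1 X) \<triangleleft> und1 X \<cdot> M)"
    using ty
    by (simp add: act_def naturality1[of "str1 X"] naturality2[of "str1 X"] mndi1_at[OF X]
       nmod_assoc[OF M, THEN lwhisk2, THEN reassoc2] naturality1[of "str1 X", THEN reassoc2]
       naturality2[of "str1 X", THEN reassoc2])
  then show ?thesis using ty by (simp add: nmod_def hom2_iff act_def)
qed

end

section \<open>The 2-categories of monads\<close>

lemma is_mndi2_iff: "is_mndi2 K x \<longleftrightarrow> is_mndi1 K (src2 x) \<and> is_mndi1 K (trg2 x) \<and>
     src1 (src2 x) = src1 (trg2 x) \<and> trg1 (src2 x) = trg1 (trg2 x) \<and>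
     und2 x \<in> hom2 K (und1 (src2 x)) (und1 (trg2 x)) \<and>
     (und2 x \<triangleleft>\<^bsub>K\<^esub> mcar (src1 (src2 x))) \<ast>\<^bsub>K\<^esub> str1 (src2 x) =
        (und1 (trg2 x) \<triangleright>\<^bsub>K\<^esub> mmult (src1 (src2 x))) \<ast>\<^bsub>K\<^esub> (str1 (trg2 x) \<triangleleft>\<^bsub>K\<^esub> mcar (src1 (src2 x)))
          \<ast>\<^bsub>K\<^esub> (mcar (trg1 (src2 x)) \<triangleright>\<^bsub>K\<^esub> und2 x \<triangleleft>\<^bsub>K\<^esub> mcar (src1 (src2 x)))
          \<ast>\<^bsub>K\<^esub> (mcar (trg1 (src2 x)) \<triangleright>\<^bsub>K\<^esub> str1 (src2 x))
          \<ast>\<^bsub>K\<^esub> (mcar (trg1 (src2 x)) \<triangleright>\<^bsub>K\<^esub> munit (trg1 (src2 x)) \<triangleleft>\<^bsub>K\<^esub> und1 (src2 x))"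
  by (cases x) (simp add: is_mndi2_def Let_def)

lemma is_mnd1_iff: "is_mnd1 K X \<longleftrightarrow> is_mndi1 K X \<and>
    str1 X \<ast>\<^bsub>K\<^esub> (munit (trg1 X) \<triangleleft>\<^bsub>K\<^esub> und1 X) = und1 X \<triangleright>\<^bsub>K\<^esub> munit (src1 X)"
  by (cases X) (simp add: is_mnd1_def)

lemma is_mnd2_iff: "is_mnd2 K x \<longleftrightarrow> is_mnd1 K (src2 x) \<and> is_mnd1 K (trg2 x) \<and>
     src1 (src2 x) = src1 (trg2 x) \<and> trg1 (src2 x) = trg1 (trg2 x) \<and>
     und2 x \<in> hom2 K (und1 (src2 x)) (und1 (trg2 x)) \<and>
     (und2 x \<triangleleft>\<^bsub>K\<^esub> mcar (src1 (src2 x))) \<ast>\<^bsub>K\<^esub> str1 (src2 x) =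
       str1 (trg2 x) \<ast>\<^bsub>K\<^esub> (mcar (trg1 (src2 x)) \<triangleright>\<^bsub>K\<^esub> und2 x)"
  by (cases x) (auto simp add: is_mnd2_def Let_def)

lemma mnd1_mndi1: "is_mnd1 K X \<Longrightarrow> is_mndi1 K X"
  by (simp add: is_mnd1_iff)

context two_category
begin

lemma mndi2_ty:
  assumes "is_mndi2 K x"
  shows "is_mndi1 K (src2 x)" "is_mndi1 K (trg2 x)"
     "src1 (trg2 x) = src1 (src2 x)" "trg1 (trg2 x) = trg1 (src2 x)"
     "und2 x \<in> twos K" "s2 K (und2 x) = und1 (src2 x)" "t2 K (und2 x) = und1 (trg2 x)"
  using assms by (auto simp: is_mndi2_iff hom2_iff)

lemma cmp_mon1_sel [simp]: "src1 (cmp_mon1 K Y X) = src1 X" "trg1 (cmp_mon1 K Y X) = trg1 Y"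
  "und1 (cmp_mon1 K Y X) = und1 Y \<cdot> und1 X"
  "str1 (cmp_mon1 K Y X) = (und1 Y \<triangleright> str1 X) \<ast> (str1 Y \<triangleleft> und1 X)"
  by (simp_all add: cmp_mon1_def)

lemma id_mon1_sel [simp]: "src1 (id_mon1 K T) = T" "trg1 (id_mon1 K T) = T"
  "und1 (id_mon1 K T) = id1 K (mob T)" "str1 (id_mon1 K T) = id2 K (mcar T)"
  by (simp_all add: id_mon1_def)

lemma mndi1_id: "is_monad K T \<Longrightarrow> is_mndi1 K (id_mon1 K T)"
  using monad_ty[of T] by (simp add: is_mndi1_iff hom1_iff hom2_iff)

lemma mnd1_id: "is_monad K T \<Longrightarrow> is_mnd1 K (id_mon1 K T)"
  using monad_ty[of T] by (simp add: is_mnd1_iff mndi1_id)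

lemma mndi1_cmp:
  assumes X: "is_mndi1 K X" and Y: "is_mndi1 K Y" and XY: "trg1 X = src1 Y"
  shows "is_mndi1 K (cmp_mon1 K Y X)"
proof -
  note ty = mndi1_tys[OF X] mndi1_tys[OF Y] XY
  have "(und1 X \<triangleright> mmult (src1 X)) \<ast> (str1 X \<triangleleft> mcar (src1 X)) \<ast> (mcar (src1 Y) \<triangleright> str1 X)
       = str1 X \<ast> (mmult (src1 Y) \<triangleleft> und1 X)"
    using X by (simp add: is_mndi1_iff XY)
  note 1 = this[THEN lwhisk3, of "und1 Y"] this[THEN lwhisk3, THEN reassoc3, of "und1 Y"]
  note 2 = mndi1_at[OF Y, of "und1 X"]
  show ?thesis
    using ty by (simp add: is_mndi1_iff hom1_iff hom2_iff naturality1[of "str1 Y"] naturality2[of "str1 Y"]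
       naturality1[of "str1 Y", THEN reassoc2] naturality2[of "str1 Y", THEN reassoc2] 1 2)
qed

lemma mnd1_cmp:
  assumes X: "is_mnd1 K X" and Y: "is_mnd1 K Y" and XY: "trg1 X = src1 Y"
  shows "is_mnd1 K (cmp_mon1 K Y X)"
proof -
  have X': "is_mndi1 K X" and Y': "is_mndi1 K Y" using X Y by (simp_all add: is_mnd1_iff)
  note ty = mndi1_tys[OF X'] mndi1_tys[OF Y'] XY
  have 1: "str1 X \<ast> (munit (src1 Y) \<triangleleft> und1 X) = und1 X \<triangleright> munit (src1 X)"
    using X by (simp add: is_mnd1_iff XY)
  have "str1 Y \<ast> (munit (trg1 Y) \<triangleleft> und1 Y) = und1 Y \<triangleright> munit (src1 Y)"
    using Y by (simp add: is_mnd1_iff)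
  from this[THEN rwhisk2, of "und1 X"]
  have 2: "(str1 Y \<triangleleft> und1 X) \<ast> (munit (trg1 Y) \<triangleleft> und1 Y \<cdot> und1 X) = und1 Y \<triangleright> munit (src1 Y) \<triangleleft> und1 X"
    using ty by simp
  show ?thesis using mndi1_cmp[OF X' Y' XY] ty by (simp add: is_mnd1_iff 1[THEN lwhisk2] 2)
qed

lemma act_cmp:
  assumes X: "is_mndi1 K X" and Y: "is_mndi1 K Y" and XY: "trg1 X = src1 Y"
    and M: "nmod K (src1 X) M r"
  shows "act K (cmp_mon1 K Y X) M r = act K Y (und1 X \<cdot> M) (act K X M r)"
  using mndi1_tys[OF X] mndi1_tys[OF Y] nmod_ty[OF M] XY by (simp add: act_def)

lemma act_ty:
  assumes X: "is_mndi1 K X" and M: "nmod K (src1 X) M r"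
  shows "act K X M r \<in> twos K" "s2 K (act K X M r) = mcar (trg1 X) \<cdot> und1 X \<cdot> M"
    "t2 K (act K X M r) = und1 X \<cdot> M"
  using nmod_ty[OF nmod_act[OF X M]] by simp_all

text \<open>The law of \<open>g\<close> directly gives an equation in which the idempotent of
  \<open>M\<close> sits under \<open>und1 X\<close>, whereas the claim asks for the idempotent of
  the transported module. Naturality of the unit shows that the two versions differ by the
  idempotent of the transported \<open>N\<close>, which its action absorbs.\<close>

lemma wmor_act:
  assumes X: "is_mndi1 K X" and M: "nmod K (src1 X) M r" and N: "nmod K (src1 X) N s"
    and g: "wmor K (src1 X) M r N s g"
  shows "wmor K (trg1 X) (und1 X \<cdot> M) (act K X M r) (und1 X \<cdot> N) (act K X N s) (und1 X \<triangleright> g)"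
proof -
  note XM = nmod_act[OF X M] and XN = nmod_act[OF X N]
  define \<theta> where "\<theta> = idem K (src1 X) M r"
  note T = mndi1_ty(1)[OF X] and T' = mndi1_ty(2)[OF X]
  note ty = mndi1_tys[OF X] nmod_ty[OF M] nmod_ty[OF N] wmor_ty[OF g] idem_ty[OF T M, folded \<theta>_def]
    act_ty[OF X M] act_ty[OF X N] idem_ty[OF T' XM] idem_ty[OF T' XN]
  have *: "(und1 X \<triangleright> g) \<ast> act K X M r = act K X N s \<ast> (mcar (trg1 X) \<triangleright> und1 X \<triangleright> (g \<ast> \<theta>))"
    using ty by (simp add: act_def naturality1[of "str1 X"] naturality2[of "str1 X"]
     naturality1[of "str1 X", THEN reassoc2] naturality2[of "str1 X", THEN reassoc2]
        wmor_eq[OF g, folded \<theta>_def, THEN lwhisk2] wmor_eq[OF g, folded \<theta>_def, THEN lwhisk2, THEN reassoc2])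
  have "(und1 X \<triangleright> g) \<ast> idem K (trg1 X) (und1 X \<cdot> M) (act K X M r) =
      ((und1 X \<triangleright> g) \<ast> act K X M r) \<ast> (munit (trg1 X) \<triangleleft> und1 X \<cdot> M)"
    using ty by (simp add: idem_def)
  also have "... = idem K (trg1 X) (und1 X \<cdot> N) (act K X N s) \<ast> (und1 X \<triangleright> (g \<ast> \<theta>))"
    unfolding * using ty by (simp add: idem_def naturality0[of "munit (trg1 X)"] naturality0[of "munit (trg1 X)", THEN reassoc2])
  finally have 2: "(und1 X \<triangleright> g) \<ast> idem K (trg1 X) (und1 X \<cdot> M) (act K X M r) =
      idem K (trg1 X) (und1 X \<cdot> N) (act K X N s) \<ast> (und1 X \<triangleright> (g \<ast> \<theta>))" .
  have "act K X N s \<ast> (mcar (trg1 X) \<triangleright> ((und1 X \<triangleright> g) \<ast> idem K (trg1 X) (und1 X \<cdot> M) (act K X M r))) =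
     act K X N s \<ast> (mcar (trg1 X) \<triangleright> und1 X \<triangleright> (g \<ast> \<theta>))"
    unfolding 2 using ty by (simp add: nmod_idem(3)[OF T' XN, THEN reassoc2])
  then show ?thesis using * ty by (simp add: wmor_def hom2_iff)
qed

lemma mndi2_at:
  assumes x: "is_mndi2 K x" and M: "N \<in> ones K" "t1 K N = mob (src1 (src2 x))"
  shows "(und2 x \<triangleleft> mcar (src1 (src2 x)) \<cdot> N) \<ast> (str1 (src2 x) \<triangleleft> N) =
        (und1 (trg2 x) \<triangleright> mmult (src1 (src2 x)) \<triangleleft> N) \<ast> (str1 (trg2 x) \<triangleleft> mcar (src1 (src2 x)) \<cdot> N)
          \<ast> (mcar (trg1 (src2 x)) \<triangleright> und2 x \<triangleleft> mcar (src1 (src2 x)) \<cdot> N)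
          \<ast> (mcar (trg1 (src2 x)) \<triangleright> str1 (src2 x) \<triangleleft> N)
          \<ast> (mcar (trg1 (src2 x)) \<triangleright> munit (trg1 (src2 x)) \<triangleleft> und1 (src2 x) \<cdot> N)"
proof -
  note ty = mndi2_ty[OF x] mndi1_tys[OF mndi2_ty(1)[OF x]] mndi1_ty(3-)[OF mndi2_ty(2)[OF x]] M
  have "(und2 x \<triangleleft> mcar (src1 (src2 x))) \<ast> str1 (src2 x) =
        (und1 (trg2 x) \<triangleright> mmult (src1 (src2 x))) \<ast> (str1 (trg2 x) \<triangleleft> mcar (src1 (src2 x)))
          \<ast> (mcar (trg1 (src2 x)) \<triangleright> und2 x \<triangleleft> mcar (src1 (src2 x)))
          \<ast> (mcar (trg1 (src2 x)) \<triangleright> str1 (src2 x))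
          \<ast> (mcar (trg1 (src2 x)) \<triangleright> munit (trg1 (src2 x)) \<triangleleft> und1 (src2 x))"
    using x unfolding is_mndi2_iff by blast
  from this[THEN rwhisk2, of N] show ?thesis
    using ty by simp
qed

text \<open>This is the 2-cell law of \<open>Mnd\<^sup>\<iota>\<close> whiskered with
  \<open>M\<close> and followed by the action: \<mu> acting on \<open>M\<close> is replaced by
  acting twice, and the inner action is carried to the right by naturality.\<close>

lemma wmor_mndi2:
  assumes x: "is_mndi2 K x" and M: "nmod K (src1 (src2 x)) M r"
  shows "wmor K (trg1 (src2 x)) (und1 (src2 x) \<cdot> M) (act K (src2 x) M r)
      (und1 (trg2 x) \<cdot> M) (act K (trg2 x) M r) (und2 x \<triangleleft> M)"
proof -
  note X = mndi2_ty(1)[OF x] note Y = mndi2_ty(2)[OF x]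
  note ty = mndi2_ty[OF x] mndi1_tys[OF X] mndi1_ty(3-)[OF Y] nmod_ty[OF M]
  note at = mndi2_at[OF x nmod_ty(1,2)[OF M]]
  have "(und2 x \<triangleleft> M) \<ast> act K (src2 x) M r = act K (trg2 x) M r \<ast>
    (mcar (trg1 (src2 x)) \<triangleright> ((und2 x \<triangleleft> M) \<ast> idem K (trg1 (src2 x)) (und1 (src2 x) \<cdot> M) (act K (src2 x) M r)))"
    using ty by (simp add: act_def idem_def naturality1[of "und2 x", THEN reassoc2] at
       nmod_assoc[OF M, symmetric, THEN lwhisk2, THEN reassoc2]
       naturality2[of "str1 (trg2 x)", THEN reassoc2]
       naturality1[of "und2 x", THEN lwhisk2, THEN reassoc2])
  then show ?thesis using ty by (simp add: wmor_def hom2_iff)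
qed

text \<open>The structure cell is recovered from the action on the free module \<open>t\<close>: the
  unit, moved past \<psi> by naturality, cancels the multiplication.\<close>

lemma act_free:
  assumes X: "is_mndi1 K X"
  shows "act K X (mcar (src1 X)) (mmult (src1 X)) \<ast> (mcar (trg1 X) \<triangleright> und1 X \<triangleright> munit (src1 X)) = str1 X"
proof -
  note ty = mndi1_tys[OF X]
  have "mmult (src1 X) \<ast> (mcar (src1 X) \<triangleright> munit (src1 X)) = id2 K (mcar (src1 X))"
    using ty(1) by (simp add: is_monad_iff)
  note 1 = this[THEN lwhisk2, THEN reassoc2]
  show ?thesis
    using ty by (simp add: act_def naturality2[of "str1 X"] 1)
qed

lemma nmod_free1: "is_monad K T \<Longrightarrow> nmod K T (mcar T) (mmult T)"
  by (auto simp: is_monad_iff nmod_def hom1_iff)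

text \<open>The converse of \<open>wmor_mndi2\<close>, tested on the free module alone. It reduces
  the closure of 2-cells under the compositions to the closure of \<open>wmor\<close>.\<close>

lemma mndi2_of_wmor:
  assumes X: "is_mndi1 K X" and Y: "is_mndi1 K Y"
    and st: "src1 Y = src1 X" "trg1 Y = trg1 X"
    and \<omega>: "\<omega> \<in> hom2 K (und1 X) (und1 Y)"
    and w: "wmor K (trg1 X) (und1 X \<cdot> mcar (src1 X)) (act K X (mcar (src1 X)) (mmult (src1 X)))
      (und1 Y \<cdot> mcar (src1 X)) (act K Y (mcar (src1 X)) (mmult (src1 X))) (\<omega> \<triangleleft> mcar (src1 X))"
  shows "is_mndi2 K (Mon2 X Y \<omega>)"
proof -
  note T = mndi1_ty(1)[OF X] and T' = mndi1_ty(2)[OF X] and F = nmod_free1[OF mndi1_ty(1)[OF X]]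
  define a where "a = act K X (mcar (src1 X)) (mmult (src1 X))"
  define b where "b = act K Y (mcar (src1 X)) (mmult (src1 X))"
  define \<theta> where "\<theta> = idem K (trg1 X) (und1 X \<cdot> mcar (src1 X)) a"
  note ty = mndi1_tys[OF X] mndi1_ty(3-)[OF Y, unfolded st] \<omega>[unfolded hom2_iff]
    act_ty[OF X F, folded a_def] act_ty[OF Y, unfolded st, OF F, folded b_def]
    idem_ty[OF T' nmod_act[OF X F], folded a_def, folded \<theta>_def]
  have 1: "a \<ast> (mcar (trg1 X) \<triangleright> und1 X \<triangleright> munit (src1 X)) = str1 X"
    using act_free[OF X] by (simp add: a_def)
  \<comment> \<open>Naturality of the target unit together with \<open>act_free\<close> identifies
    the idempotent, evaluated on the unit of the source monad, with the cell occurring on the right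
    of the 2-cell law.\<close>
  have 2: "\<theta> \<ast> (und1 X \<triangleright> munit (src1 X)) = str1 X \<ast> (munit (trg1 X) \<triangleleft> und1 X)"
    unfolding \<theta>_def idem_def using ty by (simp add: naturality0[of "munit (trg1 X)"] 1[THEN reassoc2])
  have w: "(\<omega> \<triangleleft> mcar (src1 X)) \<ast> a = b \<ast> (mcar (trg1 X) \<triangleright> ((\<omega> \<triangleleft> mcar (src1 X)) \<ast> \<theta>))"
    using wmor_eq[OF w] by (simp add: a_def b_def \<theta>_def)
  have "(\<omega> \<triangleleft> mcar (src1 X)) \<ast> str1 X =
     ((\<omega> \<triangleleft> mcar (src1 X)) \<ast> a) \<ast> (mcar (trg1 X) \<triangleright> und1 X \<triangleright> munit (src1 X))"
    unfolding 1[symmetric] using ty by simp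
  also have "... = b \<ast> (mcar (trg1 X) \<triangleright> ((\<omega> \<triangleleft> mcar (src1 X)) \<ast> str1 X \<ast> (munit (trg1 X) \<triangleleft> und1 X)))"
    unfolding w using ty by (simp flip: 2)
  finally show ?thesis using X Y ty by (simp add: is_mndi2_iff hom2_iff b_def act_def st)
qed

lemma mndi2_id2:
  assumes X: "is_mndi1 K X"
  shows "is_mndi2 K (Mon2 X X (id2 K (und1 X)))"
  using mndi1_tys[OF X] wmor_id2[OF mndi1_ty(2)[OF X] nmod_act[OF X nmod_free1[OF mndi1_ty(1)[OF X]]]]
  by (intro mndi2_of_wmor[OF X X]) (simp_all add: hom2_iff)

lemma mndi2_vcmp:
  assumes x: "is_mndi2 K x" and y: "is_mndi2 K y" and xy: "trg2 x = src2 y"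
  shows "is_mndi2 K (Mon2 (src2 x) (trg2 y) (und2 y \<ast> und2 x))"
proof -
  have y': "is_mndi1 K (trg2 y)" "src1 (trg2 y) = src1 (src2 x)" "trg1 (trg2 y) = trg1 (src2 x)"
    using mndi2_ty[OF x] mndi2_ty[OF y] xy by simp_all
  note T' = mndi1_ty(2)[OF mndi2_ty(1)[OF x]]
  note F = nmod_free1[OF mndi1_ty(1)[OF mndi2_ty(1)[OF x]]]
  note ty = mndi2_ty[OF x] mndi2_ty(5-)[OF y] xy y' mndi1_tys[OF mndi2_ty(1)[OF x]]
  have w: "wmor K (trg1 (src2 x)) (und1 (src2 y) \<cdot> mcar (src1 (src2 x)))
      (act K (src2 y) (mcar (src1 (src2 x))) (mmult (src1 (src2 x)))) (und1 (trg2 y) \<cdot> mcar (src1 (src2 x)))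
      (act K (trg2 y) (mcar (src1 (src2 x))) (mmult (src1 (src2 x)))) (und2 y \<triangleleft> mcar (src1 (src2 x)))"
    using wmor_mndi2[OF y, of "mcar (src1 (src2 x))" "mmult (src1 (src2 x))"] F ty by simp
  have n: "nmod K (trg1 (src2 x)) (und1 (src2 y) \<cdot> mcar (src1 (src2 x)))
      (act K (src2 y) (mcar (src1 (src2 x))) (mmult (src1 (src2 x))))"
    "nmod K (trg1 (src2 x)) (und1 (trg2 y) \<cdot> mcar (src1 (src2 x)))
      (act K (trg2 y) (mcar (src1 (src2 x))) (mmult (src1 (src2 x))))"
    using nmod_act[OF mndi2_ty(2)[OF x], unfolded mndi2_ty(3)[OF x], OF F] nmod_act[OF y'(1), unfolded y', OF F]
      xy ty by simp_all
  show ?thesis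
    using ty wmor_cmp[OF T' nmod_act[OF mndi2_ty(1)[OF x] F] n wmor_mndi2[OF x F, unfolded xy] w]
    by (intro mndi2_of_wmor) (simp_all add: hom2_iff)
qed

text \<open>On the free module the horizontal composite splits by interchange into two factors:
  \<open>und2 x\<close> transported along the 1-cell \<open>src2 y\<close>, a \<open>wmor\<close> by
  \<open>wmor_act\<close>, and \<open>und2 y\<close> evaluated at the transported module, a
  \<open>wmor\<close> by \<open>wmor_mndi2\<close>.\<close>

lemma mndi2_hcmp:
  assumes x: "is_mndi2 K x" and y: "is_mndi2 K y" and xy: "trg1 (src2 x) = src1 (src2 y)"
  shows "is_mndi2 K (Mon2 (cmp_mon1 K (src2 y) (src2 x)) (cmp_mon1 K (trg2 y) (trg2 x)) (und2 y \<star> und2 x))"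
proof -
  note X = mndi2_ty(1)[OF x] and X' = mndi2_ty(2)[OF x] and Y = mndi2_ty(1)[OF y] and Y' = mndi2_ty(2)[OF y]
  note ty = mndi2_ty(3-)[OF x] mndi2_ty(3-)[OF y] xy mndi1_tys[OF X] mndi1_tys[OF Y] mndi1_ty(3-6)[OF X'] mndi1_ty(3-6)[OF Y']
  define t \<mu> where "t = mcar (src1 (src2 x))" and "\<mu> = mmult (src1 (src2 x))"
  note F = nmod_free1[OF mndi1_ty(1)[OF X], folded t_def \<mu>_def]
  note F' = F[folded mndi2_ty(3)[OF x]]
  note t = nmod_ty[OF F]
  note nX = nmod_act[OF X F, unfolded xy] and nX' = nmod_act[OF X' F', unfolded mndi2_ty(4)[OF x] xy]
  note nY' = nX'[folded mndi2_ty(3)[OF y]]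
  have 1: "wmor K (trg1 (src2 y)) (und1 (src2 y) \<cdot> und1 (src2 x) \<cdot> t) (act K (cmp_mon1 K (src2 y) (src2 x)) t \<mu>)
    (und1 (src2 y) \<cdot> und1 (trg2 x) \<cdot> t) (act K (cmp_mon1 K (src2 y) (trg2 x)) t \<mu>) (und1 (src2 y) \<triangleright> (und2 x \<triangleleft> t))"
    using wmor_act[OF Y nX nX'] wmor_mndi2[OF x F] ty F F' X X' Y by (simp add: act_cmp)
  have 2: "wmor K (trg1 (src2 y)) (und1 (src2 y) \<cdot> und1 (trg2 x) \<cdot> t) (act K (cmp_mon1 K (src2 y) (trg2 x)) t \<mu>)
    (und1 (trg2 y) \<cdot> und1 (trg2 x) \<cdot> t) (act K (cmp_mon1 K (trg2 y) (trg2 x)) t \<mu>) (und2 y \<triangleleft> und1 (trg2 x) \<cdot> t)"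
    using wmor_mndi2[OF y nX'] ty F F' X X' Y Y' by (simp add: act_cmp)
  have eq: "(und2 y \<star> und2 x) \<triangleleft> t = (und2 y \<triangleleft> und1 (trg2 x) \<cdot> t) \<ast> (und1 (src2 y) \<triangleright> (und2 x \<triangleleft> t))"
    using ty t by (simp add: hcmp_eq)
  have "wmor K (trg1 (src2 y)) (und1 (src2 y) \<cdot> und1 (src2 x) \<cdot> t) (act K (cmp_mon1 K (src2 y) (src2 x)) t \<mu>)
    (und1 (trg2 y) \<cdot> und1 (trg2 x) \<cdot> t) (act K (cmp_mon1 K (trg2 y) (trg2 x)) t \<mu>) ((und2 y \<star> und2 x) \<triangleleft> t)"
    unfolding eq
    apply (rule wmor_cmp[OF _ _ _ _ 1 2])
    using X Y X' Y' F F' ty nmod_act[OF Y nX]  nmod_act[OF Y nX'] nmod_act[OF Y' nY'] by (simp_all add: act_cmp)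
  then show ?thesis
    using ty t mndi1_cmp[OF X Y xy] mndi1_cmp[OF X' Y']
    by (intro mndi2_of_wmor) (simp_all add: hom2_iff hcmp_typ t_def \<mu>_def)
qed

text \<open>The unit law of the source 1-cell replaces \<psi> after the unit by a whiskered unit;
  naturality moves \<omega> across it, and \<open>act_free\<close> collapses the remaining
  multiplication.\<close>

lemma mndi2_eq:
  assumes x: "is_mndi2 K x" and s: "is_mnd1 K (src2 x)"
  shows "(und2 x \<triangleleft> mcar (src1 (src2 x))) \<ast> str1 (src2 x) = str1 (trg2 x) \<ast> (mcar (trg1 (src2 x)) \<triangleright> und2 x)"
proof -
  note ty = mndi2_ty(3-)[OF x] mndi1_tys[OF mndi2_ty(1)[OF x]] mndi1_tys[OF mndi2_ty(2)[OF x]]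
  have 1: "str1 (src2 x) \<ast> (munit (trg1 (src2 x)) \<triangleleft> und1 (src2 x)) = und1 (src2 x) \<triangleright> munit (src1 (src2 x))"
    using s by (simp add: is_mnd1_iff)
  have "(und2 x \<triangleleft> mcar (src1 (src2 x))) \<ast> str1 (src2 x) = act K (trg2 x) (mcar (src1 (trg2 x))) (mmult (src1 (trg2 x))) \<ast>
      (mcar (trg1 (trg2 x)) \<triangleright> und1 (trg2 x) \<triangleright> munit (src1 (trg2 x))) \<ast> (mcar (trg1 (trg2 x)) \<triangleright> und2 x)"
    using mndi2_at[OF x, of "id1 K (mob (src1 (src2 x)))"] ty
    by (simp add: act_def 1[THEN lwhisk2] naturality1[of "und2 x", THEN lwhisk2])
  also have "... = str1 (trg2 x) \<ast> (mcar (trg1 (trg2 x)) \<triangleright> und2 x)"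
    using act_free[OF mndi2_ty(2)[OF x], THEN reassoc2, of "mcar (trg1 (trg2 x)) \<triangleright> und2 x"] ty
      act_ty[OF mndi2_ty(2)[OF x] nmod_free1] by simp
  finally show ?thesis using ty by simp
qed

text \<open>A cell commuting strictly with the structure cells induces a genuine module morphism on
  the free module.\<close>

lemma mndi2_of_strict:
  assumes X: "is_mndi1 K (src2 x)" and Y: "is_mndi1 K (trg2 x)" and st: "src1 (trg2 x) = src1 (src2 x)" "trg1 (trg2 x) = trg1 (src2 x)"
    and \<omega>: "und2 x \<in> hom2 K (und1 (src2 x)) (und1 (trg2 x))"
    and eq: "(und2 x \<triangleleft> mcar (src1 (src2 x))) \<ast> str1 (src2 x) = str1 (trg2 x) \<ast> (mcar (trg1 (src2 x)) \<triangleright> und2 x)"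
  shows "is_mndi2 K x"
proof -
  note ty = st mndi1_tys[OF X] mndi1_ty(3-)[OF Y] \<omega>[unfolded hom2_iff] nmod_ty[OF nmod_free1]
  note F = nmod_free1[OF mndi1_ty(1)[OF X]]
  note e = eq[THEN rwhisk2, of "mcar (src1 (src2 x))"]
  have e: "(und2 x \<triangleleft> mcar (src1 (src2 x)) \<cdot> mcar (src1 (src2 x))) \<ast> (str1 (src2 x) \<triangleleft> mcar (src1 (src2 x))) =
     (str1 (trg2 x) \<triangleleft> mcar (src1 (src2 x))) \<ast> (mcar (trg1 (src2 x)) \<triangleright> und2 x \<triangleleft> mcar (src1 (src2 x)))"
    using e ty by simp
  have "is_mndi2 K (Mon2 (src2 x) (trg2 x) (und2 x))"
    apply (rule mndi2_of_wmor[OF X Y st \<omega>])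
    apply (rule wmor_of_strict)
    using ty F nmod_act[OF X F] nmod_act[OF Y, unfolded st, OF F]
    by (simp_all add: hom2_iff act_def naturality1[of "und2 x", THEN reassoc2] e)
  then show ?thesis by simp
qed

text \<open>Hence \<open>mnd K\<close> is the locally full part of \<open>mndi K\<close> on the
  unital 1-cells. This lets one verification of the 2-category axioms serve both.\<close>

lemma is_mnd2_iff':
  "is_mnd2 K x \<longleftrightarrow> is_mndi2 K x \<and> is_mnd1 K (src2 x) \<and> is_mnd1 K (trg2 x)"
  (is "?L = ?R")
proof
  assume L: ?L
  then have "is_mndi2 K x" by (intro mndi2_of_strict) (auto simp: is_mnd2_iff is_mnd1_iff)
  with L show ?R by (simp add: is_mnd2_iff)
next
  assume ?R then show ?L using mndi2_eq[of x] mndi2_ty[of x] by (simp add: is_mnd2_iff hom2_iff)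
qed

end

section \<open>The 2-category axioms for monads with unital and with non-unital 1-cells\<close>

lemma (in two_category) cmp_mon1_assoc:
  assumes "is_mndi1 K X" "is_mndi1 K Y" "is_mndi1 K Z" "trg1 X = src1 Y" "trg1 Y = src1 Z"
  shows "cmp_mon1 K (cmp_mon1 K Z Y) X = cmp_mon1 K Z (cmp_mon1 K Y X)"
  using mndi1_tys[OF assms(1)] mndi1_tys[OF assms(2)] mndi1_tys[OF assms(3)] assms(4,5)
  by (simp add: cmp_mon1_def)

lemma (in two_category) cmp_mon1_id:
  assumes "is_mndi1 K X"
  shows "src1 X = T \<Longrightarrow> cmp_mon1 K X (id_mon1 K T) = X" "trg1 X = T' \<Longrightarrow> cmp_mon1 K (id_mon1 K T') X = X"
  using mndi1_tys[OF assms(1)]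
  by (auto simp add: cmp_mon1_def id_mon1_def intro!: mon1.expand)

lemma (in two_category) two_category_mnd_like:
  assumes C1: "C1 \<subseteq> {X. is_mndi1 K X}" and C2: "C2 = {x. is_mndi2 K x \<and> src2 x \<in> C1 \<and> trg2 x \<in> C1}"
    and id: "\<And>T. is_monad K T \<Longrightarrow> id_mon1 K T \<in> C1"
    and cmp: "\<And>X Y. X \<in> C1 \<Longrightarrow> Y \<in> C1 \<Longrightarrow> trg1 X = src1 Y \<Longrightarrow> cmp_mon1 K Y X \<in> C1"
  shows "two_category (mnd_like K C1 C2)"
proof -
  have C1D: "is_mndi1 K X" if "X \<in> C1" for X using that C1 by auto
  note L = C1D mndi1_ty mndi2_ty monad_ty id cmp mndi2_id2 mndi2_hcmp mndi2_vcmp cmp_mon1_id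
  have und2: "und1 (src2 x) = s2 K (und2 x)" "und1 (trg2 x) = t2 K (und2 x)" if "is_mndi2 K x" for x
    using mndi2_ty[OF that] by simp_all
  have hcmp_id1: "x \<star> id2 K (id1 K a) = x" "id2 K (id1 K b) \<star> x = x"
    if "x \<in> twos K" "s1 K (s2 K x) = a" "t1 K (s2 K x) = b" for x a b
    using whisk_id1[OF that(1)] that by (simp_all add: lwhisk_def rwhisk_def)
  show ?thesis
    by unfold_locales
      (auto simp: mnd_like_def C2 hom1_iff hom2_iff L cmp_mon1_assoc hcmp_typ hcmp_assoc' interchange' hcmp_id1
        intro!: mon2.expand)
qed

lemma (in two_category) two_category_mndi: "two_category (mndi K)"
  unfolding mndi_def
  by (rule two_category_mnd_like) (auto simp: mndi1_id mndi1_cmp mndi2_ty)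

lemma (in two_category) two_category_mnd: "two_category (mnd K)"
  unfolding mnd_def
  by (rule two_category_mnd_like) (auto simp: mnd1_id mnd1_cmp is_mnd2_iff' mnd1_mndi1)

section \<open>Eilenberg-Moore objects\<close>

lemma vop_sel [simp]:
  "obs (vop K) = obs K" "ones (vop K) = ones K" "twos (vop K) = twos K" "s1 (vop K) = s1 K" "t1 (vop K) = t1 K"
  "s2 (vop K) = t2 K" "t2 (vop K) = s2 K" "id1 (vop K) = id1 K" "id2 (vop K) = id2 K" "cmp1 (vop K) = cmp1 K"
  "vcmp (vop K) \<beta> \<alpha> = vcmp K \<alpha> \<beta>" "hcmp (vop K) = hcmp K" "vop (vop K) = K"
  by (simp_all add: vop_def)

lemma vop_hom [simp]: "hom1 (vop K) = hom1 K" "hom2 (vop K) f g = hom2 K g f"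
  "lwhisk (vop K) = lwhisk K" "rwhisk (vop K) = rwhisk K"
  by (auto simp: hom1_def hom2_def lwhisk_def rwhisk_def fun_eq_iff)

lemma two_category_vop: assumes "two_category K" shows "two_category (vop K)"
proof -
  interpret two_category K by fact
  have interchange'': "(\<beta>' \<ast>\<^bsub>K\<^esub> \<beta>) \<star>\<^bsub>K\<^esub> (\<alpha>' \<ast>\<^bsub>K\<^esub> \<alpha>) = (\<beta>' \<star>\<^bsub>K\<^esub> \<alpha>') \<ast>\<^bsub>K\<^esub> (\<beta> \<star>\<^bsub>K\<^esub> \<alpha>)"
    if "\<alpha> \<in> twos K" "\<alpha>' \<in> twos K" "\<beta> \<in> twos K" "\<beta>' \<in> twos K"
      "t2 K \<alpha> = s2 K \<alpha>'" "t2 K \<beta> = s2 K \<beta>'" "s1 K (s2 K \<beta>') = t1 K (s2 K \<alpha>')" for \<alpha> \<alpha>' \<beta> \<beta>'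
    using interchange'[of \<alpha> \<alpha>' \<beta> \<beta>'] that parallel'[of \<alpha>] parallel'[of \<beta>] by simp
  show ?thesis
    by unfold_locales
      (auto simp: hom1_iff hom2_iff hcmp_typ hcmp_assoc' interchange'' parallel' one_obs
       whisk_id1[unfolded lwhisk_def rwhisk_def])
qed

section \<open>Strict 2-functors and transposition along a 2-adjunction\<close>

context two_functor
begin

text \<open>Whiskering is horizontal composition with an identity 2-cell; for identity coherence
  cells, naturality of \<open>pcmp\<close> says that horizontal composites are preserved.\<close>

lemma on2_whisk:
  assumes \<alpha>: "\<alpha> \<in> twos A" and f: "f \<in> ones A"
  shows "s1 A f = t1 A (s2 A \<alpha>) \<Longrightarrow> on2 F (f \<triangleright>\<^bsub>A\<^esub> \<alpha>) = on1 F f \<triangleright> on2 F \<alpha>"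
    "s1 A (s2 A \<alpha>) = t1 A f \<Longrightarrow> on2 F (\<alpha> \<triangleleft>\<^bsub>A\<^esub> f) = on2 F \<alpha> \<triangleleft> on1 F f"
proof -
  let ?g = "s2 A \<alpha>" let ?g' = "t2 A \<alpha>"
  have \<alpha>': "\<alpha> \<in> hom2 A ?g ?g'" "?g \<in> hom1 A (s1 A ?g) (t1 A ?g)" "?g' \<in> hom1 A (s1 A ?g) (t1 A ?g)"
    "f \<in> hom1 A (s1 A f) (t1 A f)" "id2 A f \<in> hom2 A f f"
    using \<alpha> f by (auto simp: hom1_iff hom2_iff A.parallel')
  note ty = on2[OF \<alpha>'(1), unfolded hom2_iff] on1[OF \<alpha>'(2), unfolded hom1_iff] on1[OF \<alpha>'(3), unfolded hom1_iff]
    on1[OF \<alpha>'(4), unfolded hom1_iff] on2_id[OF f] B.parallel'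
  show "on2 F (f \<triangleright>\<^bsub>A\<^esub> \<alpha>) = on1 F f \<triangleright> on2 F \<alpha>" if s: "s1 A f = t1 A ?g"
    using pcmp_natural[OF \<alpha>'(2) \<alpha>'(4)[unfolded s] \<alpha>'(1,5)] strict_cmp[OF \<alpha>'(2) \<alpha>'(4)[unfolded s]]
      strict_cmp[OF \<alpha>'(3) \<alpha>'(4)[unfolded s]] ty s A.hcmp_typ[of \<alpha> "id2 A f"]
      on2[of "id2 A f \<star>\<^bsub>A\<^esub> \<alpha>" "f \<cdot>\<^bsub>A\<^esub> ?g" "f \<cdot>\<^bsub>A\<^esub> ?g'"] f \<alpha>
    by (simp add: lwhisk_def hom2_iff B.hcmp_typ)
  show "on2 F (\<alpha> \<triangleleft>\<^bsub>A\<^esub> f) = on2 F \<alpha> \<triangleleft> on1 F f" if s: "s1 A ?g = t1 A f"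
    using pcmp_natural[OF \<alpha>'(4) \<alpha>'(2)[unfolded s] \<alpha>'(5,1)] strict_cmp[OF \<alpha>'(4) \<alpha>'(2)[unfolded s]]
      strict_cmp[OF \<alpha>'(4) \<alpha>'(3)[unfolded s]] ty s A.hcmp_typ[of "id2 A f" \<alpha>]
      on2[of "\<alpha> \<star>\<^bsub>A\<^esub> id2 A f" "?g \<cdot>\<^bsub>A\<^esub> f" "?g' \<cdot>\<^bsub>A\<^esub> f"] f \<alpha>
    by (simp add: rwhisk_def hom2_iff B.hcmp_typ)
qed

lemma on1_ty:
  assumes "f \<in> ones A" shows "on1 F f \<in> ones B" "s1 B (on1 F f) = on0 F (s1 A f)" "t1 B (on1 F f) = on0 F (t1 A f)"
  using on1[of f "s1 A f" "t1 A f"] assms by (auto simp: hom1_iff)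

lemma on2_ty:
  assumes "f \<in> twos A" shows "on2 F f \<in> twos B" "s2 B (on2 F f) = on1 F (s2 A f)" "t2 B (on2 F f) = on1 F (t2 A f)"
  using on2[of f "s2 A f" "t2 A f"] assms by (auto simp: hom2_iff)

lemma on1_cmp:
  assumes "f \<in> ones A" "g \<in> ones A" "s1 A g = t1 A f"
  shows "on1 F (g \<cdot>\<^bsub>A\<^esub> f) = on1 F g \<cdot> on1 F f"
  using strict_cmp[of f "s1 A f" "t1 A f" g "t1 A g"] assms by (auto simp: hom1_iff)

end

locale two_adj = F: two_functor A B F + G: two_functor B A G
  for A :: "('o, 'm, 'c) two_cat" and B :: "('o1, 'm1, 'c1) two_cat"
    and F :: "('o, 'm, 'c, 'o1, 'm1, 'c1) psfun" and G :: "('o1, 'm1, 'c1, 'o, 'm, 'c) psfun" +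
  fixes u :: "'o \<Rightarrow> 'm" and e :: "'o1 \<Rightarrow> 'm1"
  assumes adj: "two_adjunction A B F G u e"
begin

lemma u_ty: assumes "a \<in> obs A" shows "u a \<in> ones A" "s1 A (u a) = a" "t1 A (u a) = on0 G (on0 F a)"
  using adj assms by (auto simp: two_adjunction_def two_natural_def id_psfun_def strict_psfun_def comp_psfun_def hom1_iff)

lemma e_ty: assumes "b \<in> obs B" shows "e b \<in> ones B" "s1 B (e b) = on0 F (on0 G b)" "t1 B (e b) = b"
  using adj assms by (auto simp: two_adjunction_def two_natural_def id_psfun_def strict_psfun_def comp_psfun_def hom1_iff)

lemma u_nat: assumes "f \<in> ones A" shows "on1 G (on1 F f) \<cdot>\<^bsub>A\<^esub> u (s1 A f) = u (t1 A f) \<cdot>\<^bsub>A\<^esub> f"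
  using adj assms by (auto simp: two_adjunction_def two_natural_def id_psfun_def strict_psfun_def comp_psfun_def hom1_iff)

lemma e_nat: assumes "f \<in> ones B" shows "f \<cdot>\<^bsub>B\<^esub> e (s1 B f) = e (t1 B f) \<cdot>\<^bsub>B\<^esub> on1 F (on1 G f)"
  using adj assms by (auto simp: two_adjunction_def two_natural_def id_psfun_def strict_psfun_def comp_psfun_def hom1_iff)

lemma u_nat2: assumes "x \<in> twos A"
  shows "on2 G (on2 F x) \<triangleleft>\<^bsub>A\<^esub> u (s1 A (s2 A x)) = u (t1 A (s2 A x)) \<triangleright>\<^bsub>A\<^esub> x"
  using adj assms F.A.two_ones[of x]
  by (auto simp: two_adjunction_def two_natural_def id_psfun_def strict_psfun_def comp_psfun_def hom1_iff hom2_iff)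

lemma e_nat2: assumes "x \<in> twos B"
  shows "x \<triangleleft>\<^bsub>B\<^esub> e (s1 B (s2 B x)) = e (t1 B (s2 B x)) \<triangleright>\<^bsub>B\<^esub> on2 F (on2 G x)"
  using adj assms F.B.two_ones[of x]
  by (auto simp: two_adjunction_def two_natural_def id_psfun_def strict_psfun_def comp_psfun_def hom1_iff hom2_iff)

lemma triangles:
  "a \<in> obs A \<Longrightarrow> e (on0 F a) \<cdot>\<^bsub>B\<^esub> on1 F (u a) = id1 B (on0 F a)"
  "b \<in> obs B \<Longrightarrow> on1 G (e b) \<cdot>\<^bsub>A\<^esub> u (on0 G b) = id1 A (on0 G b)"
  using adj by (auto simp: two_adjunction_def)

lemmas tys = u_ty e_ty F.on1_ty G.on1_ty F.on2_ty G.on2_ty F.A.one_obs F.B.one_obs F.on0 G.on0 F.A.two_ones F.B.two_ones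

text \<open>Surjectivity of the correspondence between 1-cells into \<open>b\<close> out of
  \<open>F a\<close> and 1-cells from \<open>a\<close> into \<open>G b\<close>: naturality of the
  counit and a triangle identity. \<open>transpose1_inverse\<close> is injectivity, from naturality
  of the unit and the other triangle.\<close>

lemma transpose1:
  assumes "a \<in> obs A" "X \<in> ones B" "s1 B X = on0 F a"
  shows "on1 G X \<cdot>\<^bsub>A\<^esub> u a \<in> hom1 A a (on0 G (t1 B X))" "e (t1 B X) \<cdot>\<^bsub>B\<^esub> on1 F (on1 G X \<cdot>\<^bsub>A\<^esub> u a) = X"
proof -
  show "on1 G X \<cdot>\<^bsub>A\<^esub> u a \<in> hom1 A a (on0 G (t1 B X))" using assms tys by (simp add: hom1_iff)
  have "e (t1 B X) \<cdot>\<^bsub>B\<^esub> on1 F (on1 G X \<cdot>\<^bsub>A\<^esub> u a) = (e (t1 B X) \<cdot>\<^bsub>B\<^esub> on1 F (on1 G X)) \<cdot>\<^bsub>B\<^esub> on1 F (u a)"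
    using assms tys by (simp add: F.on1_cmp)
  also have "... = (X \<cdot>\<^bsub>B\<^esub> e (s1 B X)) \<cdot>\<^bsub>B\<^esub> on1 F (u a)" using e_nat[OF assms(2)] by simp
  also have "... = X" using assms tys by (simp add: triangles)
  finally show "e (t1 B X) \<cdot>\<^bsub>B\<^esub> on1 F (on1 G X \<cdot>\<^bsub>A\<^esub> u a) = X" .
qed

lemma transpose1_inverse:
  assumes "b \<in> obs B" "q \<in> ones A" "t1 A q = on0 G b"
  shows "on1 G (e b \<cdot>\<^bsub>B\<^esub> on1 F q) \<cdot>\<^bsub>A\<^esub> u (s1 A q) = q"
proof -
  have "on1 G (e b \<cdot>\<^bsub>B\<^esub> on1 F q) \<cdot>\<^bsub>A\<^esub> u (s1 A q) = on1 G (e b) \<cdot>\<^bsub>A\<^esub> on1 G (on1 F q) \<cdot>\<^bsub>A\<^esub> u (s1 A q)"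
    using assms tys by (simp add: G.on1_cmp)
  also have "... = (on1 G (e b) \<cdot>\<^bsub>A\<^esub> u (on0 G b)) \<cdot>\<^bsub>A\<^esub> q" using assms tys by (simp add: u_nat)
  finally show ?thesis using assms by (simp add: triangles)
qed

lemma transpose2_inverse:
  assumes "b \<in> obs B" "w \<in> twos A" "t1 A (s2 A w) = on0 G b"
  shows "on2 G (e b \<triangleright>\<^bsub>B\<^esub> on2 F w) \<triangleleft>\<^bsub>A\<^esub> u (s1 A (s2 A w)) = w"
proof -
  have "on2 G (e b \<triangleright>\<^bsub>B\<^esub> on2 F w) \<triangleleft>\<^bsub>A\<^esub> u (s1 A (s2 A w)) = on1 G (e b) \<triangleright>\<^bsub>A\<^esub> on2 G (on2 F w) \<triangleleft>\<^bsub>A\<^esub> u (s1 A (s2 A w))"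
    using assms tys by (simp add: G.on2_whisk)
  also have "... = (on1 G (e b) \<cdot>\<^bsub>A\<^esub> u (on0 G b)) \<triangleright>\<^bsub>A\<^esub> w" using assms tys by (simp add: u_nat2)
  finally show ?thesis using assms by (simp add: triangles)
qed

text \<open>The 2-dimensional part of the adjunction: the argument of \<open>transpose1\<close>
  repeated with whiskered 2-cells.\<close>

lemma transpose2:
  assumes b: "b \<in> obs B" and q: "q \<in> hom1 A a (on0 G b)" "q' \<in> hom1 A a (on0 G b)"
    and \<Omega>: "\<Omega> \<in> hom2 B (e b \<cdot>\<^bsub>B\<^esub> on1 F q) (e b \<cdot>\<^bsub>B\<^esub> on1 F q')"
  shows "on2 G \<Omega> \<triangleleft>\<^bsub>A\<^esub> u a \<in> hom2 A q q'" "e b \<triangleright>\<^bsub>B\<^esub> on2 F (on2 G \<Omega> \<triangleleft>\<^bsub>A\<^esub> u a) = \<Omega>"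
proof -
  note q' = q[unfolded hom1_iff] \<Omega>[unfolded hom2_iff] F.A.hom1_obs[OF q(1)]
  show "on2 G \<Omega> \<triangleleft>\<^bsub>A\<^esub> u a \<in> hom2 A q q'"
    using q' b tys transpose1_inverse[of b q] transpose1_inverse[of b q'] by (simp add: hom2_iff)
  have "e b \<triangleright>\<^bsub>B\<^esub> on2 F (on2 G \<Omega> \<triangleleft>\<^bsub>A\<^esub> u a) = (e b \<triangleright>\<^bsub>B\<^esub> on2 F (on2 G \<Omega>)) \<triangleleft>\<^bsub>B\<^esub> on1 F (u a)"
    using q' b tys by (simp add: F.on2_whisk)
  also have "... = (\<Omega> \<triangleleft>\<^bsub>B\<^esub> e (on0 F a)) \<triangleleft>\<^bsub>B\<^esub> on1 F (u a)"
    using e_nat2[of \<Omega>] q' b tys by simp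
  also have "... = \<Omega>" using q' b tys by (simp add: triangles)
  finally show "e b \<triangleright>\<^bsub>B\<^esub> on2 F (on2 G \<Omega> \<triangleleft>\<^bsub>A\<^esub> u a) = \<Omega>" .
qed

end

lemma two_adjI: "two_adjunction A B F G u e \<Longrightarrow> two_adj A B F G u e"
  by (simp add: two_adj_def two_adj_axioms_def two_adjunction_def)

text \<open>The action carried by the counit of the 2-adjunction at \<open>T\<close>. Together with
  \<open>em_v\<close> it is the universal unital module, and it equals v \<epsilon> by the lemma
  \<open>em_eps\<close>.\<close>

definition em_act :: "('o, 'm, 'c) em \<Rightarrow> ('o, 'm, 'c) mon \<Rightarrow> 'c" where
  "em_act E T = str1 (em_counit E T)"

lemma mnd_sel [simp]:
  "obs (mnd K) = {T. is_monad K T}" "ones (mnd K) = {X. is_mnd1 K X}" "twos (mnd K) = {x. is_mnd2 K x}"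
  "s1 (mnd K) = src1" "t1 (mnd K) = trg1" "s2 (mnd K) = src2" "t2 (mnd K) = trg2" "id1 (mnd K) = id_mon1 K"
  "id2 (mnd K) X = Mon2 X X (id2 K (und1 X))" "cmp1 (mnd K) = cmp_mon1 K"
  "vcmp (mnd K) y x = Mon2 (src2 x) (trg2 y) (und2 y \<ast>\<^bsub>K\<^esub> und2 x)"
  "hcmp (mnd K) y x = Mon2 (cmp_mon1 K (src2 y) (src2 x)) (cmp_mon1 K (trg2 y) (trg2 x)) (und2 y \<star>\<^bsub>K\<^esub> und2 x)"
  "lwhisk (mnd K) Y x = Mon2 (cmp_mon1 K Y (src2 x)) (cmp_mon1 K Y (trg2 x)) (und1 Y \<triangleright>\<^bsub>K\<^esub> und2 x)"
  "rwhisk (mnd K) y X = Mon2 (cmp_mon1 K (src2 y) X) (cmp_mon1 K (trg2 y) X) (und2 y \<triangleleft>\<^bsub>K\<^esub> und1 X)"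
  by (simp_all add: mnd_def mnd_like_def lwhisk_def rwhisk_def)

lemma mndi_sel [simp]:
  "obs (mndi K) = {T. is_monad K T}" "ones (mndi K) = {X. is_mndi1 K X}" "twos (mndi K) = {x. is_mndi2 K x}"
  "s1 (mndi K) = src1" "t1 (mndi K) = trg1" "s2 (mndi K) = src2" "t2 (mndi K) = trg2" "id1 (mndi K) = id_mon1 K"
  "id2 (mndi K) X = Mon2 X X (id2 K (und1 X))" "cmp1 (mndi K) = cmp_mon1 K"
  "vcmp (mndi K) y x = Mon2 (src2 x) (trg2 y) (und2 y \<ast>\<^bsub>K\<^esub> und2 x)"
  "hcmp (mndi K) y x = Mon2 (cmp_mon1 K (src2 y) (src2 x)) (cmp_mon1 K (trg2 y) (trg2 x)) (und2 y \<star>\<^bsub>K\<^esub> und2 x)"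
  "lwhisk (mndi K) Y x = Mon2 (cmp_mon1 K Y (src2 x)) (cmp_mon1 K Y (trg2 x)) (und1 Y \<triangleright>\<^bsub>K\<^esub> und2 x)"
  "rwhisk (mndi K) y X = Mon2 (cmp_mon1 K (src2 y) X) (cmp_mon1 K (trg2 y) X) (und2 y \<triangleleft>\<^bsub>K\<^esub> und1 X)"
  by (simp_all add: mndi_def mnd_like_def lwhisk_def rwhisk_def)

lemma incl_mnd_sel [simp]: "on0 (incl_mnd K) = triv_monad K" "on1 (incl_mnd K) = triv_mon1 K"
  "on2 (incl_mnd K) \<omega> = Mon2 (triv_mon1 K (s2 K \<omega>)) (triv_mon1 K (t2 K \<omega>)) \<omega>"
  by (simp_all add: incl_mnd_def strict_psfun_def)

lemma triv_sel [simp]: "mob (triv_monad K k) = k" "mcar (triv_monad K k) = id1 K k"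
  "mmult (triv_monad K k) = id2 K (id1 K k)" "munit (triv_monad K k) = id2 K (id1 K k)"
  "src1 (triv_mon1 K V) = triv_monad K (s1 K V)" "trg1 (triv_mon1 K V) = triv_monad K (t1 K V)"
  "und1 (triv_mon1 K V) = V" "str1 (triv_mon1 K V) = id2 K V"
  by (simp_all add: triv_monad_def triv_mon1_def)

section \<open>Eilenberg-Moore objects as representing objects of unital modules\<close>

context two_category
begin

lemma is_monad_triv: "k \<in> obs K \<Longrightarrow> is_monad K (triv_monad K k)"
  by (simp add: is_monad_iff hom1_iff hom2_iff)

text \<open>Unital modules with domain \<open>l\<close> are the 1-cells of \<open>mnd K\<close> from
  the trivial monad on \<open>l\<close>. This and \<open>mnd1_umod\<close> translate the
  2-adjunction into a statement on modules.\<close>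

lemma umod_mnd1:
  assumes "is_monad K T" "umod K T M r"
  shows "is_mnd1 K (Mon1 (triv_monad K (s1 K M)) T M r)"
  using monad_ty[OF assms(1)] nmod_ty[OF umod_nmod[OF assms(2)]] assms one_obs[of M]
   nmod_assoc[OF umod_nmod[OF assms(2)]]
  by (simp add: is_mnd1_iff is_mndi1_iff is_monad_triv hom1_iff hom2_iff umod_def idem_def)

lemma mnd1_umod:
  assumes "is_mnd1 K X" "src1 X = triv_monad K l"
  shows "umod K (trg1 X) (und1 X) (str1 X)"
  using assms mndi1_tys[OF mnd1_mndi1[OF assms(1)]]
  by (simp add: is_mnd1_iff is_mndi1_iff is_monad_triv hom1_iff hom2_iff umod_def nmod_def idem_def)

end

locale em_monads = two_category K for K :: "('o, 'm, 'c) two_cat" (structure) +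
  fixes E :: "('o, 'm, 'c) em"
  assumes em: "em_for_monads K E"
begin

sublocale M: two_category "mnd K" by (rule two_category_mnd)

sublocale ad: two_adj K "mnd K" "incl_mnd K" "emJ E" "em_unit E" "em_counit E"
  using em by (auto simp: em_for_monads_def intro: two_adjI)

abbreviation "J0 \<equiv> on0 (emJ E)"
abbreviation "J1 \<equiv> on1 (emJ E)"
abbreviation "J2 \<equiv> on2 (emJ E)"

lemma J0_obs: "is_monad K T \<Longrightarrow> J0 T \<in> obs K"
  using ad.G.on0[of T] by simp

lemma em_counit_eq:
  assumes T: "is_monad K T"
  shows "is_mnd1 K (em_counit E T)"
    "src1 (em_counit E T) = triv_monad K (J0 T)" "trg1 (em_counit E T) = T"
    "und1 (em_counit E T) = em_v E T" "str1 (em_counit E T) = em_act E T"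
  using ad.e_ty[of T] T by (simp_all add: em_v_def em_act_def)

lemma em_v_ty:
  assumes T: "is_monad K T"
  shows "em_v E T \<in> ones K" "s1 K (em_v E T) = J0 T" "t1 K (em_v E T) = mob T" "umod K T (em_v E T) (em_act E T)"
  using em_counit_eq[OF T] mndi1_ty[OF mnd1_mndi1[OF em_counit_eq(1)[OF T]]] mnd1_umod[of "em_counit E T"] by simp_all

lemma em_act_nmod: "is_monad K T \<Longrightarrow> nmod K T (em_v E T) (em_act E T)"
  using em_v_ty(4) umod_nmod by blast

lemmas em_tys = em_v_ty(1-3) J0_obs nmod_ty(3-5)[OF em_act_nmod]

text \<open>In terms of modules, composing the counit with \<open>I q\<close> restricts the
  universal module along \<open>q\<close>.\<close>

lemma cmp_counit:
  assumes T: "is_monad K T" and q: "q \<in> ones K" "t1 K q = J0 T"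
  shows "cmp_mon1 K (em_counit E T) (triv_mon1 K q) = Mon1 (triv_monad K (s1 K q)) T (em_v E T \<cdot> q) (em_act E T \<triangleleft> q)"
  using T q em_tys[OF T] monad_ty[OF T] by (simp add: cmp_mon1_def em_counit_eq)

text \<open>The classifying 1-cell is the transpose of the module, read as a 1-cell out of a trivial
  monad.\<close>

lemma em_ex1:
  assumes T: "is_monad K T" and M: "umod K T M r"
  shows "\<exists>q \<in> hom1 K (s1 K M) (J0 T). em_v E T \<cdot> q = M \<and> em_act E T \<triangleleft> q = r"
proof -
  let ?X = "Mon1 (triv_monad K (s1 K M)) T M r"
  let ?q = "J1 ?X \<cdot> em_unit E (s1 K M)"
  have l: "s1 K M \<in> obs K" using nmod_ty[OF umod_nmod[OF M]] one_obs by blast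
  note 1 = ad.transpose1[of "s1 K M" ?X]
  have q: "?q \<in> hom1 K (s1 K M) (J0 T)" "cmp_mon1 K (em_counit E T) (triv_mon1 K ?q) = ?X"
    using 1 umod_mnd1[OF T M] l by simp_all
  then show ?thesis using cmp_counit[OF T, of ?q] by (auto simp: hom1_iff)
qed

lemma em_uniq1:
  assumes T: "is_monad K T" and q: "q \<in> hom1 K l (J0 T)" "q' \<in> hom1 K l (J0 T)"
    and "em_v E T \<cdot> q = em_v E T \<cdot> q'" "em_act E T \<triangleleft> q = em_act E T \<triangleleft> q'"
  shows "q = q'"
  using ad.transpose1_inverse[of T q] ad.transpose1_inverse[of T q'] assms cmp_counit[OF T, of q] cmp_counit[OF T, of q']
  by (simp add: hom1_iff)

lemma mnd2_umod:
  assumes T: "is_monad K T" and M: "umod K T M r" and N: "umod K T N s" and "s1 K N = s1 K M"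
    and "\<omega> \<in> hom2 K M N" "\<omega> \<ast> r = s \<ast> (mcar T \<triangleright> \<omega>)"
  shows "is_mnd2 K (Mon2 (Mon1 (triv_monad K (s1 K M)) T M r) (Mon1 (triv_monad K (s1 K M)) T N s) \<omega>)"
  using assms umod_mnd1[OF T M] umod_mnd1[OF T N] nmod_ty[OF umod_nmod[OF M]]
  by (simp add: is_mnd2_iff hom2_iff)

lemma umod_cmp:
  assumes T: "is_monad K T" and M: "umod K T M r" and q: "q \<in> ones K" "t1 K q = s1 K M"
  shows "umod K T (M \<cdot> q) (r \<triangleleft> q)"
proof -
  note ty = monad_ty[OF T] nmod_ty[OF umod_nmod[OF M]] q
  have "idem K T M r = id2 K M" using M by (simp add: umod_def)
  then have 1: "r \<ast> (munit T \<triangleleft> M) = id2 K M" by (simp add: idem_def)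
  have "(r \<triangleleft> q) \<ast> (munit T \<triangleleft> M \<cdot> q) = id2 K M \<triangleleft> q" using 1[THEN rwhisk2, of q] ty by simp
  moreover have "(r \<triangleleft> q) \<ast> (mcar T \<triangleright> r \<triangleleft> q) = (r \<triangleleft> q) \<ast> (mmult T \<triangleleft> M \<cdot> q)"
    using nmod_assoc[OF umod_nmod[OF M], THEN rwhisk2, of q] ty by simp
  ultimately show ?thesis using ty by (simp add: umod_def nmod_def idem_def hom2_iff)
qed

text \<open>A module morphism between restrictions of the universal module is a 2-cell of
  \<open>mnd K\<close> between composites with the counit, so it has a transpose.\<close>

lemma em_ex2:
  assumes T: "is_monad K T" and q: "q \<in> hom1 K l (J0 T)" "q' \<in> hom1 K l (J0 T)"
    and \<omega>: "\<omega> \<in> hom2 K (em_v E T \<cdot> q) (em_v E T \<cdot> q')"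
    and eq: "\<omega> \<ast> (em_act E T \<triangleleft> q) = (em_act E T \<triangleleft> q') \<ast> (mcar T \<triangleright> \<omega>)"
  shows "\<exists>w \<in> hom2 K q q'. em_v E T \<triangleright> w = \<omega>"
proof -
  let ?\<Omega> = "Mon2 (cmp_mon1 K (em_counit E T) (triv_mon1 K q)) (cmp_mon1 K (em_counit E T) (triv_mon1 K q')) \<omega>"
  note u = umod_cmp[OF T em_v_ty(4)[OF T], of q] umod_cmp[OF T em_v_ty(4)[OF T], of q']
  have "is_mnd2 K ?\<Omega>" using mnd2_umod[OF T u] q \<omega> eq T em_tys[OF T]
    by (simp add: cmp_counit hom1_iff)
  then have "?\<Omega> \<in> hom2 (mnd K) (cmp_mon1 K (em_counit E T) (triv_mon1 K q)) (cmp_mon1 K (em_counit E T) (triv_mon1 K q'))"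
    by (simp add: hom2_iff)
  with ad.transpose2[of T q l q' ?\<Omega>] q T em_counit_eq[OF T] show ?thesis by (auto simp: )
qed

lemma em_uniq2:
  assumes T: "is_monad K T" and w: "w \<in> twos K" "w' \<in> twos K" "s2 K w = s2 K w'" "t2 K w = t2 K w'" "t1 K (s2 K w) = J0 T"
    and eq: "em_v E T \<triangleright> w = em_v E T \<triangleright> w'"
  shows "w = w'"
  using ad.transpose2_inverse[of T w] ad.transpose2_inverse[of T w'] assms em_counit_eq[OF T]
  by simp

text \<open>Comparing the underlying 1-cells and structure cells in the naturality square of the
  counit gives both equations; by \<open>em_uniq1\<close> they determine
  \<open>J1 X\<close>.\<close>

lemma J1:
  assumes X: "is_mnd1 K X"
  shows "J1 X \<in> hom1 K (J0 (src1 X)) (J0 (trg1 X))"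
    "em_v E (trg1 X) \<cdot> J1 X = und1 X \<cdot> em_v E (src1 X)"
    "em_act E (trg1 X) \<triangleleft> J1 X = act K X (em_v E (src1 X)) (em_act E (src1 X))"
proof -
  note ty = mndi1_ty[OF mnd1_mndi1[OF X]]
  show J: "J1 X \<in> hom1 K (J0 (src1 X)) (J0 (trg1 X))"
    using ad.G.on1_ty[of X] X by (simp add: hom1_iff)
  have 1: "cmp_mon1 K X (em_counit E (src1 X)) = cmp_mon1 K (em_counit E (trg1 X)) (triv_mon1 K (J1 X))"
    using ad.e_nat[of X] X by simp
  also have "... = Mon1 (triv_monad K (J0 (src1 X))) (trg1 X) (em_v E (trg1 X) \<cdot> J1 X) (em_act E (trg1 X) \<triangleleft> J1 X)"
    using cmp_counit[OF ty(2), of "J1 X"] J by (simp add: hom1_iff)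
  finally have "und1 (cmp_mon1 K X (em_counit E (src1 X))) = em_v E (trg1 X) \<cdot> J1 X"
    "str1 (cmp_mon1 K X (em_counit E (src1 X))) = em_act E (trg1 X) \<triangleleft> J1 X"
    by simp_all
  then show "em_v E (trg1 X) \<cdot> J1 X = und1 X \<cdot> em_v E (src1 X)"
    "em_act E (trg1 X) \<triangleleft> J1 X = act K X (em_v E (src1 X)) (em_act E (src1 X))"
    unfolding cmp_mon1_sel act_def em_counit_eq(4,5)[OF ty(1)] by simp_all
qed

lemma J2:
  assumes x: "is_mnd2 K x"
  shows "J2 x \<in> hom2 K (J1 (src2 x)) (J1 (trg2 x))"
    "em_v E (trg1 (src2 x)) \<triangleright> J2 x = und2 x \<triangleleft> em_v E (src1 (src2 x))"
proof -
  have x': "is_mndi2 K x" using x by (simp add: is_mnd2_iff')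
  note ty = mndi1_ty[OF mndi2_ty(1)[OF x']]
  show "J2 x \<in> hom2 K (J1 (src2 x)) (J1 (trg2 x))"
    using ad.G.on2_ty[of x] x by (simp add: hom2_iff)
  have "und2 (x \<triangleleft>\<^bsub>mnd K\<^esub> em_counit E (src1 (src2 x))) =
      und2 (em_counit E (trg1 (src2 x)) \<triangleright>\<^bsub>mnd K\<^esub> on2 (incl_mnd K) (J2 x))"
    using ad.e_nat2[of x] x by simp
  then show "em_v E (trg1 (src2 x)) \<triangleright> J2 x = und2 x \<triangleleft> em_v E (src1 (src2 x))"
    using em_counit_eq(4)[OF ty(1)] em_counit_eq(4)[OF ty(2)] by simp
qed

lemma J1_cmp: "is_mnd1 K X \<Longrightarrow> is_mnd1 K Y \<Longrightarrow> trg1 X = src1 Y \<Longrightarrow> J1 (cmp_mon1 K Y X) = J1 Y \<cdot> J1 X"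
  using ad.G.on1_cmp[of X Y] by simp

lemma J_pcmp: "is_mnd1 K X \<Longrightarrow> is_mnd1 K Y \<Longrightarrow> trg1 X = src1 Y \<Longrightarrow> pcmp (emJ E) Y X = id2 K (J1 Y \<cdot> J1 X)"
  using ad.G.strict_cmp[of X "src1 X" "trg1 X" Y "trg1 Y"] by (simp add: hom1_iff J1_cmp)

lemma J1_id: "is_monad K T \<Longrightarrow> J1 (id_mon1 K T) = id1 K (J0 T)"
  using ad.G.strict_id[of T] by simp

lemma J_punt: "is_monad K T \<Longrightarrow> punt (emJ E) T = id2 K (id1 K (J0 T))"
  using ad.G.strict_id[of T] by simp

lemma em_eps:
  assumes T: "is_monad K T"
  shows "em_f K E T \<in> hom1 K (mob T) (J0 T)" "em_eps K E T \<in> hom2 K (em_f K E T \<cdot> em_v E T) (id1 K (J0 T))"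
    "em_v E T \<triangleright> em_eps K E T = em_act E T"
proof -
  let ?f = "em_f K E T"
  note ty = monad_ty[OF T] em_tys[OF T]
  have free: "umod K T (mcar T) (mmult T)"
    using T nmod_free1[OF T] by (auto simp: umod_def idem_def is_monad_iff)
  note 1 = ad.transpose1[of "mob T" "Mon1 (triv_monad K (mob T)) T (mcar T) (mmult T)"]
  have f: "?f \<in> hom1 K (mob T) (J0 T)"
    "cmp_mon1 K (em_counit E T) (triv_mon1 K ?f) = Mon1 (triv_monad K (mob T)) T (mcar T) (mmult T)"
    using 1 umod_mnd1[OF T free] ty by (simp_all add: em_f_def)
  then show "?f \<in> hom1 K (mob T) (J0 T)" by simp
  \<comment> \<open>The 1-cell f was obtained by transposing the free module, so it classifies that
    module; this gives \<open>t = v f\<close>.\<close>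
  have f': "em_v E T \<cdot> ?f = mcar T" "em_act E T \<triangleleft> ?f = mmult T"
    using f cmp_counit[OF T, of ?f] by (auto simp: hom1_iff)
  define q where "q = ?f \<cdot> em_v E T"
  have q: "q \<in> hom1 K (J0 T) (J0 T)" using f(1) ty by (simp add: hom1_iff q_def)
  have "em_v E T \<cdot> q = (em_v E T \<cdot> ?f) \<cdot> em_v E T" "em_act E T \<triangleleft> q = (em_act E T \<triangleleft> ?f) \<triangleleft> em_v E T"
    using f(1) ty by (simp_all add: hom1_iff q_def)
  then have vq: "em_v E T \<cdot> q = mcar T \<cdot> em_v E T" "em_act E T \<triangleleft> q = mmult T \<triangleleft> em_v E T"
    by (simp_all only: f')
  let ?X = "cmp_mon1 K (em_counit E T) (triv_mon1 K q)"
  let ?\<Omega> = "Mon2 ?X (em_counit E T) (em_act E T)"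
  have X: "?X = Mon1 (triv_monad K (J0 T)) T (mcar T \<cdot> em_v E T) (mmult T \<triangleleft> em_v E T)"
    using cmp_counit[OF T, of q] q vq by (simp add: hom1_iff)
  have c: "em_counit E T = Mon1 (triv_monad K (J0 T)) T (em_v E T) (em_act E T)"
    using em_counit_eq[OF T] by (intro mon1.expand) simp_all
  have ci: "cmp_mon1 K (em_counit E T) (triv_mon1 K (id1 K (J0 T))) = em_counit E T"
    using cmp_counit[OF T, of "id1 K (J0 T)"] c ty by simp
  \<comment> \<open>By associativity the action is a morphism from the free module on v to v itself,
    hence a 2-cell of \<open>mnd K\<close>. Its transpose is what \<open>em_eps\<close>
    denotes.\<close>
  have "is_mnd2 K (Mon2 (Mon1 (triv_monad K (s1 K (mcar T \<cdot> em_v E T))) T (mcar T \<cdot> em_v E T) (mmult T \<triangleleft> em_v E T)) (Mon1 (triv_monad K (s1 K (mcar T \<cdot> em_v E T))) T (em_v E T) (em_act E T)) (em_act E T))"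
    using ty nmod_assoc[OF em_act_nmod[OF T]]
    by (intro mnd2_umod[OF T nmod_free[OF T] em_v_ty(4)[OF T]]) (simp_all add: hom2_iff)
  then have \<Omega>: "is_mnd2 K ?\<Omega>" using X c ty by simp
  have h: "?\<Omega> \<in> hom2 (mnd K) (em_counit E T \<cdot>\<^bsub>mnd K\<^esub> on1 (incl_mnd K) q)
     (em_counit E T \<cdot>\<^bsub>mnd K\<^esub> on1 (incl_mnd K) (id1 K (J0 T)))"
    using \<Omega> ci by (simp add: hom2_iff)
  have e: "em_eps K E T = J2 ?\<Omega> \<triangleleft> em_unit E (J0 T)" by (simp add: em_eps_def q_def em_act_def)
  have id: "id1 K (J0 T) \<in> hom1 K (J0 T) (J0 T)" using ty by (simp add: hom1_iff)
  have o: "T \<in> obs (mnd K)" using T by simp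
  note 2 = ad.transpose2[OF o q id h, folded e]
  show "em_eps K E T \<in> hom2 K (?f \<cdot> em_v E T) (id1 K (J0 T))"
    using 2(1) by (simp only: q_def)
  have "und2 (em_counit E T \<triangleright>\<^bsub>mnd K\<^esub> on2 (incl_mnd K) (em_eps K E T)) = em_act E T"
    unfolding 2(2) by simp
  then show "em_v E T \<triangleright> em_eps K E T = em_act E T"
    using em_counit_eq[OF T] by simp
qed

end

section \<open>The pseudo-functor \<open>Q\<close>\<close>

context two_category
begin

lemma splitD:
  assumes "is_splitting K \<theta> S" "\<theta> \<in> hom2 K M M"
  shows "split_ob S \<in> ones K" "s1 K (split_ob S) = s1 K M" "t1 K (split_ob S) = t1 K M"
    "split_pr S \<in> twos K" "s2 K (split_pr S) = M" "t2 K (split_pr S) = split_ob S"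
    "split_in S \<in> twos K" "s2 K (split_in S) = split_ob S" "t2 K (split_in S) = M"
    "split_pr S \<ast> split_in S = id2 K (split_ob S)" "split_in S \<ast> split_pr S = \<theta>"
    "split_pr S \<ast> \<theta> = split_pr S" "\<theta> \<ast> split_in S = split_in S"
proof -
  show 1: "split_ob S \<in> ones K"
    "split_pr S \<in> twos K" "s2 K (split_pr S) = M" "t2 K (split_pr S) = split_ob S"
    "split_in S \<in> twos K" "s2 K (split_in S) = split_ob S" "t2 K (split_in S) = M"
   and 2: "split_pr S \<ast> split_in S = id2 K (split_ob S)" "split_in S \<ast> split_pr S = \<theta>"
    using assms by (auto simp: is_splitting_def hom2_iff split: splitting.splits)
  show "s1 K (split_ob S) = s1 K M" "t1 K (split_ob S) = t1 K M"
    using 1 parallel'[of "split_pr S"] by simp_all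
  have "split_pr S \<ast> \<theta> = (split_pr S \<ast> split_in S) \<ast> split_pr S" using 1 by (simp flip: 2(2))
  then show "split_pr S \<ast> \<theta> = split_pr S" using 1 2(1) by simp
  have "\<theta> \<ast> split_in S = split_in S \<ast> (split_pr S \<ast> split_in S)" using 1 by (simp flip: 2(2))
  then show "\<theta> \<ast> split_in S = split_in S" using 1 2(1) by simp
qed

text \<open>On the retract the unit acts by the idempotent placed between projection and inclusion,
  which is an identity. In the associativity law the inclusion after projection in the middle is the
  idempotent, and the action absorbs it.\<close>

lemma umod_split:
  assumes T: "is_monad K T" and M: "nmod K T M r" and S: "is_splitting K (idem K T M r) S"
  shows "umod K T (split_ob S) (split_pr S \<ast> r \<ast> (mcar T \<triangleright> split_in S))"
proof -
  note s = splitD[OF S nmod_idem(1)[OF T M]] and i = nmod_idem[OF T M]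
  note ty = monad_ty[OF T] nmod_ty[OF M] s(1-9) idem_ty[OF T M]
  have "split_pr S \<ast> r \<ast> (mcar T \<triangleright> split_in S) \<ast> (munit T \<triangleleft> split_ob S) = split_pr S \<ast> idem K T M r \<ast> split_in S"
    using ty by (simp add: idem_def naturality0[of "munit T"])
  then have u: "split_pr S \<ast> r \<ast> (mcar T \<triangleright> split_in S) \<ast> (munit T \<triangleleft> split_ob S) = id2 K (split_ob S)"
    using s(10) by (simp add: s(13))
  show ?thesis
    using ty by (simp add: umod_def nmod_def hom2_iff idem_def[of K T "split_ob S"] u
      naturality1[of "mmult T"] naturality2[of "mmult T"] naturality2[of "mmult T", THEN reassoc2]
     s(11)[THEN lwhisk2, THEN reassoc2] i(3)[THEN reassoc2] nmod_assoc[OF M, THEN reassoc2])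
qed

text \<open>A \<open>wmor\<close> becomes a genuine module morphism on the retracts: the idempotents
  arising from inclusion after projection are absorbed by the actions \<open>r\<close> and
  \<open>s\<close>.\<close>

lemma split_wmor:
  assumes T: "is_monad K T" and M: "nmod K T M r" and S: "is_splitting K (idem K T M r) S"
    and N: "nmod K T N s" and R: "is_splitting K (idem K T N s) R" and g: "wmor K T M r N s g"
  shows "(split_pr R \<ast> g \<ast> split_in S) \<ast> (split_pr S \<ast> r \<ast> (mcar T \<triangleright> split_in S)) =
    (split_pr R \<ast> s \<ast> (mcar T \<triangleright> split_in R)) \<ast> (mcar T \<triangleright> (split_pr R \<ast> g \<ast> split_in S))"
proof -
  note S = splitD[OF S nmod_idem(1)[OF T M]] and i = nmod_idem[OF T M]
  note R = splitD[OF R nmod_idem(1)[OF T N]] and j = nmod_idem[OF T N]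
  note ty = monad_ty[OF T] nmod_ty[OF M] nmod_ty[OF N] wmor_ty[OF g] S(1-9) R(1-9) idem_ty[OF T M] idem_ty[OF T N]
  show ?thesis using ty by (simp add: S(11)[THEN reassoc2] R(11)[THEN lwhisk2, THEN reassoc2] i(2)[THEN reassoc2] j(3)[THEN reassoc2]
    wmor_eq[OF g, THEN reassoc2] S(13)[THEN lwhisk2])
qed

end

section \<open>The values of \<open>Q\<close> on 1-cells and 2-cells\<close>

locale em_split = em_monads K E for K :: "('o, 'm, 'c) two_cat" (structure) and E +
  fixes S :: "('o, 'm, 'c) mon1 \<Rightarrow> ('m, 'c) splitting"
  assumes spl: "splitting_choice K E S"
begin

abbreviation "v \<equiv> em_v E"
abbreviation "a \<equiv> em_act E"
abbreviation "av X \<equiv> act K X (v (src1 X)) (a (src1 X))"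
abbreviation "\<theta> X \<equiv> idem K (trg1 X) (und1 X \<cdot> v (src1 X)) (av X)"
abbreviation "\<pi> X \<equiv> split_pr (S X)"
abbreviation "\<iota> X \<equiv> split_in (S X)"
abbreviation "q \<equiv> Q1 K E S"

lemma av_nmod: "is_mndi1 K X \<Longrightarrow> nmod K (trg1 X) (und1 X \<cdot> v (src1 X)) (av X)"
  by (intro nmod_act em_act_nmod) (simp_all add: mndi1_ty)

text \<open>The idempotent split in the construction of \<open>Q\<close> is the one by which the
  unit acts on the transport along \<open>X\<close> of the universal module.\<close>

lemma Q_idem_eq: assumes X: "is_mndi1 K X" shows "Q_idem K E X = \<theta> X"
  using mndi1_tys[OF X] em_tys[OF mndi1_ty(1)[OF X]] em_eps[OF mndi1_ty(1)[OF X]]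
  by (simp add: Q_idem_def Let_def idem_def act_def hom2_iff hom1_iff)

lemma split: assumes X: "is_mndi1 K X" shows "is_splitting K (\<theta> X) (S X)"
  "\<theta> X = id2 K (und1 X \<cdot> v (src1 X)) \<Longrightarrow> S X = Splitting (und1 X \<cdot> v (src1 X)) (id2 K (und1 X \<cdot> v (src1 X))) (id2 K (und1 X \<cdot> v (src1 X)))"
  using spl[unfolded splitting_choice_def Let_def, THEN bspec, of X] X unfolding Q_idem_eq[OF X] by simp_all

text \<open>The definite description has a unique solution because the retract is a unital module by
  \<open>umod_split\<close>, and such modules are classified by the Eilenberg-Moore object.\<close>

lemma Q1:
  assumes X: "is_mndi1 K X"
  shows "q X \<in> hom1 K (J0 (src1 X)) (J0 (trg1 X))" "v (trg1 X) \<cdot> q X = split_ob (S X)"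
    "a (trg1 X) \<triangleleft> q X = \<pi> X \<ast> av X \<ast> (mcar (trg1 X) \<triangleright> \<iota> X)"
proof -
  note ty = mndi1_tys[OF X] em_tys[OF mndi1_ty(1)[OF X]] em_tys[OF mndi1_ty(2)[OF X]]
    em_eps[OF mndi1_ty(1)[OF X], unfolded hom1_iff hom2_iff] em_eps[OF mndi1_ty(2)[OF X], unfolded hom1_iff hom2_iff]
  note s = splitD[OF split(1)[OF X] nmod_idem(1)[OF mndi1_ty(2)[OF X] av_nmod[OF X]]]
  define P where "P x \<longleftrightarrow> x \<in> hom1 K (J0 (src1 X)) (J0 (trg1 X)) \<and>
       v (trg1 X) \<cdot> x = split_ob (S X) \<and>
       a (trg1 X) \<triangleleft> x = \<pi> X \<ast> av X \<ast> (mcar (trg1 X) \<triangleright> \<iota> X)" for x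
  \<comment> \<open>The description is phrased with the counit of the canonical adjunction;
    rewriting it with the universal action makes it a classification problem for modules.\<close>
  have "v (trg1 X) \<triangleright> em_eps K E (trg1 X) \<triangleleft> x = a (trg1 X) \<triangleleft> x" if "x \<in> hom1 K (J0 (src1 X)) (J0 (trg1 X))" for x
  proof -
    have "(v (trg1 X) \<triangleright> em_eps K E (trg1 X)) \<triangleleft> x = v (trg1 X) \<triangleright> em_eps K E (trg1 X) \<triangleleft> x"
      using that em_eps(1,2)[OF mndi1_ty(2)[OF X]] em_tys[OF mndi1_ty(2)[OF X]] by (simp add: hom1_iff hom2_iff)
    then show ?thesis using ty by simp
  qed
  then have "q X = (THE x. P x)" using ty s unfolding Q1_def P_def Let_def
    by (intro arg_cong[where f=The]) (auto simp add: act_def fun_eq_iff)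
  moreover have "\<exists>!x. P x"
    using em_ex1[OF mndi1_ty(2)[OF X] umod_split[OF mndi1_ty(2)[OF X] av_nmod[OF X] split(1)[OF X]]] em_uniq1[OF mndi1_ty(2)[OF X]] s ty
    unfolding P_def by auto
  ultimately have "P (q X)" using theI'[of P] by simp
  then show "q X \<in> hom1 K (J0 (src1 X)) (J0 (trg1 X))" "v (trg1 X) \<cdot> q X = split_ob (S X)"
    "a (trg1 X) \<triangleleft> q X = \<pi> X \<ast> av X \<ast> (mcar (trg1 X) \<triangleright> \<iota> X)" by (simp_all add: P_def)
qed

lemma split_ty:
  assumes X: "is_mndi1 K X"
  shows "q X \<in> ones K" "s1 K (q X) = J0 (src1 X)" "t1 K (q X) = J0 (trg1 X)"
    "\<pi> X \<in> twos K" "s2 K (\<pi> X) = und1 X \<cdot> v (src1 X)" "t2 K (\<pi> X) = v (trg1 X) \<cdot> q X"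
    "\<iota> X \<in> twos K" "s2 K (\<iota> X) = v (trg1 X) \<cdot> q X" "t2 K (\<iota> X) = und1 X \<cdot> v (src1 X)"
    "\<theta> X \<in> twos K" "s2 K (\<theta> X) = und1 X \<cdot> v (src1 X)" "t2 K (\<theta> X) = und1 X \<cdot> v (src1 X)"
    "av X \<in> twos K" "s2 K (av X) = mcar (trg1 X) \<cdot> und1 X \<cdot> v (src1 X)" "t2 K (av X) = und1 X \<cdot> v (src1 X)"
  using splitD(1-9)[OF split(1)[OF X] nmod_idem(1)[OF mndi1_ty(2)[OF X] av_nmod[OF X]]] Q1(1,2)[OF X]
    idem_ty[OF mndi1_ty(2)[OF X] av_nmod[OF X]] nmod_ty[OF av_nmod[OF X]]
  by (simp_all add: hom1_iff)

lemma split_eq: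
  assumes X: "is_mndi1 K X"
  shows "\<pi> X \<ast> \<iota> X = id2 K (v (trg1 X) \<cdot> q X)" "\<iota> X \<ast> \<pi> X = \<theta> X"
    "\<pi> X \<ast> \<theta> X = \<pi> X" "\<theta> X \<ast> \<iota> X = \<iota> X"
  using splitD(10-)[OF split(1)[OF X] nmod_idem(1)[OF mndi1_ty(2)[OF X] av_nmod[OF X]]]
  unfolding Q1(2)[OF X] by simp_all

lemmas Q_tys = mndi1_tys em_tys[OF mndi1_ty(1)] em_tys[OF mndi1_ty(2)] split_ty

end

section \<open>Comparison of splittings lifted to the Eilenberg-Moore object\<close>

lemma (in em_monads) em_ex1_2:
  assumes T: "is_monad K T" and q: "q \<in> hom1 K l (J0 T)" "q' \<in> hom1 K l (J0 T)"
    and \<omega>: "\<omega> \<in> hom2 K (em_v E T \<cdot> q) (em_v E T \<cdot> q')"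
    and eq: "\<omega> \<ast> (em_act E T \<triangleleft> q) = (em_act E T \<triangleleft> q') \<ast> (mcar T \<triangleright> \<omega>)"
  shows "\<exists>!w. w \<in> hom2 K q q' \<and> em_v E T \<triangleright> w = \<omega>"
proof -
  obtain w where w: "w \<in> hom2 K q q'" "em_v E T \<triangleright> w = \<omega>" using em_ex2[OF assms] by blast
  moreover have "w' = w" if w': "w' \<in> hom2 K q q'" "em_v E T \<triangleright> w' = \<omega>" for w'
  proof (rule em_uniq2[OF T])
    show "em_v E T \<triangleright> w' = em_v E T \<triangleright> w" using w w' by simp
  qed (use w(1) w'(1) q in \<open>simp_all add: hom1_iff hom2_iff\<close>)
  ultimately show ?thesis by blast
qed

text \<open>A splitting of \<open>idem K T M r\<close> through the Eilenberg-Moore object of \<open>T\<close>.\<close>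

definition lifted_split :: "('o, 'm, 'c) two_cat \<Rightarrow> ('o, 'm, 'c) em \<Rightarrow> ('o, 'm, 'c) mon \<Rightarrow> 'm \<Rightarrow> 'c \<Rightarrow> 'm \<Rightarrow> 'c \<Rightarrow> 'c \<Rightarrow> bool" where
  "lifted_split K E T M r q p i \<longleftrightarrow> q \<in> ones K \<and> t1 K q = on0 (emJ E) T \<and> s1 K q = s1 K M \<and>
    p \<in> hom2 K M (em_v E T \<cdot>\<^bsub>K\<^esub> q) \<and> i \<in> hom2 K (em_v E T \<cdot>\<^bsub>K\<^esub> q) M \<and>
    p \<ast>\<^bsub>K\<^esub> i = id2 K (em_v E T \<cdot>\<^bsub>K\<^esub> q) \<and> i \<ast>\<^bsub>K\<^esub> p = idem K T M r \<and>
    em_act E T \<triangleleft>\<^bsub>K\<^esub> q = p \<ast>\<^bsub>K\<^esub> r \<ast>\<^bsub>K\<^esub> (mcar T \<triangleright>\<^bsub>K\<^esub> i)"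

context em_monads
begin

lemma lifted_splitD:
  assumes "lifted_split K E T M r q p i"
  shows "q \<in> ones K" "t1 K q = J0 T" "s1 K q = s1 K M" "p \<in> twos K" "s2 K p = M" "t2 K p = em_v E T \<cdot> q"
    "i \<in> twos K" "s2 K i = em_v E T \<cdot> q" "t2 K i = M"
  using assms by (auto simp: lifted_split_def hom2_iff)

text \<open>The canonical comparison \<open>p' \<ast> i\<close> of two splittings of one idempotent
  respects the actions, since the action \<open>r\<close> absorbs that idempotent; hence it lifts
  uniquely.\<close>

lemma lifted_split_unique:
  assumes T: "is_monad K T" and M: "nmod K T M r"
    and q: "lifted_split K E T M r q p i" and q': "lifted_split K E T M r q' p' i'"
  shows "\<exists>!g. g \<in> hom2 K q q' \<and> em_v E T \<triangleright> g = p' \<ast> i"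
proof (rule em_ex1_2[OF T])
  note ty = monad_ty[OF T] em_tys[OF T] nmod_ty[OF M] lifted_splitD[OF q] lifted_splitD[OF q'] idem_ty[OF T M]
  note I = nmod_idem[OF T M]
  have 1: "i \<ast> p = idem K T M r" "i' \<ast> p' = idem K T M r" "p \<ast> i = id2 K (em_v E T \<cdot> q)"
    and 2: "em_act E T \<triangleleft> q = p \<ast> r \<ast> (mcar T \<triangleright> i)" "em_act E T \<triangleleft> q' = p' \<ast> r \<ast> (mcar T \<triangleright> i')"
    using q q' by (simp_all add: lifted_split_def)
  show "q \<in> hom1 K (s1 K M) (J0 T)" "q' \<in> hom1 K (s1 K M) (J0 T)" "p' \<ast> i \<in> hom2 K (em_v E T \<cdot> q) (em_v E T \<cdot> q')"
    using ty by (simp_all add: hom1_iff hom2_iff)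
  show "(p' \<ast> i) \<ast> (em_act E T \<triangleleft> q) = (em_act E T \<triangleleft> q') \<ast> (mcar T \<triangleright> (p' \<ast> i))"
    unfolding 2 using ty by (simp add: 1(1)[THEN reassoc2] 1(2)[THEN lwhisk2, THEN reassoc2] I(2)[THEN reassoc2] I(3)[THEN reassoc2])
qed

text \<open>Whiskered with v, the composite of the two comparisons contains
  \<open>i' \<ast> p'\<close>, which equals \<open>i \<ast> p\<close> as both split the same
  idempotent; what remains is an identity.\<close>

lemma lifted_split_iso:
  assumes T: "is_monad K T" and M: "nmod K T M r"
    and q: "lifted_split K E T M r q p i" and q': "lifted_split K E T M r q' p' i'"
    and g: "g \<in> hom2 K q q'" "em_v E T \<triangleright> g = p' \<ast> i"
    and h: "h \<in> hom2 K q' q" "em_v E T \<triangleright> h = p \<ast> i'"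
  shows "h \<ast> g = id2 K q"
proof (rule em_uniq2[OF T])
  note ty = monad_ty[OF T] em_tys[OF T] nmod_ty[OF M] lifted_splitD[OF q] lifted_splitD[OF q'] idem_ty[OF T M]
    g(1)[unfolded hom2_iff] h(1)[unfolded hom2_iff]
  have 1: "i \<ast> p = idem K T M r" "i' \<ast> p' = idem K T M r" "p \<ast> i = id2 K (em_v E T \<cdot> q)"
    using q q' by (simp_all add: lifted_split_def)
  have "em_v E T \<triangleright> (h \<ast> g) = p \<ast> (i' \<ast> p') \<ast> i" using ty by (simp add: g(2) h(2))
  also have "... = (p \<ast> i) \<ast> (p \<ast> i)" unfolding 1(2) 1(1)[symmetric] using ty by simp
  also have "... = em_v E T \<triangleright> id2 K q" unfolding 1(3) using ty by simp
  finally show "em_v E T \<triangleright> (h \<ast> g) = em_v E T \<triangleright> id2 K q" .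
  show "h \<ast> g \<in> twos K" "id2 K q \<in> twos K" "s2 K (h \<ast> g) = s2 K (id2 K q)" "t2 K (h \<ast> g) = t2 K (id2 K q)" "t1 K (s2 K (h \<ast> g)) = J0 T"
    using ty by simp_all
qed

end

context em_split
begin

text \<open>Evaluated at the universal module, a 2-cell of \<open>mndi\<close> is a
  \<open>wmor\<close>; its restriction to the retracts is a module morphism by
  \<open>split_wmor\<close> and therefore lifts uniquely.\<close>

lemma Q2:
  assumes x: "is_mndi2 K x"
  shows "Q2 K E S x \<in> hom2 K (q (src2 x)) (q (trg2 x))"
    "v (trg1 (src2 x)) \<triangleright> Q2 K E S x = \<pi> (trg2 x) \<ast> (und2 x \<triangleleft> v (src1 (src2 x))) \<ast> \<iota> (src2 x)"
proof -
  define X Y where XY: "X = src2 x" "Y = trg2 x"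
  have X: "is_mndi1 K X" and Y: "is_mndi1 K Y" and st: "src1 Y = src1 X" "trg1 Y = trg1 X"
    and u: "und2 x \<in> twos K" "s2 K (und2 x) = und1 X" "t2 K (und2 x) = und1 Y"
    using mndi2_ty[OF x] by (simp_all add: XY)
  note T' = mndi1_ty(2)[OF X]
  let ?h = "\<pi> Y \<ast> (und2 x \<triangleleft> v (src1 X)) \<ast> \<iota> X"
  note ty = Q_tys[OF X] Q_tys[OF Y, unfolded st] u
  have w: "wmor K (trg1 X) (und1 X \<cdot> v (src1 X)) (av X) (und1 Y \<cdot> v (src1 X)) (av Y) (und2 x \<triangleleft> v (src1 X))"
    using wmor_mndi2[OF x em_act_nmod] ty(1) by (simp add: XY[symmetric] st)
  note 1 = split_wmor[OF T' av_nmod[OF X] split(1)[OF X] av_nmod[OF Y, unfolded st] split(1)[OF Y, unfolded st] w[unfolded st]]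
  have e: "?h \<ast> (a (trg1 X) \<triangleleft> q X) = (a (trg1 X) \<triangleleft> q Y) \<ast> (mcar (trg1 X) \<triangleright> ?h)"
    using 1 Q1(3)[OF X] Q1(3)[OF Y] by (simp only: st)
  have "\<exists>!w. w \<in> hom2 K (q X) (q Y) \<and> v (trg1 X) \<triangleright> w = ?h"
    using ty by (intro em_ex1_2[OF T' _ _ _ e, of "J0 (src1 X)"]) (simp_all add: hom2_iff hom1_iff)
  note ex = theI'[OF this]
  have eq: "Q2 K E S x = (THE w. w \<in> hom2 K (q X) (q Y) \<and> v (trg1 X) \<triangleright> w = ?h)"
    unfolding Q2_def Let_def XY by (rule refl)
  show "Q2 K E S x \<in> hom2 K (q (src2 x)) (q (trg2 x))"
    "v (trg1 (src2 x)) \<triangleright> Q2 K E S x = \<pi> (trg2 x) \<ast> (und2 x \<triangleleft> v (src1 (src2 x))) \<ast> \<iota> (src2 x)"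
    using ex[folded eq] unfolding XY by simp_all
qed

text \<open>Splitting the idempotents of \<open>X\<close> and \<open>Y\<close> in turn is another way to split that of \<open>Y X\<close>.\<close>

lemma split_cmp:
  assumes X: "is_mndi1 K X" and Y: "is_mndi1 K Y" and XY: "trg1 X = src1 Y"
  defines "p \<equiv> (\<pi> Y \<triangleleft> q X) \<ast> (und1 Y \<triangleright> \<pi> X)" and "i \<equiv> (und1 Y \<triangleright> \<iota> X) \<ast> (\<iota> Y \<triangleleft> q X)"
  shows "i \<ast> p = \<theta> (cmp_mon1 K Y X)" "p \<ast> i = id2 K (v (trg1 Y) \<cdot> q Y \<cdot> q X)"
    "a (trg1 Y) \<triangleleft> q Y \<cdot> q X = p \<ast> av (cmp_mon1 K Y X) \<ast> (mcar (trg1 Y) \<triangleright> i)"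
proof -
  define A where "A = av X"
  define \<theta>' where "\<theta>' = \<theta> X"
  note ty = Q_tys[OF X, folded \<theta>'_def, folded A_def, unfolded XY] Q_tys[OF Y]
  have A: "A \<ast> (mcar (src1 Y) \<triangleright> \<theta>') = A" "\<theta>' \<ast> A = A"
    using nmod_idem(2,3)[OF mndi1_ty(2)[OF X] av_nmod[OF X]] by (simp_all add: XY A_def \<theta>'_def)
  have \<iota>\<pi>: "\<iota> X \<ast> \<pi> X = \<theta>'" using split_eq(2)[OF X] by (simp add: \<theta>'_def)
  have avYX: "act K (cmp_mon1 K Y X) (v (src1 X)) (a (src1 X)) = act K Y (und1 X \<cdot> v (src1 X)) A"
    using act_cmp[OF X Y XY em_act_nmod] ty by (simp add: A_def)
  have aq: "a (src1 Y) \<triangleleft> q X = \<pi> X \<ast> A \<ast> (mcar (src1 Y) \<triangleright> \<iota> X)"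
    using Q1(3)[OF X] by (simp only: XY A_def)
  have nat: "str1 Y \<in> twos K" "s2 K (str1 Y) = mcar (trg1 Y) \<cdot> und1 Y" by (simp_all add: ty)
  show "p \<ast> i = id2 K (v (trg1 Y) \<cdot> q Y \<cdot> q X)"
    using ty split_eq(1)[OF Y, THEN rwhisk2, of "q X"]
    by (simp add: p_def i_def split_eq(1)[OF X, unfolded XY, THEN lwhisk2, THEN reassoc2])
  have "a (trg1 Y) \<triangleleft> q Y \<cdot> q X = (\<pi> Y \<ast> av Y \<ast> (mcar (trg1 Y) \<triangleright> \<iota> Y)) \<triangleleft> q X"
    unfolding Q1(3)[OF Y, symmetric] using ty by simp
  also have "... = p \<ast> av (cmp_mon1 K Y X) \<ast> (mcar (trg1 Y) \<triangleright> i)"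
    using ty by (simp add: avYX p_def i_def act_def[of K Y] aq naturality2[of "str1 Y", THEN reassoc2])
  finally show "a (trg1 Y) \<triangleleft> q Y \<cdot> q X = p \<ast> av (cmp_mon1 K Y X) \<ast> (mcar (trg1 Y) \<triangleright> i)" .
  \<comment> \<open>The inner product of inclusion and projection is the idempotent of
    \<open>Y\<close> restricted along \<open>q X\<close>. Once it is expanded, the action on the
    restricted module is that of the retract, so each inclusion of \<open>X\<close> meets a
    projection; the idempotents of \<open>X\<close> so created are absorbed by the action
    \<open>A\<close>.\<close>
  have "i \<ast> p = (und1 Y \<triangleright> \<iota> X) \<ast> (\<theta> Y \<triangleleft> q X) \<ast> (und1 Y \<triangleright> \<pi> X)"
    using ty split_eq(2)[OF Y, THEN rwhisk2, of "q X", THEN reassoc2] by (simp add: p_def i_def)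
  also have "... = \<theta> (cmp_mon1 K Y X)"
    using ty by (simp add: idem_def[of K "trg1 Y"] avYX act_def[of K Y] aq naturality0[of "munit (trg1 Y)"]
      naturality2[of "str1 Y", THEN reassoc2] \<iota>\<pi>[THEN lwhisk2, THEN reassoc2]
      \<iota>\<pi>[THEN lwhisk2, THEN lwhisk2, THEN reassoc2]
      A(2)[THEN lwhisk2, THEN reassoc2] A(1)[THEN lwhisk2, THEN reassoc2])
  finally show "i \<ast> p = \<theta> (cmp_mon1 K Y X)" .
qed

lemma lifted_split_q:
  assumes X: "is_mndi1 K X"
  shows "lifted_split K E (trg1 X) (und1 X \<cdot> v (src1 X)) (av X) (q X) (\<pi> X) (\<iota> X)"
  using Q1(3)[OF X] split_eq[OF X] Q_tys[OF X] unfolding lifted_split_def hom2_iff by simp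

lemma lifted_split_qq:
  assumes X: "is_mndi1 K X" and Y: "is_mndi1 K Y" and XY: "trg1 X = src1 Y"
  shows "lifted_split K E (trg1 Y) (und1 (cmp_mon1 K Y X) \<cdot> v (src1 X)) (av (cmp_mon1 K Y X)) (q Y \<cdot> q X)
    ((\<pi> Y \<triangleleft> q X) \<ast> (und1 Y \<triangleright> \<pi> X)) ((und1 Y \<triangleright> \<iota> X) \<ast> (\<iota> Y \<triangleleft> q X))"
  using split_cmp[OF X Y XY] Q_tys[OF X, unfolded XY] Q_tys[OF Y] XY unfolding lifted_split_def hom2_iff by simp

text \<open>\<open>Q\<close> of the composite and the composite of the values of \<open>Q\<close>
  carry lifted splittings of the same idempotent. The coherence cell is the comparison from the one
  to the other, so the comparison in the opposite direction is its inverse.\<close>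

lemma Q_cmp:
  assumes X: "is_mndi1 K X" and Y: "is_mndi1 K Y" and XY: "trg1 X = src1 Y"
  shows "Q_cmp K E S Y X \<in> hom2 K (q (cmp_mon1 K Y X)) (q Y \<cdot> q X)"
    "v (trg1 Y) \<triangleright> Q_cmp K E S Y X = (\<pi> Y \<triangleleft> q X) \<ast> (und1 Y \<triangleright> \<pi> X) \<ast> \<iota> (cmp_mon1 K Y X)"
    "\<exists>g. inverse_2cells K (Q_cmp K E S Y X) g"
proof -
  let ?Z = "cmp_mon1 K Y X"
  note Z = mndi1_cmp[OF X Y XY] and T = mndi1_ty(2)[OF Y]
  note n = av_nmod[OF Z, unfolded cmp_mon1_sel(1,2)]
  note l = lifted_split_q[OF Z, unfolded cmp_mon1_sel(1,2)] and l' = lifted_split_qq[OF X Y XY, unfolded cmp_mon1_sel(1,2)]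
  have eq: "((\<pi> Y \<triangleleft> q X) \<ast> (und1 Y \<triangleright> \<pi> X)) \<ast> \<iota> ?Z = (\<pi> Y \<triangleleft> q X) \<ast> (und1 Y \<triangleright> \<pi> X) \<ast> \<iota> ?Z"
    using Q_tys[OF X, unfolded XY] Q_tys[OF Y] split_ty[OF Z] by simp
  have def: "Q_cmp K E S Y X = (THE g. g \<in> hom2 K (q ?Z) (q Y \<cdot> q X) \<and>
       v (trg1 Y) \<triangleright> g = (\<pi> Y \<triangleleft> q X) \<ast> (und1 Y \<triangleright> \<pi> X) \<ast> \<iota> ?Z)"
    unfolding Q_cmp_def mndi_sel by (rule refl)
  note ex = theI'[OF lifted_split_unique[OF T n l l'], unfolded eq, folded def]
  show 1: "Q_cmp K E S Y X \<in> hom2 K (q ?Z) (q Y \<cdot> q X)"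
    and 2: "v (trg1 Y) \<triangleright> Q_cmp K E S Y X = (\<pi> Y \<triangleleft> q X) \<ast> (und1 Y \<triangleright> \<pi> X) \<ast> \<iota> ?Z"
    using ex by simp_all
  note 2 = 2[folded eq]
  obtain h where h: "h \<in> hom2 K (q Y \<cdot> q X) (q ?Z)" "v (trg1 Y) \<triangleright> h = \<pi> ?Z \<ast> (und1 Y \<triangleright> \<iota> X) \<ast> (\<iota> Y \<triangleleft> q X)"
    using lifted_split_unique[OF T n l' l] by blast
  have "inverse_2cells K (Q_cmp K E S Y X) h"
    using 1 h(1) lifted_split_iso[OF T n l l' 1 2 h] lifted_split_iso[OF T n l' l h 1 2]
    by (simp add: inverse_2cells_def hom2_iff)
  then show "\<exists>g. inverse_2cells K (Q_cmp K E S Y X) g" by blast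
qed

text \<open>The unit law makes the idempotent an identity, so the splitting is the prescribed
  trivial one; then \<open>q X\<close> satisfies the equations that determine
  \<open>J1 X\<close>.\<close>

lemma split_strict:
  assumes X: "is_mnd1 K X"
  shows "q X = J1 X" "v (trg1 X) \<cdot> q X = und1 X \<cdot> v (src1 X)" "\<pi> X = id2 K (und1 X \<cdot> v (src1 X))" "\<iota> X = id2 K (und1 X \<cdot> v (src1 X))"
    "\<theta> X = id2 K (und1 X \<cdot> v (src1 X))"
proof -
  have X': "is_mndi1 K X" using X by (rule mnd1_mndi1)
  note ty = mndi1_tys[OF X'] em_tys[OF mndi1_ty(1)[OF X']] act_ty[OF X' em_act_nmod[OF mndi1_ty(1)[OF X']]]
  note ty' = em_tys[OF mndi1_ty(2)[OF X']]
  have u: "a (src1 X) \<ast> (munit (src1 X) \<triangleleft> v (src1 X)) = id2 K (v (src1 X))"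
    using em_v_ty(4)[OF mndi1_ty(1)[OF X']] by (simp add: umod_def idem_def)
  have "str1 X \<ast> (munit (trg1 X) \<triangleleft> und1 X) = und1 X \<triangleright> munit (src1 X)" using X by (simp add: is_mnd1_iff)
  from this[THEN rwhisk2, of "v (src1 X)"]
  have "(str1 X \<triangleleft> v (src1 X)) \<ast> (munit (trg1 X) \<triangleleft> und1 X \<cdot> v (src1 X)) = und1 X \<triangleright> munit (src1 X) \<triangleleft> v (src1 X)"
    using ty by simp
  then show \<theta>: "\<theta> X = id2 K (und1 X \<cdot> v (src1 X))"
    using ty by (simp add: idem_def act_def u[THEN lwhisk2])
  note S = split(2)[OF X' \<theta>]
  show \<pi>\<iota>: "\<pi> X = id2 K (und1 X \<cdot> v (src1 X))" "\<iota> X = id2 K (und1 X \<cdot> v (src1 X))" unfolding S by simp_all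
  show vq: "v (trg1 X) \<cdot> q X = und1 X \<cdot> v (src1 X)" unfolding Q1(2)[OF X'] S by simp
  show "q X = J1 X"
  proof (rule em_uniq1[OF mndi1_ty(2)[OF X'] Q1(1)[OF X'] J1(1)[OF X]])
    show "v (trg1 X) \<cdot> q X = v (trg1 X) \<cdot> J1 X" using vq J1(2)[OF X] by simp
    show "a (trg1 X) \<triangleleft> q X = a (trg1 X) \<triangleleft> J1 X"
      unfolding Q1(3)[OF X'] J1(3)[OF X] \<pi>\<iota> using ty by simp
  qed
qed

end

section \<open>Duality\<close>

text \<open>The coherence cells are identities, so the same data have the right direction after
  2-cells are reversed. What has to be restated is horizontal composition, with typing conditions
  read at the other end of each 2-cell.\<close>

lemma two_functor_vop: assumes "two_functor A B F" shows "two_functor (vop A) (vop B) F"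
proof -
  interpret two_functor A B F by fact
  interpret A': two_category "vop A" by (rule two_category_vop) (rule A.two_category_axioms)
  interpret B': two_category "vop B" by (rule two_category_vop) (rule B.two_category_axioms)
  have inv: "invertible_2cell (vop B) (id2 B f)" if "f \<in> ones B" for f
    unfolding invertible_2cell_def inverse_2cells_def using that
    by (intro exI[of _ "id2 B f"]) (simp add: hom2_iff)
  have str: "pcmp F g f = id2 B (on1 F (g \<cdot>\<^bsub>A\<^esub> f))" "on1 F (g \<cdot>\<^bsub>A\<^esub> f) = on1 F g \<cdot>\<^bsub>B\<^esub> on1 F f"
    if "f \<in> ones A" "g \<in> ones A" "s1 A g = t1 A f" for f g
    using strict_cmp[of f "s1 A f" "t1 A f" g "t1 A g"] that by (simp_all add: hom1_iff)
  have hc: "on2 F (\<beta> \<star>\<^bsub>A\<^esub> \<alpha>) = on2 F \<beta> \<star>\<^bsub>B\<^esub> on2 F \<alpha>"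
    if "\<alpha> \<in> twos A" "\<beta> \<in> twos A" "s1 A (s2 A \<beta>) = t1 A (s2 A \<alpha>)" for \<alpha> \<beta>
    using pcmp_natural[of "s2 A \<alpha>" "s1 A (s2 A \<alpha>)" "t1 A (s2 A \<alpha>)" "s2 A \<beta>" "t1 A (s2 A \<beta>)" \<alpha> "t2 A \<alpha>" \<beta> "t2 A \<beta>"] that
      A.parallel' on1_ty on2_ty on2_ty[OF A.hcmp_typ(1)[OF that]] A.hcmp_typ[OF that] B.hcmp_typ[of "on2 F \<alpha>" "on2 F \<beta>"]
    by (simp add: hom1_iff hom2_iff str)
  note p = A.parallel' B.parallel'
  show ?thesis
  proof
    fix f a b g c \<alpha> f' \<beta> g'
    assume h: "f \<in> hom1 (vop A) a b" "g \<in> hom1 (vop A) b c" "\<alpha> \<in> hom2 (vop A) f f'" "\<beta> \<in> hom2 (vop A) g g'"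
    then have "\<alpha> \<in> twos A" "\<beta> \<in> twos A" "s1 A (s2 A \<beta>) = t1 A (s2 A \<alpha>)" "s1 A g' = t1 A f'" "s2 A \<alpha> = f'" "s2 A \<beta> = g'"
      "t2 A \<alpha> = f" "t2 A \<beta> = g"
      using p(1,2)[of \<alpha>] p(1,2)[of \<beta>] by (simp_all add: hom1_iff hom2_iff)
    then show "pcmp F g' f' \<ast>\<^bsub>vop B\<^esub> on2 F (\<beta> \<star>\<^bsub>vop A\<^esub> \<alpha>) =
       (on2 F \<beta> \<star>\<^bsub>vop B\<^esub> on2 F \<alpha>) \<ast>\<^bsub>vop B\<^esub> pcmp F g f"
      using hc[of \<alpha> \<beta>] on2_ty[OF A.hcmp_typ(1), of \<alpha> \<beta>] on1_ty on2_ty A.hcmp_typ[of \<alpha> \<beta>] h A.two_ones[of \<alpha>] A.two_ones[of \<beta>] B.hcmp_typ[of "on2 F \<alpha>" "on2 F \<beta>"]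
      by (simp add: hom1_iff hom2_iff str)
  qed (use on0 A.one_obs on1_ty on2_ty on2_id on2_vcmp strict_id str inv in \<open>auto simp: hom1_iff hom2_iff\<close>)
qed

lemma two_natural_vop:
  assumes A: "two_category A" and n: "two_natural A B F G \<sigma>"
  shows "two_natural (vop A) (vop B) F G \<sigma>"
proof -
  interpret A: two_category A by fact
  have 1: "\<And>a b f. f \<in> hom1 A a b \<Longrightarrow> on1 G f \<cdot>\<^bsub>B\<^esub> \<sigma> a = \<sigma> b \<cdot>\<^bsub>B\<^esub> on1 F f"
    and 2: "\<And>a b f g \<alpha>. \<alpha> \<in> hom2 A f g \<Longrightarrow> f \<in> hom1 A a b \<Longrightarrow> on2 G \<alpha> \<triangleleft>\<^bsub>B\<^esub> \<sigma> a = \<sigma> b \<triangleright>\<^bsub>B\<^esub> on2 F \<alpha>"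
    and 3: "\<And>a. a \<in> obs A \<Longrightarrow> \<sigma> a \<in> hom1 B (on0 F a) (on0 G a)"
    using n unfolding two_natural_def by blast+
  have "on2 G \<alpha> \<triangleleft>\<^bsub>B\<^esub> \<sigma> a = \<sigma> b \<triangleright>\<^bsub>B\<^esub> on2 F \<alpha>" if "\<alpha> \<in> hom2 A g f" "f \<in> hom1 A a b" for a b f g \<alpha>
    using 2[OF that(1), of a b] that A.hom2_ones[OF that(1)] by (simp add: hom1_iff)
  with 1 3 show ?thesis unfolding two_natural_def by auto
qed

lemma id_psfun_vop: "id_psfun (vop A) = id_psfun A"
  by (simp add: id_psfun_def strict_psfun_def)

lemma two_natural_comp_psfun:
  "two_natural A B F (comp_psfun (vop C) G H) u = two_natural A B F (comp_psfun C G H) u"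
  "two_natural A B (comp_psfun (vop C) G H) F u = two_natural A B (comp_psfun C G H) F u"
  by (simp_all add: two_natural_def comp_psfun_def)

lemma two_adjunction_vop: "two_adjunction A B F G u e \<Longrightarrow> two_adjunction (vop A) (vop B) F G u e"
proof -
  assume h: "two_adjunction A B F G u e"
  then interpret F: two_functor A B F by (simp add: two_adjunction_def)
  show "two_adjunction (vop A) (vop B) F G u e"
    using h F.A.two_category_axioms F.B.two_category_axioms
    unfolding two_adjunction_def id_psfun_vop two_natural_comp_psfun
    by (simp add: two_functor_vop two_natural_vop)
qed

text \<open>By \<open>incl_cmd_eq\<close> the inclusions into \<open>cmd K\<close> and into
  \<open>mnd (vop K)\<close> have the same data, so the adjunction carries over with the same unit
  and counit.\<close>

lemma em_for_comonads_vop: "em_for_comonads K E \<Longrightarrow> em_for_monads (vop K) E"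
  unfolding em_for_comonads_def em_for_monads_def incl_cmd_eq cmd_def
  using two_adjunction_vop[of K "vop (mnd (vop K))"] by simp

lemma em_for_monads_vop: "em_for_monads K E \<Longrightarrow> em_for_comonads (vop K) E"
  unfolding em_for_comonads_def em_for_monads_def incl_cmd_eq cmd_def
  using two_adjunction_vop[of K "(mnd K)"] by simp

section \<open>Comonads and comodules as monads and modules in the vertical opposite\<close>

locale em_comonads = two_category K for K :: "('o, 'm, 'c) two_cat" (structure) +
  fixes Es :: "('o, 'm, 'c) em"
  assumes em_co: "em_for_comonads K Es"
begin

lemma em_monads_vop: "em_monads (vop K) Es"
  by (intro em_monads.intro em_monads_axioms.intro two_category_vop two_category_axioms em_for_comonads_vop em_co)

abbreviation "comod C M k \<equiv> umod (vop K) C M k"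

lemma comod_iff: "comod C M k \<longleftrightarrow> M \<in> ones K \<and> t1 K M = mob C \<and> k \<in> hom2 K M (mcar C \<cdot> M) \<and>
    (mcar C \<triangleright> k) \<ast> k = (mmult C \<triangleleft> M) \<ast> k \<and> (munit C \<triangleleft> M) \<ast> k = id2 K M"
  by (simp add: umod_def nmod_def idem_def)

lemmas comonad_ty = two_category.monad_ty[OF two_category_vop[OF two_category_axioms], unfolded vop_sel]

lemma comonad_at:
  assumes "is_comonad K C" "N \<in> ones K" "t1 K N = mob C"
  shows "(mcar C \<triangleright> mmult C \<triangleleft> N) \<ast> (mmult C \<triangleleft> N) = (mmult C \<triangleleft> mcar C \<cdot> N) \<ast> (mmult C \<triangleleft> N)"
    "(mcar C \<triangleright> munit C \<triangleleft> N) \<ast> (mmult C \<triangleleft> N) = id2 K (mcar C \<cdot> N)"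
    "(munit C \<triangleleft> mcar C \<cdot> N) \<ast> (mmult C \<triangleleft> N) = id2 K (mcar C \<cdot> N)"
  using two_category.monad_at[OF two_category_vop[OF two_category_axioms] assms(1)] assms(2,3) by simp_all

lemmas co_v_ty = em_monads.em_v_ty[OF em_monads_vop, unfolded vop_sel]
lemmas co_act_ty = em_monads.em_tys(5-7)[OF em_monads_vop, unfolded vop_sel]
lemmas co_obs = em_monads.J0_obs[OF em_monads_vop, unfolded vop_sel]
lemmas co_ex1 = em_monads.em_ex1[OF em_monads_vop, unfolded vop_sel vop_hom]
lemmas co_uniq1 = em_monads.em_uniq1[OF em_monads_vop, unfolded vop_sel vop_hom]
lemmas co_uniq2 = em_monads.em_uniq2[OF em_monads_vop, unfolded vop_sel vop_hom]
lemmas co_J1 = em_monads.J1[OF em_monads_vop, unfolded vop_sel vop_hom act_def]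
lemmas co_J2 = em_monads.J2[OF em_monads_vop, unfolded vop_sel vop_hom]
lemmas co_J1_cmp = em_monads.J1_cmp[OF em_monads_vop, unfolded vop_sel vop_hom]
lemmas co_J1_id = em_monads.J1_id[OF em_monads_vop, unfolded vop_sel vop_hom]
lemmas co_J_pcmp = em_monads.J_pcmp[OF em_monads_vop, unfolded vop_sel vop_hom]
lemmas co_J_punt = em_monads.J_punt[OF em_monads_vop, unfolded vop_sel vop_hom]

end

section \<open>The cells of \<open>Q\<close> seen through the inclusions of the retracts\<close>

context em_split
begin

text \<open>A form of the defining equation of \<open>Q2\<close> in which no projection occurs: the
  inclusions are natural in 2-cells, because a \<open>wmor\<close> preserves the images of the
  idempotents.\<close>

lemma iota_Q2:
  assumes x: "is_mndi2 K x"
  shows "\<iota> (trg2 x) \<ast> (v (trg1 (src2 x)) \<triangleright> Q2 K E S x) = (und2 x \<triangleleft> v (src1 (src2 x))) \<ast> \<iota> (src2 x)"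
proof -
  define X Y where XY: "X = src2 x" "Y = trg2 x"
  have X: "is_mndi1 K X" and Y: "is_mndi1 K Y" and st: "src1 Y = src1 X" "trg1 Y = trg1 X"
    and u: "und2 x \<in> twos K" "s2 K (und2 x) = und1 X" "t2 K (und2 x) = und1 Y"
    using mndi2_ty[OF x] by (simp_all add: XY)
  note T' = mndi1_ty(2)[OF X] and T = mndi1_ty(1)[OF X]
  let ?g = "und2 x \<triangleleft> v (src1 X)"
  note ty = mndi1_ty[OF X] mndi1_ty[OF Y, unfolded st] split_ty[OF X] split_ty[OF Y, unfolded st] u em_tys[OF T] em_tys[OF T']
  have w: "wmor K (trg1 X) (und1 X \<cdot> v (src1 X)) (av X) (und1 Y \<cdot> v (src1 X)) (av Y) (und2 x \<triangleleft> v (src1 X))"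
    using wmor_mndi2[OF x em_act_nmod] ty(1) by (simp add: XY[symmetric] st)
  note 1 = wmor_idem(2)[OF T' av_nmod[OF X] av_nmod[OF Y, unfolded st] w[unfolded st]]
  have "\<iota> Y \<ast> (v (trg1 X) \<triangleright> Q2 K E S x) = (\<iota> Y \<ast> \<pi> Y) \<ast> ?g \<ast> \<iota> X"
    using Q2(2)[OF x] ty by (simp add: XY[symmetric])
  \<comment> \<open>The inclusion absorbs the idempotent of \<open>X\<close>. Inserting it makes
    \<open>wmor_idem\<close> applicable, where the morphism is preceded by that idempotent.\<close>
  also have "... = \<theta> Y \<ast> ?g \<ast> \<theta> X \<ast> \<iota> X"
    by (simp only: split_eq[OF X] split_eq[OF Y])
  also have "... = ?g \<ast> \<iota> X"
  proof -
    have "(\<theta> Y \<ast> ?g \<ast> \<theta> X) \<ast> \<iota> X = (?g \<ast> \<theta> X) \<ast> \<iota> X" by (simp only: 1 st)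
    then show ?thesis using ty by (simp add: st split_eq[OF X])
  qed
  finally show ?thesis by (simp add: XY)
qed

text \<open>The coherence cell expands into the iterated projection after an inclusion. Iterated
  inclusion after iterated projection is the idempotent of the composite, which that inclusion
  absorbs.\<close>

lemma iota_Q_cmp:
  assumes X: "is_mndi1 K X" and Y: "is_mndi1 K Y" and XY: "trg1 X = src1 Y"
  shows "(und1 Y \<triangleright> \<iota> X) \<ast> (\<iota> Y \<triangleleft> q X) \<ast> (v (trg1 Y) \<triangleright> Q_cmp K E S Y X) = \<iota> (cmp_mon1 K Y X)"
proof -
  note Z = mndi1_cmp[OF X Y XY]
  note ty = Q_tys[OF X, unfolded XY] Q_tys[OF Y] split_ty[OF Z, unfolded cmp_mon1_sel(1-3)]
  have "(und1 Y \<triangleright> \<iota> X) \<ast> (\<iota> Y \<triangleleft> q X) \<ast> (v (trg1 Y) \<triangleright> Q_cmp K E S Y X) =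
    (((und1 Y \<triangleright> \<iota> X) \<ast> (\<iota> Y \<triangleleft> q X)) \<ast> ((\<pi> Y \<triangleleft> q X) \<ast> (und1 Y \<triangleright> \<pi> X))) \<ast> \<iota> (cmp_mon1 K Y X)"
    unfolding Q_cmp(2)[OF X Y XY] using ty XY by simp
  also have "... = \<iota> (cmp_mon1 K Y X)" unfolding split_cmp(1)[OF X Y XY] split_eq(4)[OF Z] ..
  finally show ?thesis .
qed

end

section \<open>The comonad induced by a weak entwining structure\<close>

definition entw_mod :: "('o, 'm, 'c) two_cat \<Rightarrow> ('o, 'm, 'c) entw0 \<Rightarrow> 'm \<Rightarrow> 'c \<Rightarrow> 'c \<Rightarrow> bool" where
  "entw_mod K x M r k \<longleftrightarrow> umod K (ent_mon x) M r \<and> umod (vop K) (ent_com x) M k \<and>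
     k \<ast>\<^bsub>K\<^esub> r = (mcar (ent_com x) \<triangleright>\<^bsub>K\<^esub> r) \<ast>\<^bsub>K\<^esub> (ent_law x \<triangleleft>\<^bsub>K\<^esub> M) \<ast>\<^bsub>K\<^esub> (mcar (ent_mon x) \<triangleright>\<^bsub>K\<^esub> k)"

context two_category
begin

lemma weak_entD:
  assumes "weak_entwining K T C \<psi>"
  shows "is_monad K T" "is_comonad K C" "mob C = mob T" "\<psi> \<in> twos K" "s2 K \<psi> = mcar T \<cdot> mcar C" "t2 K \<psi> = mcar C \<cdot> mcar T"
    "\<psi> \<ast> (mmult T \<triangleleft> mcar C) = (mcar C \<triangleright> mmult T) \<ast> (\<psi> \<triangleleft> mcar T) \<ast> (mcar T \<triangleright> \<psi>)"
    "(mmult C \<triangleleft> mcar T) \<ast> \<psi> = (mcar C \<triangleright> \<psi>) \<ast> (\<psi> \<triangleleft> mcar C) \<ast> (mcar T \<triangleright> mmult C)"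
    "\<psi> \<ast> (munit T \<triangleleft> mcar C) = (mcar C \<triangleright> munit C \<triangleleft> mcar T) \<ast> (mcar C \<triangleright> \<psi>) \<ast> (mcar C \<triangleright> munit T \<triangleleft> mcar C) \<ast> mmult C"
    "(munit C \<triangleleft> mcar T) \<ast> \<psi> = mmult T \<ast> (mcar T \<triangleright> munit C \<triangleleft> mcar T) \<ast> (mcar T \<triangleright> \<psi>) \<ast> (mcar T \<triangleright> munit T \<triangleleft> mcar C)"
  using assms by (simp_all add: weak_entwining_def Let_def hom2_iff)

lemmas comonad_ty = two_category.monad_ty[OF two_category_vop[OF two_category_axioms], unfolded vop_sel]

lemma ent_tys:
  assumes "weak_entwining K T C \<psi>"
  shows "mcar C \<in> ones K" "s1 K (mcar C) = mob T" "t1 K (mcar C) = mob T"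
    "mmult C \<in> twos K" "s2 K (mmult C) = mcar C" "t2 K (mmult C) = mcar C \<cdot> mcar C"
    "munit C \<in> twos K" "s2 K (munit C) = mcar C" "t2 K (munit C) = id1 K (mob T)"
    "\<psi> \<in> twos K" "s2 K \<psi> = mcar T \<cdot> mcar C" "t2 K \<psi> = mcar C \<cdot> mcar T"
    "mob T \<in> obs K" "mcar T \<in> ones K" "s1 K (mcar T) = mob T" "t1 K (mcar T) = mob T"
    "mmult T \<in> twos K" "s2 K (mmult T) = mcar T \<cdot> mcar T" "t2 K (mmult T) = mcar T"
    "munit T \<in> twos K" "s2 K (munit T) = id1 K (mob T)" "t2 K (munit T) = mcar T"
  using weak_entD[OF assms] comonad_ty[OF weak_entD(2)[OF assms]] monad_ty[OF weak_entD(1)[OF assms]] by simp_all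

lemma ent_mndi1:
  assumes "weak_entwining K T C \<psi>"
  shows "is_mndi1 K (Mon1 T T (mcar C) \<psi>)"
  using ent_tys[OF assms] weak_entD[OF assms] by (simp add: is_mndi1_iff hom1_iff hom2_iff)

text \<open>The second axiom of a weak entwining structure makes \<delta> commute strictly with the
  structure cells, while the fourth is precisely the weaker 2-cell law of \<open>mndi\<close> for
  \<epsilon>, as used in \<open>ent_eps\<close>.\<close>

lemma ent_delta:
  assumes "weak_entwining K T C \<psi>"
  defines "X \<equiv> Mon1 T T (mcar C) \<psi>"
  shows "is_mndi2 K (Mon2 X (cmp_mon1 K X X) (mmult C))"
  using ent_tys[OF assms(1)] weak_entD(8)[OF assms(1)] ent_mndi1[OF assms(1)] mndi1_cmp[of X X]
  by (intro mndi2_of_strict) (simp_all add: X_def hom2_iff)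

lemma ent_eps:
  assumes "weak_entwining K T C \<psi>"
  shows "is_mndi2 K (Mon2 (Mon1 T T (mcar C) \<psi>) (id_mon1 K T) (munit C))"
  using ent_tys[OF assms(1)] weak_entD(1,10)[OF assms(1)] ent_mndi1[OF assms(1)]
  by (simp add: is_mndi2_iff mndi1_id hom2_iff)

lemma ent_comonad:
  assumes "weak_entwining K T C \<psi>"
  shows "is_comonad (mndi K) (A0 K (Entw0 T C \<psi>))"
proof -
  note ty = ent_tys[OF assms]
  have 1: "(mcar C \<triangleright> mmult C) \<ast> mmult C = (mmult C \<triangleleft> mcar C) \<ast> mmult C"
    "(mcar C \<triangleright> munit C) \<ast> mmult C = id2 K (mcar C)" "(munit C \<triangleleft> mcar C) \<ast> mmult C = id2 K (mcar C)"
    using weak_entD(2)[OF assms] by (simp_all add: is_monad_iff)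
  show ?thesis
    using ent_mndi1[OF assms] ent_delta[OF assms] ent_eps[OF assms] weak_entD(1)[OF assms] 1
    by (simp add: is_monad_iff A0_def Let_def hom1_iff hom2_iff cmp_mon1_assoc cmp_mon1_id)
qed

text \<open>Asking for a retraction instead of mere left cancellability makes the property stable
  under whiskering on both sides. The inclusions have the projections as retractions.\<close>

definition split_mono :: "'c \<Rightarrow> bool" where
  "split_mono m \<longleftrightarrow> m \<in> twos K \<and> (\<exists>r \<in> hom2 K (t2 K m) (s2 K m). r \<ast> m = id2 K (s2 K m))"

lemma split_monoI: "m \<in> twos K \<Longrightarrow> r \<in> twos K \<Longrightarrow> s2 K r = t2 K m \<Longrightarrow> r \<ast> m = id2 K (s2 K m) \<Longrightarrow> split_mono m"
  using vcmp_typ(3)[of m r] by (auto simp: split_mono_def hom2_iff)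

lemma split_mono_cancel:
  assumes "split_mono m" "x \<in> twos K" "y \<in> twos K" "t2 K x = s2 K m" "t2 K y = s2 K m" and eq: "m \<ast> x = m \<ast> y"
  shows "x = y"
proof -
  obtain r where r: "m \<in> twos K" "r \<in> twos K" "s2 K r = t2 K m" "t2 K r = s2 K m" "r \<ast> m = id2 K (s2 K m)"
    using assms(1) by (auto simp: split_mono_def hom2_iff)
  have "x = r \<ast> m \<ast> x" "y = r \<ast> m \<ast> y" using r assms(2-5) by (simp_all add: r(5)[THEN reassoc2])
  then show ?thesis using eq by simp
qed

lemma split_mono_cmp:
  assumes "split_mono m" "split_mono n" "s2 K m = t2 K n" shows "split_mono (m \<ast> n)"
proof -
  obtain r where r: "m \<in> twos K" "r \<in> twos K" "s2 K r = t2 K m" "t2 K r = s2 K m" "r \<ast> m = id2 K (s2 K m)"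
    using assms(1) by (auto simp: split_mono_def hom2_iff)
  obtain s where s: "n \<in> twos K" "s \<in> twos K" "s2 K s = t2 K n" "t2 K s = s2 K n" "s \<ast> n = id2 K (s2 K n)"
    using assms(2) by (auto simp: split_mono_def hom2_iff)
  show ?thesis using r s assms(3) by (intro split_monoI[of _ "s \<ast> r"]) (simp_all add: r(5)[THEN reassoc2])
qed

lemma split_mono_lwhisk:
  assumes "split_mono m" "g \<in> ones K" "s1 K g = t1 K (s2 K m)" shows "split_mono (g \<triangleright> m)"
proof -
  obtain r where r: "m \<in> twos K" "r \<in> twos K" "s2 K r = t2 K m" "t2 K r = s2 K m" "r \<ast> m = id2 K (s2 K m)"
    using assms(1) by (auto simp: split_mono_def hom2_iff)
  show ?thesis using r assms parallel'[OF r(1)] by (intro split_monoI[of _ "g \<triangleright> r"]) (simp_all add: r(5)[THEN lwhisk2])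
qed

lemma split_mono_rwhisk:
  assumes "split_mono m" "g \<in> ones K" "s1 K (s2 K m) = t1 K g" shows "split_mono (m \<triangleleft> g)"
proof -
  obtain r where r: "m \<in> twos K" "r \<in> twos K" "s2 K r = t2 K m" "t2 K r = s2 K m" "r \<ast> m = id2 K (s2 K m)"
    using assms(1) by (auto simp: split_mono_def hom2_iff)
  show ?thesis using r assms parallel'[OF r(1)] by (intro split_monoI[of _ "r \<triangleleft> g"]) (simp_all add: r(5)[THEN rwhisk2])
qed

end

lemma Q_sel [simp]: "on0 (Q K E S) = on0 (emJ E)" "on1 (Q K E S) = Q1 K E S" "on2 (Q K E S) = Q2 K E S"
  "pcmp (Q K E S) = Q_cmp K E S" "punt (Q K E S) T = id2 K (id1 K (on0 (emJ E) T))"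
  by (simp_all add: Q_def)

locale em_pair = em_split K E S + em_comonads K Es
  for K :: "('o, 'm, 'c) two_cat" (structure) and E S Es
begin

lemma iota_smono: "is_mndi1 K X \<Longrightarrow> split_mono (\<iota> X)"
  using split_ty[of X] split_eq(1)[of X] by (intro split_monoI[of _ "\<pi> X"]) simp_all

abbreviation "QC \<equiv> cmd_psfun (mndi K) K (Q K E S)"

text \<open>The target is an identity 1-cell, hence unital: its inclusion is an identity and
  disappears from \<open>iota_Q2\<close>.\<close>

lemma punt_Q2_eps:
  assumes X: "is_mndi2 K (Mon2 X (id_mon1 K T) e)"
  shows "Q2 K E S (Mon2 X (id_mon1 K T) e) \<in> hom2 K (q X) (id1 K (J0 T))" "v T \<triangleright> Q2 K E S (Mon2 X (id_mon1 K T) e) = (e \<triangleleft> v T) \<ast> \<iota> X"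
proof -
  note m = mndi2_ty[OF X, unfolded mon2.sel id_mon1_sel]
  have i: "is_mnd1 K (id_mon1 K T)" using mndi1_ty(1)[OF m(2)] by (simp add: mnd1_id)
  note ty = split_ty[OF m(1)] mndi1_ty[OF m(1)] em_tys[OF mndi1_ty(1)[OF m(2)]] m(3-)
  show 1: "Q2 K E S (Mon2 X (id_mon1 K T) e) \<in> hom2 K (q X) (id1 K (J0 T))"
    using Q2(1)[OF X] split_strict(1)[OF i] ty J1_id[OF mndi1_ty(1)[OF m(2)]] by simp
  show "v T \<triangleright> Q2 K E S (Mon2 X (id_mon1 K T) e) = (e \<triangleleft> v T) \<ast> \<iota> X"
    using iota_Q2[OF X] split_strict(4)[OF i] ty 1[unfolded hom2_iff] by simp
qed

end

text \<open>\<open>X\<close> is the 1-cell \<open>(c, \<psi>)\<close> and \<open>D\<close> the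
  comonad on J(t) that \<open>Q\<close> makes of it. They are parameters fixed by equations, so that
  the results can be instantiated with any other expression for the same cells.\<close>

locale ent_em = em_pair K E S Es
  for K :: "('o, 'm, 'c) two_cat" (structure) and E S Es +
  fixes T C :: "('o, 'm, 'c) mon" and \<psi> :: 'c and X and D
  assumes ent: "weak_entwining K T C \<psi>"
    and X_def: "X = Mon1 T T (mcar C) \<psi>"
    and D_def: "D = on0 (cmd_psfun (mndi K) K (Q K E S)) (A0 K (Entw0 T C \<psi>))"
begin

lemma X_mndi1: "is_mndi1 K X"
  using ent_mndi1[OF ent] by (simp add: X_def)

lemma X_sel: "src1 X = T" "trg1 X = T" "und1 X = mcar C" "str1 X = \<psi>"
  by (simp_all add: X_def)

lemmas X_split_ty = split_ty[OF X_mndi1, unfolded X_sel]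
lemmas ent_ty = ent_tys[OF ent] X_split_ty em_tys[OF weak_entD(1)[OF ent]]

lemma D_sel: "mob D = J0 T" "mcar D = q X"
  by (simp_all add: D_def cmd_psfun_def Let_def A0_def X_def)

lemma D_munit:
  "munit D \<in> hom2 K (q X) (id1 K (J0 T))" "v T \<triangleright> munit D = (munit C \<triangleleft> v T) \<ast> \<iota> X"
proof -
  note e = punt_Q2_eps[OF ent_eps[OF ent, folded X_def]]
  have "munit D = Q2 K E S (Mon2 X (id_mon1 K T) (munit C))"
    using e(1)[unfolded hom2_iff] by (simp add: D_def cmd_psfun_def Let_def A0_def X_def)
  then show "munit D \<in> hom2 K (q X) (id1 K (J0 T))" "v T \<triangleright> munit D = (munit C \<triangleleft> v T) \<ast> \<iota> X"
    using e by simp_all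
qed

text \<open>Through the inclusion of the iterated retract into \<open>c c v\<close>, the
  comultiplication of \<open>D\<close> is that of \<open>c\<close> restricted along the inclusion of
  the retract. Combine \<open>iota_Q_cmp\<close> for the coherence cell with \<open>iota_Q2\<close>
  for \<delta>.\<close>

lemma D_mmult:
  "mmult D \<in> hom2 K (q X) (q X \<cdot> q X)" "(mcar C \<triangleright> \<iota> X) \<ast> (\<iota> X \<triangleleft> q X) \<ast> (v T \<triangleright> mmult D) = (mmult C \<triangleleft> v T) \<ast> \<iota> X"
proof -
  let ?x = "Mon2 X (cmp_mon1 K X X) (mmult C)"
  have st: "src1 X = T" "trg1 X = T" "und1 X = mcar C" by (simp_all add: X_def)
  have D: "mmult D = Q_cmp K E S X X \<ast> Q2 K E S ?x"
    by (simp add: D_def cmd_psfun_def Let_def A0_def X_def)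
  note d = Q2[OF ent_delta[OF ent, folded X_def], unfolded mon2.sel st] and d' = iota_Q2[OF ent_delta[OF ent, folded X_def], unfolded mon2.sel st]
  note c = Q_cmp[OF X_mndi1 X_mndi1, unfolded st, OF refl] and c' = iota_Q_cmp[OF X_mndi1 X_mndi1, unfolded st, OF refl]
  note ty = ent_ty d(1)[unfolded hom2_iff] c(1)[unfolded hom2_iff]
    split_ty[OF mndi1_cmp[OF X_mndi1 X_mndi1], unfolded st cmp_mon1_sel, OF refl]
  show "mmult D \<in> hom2 K (q X) (q X \<cdot> q X)" using ty unfolding D by (simp add: hom2_iff)
  have "(mcar C \<triangleright> \<iota> X) \<ast> (\<iota> X \<triangleleft> q X) \<ast> (v T \<triangleright> mmult D) =
     ((mcar C \<triangleright> \<iota> X) \<ast> (\<iota> X \<triangleleft> q X) \<ast> (v T \<triangleright> Q_cmp K E S X X)) \<ast> (v T \<triangleright> Q2 K E S ?x)"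
    using ty unfolding D by simp
  also have "... = (mmult C \<triangleleft> v T) \<ast> \<iota> X" unfolding c' d' ..
  finally show "(mcar C \<triangleright> \<iota> X) \<ast> (\<iota> X \<triangleleft> q X) \<ast> (v T \<triangleright> mmult D) = (mmult C \<triangleleft> v T) \<ast> \<iota> X" .
qed

lemmas D_tys = ent_ty D_mmult(1)[unfolded hom2_iff] D_munit(1)[unfolded hom2_iff] D_sel

lemma iota2_smono: "split_mono ((mcar C \<triangleright> \<iota> X) \<ast> (\<iota> X \<triangleleft> q X))"
  using iota_smono[OF X_mndi1] D_tys by (intro split_mono_cmp split_mono_lwhisk split_mono_rwhisk) simp_all

text \<open>Whiskering with \<open>v T\<close> is faithful and the inclusions can be cancelled, so
  each law may be tested after both; there it is the corresponding law of the comonad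
  \<open>c\<close> at \<open>v T\<close>.\<close>

lemma D_comonad: "is_comonad K D"
proof -
  note ty = D_tys
  have "t1 K (v T) = mob C" using ty weak_entD(3)[OF ent] by simp
  note \<delta> = comonad_at[OF weak_entD(2)[OF ent] em_v_ty(1)[OF weak_entD(1)[OF ent]] this]
  have \<iota>: "split_mono (\<iota> X)" by (rule iota_smono[OF X_mndi1])
  \<comment> \<open>The threefold inclusion, from \<open>v T\<close> followed by three copies of
    \<open>q X\<close> into \<open>c c c v\<close>, on whose domain the two sides of coassociativity
    end.\<close>
  define \<iota>3 where "\<iota>3 = (mcar C \<triangleright> mcar C \<triangleright> \<iota> X) \<ast> (mcar C \<triangleright> \<iota> X \<triangleleft> q X) \<ast> (\<iota> X \<triangleleft> q X \<cdot> q X)"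
  have i3: "split_mono \<iota>3" unfolding \<iota>3_def
    using \<iota> ty by (intro split_mono_cmp split_mono_lwhisk split_mono_rwhisk) simp_all
  note D2 = D_mmult(2) and D0 = D_munit(2)
  have 1: "\<iota>3 \<ast> (v T \<triangleright> q X \<triangleright> mmult D) = (mcar C \<triangleright> mmult C \<triangleleft> v T) \<ast> (mcar C \<triangleright> \<iota> X) \<ast> (\<iota> X \<triangleleft> q X)"
    using ty by (simp add: \<iota>3_def naturality2[of "\<iota> X"] naturality2[of "\<iota> X", THEN reassoc2]
      D2[THEN lwhisk3] D2[THEN lwhisk3, THEN reassoc3])
  have 2: "\<iota>3 \<ast> (v T \<triangleright> mmult D \<triangleleft> q X) = (mmult C \<triangleleft> mcar C \<cdot> v T) \<ast> (mcar C \<triangleright> \<iota> X) \<ast> (\<iota> X \<triangleleft> q X)"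
    using ty D2[THEN rwhisk3, of "q X"] by (simp add: \<iota>3_def naturality1[of "mmult C", THEN reassoc2])
  have i3_ty: "\<iota>3 \<in> twos K" "s2 K \<iota>3 = v T \<cdot> q X \<cdot> q X \<cdot> q X" using ty by (simp_all add: \<iota>3_def)
  have coassoc: "(q X \<triangleright> mmult D) \<ast> mmult D = (mmult D \<triangleleft> q X) \<ast> mmult D"
  proof (rule em_uniq2[OF weak_entD(1)[OF ent]])
    have "\<iota>3 \<ast> (v T \<triangleright> ((q X \<triangleright> mmult D) \<ast> mmult D)) = \<iota>3 \<ast> (v T \<triangleright> ((mmult D \<triangleleft> q X) \<ast> mmult D))"
      using ty i3_ty by (simp add: 1[THEN reassoc2] 2[THEN reassoc2] D2 \<delta>(1)[THEN reassoc2])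
    from split_mono_cancel[OF i3 _ _ _ _ this] show "v T \<triangleright> ((q X \<triangleright> mmult D) \<ast> mmult D) = v T \<triangleright> ((mmult D \<triangleleft> q X) \<ast> mmult D)"
      using ty i3_ty by simp
  qed (use ty in simp_all)
  have counit1: "(q X \<triangleright> munit D) \<ast> mmult D = id2 K (q X)"
  proof (rule em_uniq2[OF weak_entD(1)[OF ent]])
    have n: "\<iota> X \<ast> (v T \<triangleright> q X \<triangleright> munit D) = (mcar C \<triangleright> v T \<triangleright> munit D) \<ast> (\<iota> X \<triangleleft> q X)"
      using naturality2[of "\<iota> X" "munit D" "v T" "q X" "mcar C \<cdot> v T" "q X" "id1 K (J0 T)"] ty by simp
    have "\<iota> X \<ast> (v T \<triangleright> ((q X \<triangleright> munit D) \<ast> mmult D)) = \<iota> X \<ast> (v T \<triangleright> id2 K (q X))"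
      using ty by (simp add: n[THEN reassoc2] D0 D2 \<delta>(2)[THEN reassoc2])
    from split_mono_cancel[OF \<iota> _ _ _ _ this] show "v T \<triangleright> ((q X \<triangleright> munit D) \<ast> mmult D) = v T \<triangleright> id2 K (q X)"
      using ty by simp
  qed (use ty in simp_all)
  have counit2: "(munit D \<triangleleft> q X) \<ast> mmult D = id2 K (q X)"
  proof (rule em_uniq2[OF weak_entD(1)[OF ent]])
    have n: "\<iota> X \<ast> (munit C \<triangleleft> v T \<cdot> q X) = (munit C \<triangleleft> mcar C \<cdot> v T) \<ast> (mcar C \<triangleright> \<iota> X)"
      using naturality1[of "munit C" "\<iota> X" "mcar C" "id1 K (mob T)" "v T \<cdot> q X" "mcar C \<cdot> v T"] ty by simp
    have e: "v T \<triangleright> munit D \<triangleleft> q X = (munit C \<triangleleft> v T \<cdot> q X) \<ast> (\<iota> X \<triangleleft> q X)"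
      using arg_cong[OF D0, of "\<lambda>x. x \<triangleleft> q X"] ty by simp
    have "\<iota> X \<ast> (v T \<triangleright> ((munit D \<triangleleft> q X) \<ast> mmult D)) = \<iota> X \<ast> (v T \<triangleright> id2 K (q X))"
      using ty by (simp add: n[THEN reassoc2] e D2 \<delta>(3)[THEN reassoc2])
    from split_mono_cancel[OF \<iota> _ _ _ _ this] show "v T \<triangleright> ((munit D \<triangleleft> q X) \<ast> mmult D) = v T \<triangleright> id2 K (q X)"
      using ty by simp
  qed (use ty in simp_all)
  show ?thesis using ty coassoc counit1 counit2 by (simp add: is_monad_iff hom1_iff hom2_iff)
qed

end

section \<open>The universal weak entwined module\<close>

context ent_em
begin

lemmas co_tys = co_v_ty(1-3)[OF D_comonad, unfolded D_sel] co_act_ty[OF D_comonad, unfolded D_sel]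
  co_obs[OF D_comonad]
lemmas DT = D_tys co_tys

text \<open>The universal comodule of \<open>D\<close>, with coaction \<kappa>. Composing it with
  the universal \<open>T\<close>-module gives \<open>vm\<close> and \<open>rm\<close>, and pushing
  \<kappa> along the inclusion into \<open>c v\<close> gives \<open>km\<close>.\<close>

abbreviation "w \<equiv> em_v Es D"
abbreviation "\<kappa> \<equiv> em_act Es D"
abbreviation "vm \<equiv> v T \<cdot> w"
abbreviation "rm \<equiv> a T \<triangleleft> w"
abbreviation "km \<equiv> (\<iota> X \<triangleleft> w) \<ast> (v T \<triangleright> \<kappa>)"

text \<open>The action on the retract is defined with a projection in front. Composing with the
  inclusion produces the idempotent, which the action on \<open>c v\<close> absorbs.\<close>

lemma aq_at:
  assumes "z \<in> ones K" "t1 K z = J0 T"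
  shows "(\<iota> X \<triangleleft> z) \<ast> (a T \<triangleleft> q X \<cdot> z) = (mcar C \<triangleright> a T \<triangleleft> z) \<ast> (\<psi> \<triangleleft> v T \<cdot> z) \<ast> (mcar T \<triangleright> \<iota> X \<triangleleft> z)"
proof -
  note ty = DT weak_entD(1)[OF ent]
  have i: "idem K T (mcar C \<cdot> v T) (av X) \<ast> av X = av X"
    using nmod_idem(2)[OF mndi1_ty(2)[OF X_mndi1] av_nmod[OF X_mndi1]] by (simp add: X_def)
  have "(a T \<triangleleft> q X) = \<pi> X \<ast> av X \<ast> (mcar T \<triangleright> \<iota> X)" using Q1(3)[OF X_mndi1] by (simp add: X_def)
  then have "\<iota> X \<ast> (a T \<triangleleft> q X) = av X \<ast> (mcar T \<triangleright> \<iota> X)"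
    using ty split_eq(2)[OF X_mndi1, THEN reassoc2] i[THEN reassoc2] by (simp add: X_def)
  then have "\<iota> X \<ast> (a T \<triangleleft> q X) = (mcar C \<triangleright> a T) \<ast> (\<psi> \<triangleleft> v T) \<ast> (mcar T \<triangleright> \<iota> X)"
    using ty by (simp add: act_def X_def)
  from this[THEN rwhisk2, of z] show ?thesis using assms ty by simp
qed

text \<open>The comodule laws are those of \<kappa> pushed along the inclusions by
  \<open>D_mmult\<close> and \<open>D_munit\<close>. Compatibility of action and coaction holds
  because \<open>v T \<triangleright> \<kappa>\<close> is a module morphism, by naturality of the
  action, and because of \<open>aq_at\<close>.\<close>

lemma univ_entw_mod: "entw_mod K (Entw0 T C \<psi>) vm rm km"
proof -
  note ty = DT
  have rm: "umod K T vm rm" using umod_cmp[OF weak_entD(1)[OF ent] em_v_ty(4)[OF weak_entD(1)[OF ent]], of w] ty by simp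
  have k: "(q X \<triangleright> \<kappa>) \<ast> \<kappa> = (mmult D \<triangleleft> w) \<ast> \<kappa>" "(munit D \<triangleleft> w) \<ast> \<kappa> = id2 K w"
    using co_v_ty(4)[OF D_comonad] unfolding comod_iff by (simp_all add: D_sel)
  have 1: "(mcar C \<triangleright> \<iota> X \<triangleleft> w) \<ast> (\<iota> X \<triangleleft> q X \<cdot> w) \<ast> (v T \<triangleright> mmult D \<triangleleft> w) = (mmult C \<triangleleft> vm) \<ast> (\<iota> X \<triangleleft> w)"
    using ty D_mmult(2)[THEN rwhisk3, of w] by simp
  have 2: "v T \<triangleright> munit D \<triangleleft> w = (munit C \<triangleleft> vm) \<ast> (\<iota> X \<triangleleft> w)"
    using arg_cong[OF D_munit(2), of "\<lambda>x. x \<triangleleft> w"] ty by simp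
  have n1: "(mcar C \<triangleright> v T \<triangleright> \<kappa>) \<ast> (\<iota> X \<triangleleft> w) = (\<iota> X \<triangleleft> q X \<cdot> w) \<ast> (v T \<triangleright> q X \<triangleright> \<kappa>)"
    using naturality2[of "\<iota> X" \<kappa> "v T" "q X" "mcar C \<cdot> v T" w "q X \<cdot> w"] ty by simp
  have n2: "(v T \<triangleright> \<kappa>) \<ast> (a T \<triangleleft> w) = (a T \<triangleleft> q X \<cdot> w) \<ast> (mcar T \<triangleright> v T \<triangleright> \<kappa>)"
    using naturality2[of "a T" \<kappa> "mcar T" "v T" "v T" w "q X \<cdot> w"] ty by simp
  have "(mcar C \<triangleright> km) \<ast> km = (mmult C \<triangleleft> vm) \<ast> km"
    using ty by (simp add: n1[THEN reassoc2] k(1)[THEN lwhisk2] 1[THEN reassoc3])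
  moreover have "(munit C \<triangleleft> vm) \<ast> km = id2 K vm"
    using ty k(2)[THEN lwhisk2, of "v T"] by (simp add: 2)
  moreover have "km \<ast> rm = (mcar C \<triangleright> rm) \<ast> (\<psi> \<triangleleft> vm) \<ast> (mcar T \<triangleright> km)"
    using ty by (simp add: n2 aq_at[THEN reassoc2])
  ultimately show ?thesis using rm ty weak_entD(3)[OF ent] by (simp add: entw_mod_def comod_iff hom2_iff)
qed

lemma iota_cancel:
  assumes "z \<in> ones K" "t1 K z = J0 T" "x \<in> twos K" "y \<in> twos K" "t2 K x = v T \<cdot> q X \<cdot> z" "t2 K y = v T \<cdot> q X \<cdot> z"
    and "(\<iota> X \<triangleleft> z) \<ast> x = (\<iota> X \<triangleleft> z) \<ast> y"
  shows "x = y"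
  by (rule split_mono_cancel[OF split_mono_rwhisk[OF iota_smono[OF X_mndi1]] _ _ _ _ assms(7)]) (use assms DT in simp_all)

text \<open>Uniqueness in two stages: the module part determines \<open>w \<cdot> z\<close> by the
  property of J(t). The coaction then determines \<open>\<kappa> \<triangleleft> z\<close> after
  cancelling the inclusion and \<open>v T\<close>, and these two determine \<open>z\<close> by the
  property of the Eilenberg-Moore object of \<open>D\<close>.\<close>

lemma univ_uniq1:
  assumes z: "z \<in> hom1 K l (on0 (emJ Es) D)" "z' \<in> hom1 K l (on0 (emJ Es) D)"
    and eq: "vm \<cdot> z = vm \<cdot> z'" "rm \<triangleleft> z = rm \<triangleleft> z'" "km \<triangleleft> z = km \<triangleleft> z'"
  shows "z = z'"
proof -
  note ty = DT z[unfolded hom1_iff]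
  have w: "w \<cdot> z = w \<cdot> z'"
  proof (rule em_uniq1[OF weak_entD(1)[OF ent]])
    show "v T \<cdot> (w \<cdot> z) = v T \<cdot> (w \<cdot> z')" using eq(1) ty by simp
    show "a T \<triangleleft> (w \<cdot> z) = a T \<triangleleft> (w \<cdot> z')" using eq(2) ty by simp
  qed (use ty in \<open>simp_all add: hom1_iff\<close>)
  have k: "v T \<triangleright> (\<kappa> \<triangleleft> z) = v T \<triangleright> (\<kappa> \<triangleleft> z')"
  proof (rule iota_cancel[of "w \<cdot> z"])
    have "(\<iota> X \<triangleleft> w \<cdot> z) \<ast> (v T \<triangleright> \<kappa> \<triangleleft> z) = km \<triangleleft> z" using ty by simp
    also have "... = (\<iota> X \<triangleleft> w \<cdot> z') \<ast> (v T \<triangleright> \<kappa> \<triangleleft> z')" unfolding eq(3) using ty by simp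
    finally show "(\<iota> X \<triangleleft> w \<cdot> z) \<ast> (v T \<triangleright> \<kappa> \<triangleleft> z) = (\<iota> X \<triangleleft> w \<cdot> z) \<ast> (v T \<triangleright> \<kappa> \<triangleleft> z')" by (simp only: w)
  qed (use ty w in simp_all)
  have g1: "\<kappa> \<triangleleft> z \<in> twos K" using ty by simp
  have g2: "\<kappa> \<triangleleft> z' \<in> twos K" using ty by simp
  have g5: "t1 K (s2 K (\<kappa> \<triangleleft> z)) = J0 T" using ty by simp
  have g3: "s2 K (\<kappa> \<triangleleft> z) = s2 K (\<kappa> \<triangleleft> z')" using ty w by simp
  have g4: "t2 K (\<kappa> \<triangleleft> z) = t2 K (\<kappa> \<triangleleft> z')" using ty w by simp
  have "\<kappa> \<triangleleft> z = \<kappa> \<triangleleft> z'"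
    by (rule em_uniq2[OF weak_entD(1)[OF ent] g1 g2 g3 g4 g5 k])
  show ?thesis
    by (rule co_uniq1[OF D_comonad z w]) fact
qed

lemma univ_ex:
  assumes entw_mod: "entw_mod K (Entw0 T C \<psi>) M s n"
  shows "\<exists>z \<in> hom1 K (s1 K M) (on0 (emJ Es) D). vm \<cdot> z = M \<and> rm \<triangleleft> z = s \<and> km \<triangleleft> z = n"
proof -
  have s: "umod K T M s" and n: "n \<in> hom2 K M (mcar C \<cdot> M)" "(mcar C \<triangleright> n) \<ast> n = (mmult C \<triangleleft> M) \<ast> n"
     "(munit C \<triangleleft> M) \<ast> n = id2 K M" and M: "M \<in> ones K" "t1 K M = mob T"
    and sn: "n \<ast> s = (mcar C \<triangleright> s) \<ast> (\<psi> \<triangleleft> M) \<ast> (mcar T \<triangleright> n)"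
    using entw_mod weak_entD(3)[OF ent] by (simp_all add: entw_mod_def comod_iff)
  obtain b where b: "b \<in> ones K" "s1 K b = s1 K M" "t1 K b = J0 T" and vb: "v T \<cdot> b = M" "a T \<triangleleft> b = s"
    using em_ex1[OF weak_entD(1)[OF ent] s] by (auto simp: hom1_iff)
  note ty = DT n(1)[unfolded hom2_iff] nmod_ty[OF umod_nmod[OF s]] b
  have idb: "\<theta> X \<triangleleft> b = (mcar C \<triangleright> s) \<ast> (\<psi> \<triangleleft> M) \<ast> (munit T \<triangleleft> mcar C \<cdot> M)"
    using ty vb by (simp add: idem_def act_def X_def)
  have "(\<theta> X \<triangleleft> b) \<ast> n = (mcar C \<triangleright> s) \<ast> (\<psi> \<triangleleft> M) \<ast> (mcar T \<triangleright> n) \<ast> (munit T \<triangleleft> M)"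
    unfolding idb using ty by (simp add: naturality0[of "munit T"])
  also have "... = (n \<ast> s) \<ast> (munit T \<triangleleft> M)" unfolding sn using ty by simp
  also have "... = n" using s ty by (simp add: umod_def idem_def)
  finally have \<theta>n: "(\<theta> X \<triangleleft> b) \<ast> n = n" .
  define n' where "n' = (\<pi> X \<triangleleft> b) \<ast> n"
  have n'_ty: "n' \<in> twos K" "s2 K n' = v T \<cdot> b" "t2 K n' = v T \<cdot> q X \<cdot> b"
    using ty vb by (simp_all add: n'_def)
  have \<iota>n: "(\<iota> X \<triangleleft> b) \<ast> n' = n"
    using split_eq(2)[OF X_mndi1, THEN rwhisk2, THEN reassoc2, of b n] ty vb \<theta>n by (simp add: n'_def)
  \<comment> \<open>The corestriction \<open>n'\<close> of the coaction to the retract is a module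
    morphism. This can be tested after the inclusion, where it is the compatibility of
    \<open>n\<close> with \<open>s\<close>; hence \<open>n'\<close> lifts to a candidate coaction
    \<open>l\<close> on the classifying 1-cell \<open>b\<close>.\<close>
  have "n' \<ast> (a T \<triangleleft> b) = (a T \<triangleleft> q X \<cdot> b) \<ast> (mcar T \<triangleright> n')"
  proof (rule iota_cancel[of b])
    have "(\<iota> X \<triangleleft> b) \<ast> n' \<ast> (a T \<triangleleft> b) = n \<ast> s" using ty n'_ty \<iota>n[THEN reassoc2] vb by simp
    also have "... = (\<iota> X \<triangleleft> b) \<ast> (a T \<triangleleft> q X \<cdot> b) \<ast> (mcar T \<triangleright> n')"
      using ty n'_ty vb \<iota>n[THEN lwhisk2] by (simp add: aq_at[THEN reassoc2] sn)
    finally show "(\<iota> X \<triangleleft> b) \<ast> n' \<ast> (a T \<triangleleft> b) = (\<iota> X \<triangleleft> b) \<ast> (a T \<triangleleft> q X \<cdot> b) \<ast> (mcar T \<triangleright> n')" .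
  qed (use ty n'_ty vb in simp_all)
  then obtain l where l: "l \<in> twos K" "s2 K l = b" "t2 K l = q X \<cdot> b" and vl: "v T \<triangleright> l = n'"
    using em_ex2[OF weak_entD(1)[OF ent], of b "s1 K M" "q X \<cdot> b" n'] ty n'_ty by (auto simp: hom1_iff hom2_iff)
  have D1: "(mcar C \<triangleright> \<iota> X \<triangleleft> b) \<ast> (\<iota> X \<triangleleft> q X \<cdot> b) \<ast> (v T \<triangleright> mmult D \<triangleleft> b) = (mmult C \<triangleleft> M) \<ast> (\<iota> X \<triangleleft> b)"
    using ty vb(1) D_mmult(2)[THEN rwhisk3, of b] by simp
  have D0: "v T \<triangleright> munit D \<triangleleft> b = (munit C \<triangleleft> M) \<ast> (\<iota> X \<triangleleft> b)"
    using arg_cong[OF D_munit(2), of "\<lambda>x. x \<triangleleft> b"] ty vb(1) by simp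
  have N1: "(\<iota> X \<triangleleft> q X \<cdot> b) \<ast> (v T \<triangleright> q X \<triangleright> l) = (mcar C \<triangleright> n') \<ast> (\<iota> X \<triangleleft> b)"
    using naturality2[of "\<iota> X" l "v T" "q X" "mcar C \<cdot> v T" b "q X \<cdot> b"] ty l vl by simp
  have L: "(q X \<triangleright> l) \<ast> l \<in> twos K" "s2 K ((q X \<triangleright> l) \<ast> l) = b" "t2 K ((q X \<triangleright> l) \<ast> l) = q X \<cdot> q X \<cdot> b"
    "(mmult D \<triangleleft> b) \<ast> l \<in> twos K" "s2 K ((mmult D \<triangleleft> b) \<ast> l) = b" "t2 K ((mmult D \<triangleleft> b) \<ast> l) = q X \<cdot> q X \<cdot> b"
    "(munit D \<triangleleft> b) \<ast> l \<in> twos K" "s2 K ((munit D \<triangleleft> b) \<ast> l) = b" "t2 K ((munit D \<triangleleft> b) \<ast> l) = b"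
    using ty l by simp_all
  note l_ty = ty l n'_ty vb(1)
  \<comment> \<open>Coassociativity of \<open>l\<close> is tested after \<open>v T\<close> and the
    twofold inclusion, where it becomes coassociativity of \<open>n\<close>.\<close>
  have "((mcar C \<triangleright> \<iota> X \<triangleleft> b) \<ast> (\<iota> X \<triangleleft> q X \<cdot> b)) \<ast> (v T \<triangleright> ((q X \<triangleright> l) \<ast> l)) = (mcar C \<triangleright> ((\<iota> X \<triangleleft> b) \<ast> n')) \<ast> (\<iota> X \<triangleleft> b) \<ast> n'"
    using l_ty by (simp add: N1[THEN reassoc2] vl)
  also have "... = (mmult C \<triangleleft> M) \<ast> (\<iota> X \<triangleleft> b) \<ast> n'" by (simp only: \<iota>n n)
  also have "... = ((mcar C \<triangleright> \<iota> X \<triangleleft> b) \<ast> (\<iota> X \<triangleleft> q X \<cdot> b)) \<ast> (v T \<triangleright> ((mmult D \<triangleleft> b) \<ast> l))"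
    using l_ty by (simp add: D1[THEN reassoc3] vl)
  finally have e1: "((mcar C \<triangleright> \<iota> X \<triangleleft> b) \<ast> (\<iota> X \<triangleleft> q X \<cdot> b)) \<ast> (v T \<triangleright> ((q X \<triangleright> l) \<ast> l))
      = ((mcar C \<triangleright> \<iota> X \<triangleleft> b) \<ast> (\<iota> X \<triangleleft> q X \<cdot> b)) \<ast> (v T \<triangleright> ((mmult D \<triangleleft> b) \<ast> l))" .
  have sm: "split_mono ((mcar C \<triangleright> \<iota> X \<triangleleft> b) \<ast> (\<iota> X \<triangleleft> q X \<cdot> b))"
    using split_mono_rwhisk[OF iota2_smono, of b] ty by simp
  have e1': "v T \<triangleright> ((q X \<triangleright> l) \<ast> l) = v T \<triangleright> ((mmult D \<triangleleft> b) \<ast> l)"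
    by (rule split_mono_cancel[OF sm _ _ _ _ e1]) (use ty L in simp_all)
  have c1: "(q X \<triangleright> l) \<ast> l = (mmult D \<triangleleft> b) \<ast> l"
    by (rule em_uniq2[OF weak_entD(1)[OF ent] _ _ _ _ _ e1']) (simp_all add: L b)
  have e2: "v T \<triangleright> ((munit D \<triangleleft> b) \<ast> l) = v T \<triangleright> id2 K b"
    using l_ty by (simp add: D0 vl \<iota>n n)
  have c2: "(munit D \<triangleleft> b) \<ast> l = id2 K b"
    by (rule em_uniq2[OF weak_entD(1)[OF ent] _ _ _ _ _ e2]) (simp_all add: L b)
  have "comod D b l" using c1 c2 by (simp add: comod_iff D_sel b l hom2_iff)
  from co_ex1[OF D_comonad this] obtain z where z: "z \<in> hom1 K (s1 K M) (on0 (emJ Es) D)" "w \<cdot> z = b" "\<kappa> \<triangleleft> z = l"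
    by (auto simp: b)
  note zt = z(1)[unfolded hom1_iff]
  have "vm \<cdot> z = v T \<cdot> b" "rm \<triangleleft> z = a T \<triangleleft> b" "km \<triangleleft> z = (\<iota> X \<triangleleft> b) \<ast> (v T \<triangleright> l)"
    using DT zt by (simp_all flip: z(2,3))
  with z(1) vb vl \<iota>n show ?thesis by auto
qed

lemma univ_uniq2:
  assumes y: "y \<in> twos K" "y' \<in> twos K" "s2 K y = s2 K y'" "t2 K y = t2 K y'" "t1 K (s2 K y') = on0 (emJ Es) D"
    and eq: "vm \<triangleright> y = vm \<triangleright> y'"
  shows "y = y'"
proof -
  have eq': "v T \<triangleright> (w \<triangleright> y) = v T \<triangleright> (w \<triangleright> y')" using eq DT y by simp
  have 1: "w \<triangleright> y = w \<triangleright> y'"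
    by (rule em_uniq2[OF weak_entD(1)[OF ent] _ _ _ _ _ eq']) (use DT y in simp_all)
  show ?thesis
    by (rule co_uniq2[OF D_comonad y(1,2,4,3) _ 1]) (use y parallel'[of y] in simp)
qed

end

section \<open>The comonad morphism induced by a 1-cell of weak entwining structures\<close>

lemma cmd_sel [simp]:
  "obs (cmd K) = {T. is_comonad K T}" "ones (cmd K) = {X. is_mnd1 (vop K) X}" "twos (cmd K) = {x. is_mnd2 (vop K) x}"
  "s1 (cmd K) = src1" "t1 (cmd K) = trg1" "s2 (cmd K) = trg2" "t2 (cmd K) = src2" "id1 (cmd K) = id_mon1 K"
  "id2 (cmd K) X = Mon2 X X (id2 K (und1 X))" "cmp1 (cmd K) = cmp_mon1 (vop K)"
  "vcmp (cmd K) y x = Mon2 (src2 y) (trg2 x) (und2 y \<ast>\<^bsub>K\<^esub> und2 x)"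
  "hcmp (cmd K) y x = Mon2 (cmp_mon1 (vop K) (src2 y) (src2 x)) (cmp_mon1 (vop K) (trg2 y) (trg2 x)) (und2 y \<star>\<^bsub>K\<^esub> und2 x)"
  by (simp_all add: cmd_def id_mon1_def fun_eq_iff)

context two_category
begin

lemma entw1D:
  assumes "is_entw1 K (Entw1 (Entw0 T C \<psi>) (Entw0 T' C' \<psi>') W \<alpha> \<beta>)"
  defines "Y \<equiv> Mon1 T T' W \<alpha>" and "X \<equiv> Mon1 T T (mcar C) \<psi>" and "X' \<equiv> Mon1 T' T' (mcar C') \<psi>'"
  shows "weak_entwining K T C \<psi>" "weak_entwining K T' C' \<psi>'" "is_mnd1 K Y"
    "is_mndi2 K (Mon2 (cmp_mon1 K Y X) (cmp_mon1 K X' Y) \<beta>)"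
    "(mmult C' \<triangleleft> W) \<ast> \<beta> = (mcar C' \<triangleright> \<beta>) \<ast> (\<beta> \<triangleleft> mcar C) \<ast> (W \<triangleright> mmult C)"
    "(munit C' \<triangleleft> W) \<ast> \<beta> = W \<triangleright> munit C"
proof -
  let ?f = "Entw1 (Entw0 T C \<psi>) (Entw0 T' C' \<psi>') W \<alpha> \<beta>"
  show w: "weak_entwining K T C \<psi>" "weak_entwining K T' C' \<psi>'" using assms by (simp_all add: is_entw1_def is_entw0_def)
  have A: "is_mnd1 (vop (mndi K)) (A1 K ?f)" and B: "is_mnd1 (vop (vop (cmdp K))) (B1 K ?f)"
    using assms(1) by (simp_all add: is_entw1_def)
  have Y: "is_mndi1 K Y" using A by (simp add: is_mnd1_iff is_mndi1_iff A1_def Let_def hom1_iff Y_def)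
  have "\<alpha> \<ast> (munit T' \<triangleleft> W) = W \<triangleright> munit T"
    using B by (simp add: is_mnd1_iff B1_def Let_def B0_def cmdp_def)
  with Y show "is_mnd1 K Y" by (simp add: is_mnd1_iff Y_def)
  show b: "is_mndi2 K (Mon2 (cmp_mon1 K Y X) (cmp_mon1 K X' Y) \<beta>)"
    using A by (simp add: is_mnd1_iff is_mndi1_iff A1_def A0_def Let_def hom2_iff Y_def X_def X'_def)
  show "(munit C' \<triangleleft> W) \<ast> \<beta> = W \<triangleright> munit C"
    using A by (simp add: is_mnd1_iff A1_def A0_def Let_def)
  have "((mcar C' \<triangleright> \<beta>) \<ast> (\<beta> \<triangleleft> mcar C)) \<ast> (W \<triangleright> mmult C) = (mmult C' \<triangleleft> W) \<ast> \<beta>"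
    using A by (simp add: is_mnd1_iff is_mndi1_iff A1_def A0_def Let_def)
  then show "(mmult C' \<triangleleft> W) \<ast> \<beta> = (mcar C' \<triangleright> \<beta>) \<ast> (\<beta> \<triangleleft> mcar C) \<ast> (W \<triangleright> mmult C)"
    using ent_tys[OF w(1)] ent_tys[OF w(2)] mndi1_ty[OF Y] mndi2_ty[OF b] by (simp add: Y_def X_def X'_def)
qed

lemma inv2_eq: assumes "inverse_2cells K x y" shows "inv2 K x = y"
proof -
  have "y' = y" if h: "inverse_2cells K x y'" for y'
  proof -
    have "y' = y' \<ast> (x \<ast> y)" using assms h by (simp add: inverse_2cells_def hom2_iff)
    also have "... = (y' \<ast> x) \<ast> y" by (rule vcmp_assoc'[symmetric]) (use assms h in \<open>auto simp: inverse_2cells_def hom2_iff\<close>)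
    also have "y' \<ast> x = id2 K (s2 K x)" using h by (simp add: inverse_2cells_def)
    also have "... \<ast> y = y" using assms by (simp add: inverse_2cells_def hom2_iff)
    finally show ?thesis .
  qed
  with assms show ?thesis unfolding inv2_def by (rule the_equality)
qed

end

text \<open>\<open>Y\<close> is the 1-cell \<open>(W, \<alpha>)\<close> of \<open>mnd K\<close>, and
  \<Lambda> is the comonad morphism from \<open>D\<close> to \<open>D'\<close> that \<open>Q\<close>
  makes of it and of \<beta>.\<close>

locale ent_mor = em_pair K E S Es + A: ent_em K E S Es T C \<psi> X D + B: ent_em K E S Es T' C' \<psi>' X' D'
  for K :: "('o, 'm, 'c) two_cat" (structure) and E S Es T C \<psi> X D T' C' \<psi>' X' D' +
  fixes W :: 'm and \<alpha> \<beta> :: 'c and Y :: "('o, 'm, 'c) mon1" and \<Lambda> :: "('o, 'm, 'c) mon1"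
  assumes mor: "is_entw1 K (Entw1 (Entw0 T C \<psi>) (Entw0 T' C' \<psi>') W \<alpha> \<beta>)"
    and Y_def: "Y = Mon1 T T' W \<alpha>"
    and L_def: "\<Lambda> = on1 (cmd_psfun (mndi K) K (Q K E S)) (A1 K (Entw1 (Entw0 T C \<psi>) (Entw0 T' C' \<psi>') W \<alpha> \<beta>))"
begin

lemma Y_sel: "src1 Y = T" "trg1 Y = T'" "und1 Y = W" "str1 Y = \<alpha>" by (simp_all add: Y_def)

lemma Y: "is_mnd1 K Y" "is_mndi1 K Y" using entw1D(3)[OF mor] by (simp_all add: Y_def mnd1_mndi1)

lemma beta2: "is_mndi2 K (Mon2 (cmp_mon1 K Y X) (cmp_mon1 K X' Y) \<beta>)"
  using entw1D(4)[OF mor] by (simp add: Y_def A.X_def B.X_def)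

lemma Y_split: "q Y = on1 (emJ E) Y" "v T' \<cdot> q Y = W \<cdot> v T" "\<iota> Y = id2 K (W \<cdot> v T)"
  using split_strict[OF Y(1)] by (simp_all add: Y_sel)

lemma Y_ty: "W \<in> ones K" "s1 K W = mob T" "t1 K W = mob T'" "\<alpha> \<in> twos K" "s2 K \<alpha> = mcar T' \<cdot> W" "t2 K \<alpha> = W \<cdot> mcar T"
  "\<beta> \<in> twos K" "s2 K \<beta> = W \<cdot> mcar C" "t2 K \<beta> = mcar C' \<cdot> W" "q Y \<in> ones K" "s1 K (q Y) = on0 (emJ E) T" "t1 K (q Y) = on0 (emJ E) T'"
  using mndi1_ty[OF Y(2)] mndi2_ty[OF beta2] split_ty(1-3)[OF Y(2)] by (simp_all add: Y_sel A.X_sel B.X_sel)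

text \<open>Composites are normalised to the right, so \<open>v T' \<cdot> q Y\<close> is not a
  subterm of a longer composite. This and \<open>vJ2\<close> are the instances in which the equation
  from \<open>Y_split\<close> can still rewrite.\<close>

lemma vJ1: "z \<in> ones K \<Longrightarrow> t1 K z = on0 (emJ E) T \<Longrightarrow> v T' \<cdot> q Y \<cdot> z = W \<cdot> v T \<cdot> z"
  using cmp1_assoc'[of z "q Y" "v T'"] cmp1_assoc'[of z "v T" W] Y_ty A.DT B.DT Y_split(2) by simp

lemma vJ2: "x \<in> twos K \<Longrightarrow> t1 K (s2 K x) = on0 (emJ E) T \<Longrightarrow> v T' \<triangleright> q Y \<triangleright> x = W \<triangleright> v T \<triangleright> x"
  using lwhisk_lwhisk[of x "q Y" "v T'"] lwhisk_lwhisk[of x "v T" W] Y_ty A.DT B.DT Y_split(2) by simp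

lemmas vJ = Y_split(2) vJ1 vJ2

lemma aJ: "a T' \<triangleleft> q Y = (W \<triangleright> a T) \<ast> (\<alpha> \<triangleleft> v T)"
  using J1(3)[OF Y(1)] unfolding Y_split(1) by (simp add: Y_sel act_def)

lemma L_sel: "src1 \<Lambda> = D" "trg1 \<Lambda> = D'" "und1 \<Lambda> = q Y"
  by (simp_all add: L_def cmd_psfun_def Let_def A.D_def B.D_def A1_def Y_def)

text \<open>The structure cell of \<Lambda> involves an inverse coherence cell. Seen through the
  inclusion of the target it is simply \<beta> restricted to the retract, and as that inclusion can
  be cancelled this characterises it.\<close>

lemma lam:
  "str1 \<Lambda> \<in> hom2 K (q Y \<cdot> q X) (q X' \<cdot> q Y)" "(\<iota> X' \<triangleleft> q Y) \<ast> (v T' \<triangleright> str1 \<Lambda>) = (\<beta> \<triangleleft> v T) \<ast> (W \<triangleright> \<iota> X)"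
proof -
  let ?b2 = "Mon2 (cmp_mon1 K Y X) (cmp_mon1 K X' Y) \<beta>"
  define c1 c2 b where "c1 = Q_cmp K E S Y X" and "c2 = Q_cmp K E S X' Y" and "b = Q2 K E S ?b2"
  have YX: "trg1 X = src1 Y" "trg1 Y = src1 X'" by (simp_all add: Y_sel A.X_sel B.X_sel)
  note c1 = Q_cmp(1,3)[OF A.X_mndi1 Y(2) YX(1), folded c1_def] and c2 = Q_cmp(1)[OF Y(2) B.X_mndi1 YX(2), folded c2_def]
  note b = Q2(1)[OF beta2, folded b_def, unfolded mon2.sel]
  obtain g where g: "inverse_2cells K c1 g" using c1(2) by blast
  have L: "str1 \<Lambda> = c2 \<ast> b \<ast> g"
    using inv2_eq[OF g] by (simp add: L_def cmd_psfun_def Let_def A1_def A0_def c1_def c2_def b_def A.X_def B.X_def Y_def)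
  note ty = A.DT B.DT Y_ty vJ c1(1)[unfolded hom2_iff] c2[unfolded hom2_iff] b[unfolded hom2_iff]
   split_ty[OF mndi1_cmp[OF A.X_mndi1 Y(2) YX(1)], unfolded cmp_mon1_sel Y_sel A.X_sel]
   split_ty[OF mndi1_cmp[OF Y(2) B.X_mndi1 YX(2)], unfolded cmp_mon1_sel Y_sel B.X_sel]
  have gt: "g \<in> twos K" "s2 K g = q Y \<cdot> q X" "t2 K g = q (cmp_mon1 K Y X)" "c1 \<ast> g = id2 K (q Y \<cdot> q X)"
    using g c1(1) by (simp_all add: inverse_2cells_def hom2_iff)
  show "str1 \<Lambda> \<in> hom2 K (q Y \<cdot> q X) (q X' \<cdot> q Y)" using ty gt unfolding L by (simp add: hom2_iff)
  have 1: "(W \<triangleright> \<iota> X) \<ast> (v T' \<triangleright> c1) = \<iota> (cmp_mon1 K Y X)"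
    using iota_Q_cmp[OF A.X_mndi1 Y(2) YX(1), folded c1_def] ty by (simp add: Y_split Y_sel)
  have 2: "(\<iota> X' \<triangleleft> q Y) \<ast> (v T' \<triangleright> c2) = \<iota> (cmp_mon1 K X' Y)"
    using iota_Q_cmp[OF Y(2) B.X_mndi1 YX(2), folded c2_def] ty by (simp add: Y_split Y_sel B.X_sel)
  have 3: "\<iota> (cmp_mon1 K X' Y) \<ast> (v T' \<triangleright> b) = (\<beta> \<triangleleft> v T) \<ast> \<iota> (cmp_mon1 K Y X)"
    using iota_Q2[OF beta2, folded b_def] by (simp add: Y_sel A.X_sel)
  have "(\<iota> X' \<triangleleft> q Y) \<ast> (v T' \<triangleright> str1 \<Lambda>) = (\<beta> \<triangleleft> v T) \<ast> \<iota> (cmp_mon1 K Y X) \<ast> (v T' \<triangleright> g)"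
    unfolding L using ty gt by (simp add: 2[THEN reassoc2] 3[THEN reassoc2])
  \<comment> \<open>Factoring the inclusion of the composite through the coherence cell
    \<open>c1\<close> makes \<open>c1\<close> meet its inverse \<open>g\<close>.\<close>
  also have "... = (\<beta> \<triangleleft> v T) \<ast> (W \<triangleright> \<iota> X) \<ast> (v T' \<triangleright> (c1 \<ast> g))"
    unfolding 1[symmetric] using ty gt(1-3) by simp
  also have "... = (\<beta> \<triangleleft> v T) \<ast> (W \<triangleright> \<iota> X)"
    unfolding gt(4) using ty by simp
  finally show "(\<iota> X' \<triangleleft> q Y) \<ast> (v T' \<triangleright> str1 \<Lambda>) = (\<beta> \<triangleleft> v T) \<ast> (W \<triangleright> \<iota> X)" .
qed

end

context ent_mor
begin

abbreviation "l \<equiv> str1 \<Lambda>"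

lemmas mor_tys = A.DT B.DT Y_ty lam(1)[unfolded hom2_iff]

text \<open>Both laws of a comonad morphism are tested after \<open>v T'\<close>, and the one for
  the comultiplications also after the twofold inclusion \<open>j\<close>. By \<open>lam\<close>
  they turn into the laws of \<beta> with respect to \<delta> and \<epsilon>.\<close>

lemma L_mnd1: "is_mnd1 (vop K) \<Lambda>"
proof -
  note ty = mor_tys vJ
  have T': "is_monad K T'" by (rule weak_entD(1)[OF B.ent])
  have D2: "(mcar C' \<triangleright> \<iota> X' \<triangleleft> q Y) \<ast> (\<iota> X' \<triangleleft> q X' \<cdot> q Y) \<ast> (v T' \<triangleright> mmult D' \<triangleleft> q Y) = (mmult C' \<triangleleft> W \<cdot> v T) \<ast> (\<iota> X' \<triangleleft> q Y)"
    using ty B.D_mmult(2)[THEN rwhisk3, of "q Y"] by simp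
  have D0: "v T' \<triangleright> munit D' \<triangleleft> q Y = (munit C' \<triangleleft> W \<cdot> v T) \<ast> (\<iota> X' \<triangleleft> q Y)"
    using arg_cong[OF B.D_munit(2), of "\<lambda>x. x \<triangleleft> q Y"] ty by simp
  have N1: "(\<iota> X' \<triangleleft> q X' \<cdot> q Y) \<ast> (v T' \<triangleright> q X' \<triangleright> l) = (mcar C' \<triangleright> v T' \<triangleright> l) \<ast> (\<iota> X' \<triangleleft> q Y \<cdot> q X)"
    using naturality2[of "\<iota> X'" l "v T'" "q X'" "mcar C' \<cdot> v T'" "q Y \<cdot> q X" "q X' \<cdot> q Y"] ty by simp
  have N2: "(mcar C' \<triangleright> W \<triangleright> \<iota> X) \<ast> (\<beta> \<triangleleft> v T \<cdot> q X) = (\<beta> \<triangleleft> mcar C \<cdot> v T) \<ast> (W \<triangleright> mcar C \<triangleright> \<iota> X)"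
    using naturality2[of \<beta> "\<iota> X" W "mcar C" "mcar C' \<cdot> W" "v T \<cdot> q X" "mcar C \<cdot> v T"] ty by simp
  have l: "(\<iota> X' \<triangleleft> q Y) \<ast> (v T' \<triangleright> l) = (\<beta> \<triangleleft> v T) \<ast> (W \<triangleright> \<iota> X)" by (rule lam(2))
  have lq: "(\<iota> X' \<triangleleft> q Y \<cdot> q X) \<ast> (v T' \<triangleright> l \<triangleleft> q X) = (\<beta> \<triangleleft> v T \<cdot> q X) \<ast> (W \<triangleright> \<iota> X \<triangleleft> q X)"
    using l[THEN rwhisk2, of "q X"] ty by simp
  have cl: "(mcar C' \<triangleright> \<iota> X' \<triangleleft> q Y) \<ast> (mcar C' \<triangleright> v T' \<triangleright> l) = (mcar C' \<triangleright> \<beta> \<triangleleft> v T) \<ast> (mcar C' \<triangleright> W \<triangleright> \<iota> X)"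
    using l[THEN lwhisk2, of "mcar C'"] ty by simp
  have b5: "(mmult C' \<triangleleft> W \<cdot> v T) \<ast> (\<beta> \<triangleleft> v T) = (mcar C' \<triangleright> \<beta> \<triangleleft> v T) \<ast> (\<beta> \<triangleleft> mcar C \<cdot> v T) \<ast> (W \<triangleright> mmult C \<triangleleft> v T)"
    using entw1D(5)[OF mor, THEN rwhisk2, of "v T"] ty by simp
  have b6: "(munit C' \<triangleleft> W \<cdot> v T) \<ast> (\<beta> \<triangleleft> v T) = W \<triangleright> munit C \<triangleleft> v T"
    using entw1D(6)[OF mor, THEN rwhisk2, of "v T"] ty by simp
  define j where "j = (mcar C' \<triangleright> \<iota> X' \<triangleleft> q Y) \<ast> (\<iota> X' \<triangleleft> q X' \<cdot> q Y)"
  have j: "j \<in> twos K" "s2 K j = v T' \<cdot> q X' \<cdot> q X' \<cdot> q Y" "split_mono j"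
    using split_mono_rwhisk[OF B.iota2_smono, of "q Y"] ty by (simp_all add: j_def)
  let ?L = "(mmult D' \<triangleleft> q Y) \<ast> l" and ?R = "(q X' \<triangleright> l) \<ast> (l \<triangleleft> q X) \<ast> (q Y \<triangleright> mmult D)"
  have Lty: "?L \<in> twos K" "s2 K ?L = q Y \<cdot> q X" "t2 K ?L = q X' \<cdot> q X' \<cdot> q Y"
    and Rty: "?R \<in> twos K" "s2 K ?R = q Y \<cdot> q X" "t2 K ?R = q X' \<cdot> q X' \<cdot> q Y" by (simp_all add: ty)
  have "j \<ast> (v T' \<triangleright> ?L) = (mmult C' \<triangleleft> W \<cdot> v T) \<ast> (\<beta> \<triangleleft> v T) \<ast> (W \<triangleright> \<iota> X)"
    by (simp add: ty j_def D2[THEN reassoc3] l)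
  also have "... = (mcar C' \<triangleright> \<beta> \<triangleleft> v T) \<ast> (\<beta> \<triangleleft> mcar C \<cdot> v T) \<ast> (W \<triangleright> ((mmult C \<triangleleft> v T) \<ast> \<iota> X))"
    by (simp add: ty b5[THEN reassoc2])
  also have "... = (mcar C' \<triangleright> \<beta> \<triangleleft> v T) \<ast> (\<beta> \<triangleleft> mcar C \<cdot> v T) \<ast> (W \<triangleright> ((mcar C \<triangleright> \<iota> X) \<ast> (\<iota> X \<triangleleft> q X) \<ast> (v T \<triangleright> mmult D)))"
    unfolding A.D_mmult(2) by (simp add: ty)
  also have "... = j \<ast> (v T' \<triangleright> ?R)"
    by (simp add: ty j_def N1[THEN reassoc2] cl[THEN reassoc2] lq[THEN reassoc2] N2[THEN reassoc2])
  finally have e1: "j \<ast> (v T' \<triangleright> ?L) = j \<ast> (v T' \<triangleright> ?R)" .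
  have e1: "v T' \<triangleright> ?L = v T' \<triangleright> ?R"
    by (rule split_mono_cancel[OF j(3) _ _ _ _ e1]) (use j in \<open>simp_all add: ty Lty Rty\<close>)
  have c1: "?L = ?R"
    by (rule em_uniq2[OF T' _ _ _ _ _ e1]) (simp_all add: Lty Rty ty)
  let ?e = "(munit D' \<triangleleft> q Y) \<ast> l"
  have ety: "?e \<in> twos K" "s2 K ?e = q Y \<cdot> q X" "t2 K ?e = q Y" "q Y \<triangleright> munit D \<in> twos K" "s2 K (q Y \<triangleright> munit D) = q Y \<cdot> q X" "t2 K (q Y \<triangleright> munit D) = q Y"
    by (simp_all add: ty)
  have "v T' \<triangleright> ?e = W \<triangleright> ((munit C \<triangleleft> v T) \<ast> \<iota> X)"
    by (simp add: ty D0 l b6[THEN reassoc2])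
  also have "... = v T' \<triangleright> (q Y \<triangleright> munit D)"
    unfolding A.D_munit(2)[symmetric] by (simp add: ty)
  finally have e2: "v T' \<triangleright> ?e = v T' \<triangleright> (q Y \<triangleright> munit D)" .
  have c2: "?e = q Y \<triangleright> munit D"
    by (rule em_uniq2[OF T' _ _ _ _ _ e2]) (simp_all add: ety ty)
  show ?thesis
    using c1 c2 A.D_comonad B.D_comonad by (simp add: ty is_mnd1_iff is_mndi1_iff L_sel hom1_iff hom2_iff)
qed

abbreviation "Z \<equiv> on1 (emJ Es) \<Lambda>"

text \<open>The value of the composite at \<open>(W, \<alpha>, \<beta>)\<close> pulls the universal
  module of the target back to the module induced by \<open>W\<close> on that of the source;
  \<open>aJ\<close> accounts for the action and \<open>lam\<close> for the coaction.\<close>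

lemma Z:
  "Z \<in> hom1 K (on0 (emJ Es) D) (on0 (emJ Es) D')" "B.vm \<cdot> Z = W \<cdot> A.vm" "B.rm \<triangleleft> Z = (W \<triangleright> A.rm) \<ast> (\<alpha> \<triangleleft> A.vm)"
  "B.km \<triangleleft> Z = (\<beta> \<triangleleft> A.vm) \<ast> (W \<triangleright> A.km)"
proof -
  note z = co_J1[OF L_mnd1, unfolded L_sel]
  note ty = mor_tys vJ z(1)[unfolded hom1_iff]
  show "Z \<in> hom1 K (on0 (emJ Es) D) (on0 (emJ Es) D')" by (rule z)
  show "B.vm \<cdot> Z = W \<cdot> A.vm" by (simp add: ty z(2))
  have "B.rm \<triangleleft> Z = (a T' \<triangleleft> q Y) \<triangleleft> A.w" by (simp add: ty z(2))
  also have "... = (W \<triangleright> A.rm) \<ast> (\<alpha> \<triangleleft> A.vm)" unfolding aJ by (simp add: ty)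
  finally show "B.rm \<triangleleft> Z = (W \<triangleright> A.rm) \<ast> (\<alpha> \<triangleleft> A.vm)" .
  have l: "(\<iota> X' \<triangleleft> q Y \<cdot> A.w) \<ast> (v T' \<triangleright> l \<triangleleft> A.w) = (\<beta> \<triangleleft> A.vm) \<ast> (W \<triangleright> \<iota> X \<triangleleft> A.w)"
    using lam(2)[THEN rwhisk2, of A.w] by (simp add: ty)
  show "B.km \<triangleleft> Z = (\<beta> \<triangleleft> A.vm) \<ast> (W \<triangleright> A.km)"
    by (simp add: ty z(2,3) l[THEN reassoc2])
qed

end

section \<open>Representations of weak entwined modules\<close>

lemma entw_sel [simp]:
  "obs (entw K) = {x. is_entw0 K x}" "ones (entw K) = {x. is_entw1 K x}" "twos (entw K) = {x. is_entw2 K x}"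
  "s1 (entw K) = esrc1" "t1 (entw K) = etrg1" "s2 (entw K) = esrc2" "t2 (entw K) = etrg2"
  "id1 (entw K) x = Entw1 x x (id1 K (mob (ent_mon x))) (id2 K (mcar (ent_mon x))) (id2 K (mcar (ent_com x)))"
  "id2 (entw K) f = Entw2 f f (id2 K (eund1 f))" "cmp1 (entw K) = cmp_entw1 K"
  "vcmp (entw K) z y = Entw2 (esrc2 y) (etrg2 z) (eund2 z \<ast>\<^bsub>K\<^esub> eund2 y)"
  "hcmp (entw K) z y = Entw2 (cmp_entw1 K (esrc2 z) (esrc2 y)) (cmp_entw1 K (etrg2 z) (etrg2 y)) (eund2 z \<star>\<^bsub>K\<^esub> eund2 y)"
  by (simp_all add: entw_def)

context two_category
begin

lemma entw0_ty:
  assumes "is_entw0 K x"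
  shows "mob (ent_com x) = mob (ent_mon x)" "mob (ent_mon x) \<in> obs K"
    "mcar (ent_mon x) \<in> ones K" "s1 K (mcar (ent_mon x)) = mob (ent_mon x)" "t1 K (mcar (ent_mon x)) = mob (ent_mon x)"
    "mcar (ent_com x) \<in> ones K" "s1 K (mcar (ent_com x)) = mob (ent_mon x)" "t1 K (mcar (ent_com x)) = mob (ent_mon x)"
    "ent_law x \<in> twos K" "s2 K (ent_law x) = mcar (ent_mon x) \<cdot> mcar (ent_com x)" "t2 K (ent_law x) = mcar (ent_com x) \<cdot> mcar (ent_mon x)"
    "is_monad K (ent_mon x)" "is_comonad K (ent_com x)"
  using assms ent_tys[of "ent_mon x" "ent_com x" "ent_law x"] weak_entD[of "ent_mon x" "ent_com x" "ent_law x"]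
  by (simp_all add: is_entw0_def)

lemma entw1_parts:
  assumes "is_entw1 K f"
  shows "is_entw0 K (esrc1 f)" "is_entw0 K (etrg1 f)"
    "is_mnd1 K (Mon1 (ent_mon (esrc1 f)) (ent_mon (etrg1 f)) (eund1 f) (ealpha f))"
    "ebeta f \<in> hom2 K (eund1 f \<cdot> mcar (ent_com (esrc1 f))) (mcar (ent_com (etrg1 f)) \<cdot> eund1 f)"
proof -
  obtain T C \<psi> T' C' \<psi>' W \<alpha> \<beta> where f: "f = Entw1 (Entw0 T C \<psi>) (Entw0 T' C' \<psi>') W \<alpha> \<beta>"
    by (metis entw0.exhaust entw1.exhaust)
  show "is_entw0 K (esrc1 f)" "is_entw0 K (etrg1 f)" using assms by (simp_all add: is_entw1_def)
  show "is_mnd1 K (Mon1 (ent_mon (esrc1 f)) (ent_mon (etrg1 f)) (eund1 f) (ealpha f))"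
    "ebeta f \<in> hom2 K (eund1 f \<cdot> mcar (ent_com (esrc1 f))) (mcar (ent_com (etrg1 f)) \<cdot> eund1 f)"
    using entw1D(3)[OF assms[unfolded f]] mndi2_ty[OF entw1D(4)[OF assms[unfolded f]]] by (simp_all add: f hom2_iff)
qed

lemma entw1_ty:
  assumes "is_entw1 K f"
  shows "eund1 f \<in> ones K" "s1 K (eund1 f) = mob (ent_mon (esrc1 f))" "t1 K (eund1 f) = mob (ent_mon (etrg1 f))"
    "ealpha f \<in> twos K" "s2 K (ealpha f) = mcar (ent_mon (etrg1 f)) \<cdot> eund1 f" "t2 K (ealpha f) = eund1 f \<cdot> mcar (ent_mon (esrc1 f))"
    "ebeta f \<in> twos K" "s2 K (ebeta f) = eund1 f \<cdot> mcar (ent_com (esrc1 f))" "t2 K (ebeta f) = mcar (ent_com (etrg1 f)) \<cdot> eund1 f"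
  using mndi1_ty[OF mnd1_mndi1[OF entw1_parts(3)[OF assms]]] entw1_parts(4)[OF assms] by (simp_all add: hom2_iff)

lemma entw2_ty:
  assumes "is_entw2 K w"
  shows "is_entw1 K (esrc2 w)" "is_entw1 K (etrg2 w)" "esrc1 (etrg2 w) = esrc1 (esrc2 w)" "etrg1 (etrg2 w) = etrg1 (esrc2 w)"
    "eund2 w \<in> twos K" "s2 K (eund2 w) = eund1 (esrc2 w)" "t2 K (eund2 w) = eund1 (etrg2 w)"
proof -
  obtain f g \<omega> where w: "w = Entw2 f g \<omega>" by (cases w)
  obtain x x' W \<alpha> \<beta> y y' W' \<alpha>' \<beta>' where f: "f = Entw1 x x' W \<alpha> \<beta>" and g: "g = Entw1 y y' W' \<alpha>' \<beta>'"
    by (metis entw1.exhaust)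
  show "is_entw1 K (esrc2 w)" "is_entw1 K (etrg2 w)" "esrc1 (etrg2 w) = esrc1 (esrc2 w)" "etrg1 (etrg2 w) = etrg1 (esrc2 w)"
    using assms by (simp_all add: is_entw2_def)
  have "is_mnd2 (vop (mndi K)) (A2 K w)" using assms by (simp add: is_entw2_def)
  then have "Mon2 (und1 (A1 K f)) (und1 (A1 K g)) \<omega> \<in> hom2 (mndi K) (und1 (A1 K f)) (und1 (A1 K g))"
    by (simp add: is_mnd2_iff w A2_def hom2_iff)
  then have "is_mndi2 K (Mon2 (und1 (A1 K f)) (und1 (A1 K g)) \<omega>)" by (simp add: hom2_iff)
  from mndi2_ty(5-7)[OF this] show "eund2 w \<in> twos K" "s2 K (eund2 w) = eund1 (esrc2 w)" "t2 K (eund2 w) = eund1 (etrg2 w)"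
    by (simp_all add: w f g A1_def Let_def)
qed

end

text \<open>The common description by which the two composites are compared: identity coherence
  cells, a universal weak entwined module \<open>V\<close>, \<open>R\<close>, \<open>k\<close> at
  each object, and on 1- and 2-cells the effect of whiskering with the underlying cells of
  \<open>K\<close>. It can be read in \<open>vop K\<close> as well, where \<open>R\<close> and
  \<open>k\<close> exchange their roles.\<close>

definition represents_entw_mod :: "('o, 'm, 'c) two_cat \<Rightarrow> (('o, 'm, 'c) entw0, ('o, 'm, 'c) entw1, ('o, 'm, 'c) entw2, 'o, 'm, 'c) psfun \<Rightarrow>
    (('o, 'm, 'c) entw0 \<Rightarrow> 'm) \<Rightarrow> (('o, 'm, 'c) entw0 \<Rightarrow> 'c) \<Rightarrow> (('o, 'm, 'c) entw0 \<Rightarrow> 'c) \<Rightarrow> bool" where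
  "represents_entw_mod K F V R k \<longleftrightarrow>
     (\<forall>x. is_entw0 K x \<longrightarrow> on0 F x \<in> obs K \<and> V x \<in> hom1 K (on0 F x) (mob (ent_mon x)) \<and> entw_mod K x (V x) (R x) (k x) \<and>
        punt F x = id2 K (id1 K (on0 F x)) \<and> on1 F (id1 (entw K) x) = id1 K (on0 F x) \<and>
        (\<forall>M r n. entw_mod K x M r n \<longrightarrow> (\<exists>z \<in> hom1 K (s1 K M) (on0 F x).
           V x \<cdot>\<^bsub>K\<^esub> z = M \<and> R x \<triangleleft>\<^bsub>K\<^esub> z = r \<and> k x \<triangleleft>\<^bsub>K\<^esub> z = n)) \<and>
        (\<forall>l. \<forall>z \<in> hom1 K l (on0 F x). \<forall>z' \<in> hom1 K l (on0 F x).
           V x \<cdot>\<^bsub>K\<^esub> z = V x \<cdot>\<^bsub>K\<^esub> z' \<longrightarrow> R x \<triangleleft>\<^bsub>K\<^esub> z = R x \<triangleleft>\<^bsub>K\<^esub> z' \<longrightarrow> k x \<triangleleft>\<^bsub>K\<^esub> z = k x \<triangleleft>\<^bsub>K\<^esub> z' \<longrightarrow> z = z') \<and>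
        (\<forall>y \<in> twos K. \<forall>y' \<in> twos K. s2 K y = s2 K y' \<longrightarrow> t2 K y = t2 K y' \<longrightarrow> t1 K (s2 K y') = on0 F x
           \<longrightarrow> V x \<triangleright>\<^bsub>K\<^esub> y = V x \<triangleright>\<^bsub>K\<^esub> y' \<longrightarrow> y = y')) \<and>
     (\<forall>f. is_entw1 K f \<longrightarrow> on1 F f \<in> hom1 K (on0 F (esrc1 f)) (on0 F (etrg1 f)) \<and>
        V (etrg1 f) \<cdot>\<^bsub>K\<^esub> on1 F f = eund1 f \<cdot>\<^bsub>K\<^esub> V (esrc1 f) \<and>
        R (etrg1 f) \<triangleleft>\<^bsub>K\<^esub> on1 F f = (eund1 f \<triangleright>\<^bsub>K\<^esub> R (esrc1 f)) \<ast>\<^bsub>K\<^esub> (ealpha f \<triangleleft>\<^bsub>K\<^esub> V (esrc1 f)) \<and>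
        k (etrg1 f) \<triangleleft>\<^bsub>K\<^esub> on1 F f = (ebeta f \<triangleleft>\<^bsub>K\<^esub> V (esrc1 f)) \<ast>\<^bsub>K\<^esub> (eund1 f \<triangleright>\<^bsub>K\<^esub> k (esrc1 f))) \<and>
     (\<forall>f g. is_entw1 K f \<longrightarrow> is_entw1 K g \<longrightarrow> etrg1 f = esrc1 g \<longrightarrow> pcmp F g f = id2 K (on1 F (cmp_entw1 K g f))) \<and>
     (\<forall>w. is_entw2 K w \<longrightarrow> on2 F w \<in> hom2 K (on1 F (esrc2 w)) (on1 F (etrg2 w)) \<and>
        V (etrg1 (esrc2 w)) \<triangleright>\<^bsub>K\<^esub> on2 F w = eund2 w \<triangleleft>\<^bsub>K\<^esub> V (esrc1 (esrc2 w)))"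

section \<open>Pseudo-functors that represent weak entwined modules\<close>

locale entw_mod_represented = two_category K for K :: "('o, 'm, 'c) two_cat" (structure) +
  fixes F V R k
  assumes rep: "represents_entw_mod K F V R k" and ent2: "two_category (entw K)"
begin

sublocale N: two_category "entw K" by (rule ent2)

lemma rep0:
  assumes "is_entw0 K x"
  shows "on0 F x \<in> obs K" "V x \<in> ones K" "s1 K (V x) = on0 F x" "t1 K (V x) = mob (ent_mon x)"
    "entw_mod K x (V x) (R x) (k x)" "punt F x = id2 K (id1 K (on0 F x))" "on1 F (id1 (entw K) x) = id1 K (on0 F x)"
    "R x \<in> twos K" "s2 K (R x) = mcar (ent_mon x) \<cdot> V x" "t2 K (R x) = V x"
    "k x \<in> twos K" "s2 K (k x) = V x" "t2 K (k x) = mcar (ent_com x) \<cdot> V x"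
proof -
  show 1: "on0 F x \<in> obs K" "V x \<in> ones K" "s1 K (V x) = on0 F x" "t1 K (V x) = mob (ent_mon x)"
    and w: "entw_mod K x (V x) (R x) (k x)" and "punt F x = id2 K (id1 K (on0 F x))" "on1 F (id1 (entw K) x) = id1 K (on0 F x)"
    using rep assms unfolding represents_entw_mod_def by (simp_all add: hom1_iff)
  show "R x \<in> twos K" "s2 K (R x) = mcar (ent_mon x) \<cdot> V x" "t2 K (R x) = V x"
    "k x \<in> twos K" "s2 K (k x) = V x" "t2 K (k x) = mcar (ent_com x) \<cdot> V x"
    using w by (simp_all add: entw_mod_def umod_def nmod_def hom2_iff)
qed

lemma rep_ex:
  assumes "is_entw0 K x" "entw_mod K x M r n"
  shows "\<exists>z \<in> hom1 K (s1 K M) (on0 F x). V x \<cdot> z = M \<and> R x \<triangleleft> z = r \<and> k x \<triangleleft> z = n"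
  using rep assms unfolding represents_entw_mod_def by blast

lemma rep_uniq1:
  assumes "is_entw0 K x" "z \<in> ones K" "z' \<in> ones K" "s1 K z = s1 K z'" "t1 K z = on0 F x" "t1 K z' = on0 F x"
    "V x \<cdot> z = V x \<cdot> z'" "R x \<triangleleft> z = R x \<triangleleft> z'" "k x \<triangleleft> z = k x \<triangleleft> z'"
  shows "z = z'"
proof -
  have "z \<in> hom1 K (s1 K z') (on0 F x)" "z' \<in> hom1 K (s1 K z') (on0 F x)" using assms by (simp_all add: hom1_iff)
  then show ?thesis using rep assms unfolding represents_entw_mod_def by blast
qed

lemma rep_uniq2:
  assumes "is_entw0 K x" "y \<in> twos K" "y' \<in> twos K" "s2 K y = s2 K y'" "t2 K y = t2 K y'" "t1 K (s2 K y') = on0 F x"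
    "V x \<triangleright> y = V x \<triangleright> y'"
  shows "y = y'"
  using rep assms unfolding represents_entw_mod_def by blast

lemma rep1:
  assumes "is_entw1 K f"
  shows "on1 F f \<in> ones K" "s1 K (on1 F f) = on0 F (esrc1 f)" "t1 K (on1 F f) = on0 F (etrg1 f)"
    "V (etrg1 f) \<cdot> on1 F f = eund1 f \<cdot> V (esrc1 f)"
    "R (etrg1 f) \<triangleleft> on1 F f = (eund1 f \<triangleright> R (esrc1 f)) \<ast> (ealpha f \<triangleleft> V (esrc1 f))"
    "k (etrg1 f) \<triangleleft> on1 F f = (ebeta f \<triangleleft> V (esrc1 f)) \<ast> (eund1 f \<triangleright> k (esrc1 f))"
  using rep assms unfolding represents_entw_mod_def by (simp_all add: hom1_iff)

lemma rep2:
  assumes "is_entw2 K w"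
  shows "on2 F w \<in> twos K" "s2 K (on2 F w) = on1 F (esrc2 w)" "t2 K (on2 F w) = on1 F (etrg2 w)"
    "V (etrg1 (esrc2 w)) \<triangleright> on2 F w = eund2 w \<triangleleft> V (esrc1 (esrc2 w))"
  using rep assms unfolding represents_entw_mod_def by (simp_all add: hom2_iff)

lemma rep_pcmp: "is_entw1 K f \<Longrightarrow> is_entw1 K g \<Longrightarrow> etrg1 f = esrc1 g \<Longrightarrow> pcmp F g f = id2 K (on1 F (cmp_entw1 K g f))"
  using rep unfolding represents_entw_mod_def by blast

lemma cmp_entw1_closed: "is_entw1 K f \<Longrightarrow> is_entw1 K g \<Longrightarrow> etrg1 f = esrc1 g \<Longrightarrow> is_entw1 K (cmp_entw1 K g f)"
  using N.cmp1_typ(1)[of f g] by simp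

text \<open>The equation for \<open>V\<close> in \<open>rep1\<close>, in a form that matches inside
  right-nested composites and successive whiskerings.\<close>

lemma V_at:
  assumes f: "is_entw1 K f"
  shows "z \<in> ones K \<Longrightarrow> t1 K z = on0 F (esrc1 f) \<Longrightarrow> V (etrg1 f) \<cdot> on1 F f \<cdot> z = eund1 f \<cdot> V (esrc1 f) \<cdot> z"
    "y \<in> twos K \<Longrightarrow> t1 K (s2 K y) = on0 F (esrc1 f) \<Longrightarrow> V (etrg1 f) \<triangleright> on1 F f \<triangleright> y = eund1 f \<triangleright> V (esrc1 f) \<triangleright> y"
proof -
  note ty = rep0(1-4)[OF entw1_parts(1)[OF f]] rep0(1-4)[OF entw1_parts(2)[OF f]] entw1_ty[OF f] rep1(1-4)[OF f]
  show "V (etrg1 f) \<cdot> on1 F f \<cdot> z = eund1 f \<cdot> V (esrc1 f) \<cdot> z" if "z \<in> ones K" "t1 K z = on0 F (esrc1 f)"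
    using cmp1_assoc'[of z "on1 F f" "V (etrg1 f)"] cmp1_assoc'[of z "V (esrc1 f)" "eund1 f"] ty that by simp
  show "V (etrg1 f) \<triangleright> on1 F f \<triangleright> y = eund1 f \<triangleright> V (esrc1 f) \<triangleright> y" if "y \<in> twos K" "t1 K (s2 K y) = on0 F (esrc1 f)"
    using lwhisk_lwhisk[of y "on1 F f" "V (etrg1 f)"] lwhisk_lwhisk[of y "V (esrc1 f)" "eund1 f"] ty that by simp
qed

text \<open>Both sides pull the universal module back to the same weak entwined module, so they
  agree by uniqueness of classifying 1-cells.\<close>

lemma rep1_cmp:
  assumes f: "is_entw1 K f" and g: "is_entw1 K g" and fg: "etrg1 f = esrc1 g"
  shows "on1 F (cmp_entw1 K g f) = on1 F g \<cdot> on1 F f"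
proof -
  note h = cmp_entw1_closed[OF f g fg]
  note ty = rep0[OF entw1_parts(1)[OF f]] rep0[OF entw1_parts(1)[OF g]] rep0[OF entw1_parts(2)[OF g]]
    entw1_ty[OF f, unfolded fg] entw1_ty[OF g] rep1(1-4)[OF f, unfolded fg] rep1(1-4)[OF g]
    entw0_ty(2-11)[OF entw1_parts(1)[OF f]] entw0_ty(2-11)[OF entw1_parts(1)[OF g]] entw0_ty(2-11)[OF entw1_parts(2)[OF g]]
  have sel: "esrc1 (cmp_entw1 K g f) = esrc1 f" "etrg1 (cmp_entw1 K g f) = etrg1 g" "eund1 (cmp_entw1 K g f) = eund1 g \<cdot> eund1 f"
    "ealpha (cmp_entw1 K g f) = (eund1 g \<triangleright> ealpha f) \<ast> (ealpha g \<triangleleft> eund1 f)"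
    "ebeta (cmp_entw1 K g f) = (ebeta g \<triangleleft> eund1 f) \<ast> (eund1 g \<triangleright> ebeta f)"
    by (simp_all add: cmp_entw1_def)
  note V = V_at[OF f, unfolded fg] V_at[OF g]
  note H = rep1[OF h, unfolded sel]
  have 1: "V (etrg1 g) \<cdot> on1 F (cmp_entw1 K g f) = V (etrg1 g) \<cdot> (on1 F g \<cdot> on1 F f)"
    unfolding H(4) by (simp add: ty V)
  have "R (etrg1 g) \<triangleleft> (on1 F g \<cdot> on1 F f) = (R (etrg1 g) \<triangleleft> on1 F g) \<triangleleft> on1 F f" by (simp add: ty)
  also have "... = R (etrg1 g) \<triangleleft> on1 F (cmp_entw1 K g f)"
    unfolding H(5) rep1(5)[OF g] by (simp add: ty V rep1(5)[OF f, unfolded fg])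
  finally have 2: "R (etrg1 g) \<triangleleft> on1 F (cmp_entw1 K g f) = R (etrg1 g) \<triangleleft> (on1 F g \<cdot> on1 F f)" by simp
  have "k (etrg1 g) \<triangleleft> (on1 F g \<cdot> on1 F f) = (k (etrg1 g) \<triangleleft> on1 F g) \<triangleleft> on1 F f" by (simp add: ty)
  also have "... = k (etrg1 g) \<triangleleft> on1 F (cmp_entw1 K g f)"
    unfolding H(6) rep1(6)[OF g] by (simp add: ty V rep1(6)[OF f, unfolded fg])
  finally have 3: "k (etrg1 g) \<triangleleft> on1 F (cmp_entw1 K g f) = k (etrg1 g) \<triangleleft> (on1 F g \<cdot> on1 F f)" by simp
  show ?thesis
    by (rule rep_uniq1[OF entw1_parts(2)[OF g] _ _ _ _ _ 1 2 3]) (simp_all add: H(1-3) ty)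
qed

end

lemma (in two_category) invertible_id2: "f \<in> ones K \<Longrightarrow> invertible_2cell K (id2 K f)"
  unfolding invertible_2cell_def inverse_2cells_def by (intro exI[of _ "id2 K f"]) (simp add: hom2_iff)

context entw_mod_represented
begin

text \<open>Whiskering with \<open>V\<close> is faithful, and on both sides it yields the horizontal
  composite of the underlying 2-cells at \<open>V\<close>.\<close>

lemma rep2_hcmp:
  assumes x: "is_entw2 K x" and y: "is_entw2 K y" and xy: "etrg1 (esrc2 x) = esrc1 (esrc2 y)"
  shows "on2 F (y \<star>\<^bsub>entw K\<^esub> x) = on2 F y \<star> on2 F x"
proof -
  define f f' g g' where d: "f = esrc2 x" "f' = etrg2 x" "g = esrc2 y" "g' = etrg2 y"
  note tx = entw2_ty[OF x, folded d] and ty' = entw2_ty[OF y, folded d]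
  note f = tx(1) and f' = tx(2) and g = ty'(1) and g' = ty'(2)
  have fg: "etrg1 f = esrc1 g" "etrg1 f' = esrc1 g" "esrc1 g' = esrc1 g" using xy tx ty' by (simp_all add: d)
  note ty = rep0(1-4)[OF entw1_parts(1)[OF f]] rep0(1-4)[OF entw1_parts(1)[OF g]] rep0(1-4)[OF entw1_parts(2)[OF g]]
    entw1_ty[OF f, unfolded fg] entw1_ty[OF g] entw1_ty[OF f', unfolded fg tx] entw1_ty[OF g', unfolded fg ty']
    rep1(1-4)[OF f, unfolded fg] rep1(1-4)[OF g] rep1(1-4)[OF f', unfolded fg tx] rep1(1-4)[OF g', unfolded fg ty']
    rep2(1-3)[OF x, folded d] rep2(1-3)[OF y, folded d] tx(3-) ty'(3-) fg
  have h: "is_entw2 K (y \<star>\<^bsub>entw K\<^esub> x)" using N.hcmp_typ(1)[of x y] x y xy by simp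
  have "V (etrg1 g) \<triangleright> (on2 F y \<star> on2 F x) = ((V (etrg1 g) \<triangleright> on2 F y) \<triangleleft> on1 F f') \<ast> ((V (etrg1 g) \<triangleright> on1 F g \<triangleright> on2 F x))"
    by (simp add: hcmp_eq ty)
  also have "... = (eund2 y \<triangleleft> eund1 f' \<cdot> V (esrc1 f)) \<ast> (eund1 g \<triangleright> (V (esrc1 g) \<triangleright> on2 F x))"
    using rep2(4)[OF y, folded d] V_at(2)[OF g, of "on2 F x"] by (simp add: ty)
  also have "... = (eund2 y \<star> eund2 x) \<triangleleft> V (esrc1 f)"
    using rep2(4)[OF x, folded d] by (simp add: ty hcmp_eq)
  finally have "V (etrg1 g) \<triangleright> (on2 F y \<star> on2 F x) = (eund2 y \<star> eund2 x) \<triangleleft> V (esrc1 f)" .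
  moreover have "V (etrg1 g) \<triangleright> on2 F (y \<star>\<^bsub>entw K\<^esub> x) = (eund2 y \<star> eund2 x) \<triangleleft> V (esrc1 f)"
    using rep2(4)[OF h] by (simp add: cmp_entw1_def d)
  ultimately have e: "V (etrg1 g) \<triangleright> on2 F (y \<star>\<^bsub>entw K\<^esub> x) = V (etrg1 g) \<triangleright> (on2 F y \<star> on2 F x)" by simp
  show ?thesis
    by (rule rep_uniq2[OF entw1_parts(2)[OF g] rep2(1)[OF h] _ _ _ _ e])
      (use rep2(2,3)[OF h] in \<open>simp_all add: ty hcmp_typ d[symmetric] rep1_cmp f g f' g'\<close>)
qed

text \<open>Laws for 1- and 2-cells are equations of cells into a representing object, so they
  follow from the uniqueness clauses once composed or whiskered with \<open>V\<close>; the coherence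
  laws concern identities.\<close>

lemma pseudo_functor_rep: "pseudo_functor (entw K) K F"
proof
  fix x assume "x \<in> obs (entw K)" then show "on0 F x \<in> obs K" using rep0 by simp
next
  fix f x y assume "f \<in> hom1 (entw K) x y" then show "on1 F f \<in> hom1 K (on0 F x) (on0 F y)"
    using rep1[of f] by (auto simp: hom1_iff)
next
  fix w f g assume "w \<in> hom2 (entw K) f g" then show "on2 F w \<in> hom2 K (on1 F f) (on1 F g)"
    using rep2[of w] by (auto simp: hom2_iff)
next
  fix f assume "f \<in> ones (entw K)"
  then have f: "is_entw1 K f" by simp
  have i: "is_entw2 K (id2 (entw K) f)" using N.id2_typ(1)[of f] f by simp
  note ty = rep0(1-4)[OF entw1_parts(1)[OF f]] rep0(1-4)[OF entw1_parts(2)[OF f]] entw1_ty[OF f] rep1(1-4)[OF f]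
  have e: "V (etrg1 f) \<triangleright> on2 F (id2 (entw K) f) = V (etrg1 f) \<triangleright> id2 K (on1 F f)"
    using rep2(4)[OF i] by (simp add: ty)
  show "on2 F (id2 (entw K) f) = id2 K (on1 F f)"
    by (rule rep_uniq2[OF entw1_parts(2)[OF f] rep2(1)[OF i] _ _ _ _ e]) (use rep2[OF i] in \<open>simp_all add: ty\<close>)
next
  fix x y f g h assume "x \<in> hom2 (entw K) f g" "y \<in> hom2 (entw K) g h"
  then have x: "is_entw2 K x" and y: "is_entw2 K y" and xy: "esrc2 x = f" "etrg2 x = g" "esrc2 y = g" "etrg2 y = h" by (simp_all add: hom2_iff)
  have c: "is_entw2 K (y \<ast>\<^bsub>entw K\<^esub> x)" using N.vcmp_typ(1)[of x y] x y xy by simp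
  note f = entw2_ty(1)[OF x, unfolded xy] and g = entw2_ty(1)[OF y, unfolded xy] and h = entw2_ty(2)[OF y, unfolded xy]
  note tx = entw2_ty[OF x, unfolded xy] note ty' = entw2_ty[OF y, unfolded xy tx]
  note ty = rep0(1-4)[OF entw1_parts(1)[OF f]] rep0(1-4)[OF entw1_parts(2)[OF f]] entw1_ty[OF f] rep1(1-4)[OF f]
    rep1(1-4)[OF g, unfolded tx] rep1(1-4)[OF h, unfolded ty' tx] rep2(1-3)[OF x, unfolded xy] rep2(1-3)[OF y, unfolded xy] tx(5-) ty'(5-)
    entw1_ty[OF g, unfolded tx] entw1_ty[OF h, unfolded ty' tx]
  have e: "V (etrg1 f) \<triangleright> on2 F (y \<ast>\<^bsub>entw K\<^esub> x) = V (etrg1 f) \<triangleright> (on2 F y \<ast> on2 F x)"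
    using rep2(4)[OF c] rep2(4)[OF x] rep2(4)[OF y] by (simp add: ty xy tx)
  show "on2 F (y \<ast>\<^bsub>entw K\<^esub> x) = on2 F y \<ast> on2 F x"
    by (rule rep_uniq2[OF entw1_parts(2)[OF f] rep2(1)[OF c] _ _ _ _ e]) (use rep2[OF c] in \<open>simp_all add: ty xy\<close>)
next
  fix f g x y z assume "f \<in> hom1 (entw K) x y" "g \<in> hom1 (entw K) y z"
  then have f: "is_entw1 K f" and g: "is_entw1 K g" and fg: "etrg1 f = esrc1 g" by (simp_all add: hom1_iff)
  show "pcmp F g f \<in> hom2 K (on1 F (g \<cdot>\<^bsub>entw K\<^esub> f)) (on1 F g \<cdot> on1 F f) \<and> invertible_2cell K (pcmp F g f)"
    using rep1(1-3)[OF f] rep1(1-3)[OF g] fg by (simp add: rep_pcmp f g rep1_cmp hom2_iff invertible_id2)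
next
  fix x assume "x \<in> obs (entw K)"
  then have x: "is_entw0 K x" by simp
  show "punt F x \<in> hom2 K (on1 F (id1 (entw K) x)) (id1 K (on0 F x)) \<and> invertible_2cell K (punt F x)"
    using rep0[OF x] by (simp add: hom2_iff invertible_id2)
next
  fix f a b g c \<alpha> f' \<beta> g'
  assume "f \<in> hom1 (entw K) a b" "g \<in> hom1 (entw K) b c" "\<alpha> \<in> hom2 (entw K) f f'" "\<beta> \<in> hom2 (entw K) g g'"
  then have h: "is_entw1 K f" "is_entw1 K g" "etrg1 f = esrc1 g" "is_entw2 K \<alpha>" "is_entw2 K \<beta>"
    "esrc2 \<alpha> = f" "etrg2 \<alpha> = f'" "esrc2 \<beta> = g" "etrg2 \<beta> = g'" by (simp_all add: hom1_iff hom2_iff)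
  note h' = entw2_ty[OF h(4)] entw2_ty[OF h(5)]
  have H: "on2 F (\<beta> \<star>\<^bsub>entw K\<^esub> \<alpha>) = on2 F \<beta> \<star> on2 F \<alpha>" using rep2_hcmp[of \<alpha> \<beta>] h by simp
  have f': "is_entw1 K f'" "is_entw1 K g'" "etrg1 f' = esrc1 g'" using h h' by simp_all
  show "pcmp F g' f' \<ast> on2 F (\<beta> \<star>\<^bsub>entw K\<^esub> \<alpha>) = (on2 F \<beta> \<star> on2 F \<alpha>) \<ast> pcmp F g f"
    unfolding H rep_pcmp[OF h(1-3)] rep_pcmp[OF f'] rep1_cmp[OF h(1-3)] rep1_cmp[OF f']
    using rep2[OF h(4)] rep2[OF h(5)] rep1(1-3)[OF h(1)] rep1(1-3)[OF h(2)] h hcmp_typ[of "on2 F \<alpha>" "on2 F \<beta>"]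
    by simp
next
  fix f a b g c h d
  assume "f \<in> hom1 (entw K) a b" "g \<in> hom1 (entw K) b c" "h \<in> hom1 (entw K) c d"
  then have f: "is_entw1 K f" and g: "is_entw1 K g" and h: "is_entw1 K h" and fg: "etrg1 f = esrc1 g" "etrg1 g = esrc1 h"
    by (simp_all add: hom1_iff)
  have s: "esrc1 (cmp_entw1 K g f) = esrc1 f" "etrg1 (cmp_entw1 K g f) = etrg1 g"
    "esrc1 (cmp_entw1 K h g) = esrc1 g" "etrg1 (cmp_entw1 K h g) = etrg1 h" for f g h
    by (simp_all add: cmp_entw1_def)
  note c = cmp_entw1_closed[OF f g fg(1)] cmp_entw1_closed[OF g h fg(2)]
  show "(pcmp F h g \<triangleleft> on1 F f) \<ast> pcmp F (h \<cdot>\<^bsub>entw K\<^esub> g) f = (on1 F h \<triangleright> pcmp F g f) \<ast> pcmp F h (g \<cdot>\<^bsub>entw K\<^esub> f)"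
    using rep1(1-3)[OF f] rep1(1-3)[OF g] rep1(1-3)[OF h] fg by (simp add: rep_pcmp rep1_cmp f g h c s)
next
  fix f a b assume "f \<in> hom1 (entw K) a b"
  then have f: "is_entw1 K f" and ab: "esrc1 f = a" "etrg1 f = b" by (simp_all add: hom1_iff)
  have i: "is_entw1 K (id1 (entw K) a)" "is_entw1 K (id1 (entw K) b)"
    using N.id1_typ(1)[of a] N.id1_typ(1)[of b] entw1_parts(1,2)[OF f] ab by simp_all
  have c: "cmp_entw1 K f (id1 (entw K) a) = f" "cmp_entw1 K (id1 (entw K) b) f = f"
    using N.cmp1_id1[of f] f ab by simp_all
  show "(on1 F f \<triangleright> punt F a) \<ast> pcmp F f (id1 (entw K) a) = id2 K (on1 F f)"
    "(punt F b \<triangleleft> on1 F f) \<ast> pcmp F (id1 (entw K) b) f = id2 K (on1 F f)"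
    using rep1(1-3)[OF f] rep0[OF entw1_parts(1)[OF f]] rep0[OF entw1_parts(2)[OF f]] rep_pcmp[OF i(1) f] rep_pcmp[OF f i(2)] c ab
    by simp_all
qed

end

section \<open>Comparison of two representing pseudo-functors\<close>

locale two_entw_mod_represented = F: entw_mod_represented K F V R k + G: entw_mod_represented K G V' R' k'
  for K :: "('o, 'm, 'c) two_cat" (structure) and F V R k G V' R' k'
begin

text \<open>The 1-cell that classifies, by means of \<open>G\<close>, the universal module of
  \<open>F\<close>. By \<open>rep_uniq1\<close> it is the only one with these properties, so the
  choice is immaterial.\<close>

definition comparison :: "('o, 'm, 'c) entw0 \<Rightarrow> 'm" where
  "comparison x = (SOME z. z \<in> hom1 K (on0 F x) (on0 G x) \<and> V' x \<cdot> z = V x \<and> R' x \<triangleleft> z = R x \<and> k' x \<triangleleft> z = k x)"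

lemma comparison:
  assumes x: "is_entw0 K x"
  shows "comparison x \<in> ones K" "s1 K (comparison x) = on0 F x" "t1 K (comparison x) = on0 G x"
    "V' x \<cdot> comparison x = V x" "R' x \<triangleleft> comparison x = R x" "k' x \<triangleleft> comparison x = k x"
proof -
  have "\<exists>z. z \<in> hom1 K (on0 F x) (on0 G x) \<and> V' x \<cdot> z = V x \<and> R' x \<triangleleft> z = R x \<and> k' x \<triangleleft> z = k x"
    using G.rep_ex[OF x F.rep0(5)[OF x]] F.rep0(3)[OF x] by auto
  from someI_ex[OF this] show "comparison x \<in> ones K" "s1 K (comparison x) = on0 F x" "t1 K (comparison x) = on0 G x"
    "V' x \<cdot> comparison x = V x" "R' x \<triangleleft> comparison x = R x" "k' x \<triangleleft> comparison x = k x"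
    by (simp_all add: comparison_def hom1_iff)
qed

text \<open>Both composites classify the weak entwined module that \<open>f\<close> induces on the
  universal module of \<open>F\<close> at its source; hence the square commutes strictly.\<close>

lemma comparison_natural1:
  assumes f: "is_entw1 K f"
  shows "on1 G f \<cdot> comparison (esrc1 f) = comparison (etrg1 f) \<cdot> on1 F f"
proof -
  let ?x = "esrc1 f" and ?y = "etrg1 f"
  note x = F.entw1_parts(1)[OF f] and y = F.entw1_parts(2)[OF f]
  note ty = F.rep0[OF x] F.rep0[OF y] G.rep0[OF x] G.rep0[OF y] F.entw1_ty[OF f] F.rep1(1-4)[OF f] G.rep1(1-4)[OF f] comparison(1-4)[OF x] comparison(1-4)[OF y]
   F.entw0_ty(2-11)[OF x] F.entw0_ty(2-11)[OF y]
  have "V' ?y \<cdot> (on1 G f \<cdot> comparison ?x) = V ?y \<cdot> on1 F f" using G.V_at(1)[OF f, of "comparison ?x"] by (simp add: ty)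
  also have "... = (V' ?y \<cdot> comparison ?y) \<cdot> on1 F f" by (simp only: ty)
  also have "... = V' ?y \<cdot> (comparison ?y \<cdot> on1 F f)" using ty by (intro F.cmp1_assoc') simp_all
  finally have 1: "V' ?y \<cdot> (on1 G f \<cdot> comparison ?x) = V' ?y \<cdot> (comparison ?y \<cdot> on1 F f)" .
  have "R' ?y \<triangleleft> (on1 G f \<cdot> comparison ?x) = (R' ?y \<triangleleft> on1 G f) \<triangleleft> comparison ?x" by (simp add: ty)
  also have "... = R ?y \<triangleleft> on1 F f" unfolding G.rep1(5)[OF f] F.rep1(5)[OF f] by (simp add: ty comparison(5)[OF x])
  also have "... = (R' ?y \<triangleleft> comparison ?y) \<triangleleft> on1 F f" by (simp only: comparison(5)[OF y])
  finally have 2: "R' ?y \<triangleleft> (on1 G f \<cdot> comparison ?x) = R' ?y \<triangleleft> (comparison ?y \<cdot> on1 F f)" by (simp add: ty)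
  have "k' ?y \<triangleleft> (on1 G f \<cdot> comparison ?x) = (k' ?y \<triangleleft> on1 G f) \<triangleleft> comparison ?x" by (simp add: ty)
  also have "... = k ?y \<triangleleft> on1 F f" unfolding G.rep1(6)[OF f] F.rep1(6)[OF f] by (simp add: ty comparison(6)[OF x])
  also have "... = (k' ?y \<triangleleft> comparison ?y) \<triangleleft> on1 F f" by (simp only: comparison(6)[OF y])
  finally have 3: "k' ?y \<triangleleft> (on1 G f \<cdot> comparison ?x) = k' ?y \<triangleleft> (comparison ?y \<cdot> on1 F f)" by (simp add: ty)
  show ?thesis by (rule G.rep_uniq1[OF y _ _ _ _ _ 1 2 3]) (simp_all add: ty)
qed

lemma comparison_natural2:
  assumes x: "is_entw2 K x"
  shows "on2 G x \<triangleleft> comparison (esrc1 (esrc2 x)) = comparison (etrg1 (esrc2 x)) \<triangleright> on2 F x"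
proof -
  note tx = F.entw2_ty[OF x]
  define f g where d: "f = esrc2 x" "g = etrg2 x"
  note tx = F.entw2_ty[OF x, folded d]
  note f = tx(1) and g = tx(2)
  let ?x = "esrc1 f" and ?y = "etrg1 f"
  note x0 = F.entw1_parts(1)[OF f] and y0 = F.entw1_parts(2)[OF f]
  note ty = F.rep0(1-4)[OF x0] F.rep0(1-4)[OF y0] G.rep0(1-4)[OF x0] G.rep0(1-4)[OF y0] F.entw1_ty[OF f] F.rep1(1-4)[OF f] G.rep1(1-4)[OF f]
    F.entw1_ty[OF g, unfolded tx(3,4)] F.rep1(1-4)[OF g, unfolded tx(3,4)] G.rep1(1-4)[OF g, unfolded tx(3,4)]
    comparison(1-4)[OF x0] comparison(1-4)[OF y0] F.rep2(1-3)[OF x, folded d] G.rep2(1-3)[OF x, folded d] tx(5-)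
  have "V' ?y \<triangleright> (on2 G x \<triangleleft> comparison ?x) = (V' ?y \<triangleright> on2 G x) \<triangleleft> comparison ?x" by (simp add: ty)
  also have "... = eund2 x \<triangleleft> V ?x" using G.rep2(4)[OF x, folded d] by (simp add: ty)
  also have "... = (V' ?y \<cdot> comparison ?y) \<triangleright> on2 F x" using F.rep2(4)[OF x, folded d] by (simp add: ty(1-22) comparison[OF y0])
  also have "... = V' ?y \<triangleright> (comparison ?y \<triangleright> on2 F x)" using ty by (intro F.lwhisk_lwhisk) simp_all
  finally have e: "V' ?y \<triangleright> (on2 G x \<triangleleft> comparison ?x) = V' ?y \<triangleright> (comparison ?y \<triangleright> on2 F x)" .
  have "on2 G x \<triangleleft> comparison ?x = comparison ?y \<triangleright> on2 F x"
    by (rule G.rep_uniq2[OF y0 _ _ _ _ _ e])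
      (use comparison_natural1[OF f] comparison_natural1[OF g] in \<open>simp_all add: ty tx(3,4)\<close>)
  then show ?thesis by (simp add: d)
qed

text \<open>The squares commute on the nose, so identity 2-cells are admissible as components at
  1-cells, and the coherence conditions reduce to equations between identities.\<close>

lemma pseudo_natural_comparison: "pseudo_natural (entw K) K F G comparison (\<lambda>f. id2 K (on1 G f \<cdot> comparison (esrc1 f)))"
proof (intro pseudo_natural.intro pseudo_natural_axioms.intro F.pseudo_functor_rep G.pseudo_functor_rep)
  fix x assume "x \<in> obs (entw K)" then have x: "is_entw0 K x" by simp
  then show "comparison x \<in> hom1 K (on0 F x) (on0 G x)" using comparison by (simp add: hom1_iff)
  have i: "is_entw1 K (id1 (entw K) x)" "esrc1 (id1 (entw K) x) = x" using F.N.id1_typ(1)[of x] x by simp_all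
  show "(comparison x \<triangleright> punt F x) \<ast> id2 K (on1 G (id1 (entw K) x) \<cdot> comparison (esrc1 (id1 (entw K) x))) = punt G x \<triangleleft> comparison x"
    using comparison[OF x] F.rep0[OF x] G.rep0[OF x] unfolding i(2) by simp
next
  fix f x y assume "f \<in> hom1 (entw K) x y"
  then have f: "is_entw1 K f" and xy: "esrc1 f = x" "etrg1 f = y" by (simp_all add: hom1_iff)
  note ty = comparison(1-3)[OF F.entw1_parts(1)[OF f]] comparison(1-3)[OF F.entw1_parts(2)[OF f]] F.rep1(1-3)[OF f] G.rep1(1-3)[OF f]
  show "id2 K (on1 G f \<cdot> comparison (esrc1 f)) \<in> hom2 K (on1 G f \<cdot> comparison x) (comparison y \<cdot> on1 F f) \<and> invertible_2cell K (id2 K (on1 G f \<cdot> comparison (esrc1 f)))"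
    using comparison_natural1[OF f] ty by (simp add: xy hom2_iff F.invertible_id2)
next
  fix f x y \<alpha> g assume "f \<in> hom1 (entw K) x y" "\<alpha> \<in> hom2 (entw K) f g"
  then have f: "is_entw1 K f" and \<alpha>: "is_entw2 K \<alpha>" and xy: "esrc1 f = x" "etrg1 f = y" "esrc2 \<alpha> = f" "etrg2 \<alpha> = g" by (simp_all add: hom1_iff hom2_iff)
  note tx = F.entw2_ty[OF \<alpha>, unfolded xy]
  note ty = comparison(1-3)[OF F.entw1_parts(1)[OF f]] comparison(1-3)[OF F.entw1_parts(2)[OF f]] F.rep1(1-3)[OF f] G.rep1(1-3)[OF f]
    F.rep1(1-3)[OF tx(2)] G.rep1(1-3)[OF tx(2)] F.rep2(1-3)[OF \<alpha>] G.rep2(1-3)[OF \<alpha>]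
  show "(comparison y \<triangleright> on2 F \<alpha>) \<ast> id2 K (on1 G f \<cdot> comparison (esrc1 f)) = id2 K (on1 G g \<cdot> comparison (esrc1 g)) \<ast> (on2 G \<alpha> \<triangleleft> comparison x)"
    using comparison_natural2[OF \<alpha>] comparison_natural1[OF f] comparison_natural1[OF tx(2)] ty by (simp add: xy tx)
next
  fix f x y g z assume "f \<in> hom1 (entw K) x y" "g \<in> hom1 (entw K) y z"
  then have f: "is_entw1 K f" and g: "is_entw1 K g" and xy: "esrc1 f = x" "etrg1 f = y" "esrc1 g = y" "etrg1 g = z" by (simp_all add: hom1_iff)
  have fg: "etrg1 f = esrc1 g" using xy by simp
  note ty = comparison(1-3)[OF F.entw1_parts(1)[OF f]] comparison(1-3)[OF F.entw1_parts(2)[OF f]] comparison(1-3)[OF F.entw1_parts(2)[OF g]]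
    F.rep1(1-3)[OF f] G.rep1(1-3)[OF f] F.rep1(1-3)[OF g] G.rep1(1-3)[OF g]
  have s: "esrc1 (cmp_entw1 K g f) = x" by (simp add: cmp_entw1_def xy)
  have e: "on1 G g \<cdot> on1 G f \<cdot> comparison x = comparison z \<cdot> on1 F g \<cdot> on1 F f"
  proof -
    have "on1 G g \<cdot> on1 G f \<cdot> comparison x = (on1 G g \<cdot> comparison y) \<cdot> on1 F f" using comparison_natural1[OF f] ty by (simp add: xy)
    also have "... = comparison z \<cdot> on1 F g \<cdot> on1 F f" using comparison_natural1[OF g] ty by (simp add: xy)
    finally show ?thesis .
  qed
  show "(comparison z \<triangleright> pcmp F g f) \<ast> id2 K (on1 G (g \<cdot>\<^bsub>entw K\<^esub> f) \<cdot> comparison (esrc1 (g \<cdot>\<^bsub>entw K\<^esub> f))) =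
     (id2 K (on1 G g \<cdot> comparison (esrc1 g)) \<triangleleft> on1 F f) \<ast> (on1 G g \<triangleright> id2 K (on1 G f \<cdot> comparison (esrc1 f))) \<ast> (pcmp G g f \<triangleleft> comparison x)"
    using ty e comparison_natural1[OF f] comparison_natural1[OF g]
    by (simp add: F.rep_pcmp[OF f g fg] G.rep_pcmp[OF f g fg] F.rep1_cmp[OF f g fg] G.rep1_cmp[OF f g fg] xy s)
qed

lemma swapped: "two_entw_mod_represented K G V' R' k' F V R k"
  by (intro two_entw_mod_represented.intro F.entw_mod_represented_axioms G.entw_mod_represented_axioms)

text \<open>The composite of the two comparisons and the identity classify the same universal
  module. Thus the comparison is an isomorphism, and identities witness the equivalence.\<close>

lemma comparison_inverse:
  assumes x: "is_entw0 K x"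
  shows "two_entw_mod_represented.comparison K G V' R' k' F V R k x \<cdot> comparison x = id1 K (on0 F x)"
proof -
  interpret sw: two_entw_mod_represented K G V' R' k' F V R k by (rule swapped)
  note c = comparison[OF x] and d = sw.comparison[OF x]
  note ty = c(1-3) d(1-3) F.rep0[OF x] G.rep0[OF x] F.entw0_ty(2-11)[OF x]
  have 1: "V x \<cdot> (sw.comparison x \<cdot> comparison x) = (V x \<cdot> sw.comparison x) \<cdot> comparison x" by (simp add: ty)
  have 2: "R x \<triangleleft> (sw.comparison x \<cdot> comparison x) = (R x \<triangleleft> sw.comparison x) \<triangleleft> comparison x" by (simp add: ty)
  have 3: "k x \<triangleleft> (sw.comparison x \<cdot> comparison x) = (k x \<triangleleft> sw.comparison x) \<triangleleft> comparison x" by (simp add: ty)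
  have 1: "V x \<cdot> (sw.comparison x \<cdot> comparison x) = V x \<cdot> id1 K (on0 F x)" unfolding 1 d(4) c(4) by (simp add: ty)
  have 2: "R x \<triangleleft> (sw.comparison x \<cdot> comparison x) = R x \<triangleleft> id1 K (on0 F x)" unfolding 2 d(5) c(5) by (simp add: ty)
  have 3: "k x \<triangleleft> (sw.comparison x \<cdot> comparison x) = k x \<triangleleft> id1 K (on0 F x)" unfolding 3 d(6) c(6) by (simp add: ty)
  show ?thesis by (rule F.rep_uniq1[OF x _ _ _ _ _ 1 2 3]) (simp_all add: ty)
qed

lemma comparison_equivalence:
  assumes x: "is_entw0 K x"
  shows "equivalence_1cell K (comparison x)"
proof -
  interpret sw: two_entw_mod_represented K G V' R' k' F V R k by (rule swapped)
  have 1: "sw.comparison x \<in> hom1 K (t1 K (comparison x)) (s1 K (comparison x))" using comparison[OF x] sw.comparison[OF x] by (simp add: hom1_iff)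
  have 2: "id2 K (id1 K (on0 F x)) \<in> hom2 K (id1 K (s1 K (comparison x))) (sw.comparison x \<cdot> comparison x)"
    "id2 K (id1 K (on0 G x)) \<in> hom2 K (comparison x \<cdot> sw.comparison x) (id1 K (t1 K (comparison x)))"
    using comparison_inverse[OF x] sw.comparison_inverse[OF x] comparison[OF x] F.rep0(1)[OF x] G.rep0(1)[OF x] by (simp_all add: hom2_iff)
  have 3: "invertible_2cell K (id2 K (id1 K (on0 F x)))" "invertible_2cell K (id2 K (id1 K (on0 G x)))"
    using F.rep0(1)[OF x] G.rep0(1)[OF x] by (simp_all add: F.invertible_id2)
  show ?thesis unfolding equivalence_1cell_def using 1 2 3 comparison(1)[OF x] by blast
qed

lemma equivalent: "pseudo_naturally_equivalent (entw K) K F G"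
  unfolding pseudo_naturally_equivalent_def
  using pseudo_natural_comparison F.pseudo_functor_rep G.pseudo_functor_rep comparison_equivalence by auto

lemma equivalent_at: "is_entw0 K x \<Longrightarrow> equivalent_objects K (on0 F x) (on0 G x)"
  unfolding equivalent_objects_def by (intro bexI[of _ "comparison x"] comparison_equivalence) (simp_all add: hom1_iff comparison)

end

section \<open>The 2-category of weak entwining structures\<close>

text \<open>Duality on cells: \<open>sw0\<close>, \<open>sw1\<close> and \<open>sw2\<close> pass
  between weak entwining structures in \<open>K\<close> and in \<open>vop K\<close>. The law \<psi>
  and the underlying cells stay the same, while \<open>sw2\<close> exchanges source and
  target.\<close>

definition sw0 :: "('o, 'm, 'c) entw0 \<Rightarrow> ('o, 'm, 'c) entw0" where
  "sw0 x = Entw0 (ent_com x) (ent_mon x) (ent_law x)"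

definition sw1 :: "('o, 'm, 'c) entw1 \<Rightarrow> ('o, 'm, 'c) entw1" where
  "sw1 f = Entw1 (sw0 (esrc1 f)) (sw0 (etrg1 f)) (eund1 f) (ebeta f) (ealpha f)"

definition sw2 :: "('o, 'm, 'c) entw2 \<Rightarrow> ('o, 'm, 'c) entw2" where
  "sw2 w = Entw2 (sw1 (etrg2 w)) (sw1 (esrc2 w)) (eund2 w)"

lemma sw_sel [simp]:
  "ent_mon (sw0 x) = ent_com x" "ent_com (sw0 x) = ent_mon x" "ent_law (sw0 x) = ent_law x"
  "esrc1 (sw1 f) = sw0 (esrc1 f)" "etrg1 (sw1 f) = sw0 (etrg1 f)" "eund1 (sw1 f) = eund1 f"
  "ealpha (sw1 f) = ebeta f" "ebeta (sw1 f) = ealpha f"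
  "esrc2 (sw2 w) = sw1 (etrg2 w)" "etrg2 (sw2 w) = sw1 (esrc2 w)" "eund2 (sw2 w) = eund2 w"
  by (simp_all add: sw0_def sw1_def sw2_def)

lemma sw_sw [simp]: "sw0 (sw0 x) = x" "sw1 (sw1 f) = f" "sw2 (sw2 w) = w"
  by (simp_all add: sw0_def sw1_def sw2_def)

text \<open>\<open>B\<close> is \<open>A\<close> read in the vertical opposite. Facts about the
  monad side are thereby instances of facts about the comonad side.\<close>

lemma A_vop:
  "A0 (vop K) (sw0 x) = B0 K x" "B0 (vop K) (sw0 x) = A0 K x"
  "A1 (vop K) (sw1 f) = B1 K f" "B1 (vop K) (sw1 f) = A1 K f"
  "A2 (vop K) (sw2 w) = B2 K w" "B2 (vop K) (sw2 w) = A2 K w"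
proof -
  have c: "cmp1 (cmdp L) = cmp1 (mndi (vop L))" "id1 (cmdp L) = id1 (mndi (vop L))" for L :: "('o, 'm, 'c) two_cat"
    by (simp_all add: cmdp_def fun_eq_iff)
  have a0: "A0 (vop L) (sw0 y) = B0 L y" for L :: "('o, 'm, 'c) two_cat" and y
    by (cases y) (simp add: sw0_def A0_def B0_def Let_def c)
  have b0: "B0 (vop L) (sw0 y) = A0 L y" for L :: "('o, 'm, 'c) two_cat" and y
    using a0[of "vop L" "sw0 y"] by simp
  have a1: "A1 (vop L) (sw1 g) = B1 L g" for L :: "('o, 'm, 'c) two_cat" and g
    by (cases g) (simp add: sw1_def A1_def B1_def Let_def c a0 del: mndi_sel)
  have b1: "B1 (vop L) (sw1 g) = A1 L g" for L :: "('o, 'm, 'c) two_cat" and g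
    using a1[of "vop L" "sw1 g"] by simp
  have a2: "A2 (vop L) (sw2 z) = B2 L z" for L :: "('o, 'm, 'c) two_cat" and z
    by (cases z) (simp add: sw2_def A2_def B2_def a1)
  show "A0 (vop K) (sw0 x) = B0 K x" "B0 (vop K) (sw0 x) = A0 K x" "A1 (vop K) (sw1 f) = B1 K f" "B1 (vop K) (sw1 f) = A1 K f"
    "A2 (vop K) (sw2 w) = B2 K w" "B2 (vop K) (sw2 w) = A2 K w"
    using a0 b0 a1 b1 a2[of K w] a2[of "vop K" "sw2 w"] by simp_all
qed

lemma cmdp_eq: "cmdp K = vop (mndi (vop K))"
  by (simp add: cmdp_def)

context two_category
begin

text \<open>Reversing 2-cells and swapping monad and comonad exchanges the first axiom with the
  second and the third with the fourth.\<close>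

lemma weak_entwining_vop:
  assumes "weak_entwining K T C \<psi>" shows "weak_entwining (vop K) C T \<psi>"
proof -
  note ty = ent_tys[OF assms] and eq = weak_entD[OF assms]
  show ?thesis unfolding weak_entwining_def Let_def
    using eq(1-6) by (simp add: ty eq(7-) hom2_iff)
qed

end

lemma is_entw0_vop: assumes "two_category K" shows "is_entw0 (vop K) (sw0 x) \<longleftrightarrow> is_entw0 K x"
proof -
  interpret two_category K by fact
  interpret v: two_category "vop K" by (rule two_category_vop) fact
  show ?thesis
    using weak_entwining_vop[of "ent_mon x" "ent_com x" "ent_law x"] v.weak_entwining_vop[of "ent_com x" "ent_mon x" "ent_law x"]
    by (auto simp: is_entw0_def)
qed

text \<open>The condition on \<open>B\<close> is replaced by the condition on \<open>A\<close> in
  the opposite 2-category, so that closure properties have to be proved for \<open>A\<close>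
  only.\<close>

lemma is_entw1_iff: "is_entw1 K f \<longleftrightarrow> is_entw0 K (esrc1 f) \<and> is_entw0 K (etrg1 f) \<and>
    A1 K f \<in> ones (cmd (mndi K)) \<and> A1 (vop K) (sw1 f) \<in> ones (cmd (mndi (vop K)))"
  by (simp add: is_entw1_def cmdp_eq A_vop)

lemma is_entw2_iff: "is_entw2 K w \<longleftrightarrow> is_entw1 K (esrc2 w) \<and> is_entw1 K (etrg2 w) \<and>
     esrc1 (esrc2 w) = esrc1 (etrg2 w) \<and> etrg1 (esrc2 w) = etrg1 (etrg2 w) \<and>
    A2 K w \<in> twos (cmd (mndi K)) \<and> A2 (vop K) (sw2 w) \<in> twos (cmd (mndi (vop K)))"
  by (simp add: is_entw2_def cmdp_eq A_vop)

lemma is_entw1_vop: assumes "two_category K" shows "is_entw1 (vop K) (sw1 f) \<longleftrightarrow> is_entw1 K f"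
  by (auto simp: is_entw1_iff is_entw0_vop[OF assms])

lemma sw0_inj: "sw0 x = sw0 y \<longleftrightarrow> x = y" by (metis sw_sw(1))

lemma is_entw2_vop: assumes "two_category K" shows "is_entw2 (vop K) (sw2 w) \<longleftrightarrow> is_entw2 K w"
  by (auto simp: is_entw2_iff is_entw1_vop[OF assms] sw0_inj)

section \<open>Closure of the 1- and 2-cells between weak entwining structures under the
  compositions\<close>

lemma (in two_category) two_category_cmd: "two_category (cmd K)"
  unfolding cmd_def by (intro two_category_vop two_category.two_category_mnd two_category_axioms)

context two_category
begin

lemma A1_eq: "A1 K f = Mon1 (A0 K (esrc1 f)) (A0 K (etrg1 f)) (Mon1 (ent_mon (esrc1 f)) (ent_mon (etrg1 f)) (eund1 f) (ealpha f))
   (Mon2 (cmp_mon1 K (Mon1 (ent_mon (esrc1 f)) (ent_mon (etrg1 f)) (eund1 f) (ealpha f)) (mcar (A0 K (esrc1 f))))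
     (cmp_mon1 K (mcar (A0 K (etrg1 f))) (Mon1 (ent_mon (esrc1 f)) (ent_mon (etrg1 f)) (eund1 f) (ealpha f))) (ebeta f))"
  by (cases f) (simp add: A1_def Let_def)

lemma mcar_A0: "mcar (A0 K x) = Mon1 (ent_mon x) (ent_mon x) (mcar (ent_com x)) (ent_law x)"
  by (cases x) (simp add: A0_def Let_def)

lemma A2_eq: "A2 K w = Mon2 (A1 K (etrg2 w)) (A1 K (esrc2 w)) (Mon2 (und1 (A1 K (esrc2 w))) (und1 (A1 K (etrg2 w))) (eund2 w))"
  by (cases w) (simp add: A2_def)

lemma X_mndi1': "is_entw0 K x \<Longrightarrow> is_mndi1 K (mcar (A0 K x))"
  using ent_mndi1[of "ent_mon x" "ent_com x" "ent_law x"] by (simp add: mcar_A0 is_entw0_def)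

text \<open>Strict compatibility of \<open>A\<close> with composition makes closure of
  \<open>is_entw1\<close> a consequence of composition in \<open>cmd (mndi K)\<close>.\<close>

lemma A1_cmp:
  assumes f: "is_entw1 K f" and g: "is_entw1 K g" and fg: "etrg1 f = esrc1 g"
  shows "A1 K (cmp_entw1 K g f) = A1 K g \<cdot>\<^bsub>cmd (mndi K)\<^esub> A1 K f"
proof -
  define X where "X = Mon1 (ent_mon (esrc1 f)) (ent_mon (etrg1 f)) (eund1 f) (ealpha f)"
  define Y where "Y = Mon1 (ent_mon (esrc1 g)) (ent_mon (etrg1 g)) (eund1 g) (ealpha g)"
  have XY: "is_mndi1 K X" "is_mndi1 K Y" "trg1 X = src1 Y"
    using entw1_parts(3)[OF f] entw1_parts(3)[OF g] fg by (simp_all add: X_def Y_def mnd1_mndi1)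
  have sel: "esrc1 (cmp_entw1 K g f) = esrc1 f" "etrg1 (cmp_entw1 K g f) = etrg1 g"
    "Mon1 (ent_mon (esrc1 f)) (ent_mon (etrg1 g)) (eund1 (cmp_entw1 K g f)) (ealpha (cmp_entw1 K g f)) = cmp_mon1 K Y X"
    "ebeta (cmp_entw1 K g f) = (ebeta g \<triangleleft> eund1 f) \<ast> (eund1 g \<triangleright> ebeta f)"
    by (simp_all add: cmp_entw1_def cmp_mon1_def X_def Y_def)
  have s: "src1 X = ent_mon (esrc1 f)" "trg1 Y = ent_mon (etrg1 g)" "und1 X = eund1 f" "und1 Y = eund1 g" by (simp_all add: X_def Y_def)
  have c: "cmp_mon1 K (cmp_mon1 K Y X) (mcar (A0 K (esrc1 f))) = cmp_mon1 K Y (cmp_mon1 K X (mcar (A0 K (esrc1 f))))"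
    "cmp_mon1 K (cmp_mon1 K (mcar (A0 K (etrg1 g))) Y) X = cmp_mon1 K (mcar (A0 K (etrg1 g))) (cmp_mon1 K Y X)"
    using XY X_mndi1'[OF entw1_parts(1)[OF f]] X_mndi1'[OF entw1_parts(2)[OF g]] s
    by (simp_all add: cmp_mon1_assoc mcar_A0)
  show ?thesis
    unfolding A1_eq[of "cmp_entw1 K g f"] sel
    by (simp add: A1_eq cmp_mon1_def[of "vop (mndi K)"] X_def[symmetric] Y_def[symmetric] c s)
qed

lemma A1_id:
  assumes x: "is_entw0 K x"
  shows "A1 K (id1 (entw K) x) = id_mon1 (mndi K) (A0 K x)"
proof -
  have i: "Mon1 (ent_mon x) (ent_mon x) (id1 K (mob (ent_mon x))) (id2 K (mcar (ent_mon x))) = id_mon1 K (ent_mon x)"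
    by (simp add: id_mon1_def)
  have m: "mob (A0 K x) = ent_mon x" by (cases x) (simp add: A0_def Let_def)
  show ?thesis using cmp_mon1_id[OF X_mndi1'[OF x]]
    by (simp add: A1_eq i id_mon1_def[of "mndi K"] m) (simp add: mcar_A0)
qed

lemma A1_closed_cmp:
  assumes f: "is_entw1 K f" and g: "is_entw1 K g" and fg: "etrg1 f = esrc1 g"
  shows "A1 K (cmp_entw1 K g f) \<in> ones (cmd (mndi K))"
proof -
  interpret N: two_category "cmd (mndi K)" by (rule two_category.two_category_cmd[OF two_category_mndi])
  show ?thesis unfolding A1_cmp[OF assms]
    by (rule N.cmp1_typ) (use f g fg in \<open>simp_all add: is_entw1_iff del: cmd_sel(2)\<close>, simp add: A1_eq fg)
qed

lemma A2_closed_vcmp: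
  assumes x: "is_entw2 K x" and y: "is_entw2 K y" and xy: "etrg2 x = esrc2 y"
  shows "A2 K (y \<ast>\<^bsub>entw K\<^esub> x) \<in> twos (cmd (mndi K))"
proof -
  interpret N: two_category "cmd (mndi K)" by (rule two_category.two_category_cmd[OF two_category_mndi])
  have "A2 K (y \<ast>\<^bsub>entw K\<^esub> x) = A2 K y \<ast>\<^bsub>cmd (mndi K)\<^esub> A2 K x" by (simp add: A2_eq)
  also have "... \<in> twos (cmd (mndi K))"
    by (rule N.vcmp_typ) (use x y xy in \<open>simp_all add: is_entw2_iff del: cmd_sel(3)\<close>, simp add: A2_eq xy)
  finally show ?thesis .
qed

lemma A2_closed_hcmp:
  assumes x: "is_entw2 K x" and y: "is_entw2 K y" and xy: "etrg1 (esrc2 x) = esrc1 (esrc2 y)"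
  shows "A2 K (y \<star>\<^bsub>entw K\<^esub> x) \<in> twos (cmd (mndi K))"
proof -
  interpret N: two_category "cmd (mndi K)" by (rule two_category.two_category_cmd[OF two_category_mndi])
  note tx = entw2_ty[OF x] and ty = entw2_ty[OF y]
  have c: "A1 K (cmp_entw1 K (esrc2 y) (esrc2 x)) = cmp_mon1 (vop (mndi K)) (A1 K (esrc2 y)) (A1 K (esrc2 x))"
    "A1 K (cmp_entw1 K (etrg2 y) (etrg2 x)) = cmp_mon1 (vop (mndi K)) (A1 K (etrg2 y)) (A1 K (etrg2 x))"
    using A1_cmp[OF tx(1) ty(1) xy] A1_cmp[OF tx(2) ty(2)] tx ty xy by simp_all
  have "A2 K (y \<star>\<^bsub>entw K\<^esub> x) = A2 K y \<star>\<^bsub>cmd (mndi K)\<^esub> A2 K x"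
    by (simp add: A2_eq c) (simp add: cmp_mon1_def[of "vop (mndi K)"])
  also have "... \<in> twos (cmd (mndi K))"
    by (rule N.hcmp_typ) (use x y xy in \<open>simp_all add: is_entw2_iff del: cmd_sel(3)\<close>, simp add: A2_eq A1_eq xy)
  finally show ?thesis .
qed

lemma A_closed_id:
  "is_entw0 K x \<Longrightarrow> A1 K (id1 (entw K) x) \<in> ones (cmd (mndi K))"
  "is_entw1 K f \<Longrightarrow> A2 K (id2 (entw K) f) \<in> twos (cmd (mndi K))"
proof -
  interpret N: two_category "cmd (mndi K)" by (rule two_category.two_category_cmd[OF two_category_mndi])
  show "A1 K (id1 (entw K) x) \<in> ones (cmd (mndi K))" if "is_entw0 K x"
    unfolding A1_id[OF that]
    using N.id1_typ(1)[of "A0 K x"] ent_comonad[of "ent_mon x" "ent_com x" "ent_law x"] that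
    by (simp add: is_entw0_def)
  show "A2 K (id2 (entw K) f) \<in> twos (cmd (mndi K))" if "is_entw1 K f"
  proof -
    have "und1 (und1 (A1 K f)) = eund1 f" by (simp add: A1_eq)
    then show ?thesis using N.id2_typ(1)[of "A1 K f"] that by (simp add: A2_eq is_entw1_iff)
  qed
qed

end

text \<open>Closure holds for the comonad half by the lemmas on \<open>A\<close> in
  \<open>K\<close>, and for the monad half by the same lemmas in \<open>vop K\<close>. The remaining
  axioms are inherited from \<open>K\<close>, since cells are determined by their ends and their
  underlying data.\<close>

lemma (in two_category) two_category_entw: "two_category (entw K)"
proof -
  have v: "two_category (vop K)" by (rule two_category_vop) (rule two_category_axioms)
  interpret v: two_category "vop K" by (rule v)
  note vop = is_entw0_vop[OF two_category_axioms] is_entw1_vop[OF two_category_axioms] is_entw2_vop[OF two_category_axioms]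
  have sw_cmp: "sw1 (cmp_entw1 K g f) = cmp_entw1 (vop K) (sw1 g) (sw1 f)" for f g
    by (simp add: sw1_def cmp_entw1_def)
  have cmp: "is_entw1 K (cmp_entw1 K g f)" if "is_entw1 K f" "is_entw1 K g" "etrg1 f = esrc1 g" for f g
    using A1_closed_cmp[OF that] v.A1_closed_cmp[of "sw1 f" "sw1 g"] that entw1_parts(1)[OF that(1)] entw1_parts(2)[OF that(2)]
    by (simp add: is_entw1_iff[of K "cmp_entw1 K g f"] sw_cmp vop) (simp add: cmp_entw1_def)
  have id: "is_entw1 K (id1 (entw K) x)" if "is_entw0 K x" for x
  proof -
    have "sw1 (id1 (entw K) x) = id1 (entw (vop K)) (sw0 x)" using entw0_ty(1)[OF that] by (simp add: sw1_def)
    then show ?thesis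
      using A_closed_id(1)[OF that] v.A_closed_id(1)[of "sw0 x"] that
      by (simp add: is_entw1_iff vop del: entw_sel(8)) simp
  qed
  have vc: "is_entw2 K (y \<ast>\<^bsub>entw K\<^esub> x)" if "is_entw2 K x" "is_entw2 K y" "etrg2 x = esrc2 y" for x y
  proof -
    have "sw2 (y \<ast>\<^bsub>entw K\<^esub> x) = sw2 x \<ast>\<^bsub>entw (vop K)\<^esub> sw2 y" by (simp add: sw2_def)
    then show ?thesis
      using A2_closed_vcmp[OF that] v.A2_closed_vcmp[of "sw2 y" "sw2 x"] that entw2_ty[OF that(1)] entw2_ty[OF that(2)]
      by (simp add: is_entw2_iff[of K "y \<ast>\<^bsub>entw K\<^esub> x"] vop del: entw_sel(11)) simp
  qed
  have sel: "esrc1 (cmp_entw1 K g f) = esrc1 f" "etrg1 (cmp_entw1 K g f) = etrg1 g" "eund1 (cmp_entw1 K g f) = eund1 g \<cdot> eund1 f" for f g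
    by (simp_all add: cmp_entw1_def)
  have hc: "is_entw2 K (y \<star>\<^bsub>entw K\<^esub> x)" if "is_entw2 K x" "is_entw2 K y" "etrg1 (esrc2 x) = esrc1 (esrc2 y)" for x y
  proof -
    have "sw2 (y \<star>\<^bsub>entw K\<^esub> x) = sw2 y \<star>\<^bsub>entw (vop K)\<^esub> sw2 x" by (simp add: sw2_def sw_cmp)
    moreover have "is_entw1 K (cmp_entw1 K (esrc2 y) (esrc2 x))" "is_entw1 K (cmp_entw1 K (etrg2 y) (etrg2 x))"
      using that entw2_ty[OF that(1)] entw2_ty[OF that(2)] by (simp_all add: cmp)
    ultimately show ?thesis
      using A2_closed_hcmp[OF that] v.A2_closed_hcmp[of "sw2 x" "sw2 y"] that entw2_ty[OF that(1)] entw2_ty[OF that(2)]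
      by (simp add: is_entw2_iff[of K "y \<star>\<^bsub>entw K\<^esub> x"] vop sw0_inj del: entw_sel(12)) (simp add: sel)
  qed
  have i2: "is_entw2 K (id2 (entw K) f)" if "is_entw1 K f" for f
  proof -
    have "sw2 (id2 (entw K) f) = id2 (entw (vop K)) (sw1 f)" by (simp add: sw2_def)
    then show ?thesis
      using A_closed_id(2)[OF that] v.A_closed_id(2)[of "sw1 f"] that
      by (simp add: is_entw2_iff vop del: entw_sel(9)) simp
  qed
  note cl = cmp id[simplified] vc[simplified] hc[simplified] i2[simplified]
  note ty = entw1_parts(1,2) entw1_ty entw2_ty entw0_ty(2-8) entw0_ty(12,13)
  have assoc: "cmp_entw1 K (cmp_entw1 K h g) f = cmp_entw1 K h (cmp_entw1 K g f)"
    if "is_entw1 K f" "is_entw1 K g" "is_entw1 K h" "etrg1 f = esrc1 g" "etrg1 g = esrc1 h" for f g h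
    using entw1_ty[OF that(1)] entw1_ty[OF that(2)] entw1_ty[OF that(3)] that(4,5)
      entw0_ty[OF entw1_parts(1)[OF that(1)]] entw0_ty[OF entw1_parts(1)[OF that(2)]] entw0_ty[OF entw1_parts(1)[OF that(3)]]
      entw0_ty[OF entw1_parts(2)[OF that(3)]]
    by (simp add: cmp_entw1_def)
  have unit: "cmp_entw1 K f (id1 (entw K) x) = f" if "is_entw1 K f" "esrc1 f = x" for f x
    using entw1_ty[OF that(1)] entw0_ty[OF entw1_parts(1)[OF that(1)]] entw0_ty[OF entw1_parts(2)[OF that(1)]] that(2)
    by (cases f) (simp add: cmp_entw1_def)
  have unit': "cmp_entw1 K (id1 (entw K) x) f = f" if "is_entw1 K f" "etrg1 f = x" for f x
    using entw1_ty[OF that(1)] entw0_ty[OF entw1_parts(1)[OF that(1)]] entw0_ty[OF entw1_parts(2)[OF that(1)]] that(2)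
    by (cases f) (simp add: cmp_entw1_def)
  have hcmp_id1: "x \<star> id2 K (id1 K a) = x" "id2 K (id1 K b) \<star> x = x"
    if "x \<in> twos K" "s1 K (s2 K x) = a" "t1 K (s2 K x) = b" for x a b
    using whisk_id1[OF that(1)] that by (simp_all add: lwhisk_def rwhisk_def)
  show ?thesis
    by unfold_locales
      (auto simp: hom1_iff hom2_iff cl ty sel assoc unit[simplified] unit'[simplified] hcmp_typ hcmp_assoc' interchange' hcmp_id1
        intro!: entw2.expand)
qed

section \<open>The first composite\<close>

lemma cmd_psfun_sel:
  "on2 (cmd_psfun A B F) x = Mon2 (on1 (cmd_psfun A B F) (src2 x)) (on1 (cmd_psfun A B F) (trg2 x)) (on2 F (und2 x))"
  "pcmp (cmd_psfun A B F) Y X = Mon2 (cmp_mon1 (vop B) (on1 (cmd_psfun A B F) Y) (on1 (cmd_psfun A B F) X))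
      (on1 (cmd_psfun A B F) (cmp_mon1 (vop A) Y X)) (pcmp F (und1 Y) (und1 X))"
  "punt (cmd_psfun A B F) C = Mon2 (id_mon1 B (on0 (cmd_psfun A B F) C)) (on1 (cmd_psfun A B F) (id_mon1 A C)) (punt F (mob C))"
  by (simp_all add: cmd_psfun_def Let_def)

lemma (in em_monads) J2_id: "is_mnd1 K X \<Longrightarrow> J2 (Mon2 X X (id2 K (und1 X))) = id2 K (J1 X)"
  using ad.G.on2_id[of X] by simp

lemmas (in em_comonads) co_J2_id = em_monads.J2_id[OF em_monads_vop, unfolded vop_sel]

lemma id_mon1_vop: "id_mon1 (vop K) = id_mon1 K"
  by (simp add: id_mon1_def fun_eq_iff)

context em_pair
begin

text \<open>\<open>FA\<close> is \<open>J\<^sub>* Cmd(Q) A\<close>; \<open>Vx x\<close>, \<open>Rx x\<close> and \<open>kx x\<close> are the universal weak entwined module at \<open>x\<close>.\<close>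

definition FA where "FA = comp_psfun K (emJ Es) (comp_psfun (cmd K) QC (A_fun K))"
definition Dx where "Dx x = on0 QC (A0 K x)"
definition Xx where "Xx x = mcar (A0 K x)"
definition Yx where "Yx f = und1 (A1 K f)"
definition Lx where "Lx f = on1 QC (A1 K f)"
definition Vx where "Vx x = v (ent_mon x) \<cdot> em_v Es (Dx x)"
definition Rx where "Rx x = a (ent_mon x) \<triangleleft> em_v Es (Dx x)"
definition kx where "kx x = (\<iota> (Xx x) \<triangleleft> em_v Es (Dx x)) \<ast> (v (ent_mon x) \<triangleright> em_act Es (Dx x))"

lemma FA_sel: "on0 FA x = on0 (emJ Es) (Dx x)" "on1 FA f = on1 (emJ Es) (Lx f)" "on2 FA w = on2 (emJ Es) (on2 QC (A2 K w))"
  "pcmp FA g f = pcmp (emJ Es) (Lx g) (Lx f) \<ast> on2 (emJ Es) (pcmp QC (A1 K g) (A1 K f) \<ast>\<^bsub>cmd K\<^esub> on2 QC (id2 (cmd (mndi K)) (A1 K (cmp_entw1 K g f))))"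
  "punt FA x = punt (emJ Es) (Dx x) \<ast> on2 (emJ Es) (punt QC (A0 K x) \<ast>\<^bsub>cmd K\<^esub> on2 QC (id2 (cmd (mndi K)) (A1 K (id1 (entw K) x))))"
  by (simp_all add: FA_def comp_psfun_def A_fun_def strict_psfun_def Dx_def Lx_def)

lemma ent_em_at: "is_entw0 K x \<Longrightarrow> ent_em K E S Es (ent_mon x) (ent_com x) (ent_law x) (Xx x) (Dx x)"
  by (intro ent_em.intro ent_em_axioms.intro em_pair_axioms) (simp_all add: is_entw0_def Xx_def Dx_def mcar_A0)

lemma ent_mor_at:
  assumes f: "is_entw1 K f"
  shows "ent_mor K E S Es (ent_mon (esrc1 f)) (ent_com (esrc1 f)) (ent_law (esrc1 f)) (Xx (esrc1 f)) (Dx (esrc1 f))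
    (ent_mon (etrg1 f)) (ent_com (etrg1 f)) (ent_law (etrg1 f)) (Xx (etrg1 f)) (Dx (etrg1 f))
    (eund1 f) (ealpha f) (ebeta f) (Yx f) (Lx f)"
  using f entw1_parts(1,2)[OF f]
  by (intro ent_mor.intro ent_mor_axioms.intro em_pair_axioms ent_em_at) (simp_all add: Yx_def Lx_def A1_eq)

lemma Yx: "is_entw1 K f \<Longrightarrow> is_mnd1 K (Yx f)" "src1 (Yx f) = ent_mon (esrc1 f)" "trg1 (Yx f) = ent_mon (etrg1 f)"
  "und1 (Yx f) = eund1 f" "str1 (Yx f) = ealpha f"
  using entw1_parts(3)[of f] by (simp_all add: Yx_def A1_eq)

lemma cellD:
  assumes w: "is_entw2 K w"
  shows "is_mndi2 K (Mon2 (Yx (esrc2 w)) (Yx (etrg2 w)) (eund2 w))"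
    "ebeta (etrg2 w) \<ast> (eund2 w \<triangleleft> mcar (ent_com (esrc1 (esrc2 w)))) = (mcar (ent_com (etrg1 (esrc2 w))) \<triangleright> eund2 w) \<ast> ebeta (esrc2 w)"
proof -
  have "is_mnd2 (vop (mndi K)) (A2 K w)" using w by (simp add: is_entw2_def)
  then show "is_mndi2 K (Mon2 (Yx (esrc2 w)) (Yx (etrg2 w)) (eund2 w))"
    "ebeta (etrg2 w) \<ast> (eund2 w \<triangleleft> mcar (ent_com (esrc1 (esrc2 w)))) = (mcar (ent_com (etrg1 (esrc2 w))) \<triangleright> eund2 w) \<ast> ebeta (esrc2 w)"
    using entw2_ty(3,4)[OF w] by (simp_all add: is_mnd2_iff A2_eq A1_eq Yx_def hom2_iff mcar_A0)
qed

lemma on2_QC: "on2 QC (A2 K w) = Mon2 (Lx (etrg2 w)) (Lx (esrc2 w)) (Q2 K E S (Mon2 (Yx (esrc2 w)) (Yx (etrg2 w)) (eund2 w)))"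
  by (simp add: cmd_psfun_sel A2_eq Lx_def Yx_def)

text \<open>That \<open>Q\<close> of the 2-cell is a 2-cell of comonad morphisms is tested after v
  and the inclusion of the target retract. There it is the compatibility of \<omega> with the two
  structure cells \<beta>.\<close>

lemma rep_2cell:
  assumes w: "is_entw2 K w"
  shows "on2 FA w \<in> hom2 K (on1 FA (esrc2 w)) (on1 FA (etrg2 w))"
    "Vx (etrg1 (esrc2 w)) \<triangleright> on2 FA w = eund2 w \<triangleleft> Vx (esrc1 (esrc2 w))"
proof -
  define f g where d: "f = esrc2 w" "g = etrg2 w"
  note tw = entw2_ty[OF w, folded d]
  define x y where xy: "x = esrc1 f" "y = etrg1 f"
  note tw = tw[folded xy]
  interpret f: ent_mor K E S Es "ent_mon x" "ent_com x" "ent_law x" "Xx x" "Dx x" "ent_mon y" "ent_com y" "ent_law y" "Xx y" "Dx y"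
    "eund1 f" "ealpha f" "ebeta f" "Yx f" "Lx f" using ent_mor_at[OF tw(1)] by (simp add: xy)
  interpret g: ent_mor K E S Es "ent_mon x" "ent_com x" "ent_law x" "Xx x" "Dx x" "ent_mon y" "ent_com y" "ent_law y" "Xx y" "Dx y"
    "eund1 g" "ealpha g" "ebeta g" "Yx g" "Lx g" using ent_mor_at[OF tw(2)] by (simp add: tw)
  let ?\<omega> = "eund2 w" and ?T = "ent_mon x" and ?T' = "ent_mon y" and ?c = "mcar (ent_com x)" and ?c' = "mcar (ent_com y)"
  define Q where "Q = Q2 K E S (Mon2 (Yx f) (Yx g) ?\<omega>)"
  note cell = cellD[OF w, folded d, folded xy]
  note q2 = Q2[OF cell(1), folded Q_def, unfolded mon2.sel f.Y_sel]
  have Qty: "Q \<in> twos K" "s2 K Q = q (Yx f)" "t2 K Q = q (Yx g)" using q2(1) by (simp_all add: hom2_iff)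
  note ty = f.mor_tys g.Y_ty g.lam(1)[unfolded hom2_iff] Qty tw(5-)
  \<comment> \<open>The 1-cells of \<open>Q\<close> involved here are unital, so their projections
    and inclusions are identities and drop out.\<close>
  have vQ: "v ?T' \<triangleright> Q = ?\<omega> \<triangleleft> v ?T"
    using q2(2) split_strict(3)[OF g.Y(1)] f.Y_split g.Y_split by (simp add: ty g.Y_sel)
  have vQ1: "v ?T' \<triangleright> Q \<triangleleft> z = ?\<omega> \<triangleleft> v ?T \<cdot> z" if "z \<in> ones K" "t1 K z = J0 ?T" for z
    using arg_cong[OF vQ, of "\<lambda>x. x \<triangleleft> z"] that by (simp add: ty)
  have b: "(ebeta g \<triangleleft> v ?T) \<ast> (?\<omega> \<triangleleft> ?c \<cdot> v ?T) = (?c' \<triangleright> ?\<omega> \<triangleleft> v ?T) \<ast> (ebeta f \<triangleleft> v ?T)"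
    using cell(2)[THEN rwhisk2, of "v ?T"] by (simp add: ty)
  have N1: "(eund1 g \<triangleright> \<iota> (Xx x)) \<ast> (?\<omega> \<triangleleft> v ?T \<cdot> q (Xx x)) = (?\<omega> \<triangleleft> ?c \<cdot> v ?T) \<ast> (eund1 f \<triangleright> \<iota> (Xx x))"
    using naturality1[of ?\<omega> "\<iota> (Xx x)" "eund1 f" "eund1 g" "v ?T \<cdot> q (Xx x)" "?c \<cdot> v ?T"] by (simp add: ty)
  have N2: "(\<iota> (Xx y) \<triangleleft> q (Yx g)) \<ast> (v ?T' \<triangleright> q (Xx y) \<triangleright> Q) = (?c' \<triangleright> v ?T' \<triangleright> Q) \<ast> (\<iota> (Xx y) \<triangleleft> q (Yx f))"
    using naturality2[of "\<iota> (Xx y)" Q "v ?T'" "q (Xx y)" "?c' \<cdot> v ?T'" "q (Yx f)" "q (Yx g)"] by (simp add: ty)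
  let ?L = "str1 (Lx g) \<ast> (Q \<triangleleft> q (Xx x))" and ?R = "(q (Xx y) \<triangleright> Q) \<ast> str1 (Lx f)"
  have Lty: "?L \<in> twos K" "s2 K ?L = q (Yx f) \<cdot> q (Xx x)" "t2 K ?L = q (Xx y) \<cdot> q (Yx g)"
    and Rty: "?R \<in> twos K" "s2 K ?R = q (Yx f) \<cdot> q (Xx x)" "t2 K ?R = q (Xx y) \<cdot> q (Yx g)" by (simp_all add: ty)
  have "(\<iota> (Xx y) \<triangleleft> q (Yx g)) \<ast> (v ?T' \<triangleright> ?L) = (ebeta g \<triangleleft> v ?T) \<ast> (?\<omega> \<triangleleft> ?c \<cdot> v ?T) \<ast> (eund1 f \<triangleright> \<iota> (Xx x))"
    by (simp add: ty g.vJ g.lam(2)[THEN reassoc2] vQ1 N1)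
  also have "... = (\<iota> (Xx y) \<triangleleft> q (Yx g)) \<ast> (v ?T' \<triangleright> ?R)"
    by (simp add: ty b[THEN reassoc2] N2[THEN reassoc2] f.lam(2) vQ f.vJ g.vJ)
  finally have e: "(\<iota> (Xx y) \<triangleleft> q (Yx g)) \<ast> (v ?T' \<triangleright> ?L) = (\<iota> (Xx y) \<triangleleft> q (Yx g)) \<ast> (v ?T' \<triangleright> ?R)" .
  have e: "v ?T' \<triangleright> ?L = v ?T' \<triangleright> ?R"
    by (rule f.B.iota_cancel[OF _ _ _ _ _ _ e]) (simp_all add: ty Lty Rty)
  have e: "?L = ?R"
    by (rule em_uniq2[OF weak_entD(1)[OF f.B.ent] _ _ _ _ _ e]) (simp_all add: ty Lty Rty)
  have m: "is_mnd2 (vop K) (Mon2 (Lx g) (Lx f) Q)"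
    using f.L_mnd1 g.L_mnd1 e by (simp add: is_mnd2_iff f.L_sel g.L_sel f.A.D_sel f.B.D_sel Qty hom2_iff)
  note j = co_J2[OF m, unfolded mon2.sel f.L_sel g.L_sel]
  have F: "on2 FA w = on2 (emJ Es) (Mon2 (Lx g) (Lx f) Q)" by (simp add: FA_sel on2_QC Q_def d)
  note jt = ty j(1)[unfolded hom2_iff] f.Z(1)[unfolded hom1_iff] g.Z(1)[unfolded hom1_iff]
  show "on2 FA w \<in> hom2 K (on1 FA (esrc2 w)) (on1 FA (etrg2 w))"
    using j(1)[folded F] by (simp add: FA_sel(2) d)
  have "Vx y \<triangleright> on2 FA w = ?\<omega> \<triangleleft> Vx x"
    unfolding F Vx_def by (simp add: jt j(2) vQ1)
  then show "Vx (etrg1 (esrc2 w)) \<triangleright> on2 FA w = eund2 w \<triangleleft> Vx (esrc1 (esrc2 w))"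
    by (simp add: xy d)
qed

lemma Q2_id:
  assumes X: "is_mnd1 K X"
  shows "Q2 K E S (Mon2 X X (id2 K (und1 X))) = id2 K (q X)"
proof -
  have X': "is_mndi1 K X" using X by (rule mnd1_mndi1)
  note ty = split_ty[OF X'] mndi1_ty[OF X'] em_tys[OF mndi1_ty(1)[OF X']] em_tys[OF mndi1_ty(2)[OF X']]
  note q = Q2[OF mndi2_id2[OF X'], unfolded mon2.sel]
  have e: "v (trg1 X) \<triangleright> Q2 K E S (Mon2 X X (id2 K (und1 X))) = v (trg1 X) \<triangleright> id2 K (q X)"
    unfolding q(2) by (simp add: ty split_strict(2-4)[OF X])
  show ?thesis
    by (rule em_uniq2[OF mndi1_ty(2)[OF X'] _ _ _ _ _ e]) (use q(1) in \<open>simp_all add: hom2_iff ty\<close>)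
qed

text \<open>For unital 1-cells all projections and inclusions are identities, so the coherence cell
  becomes an identity after whiskering with v, which is faithful.\<close>

lemma Q_cmp_strict:
  assumes X: "is_mnd1 K X" and Y: "is_mnd1 K Y" and XY: "trg1 X = src1 Y"
  shows "q (cmp_mon1 K Y X) = q Y \<cdot> q X" "Q_cmp K E S Y X = id2 K (q Y \<cdot> q X)"
proof -
  have X': "is_mndi1 K X" and Y': "is_mndi1 K Y" using X Y by (simp_all add: mnd1_mndi1)
  note Z = mnd1_cmp[OF X Y XY]
  show qq: "q (cmp_mon1 K Y X) = q Y \<cdot> q X"
    using split_strict(1)[OF X] split_strict(1)[OF Y] split_strict(1)[OF Z] J1_cmp[OF X Y XY] by simp
  note ty = split_ty[OF X', unfolded XY] mndi1_ty[OF X', unfolded XY] split_ty[OF Y'] mndi1_ty[OF Y']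
    em_tys[OF mndi1_ty(1)[OF X']] em_tys[OF mndi1_ty(1)[OF Y']] em_tys[OF mndi1_ty(2)[OF Y']]
  note c = Q_cmp(1,2)[OF X' Y' XY, unfolded qq]
  have "v (trg1 Y) \<cdot> q Y \<cdot> q X = (v (trg1 Y) \<cdot> q Y) \<cdot> q X" by (simp add: ty)
  also have "... = und1 Y \<cdot> (v (src1 Y) \<cdot> q X)" unfolding split_strict(2)[OF Y] by (simp add: ty)
  also have "... = und1 Y \<cdot> und1 X \<cdot> v (src1 X)" using split_strict(2)[OF X] by (simp add: XY)
  finally have vqq: "v (trg1 Y) \<cdot> q Y \<cdot> q X = und1 Y \<cdot> und1 X \<cdot> v (src1 X)" .
  have e: "v (trg1 Y) \<triangleright> Q_cmp K E S Y X = v (trg1 Y) \<triangleright> id2 K (q Y \<cdot> q X)"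
    unfolding c(2) using split_strict(2)[OF X] XY
    by (simp add: ty split_strict(3,4)[OF X] split_strict(3,4)[OF Y] split_strict(3,4)[OF Z] vqq)
  show "Q_cmp K E S Y X = id2 K (q Y \<cdot> q X)"
    by (rule em_uniq2[OF mndi1_ty(2)[OF Y'] _ _ _ _ _ e]) (use c(1) in \<open>simp_all add: hom2_iff ty\<close>)
qed

text \<open>By \<open>lam\<close> the structure cell of such a comonad morphism is determined by the
  \<beta> of its 1-cell, and both sides have the \<beta> of the composite 1-cell.\<close>

lemma Lx_cmp:
  assumes f: "is_entw1 K f" and g: "is_entw1 K g" and fg: "etrg1 f = esrc1 g" and h: "is_entw1 K (cmp_entw1 K g f)"
  shows "Lx (cmp_entw1 K g f) = cmp_mon1 (vop K) (Lx g) (Lx f)"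
proof -
  define x y z where xyz: "x = esrc1 f" "y = esrc1 g" "z = etrg1 g"
  let ?h = "cmp_entw1 K g f"
  have sel: "esrc1 ?h = x" "etrg1 ?h = z" "eund1 ?h = eund1 g \<cdot> eund1 f" "ebeta ?h = (ebeta g \<triangleleft> eund1 f) \<ast> (eund1 g \<triangleright> ebeta f)"
    by (simp_all add: cmp_entw1_def xyz)
  interpret f: ent_mor K E S Es "ent_mon x" "ent_com x" "ent_law x" "Xx x" "Dx x" "ent_mon y" "ent_com y" "ent_law y" "Xx y" "Dx y"
    "eund1 f" "ealpha f" "ebeta f" "Yx f" "Lx f" using ent_mor_at[OF f] by (simp add: xyz fg)
  interpret g: ent_mor K E S Es "ent_mon y" "ent_com y" "ent_law y" "Xx y" "Dx y" "ent_mon z" "ent_com z" "ent_law z" "Xx z" "Dx z"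
    "eund1 g" "ealpha g" "ebeta g" "Yx g" "Lx g" using ent_mor_at[OF g] by (simp add: xyz)
  interpret h: ent_mor K E S Es "ent_mon x" "ent_com x" "ent_law x" "Xx x" "Dx x" "ent_mon z" "ent_com z" "ent_law z" "Xx z" "Dx z"
    "eund1 g \<cdot> eund1 f" "ealpha ?h" "(ebeta g \<triangleleft> eund1 f) \<ast> (eund1 g \<triangleright> ebeta f)" "Yx ?h" "Lx ?h"
    using ent_mor_at[OF h] by (simp add: sel)
  note ty = f.mor_tys g.mor_tys h.lam(1)[unfolded hom2_iff] h.Y_ty(10-)
  have "Yx ?h = cmp_mon1 K (Yx g) (Yx f)"
    by (simp add: Yx_def A1_eq cmp_mon1_def) (simp add: cmp_entw1_def fg)
  then have qh: "q (Yx ?h) = q (Yx g) \<cdot> q (Yx f)"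
    using Q_cmp_strict(1)[OF f.Y(1) g.Y(1)] f.Y_sel g.Y_sel by simp
  let ?H = "(str1 (Lx g) \<triangleleft> q (Yx f)) \<ast> (q (Yx g) \<triangleright> str1 (Lx f))"
  have gl: "(\<iota> (Xx z) \<triangleleft> q (Yx g) \<cdot> q (Yx f)) \<ast> (v (ent_mon z) \<triangleright> str1 (Lx g) \<triangleleft> q (Yx f)) =
     (ebeta g \<triangleleft> eund1 f \<cdot> v (ent_mon x)) \<ast> (eund1 g \<triangleright> \<iota> (Xx y) \<triangleleft> q (Yx f))"
    using g.lam(2)[THEN rwhisk2, of "q (Yx f)"] by (simp add: ty f.vJ)
  have e: "(\<iota> (Xx z) \<triangleleft> q (Yx g) \<cdot> q (Yx f)) \<ast> (v (ent_mon z) \<triangleright> str1 (Lx ?h)) =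
     (\<iota> (Xx z) \<triangleleft> q (Yx g) \<cdot> q (Yx f)) \<ast> (v (ent_mon z) \<triangleright> ?H)"
    using h.lam(2) unfolding qh by (simp add: ty gl[THEN reassoc2] g.vJ f.vJ f.lam(2)[THEN lwhisk2])
  have e: "v (ent_mon z) \<triangleright> str1 (Lx ?h) = v (ent_mon z) \<triangleright> ?H"
    by (rule g.B.iota_cancel[OF _ _ _ _ _ _ e]) (simp_all add: ty[unfolded qh])
  have "str1 (Lx ?h) = ?H"
    by (rule em_uniq2[OF weak_entD(1)[OF g.B.ent] _ _ _ _ _ e]) (simp_all add: ty[unfolded qh])
  then show ?thesis
    by (intro mon1.expand) (simp add: cmp_mon1_def f.L_sel g.L_sel h.L_sel qh)
qed

lemma Lx_id:
  assumes x: "is_entw0 K x" and i: "is_entw1 K (id1 (entw K) x)"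
  shows "Lx (id1 (entw K) x) = id_mon1 K (Dx x)"
proof -
  let ?T = "ent_mon x"
  define i where "i = id1 (entw K) x"
  have sel: "esrc1 i = x" "etrg1 i = x" "eund1 i = id1 K (mob ?T)" "ealpha i = id2 K (mcar ?T)" "ebeta i = id2 K (mcar (ent_com x))"
    by (simp_all add: i_def)
  interpret h: ent_mor K E S Es "ent_mon x" "ent_com x" "ent_law x" "Xx x" "Dx x" "ent_mon x" "ent_com x" "ent_law x" "Xx x" "Dx x"
    "id1 K (mob ?T)" "id2 K (mcar ?T)" "id2 K (mcar (ent_com x))" "Yx i" "Lx i"
    using ent_mor_at[OF i] unfolding i_def[symmetric] sel .
  have Y: "Yx i = id_mon1 K ?T" by (simp add: Yx_def A1_eq id_mon1_def sel)
  have qY: "q (Yx i) = id1 K (J0 ?T)"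
    using split_strict(1)[OF h.Y(1)] J1_id[OF weak_entD(1)[OF h.A.ent]] Y by simp
  note ty = h.mor_tys[unfolded qY]
  have e: "\<iota> (Xx x) \<ast> (v ?T \<triangleright> str1 (Lx i)) = \<iota> (Xx x) \<ast> (v ?T \<triangleright> id2 K (q (Xx x)))"
    using h.lam(2)[unfolded qY] by (simp add: ty)
  have e: "v ?T \<triangleright> str1 (Lx i) = v ?T \<triangleright> id2 K (q (Xx x))"
    by (rule split_mono_cancel[OF iota_smono[OF h.A.X_mndi1] _ _ _ _ e]) (simp_all add: ty)
  have "str1 (Lx i) = id2 K (q (Xx x))"
    by (rule em_uniq2[OF weak_entD(1)[OF h.A.ent] _ _ _ _ _ e]) (simp_all add: ty)
  then show ?thesis unfolding i_def[symmetric]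
    by (intro mon1.expand) (simp add: id_mon1_def h.L_sel[unfolded qY] h.A.D_sel)
qed

lemma Lx_facts:
  assumes "is_entw1 K f"
  shows "is_mnd1 (vop K) (Lx f)" "und1 (Lx f) = q (Yx f)" "src1 (Lx f) = Dx (esrc1 f)" "trg1 (Lx f) = Dx (etrg1 f)"
  using ent_mor.L_mnd1[OF ent_mor_at[OF assms]] ent_mor.L_sel[OF ent_mor_at[OF assms]] by simp_all

lemma Q2_Yx: "is_entw1 K f \<Longrightarrow> Q2 K E S (Mon2 (Yx f) (Yx f) (id2 K (und1 (Yx f)))) = id2 K (und1 (Lx f))"
  using Q2_id[OF Yx(1)] Lx_facts(2) by simp

lemma Q_cmp_Yx:
  assumes f: "is_entw1 K f" and g: "is_entw1 K g" and fg: "etrg1 f = esrc1 g" and h: "is_entw1 K (cmp_entw1 K g f)"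
  shows "Q_cmp K E S (Yx g) (Yx f) = id2 K (und1 (Lx (cmp_entw1 K g f)))"
proof -
  have "und1 (cmp_mon1 (vop K) (Lx g) (Lx f)) = und1 (Lx g) \<cdot> und1 (Lx f)" by (simp add: cmp_mon1_def)
  then have u: "und1 (Lx (cmp_entw1 K g f)) = q (Yx g) \<cdot> q (Yx f)"
    unfolding Lx_cmp[OF assms] Lx_facts(2)[OF f] Lx_facts(2)[OF g] .
  show ?thesis
    unfolding u by (rule Q_cmp_strict(2)[OF Yx(1)[OF f] Yx(1)[OF g]]) (simp add: Yx(2,3) fg)
qed

text \<open>The clauses on modules and cells were obtained above. The coherence cells collapse
  because those of \<open>A\<close> are identities by definition, those of \<open>Q\<close> are
  identities at the unital 1-cells that occur, and the right 2-adjoint is strict.\<close>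

lemma FA_rep: "represents_entw_mod K FA Vx Rx kx"
proof -
  interpret N: two_category "entw K" by (rule two_category_entw)
  have cl: "is_entw1 K (cmp_entw1 K g f)" if "is_entw1 K f" "is_entw1 K g" "etrg1 f = esrc1 g" for f g
    using N.cmp1_typ(1)[of f g] that by simp
  have cli: "is_entw1 K (id1 (entw K) x)" if "is_entw0 K x" for x
    using N.id1_typ(1)[of x] that by simp
  note L = Lx_facts
  have Q2id: "on2 QC (id2 (cmd (mndi K)) (A1 K f)) = Mon2 (Lx f) (Lx f) (id2 K (und1 (Lx f)))" if "is_entw1 K f" for f
    using Q2_Yx[OF that] by (simp add: cmd_psfun_sel Lx_def[symmetric] Yx_def[symmetric])
  have J2id: "on2 (emJ Es) (Mon2 (Lx f) (Lx f) (id2 K (und1 (Lx f)))) = id2 K (on1 FA f)" "on1 FA f \<in> ones K" if "is_entw1 K f" for f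
    using co_J2_id[OF L(1)[OF that]] co_J1(1)[OF L(1)[OF that]] by (simp_all add: FA_sel(2) hom1_iff)
  have 0: "on0 FA x \<in> obs K \<and> Vx x \<in> hom1 K (on0 FA x) (mob (ent_mon x)) \<and> entw_mod K x (Vx x) (Rx x) (kx x)" if x: "is_entw0 K x" for x
  proof -
    interpret x: ent_em K E S Es "ent_mon x" "ent_com x" "ent_law x" "Xx x" "Dx x" by (rule ent_em_at[OF x])
    show ?thesis using x.univ_entw_mod x.DT by (simp add: FA_sel(1) Vx_def Rx_def kx_def hom1_iff)
  qed
  have 1: "\<exists>z \<in> hom1 K (s1 K M) (on0 FA x). Vx x \<cdot> z = M \<and> Rx x \<triangleleft> z = r \<and> kx x \<triangleleft> z = n"
    if x: "is_entw0 K x" and w: "entw_mod K x M r n" for x M r n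
    using ent_em.univ_ex[OF ent_em_at[OF x], of M r n] w by (simp add: FA_sel(1) Vx_def Rx_def kx_def)
  have 2: "z = z'" if x: "is_entw0 K x" and "z \<in> hom1 K l (on0 FA x)" "z' \<in> hom1 K l (on0 FA x)"
    "Vx x \<cdot> z = Vx x \<cdot> z'" "Rx x \<triangleleft> z = Rx x \<triangleleft> z'" "kx x \<triangleleft> z = kx x \<triangleleft> z'" for x l z z'
    by (rule ent_em.univ_uniq1[OF ent_em_at[OF x], of z l z']) (use that in \<open>simp_all add: FA_sel(1) Vx_def Rx_def kx_def\<close>)
  have 3: "y = y'" if x: "is_entw0 K x" and "y \<in> twos K" "y' \<in> twos K" "s2 K y = s2 K y'" "t2 K y = t2 K y'" "t1 K (s2 K y') = on0 FA x"
    "Vx x \<triangleright> y = Vx x \<triangleright> y'" for x y y'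
    by (rule ent_em.univ_uniq2[OF ent_em_at[OF x], of y y']) (use that in \<open>simp_all add: FA_sel(1) Vx_def\<close>)
  have 4: "punt FA x = id2 K (id1 K (on0 FA x)) \<and> on1 FA (id1 (entw K) x) = id1 K (on0 FA x)" if x: "is_entw0 K x" for x
  proof -
    interpret x: ent_em K E S Es "ent_mon x" "ent_com x" "ent_law x" "Xx x" "Dx x" by (rule ent_em_at[OF x])
    define i where "i = id1 (entw K) x"
    have i: "is_entw1 K i" "Lx i = id_mon1 K (Dx x)" "A1 K i = id_mon1 (mndi K) (A0 K x)"
      using cli[OF x] Lx_id[OF x cli[OF x]] A1_id[OF x] by (simp_all only: i_def)
    have F1: "on1 FA i = id1 K (on0 FA x)" using co_J1_id[OF x.D_comonad] by (simp add: FA_sel i(2) id_mon1_vop)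
    have u: "und1 (Lx i) = id1 K (J0 (ent_mon x))" using x.D_sel by (simp add: i(2))
    have m: "mob (A0 K x) = ent_mon x" by (cases x) (simp add: A0_def Let_def)
    have "punt QC (A0 K x) = Mon2 (Lx i) (Lx i) (id2 K (id1 K (J0 (ent_mon x))))"
      by (simp add: cmd_psfun_sel Dx_def[symmetric] i(2) i(3)[symmetric] Lx_def[symmetric] m)
    then have "punt QC (A0 K x) \<ast>\<^bsub>cmd K\<^esub> on2 QC (id2 (cmd (mndi K)) (A1 K i)) = Mon2 (Lx i) (Lx i) (id2 K (und1 (Lx i)))"
      unfolding Q2id[OF i(1)] using x.DT by (simp add: u)
    then have "punt FA x = id2 K (id1 K (on0 FA x))"
      unfolding FA_sel(5) i_def[symmetric] using J2id[OF i(1)] co_J_punt[OF x.D_comonad] F1 x.DT by (simp add: FA_sel(1))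
    with F1 show ?thesis unfolding i_def by blast
  qed
  have 5: "on1 FA f \<in> hom1 K (on0 FA (esrc1 f)) (on0 FA (etrg1 f)) \<and>
        Vx (etrg1 f) \<cdot> on1 FA f = eund1 f \<cdot> Vx (esrc1 f) \<and>
        Rx (etrg1 f) \<triangleleft> on1 FA f = (eund1 f \<triangleright> Rx (esrc1 f)) \<ast> (ealpha f \<triangleleft> Vx (esrc1 f)) \<and>
        kx (etrg1 f) \<triangleleft> on1 FA f = (ebeta f \<triangleleft> Vx (esrc1 f)) \<ast> (eund1 f \<triangleright> kx (esrc1 f))" if f: "is_entw1 K f" for f
    using ent_mor.Z[OF ent_mor_at[OF f]] by (simp add: FA_sel(1,2) Vx_def Rx_def kx_def)
  have 6: "pcmp FA g f = id2 K (on1 FA (cmp_entw1 K g f))" if f: "is_entw1 K f" and g: "is_entw1 K g" and fg: "etrg1 f = esrc1 g" for f g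
  proof -
    let ?h = "cmp_entw1 K g f"
    note h = cl[OF f g fg]
    note Lh = Lx_cmp[OF f g fg h]
    have c: "cmp_mon1 (vop (mndi K)) (A1 K g) (A1 K f) = A1 K ?h" using A1_cmp[OF f g fg] by simp
    have "Q_cmp K E S (Yx g) (Yx f) = id2 K (und1 (Lx ?h))" by (rule Q_cmp_Yx[OF f g fg h])
    then have "pcmp QC (A1 K g) (A1 K f) = Mon2 (Lx ?h) (Lx ?h) (id2 K (und1 (Lx ?h)))"
      unfolding cmd_psfun_sel(2) c Q_sel Lx_def[symmetric] Yx_def[symmetric] Lh[symmetric] by simp
    then have "pcmp QC (A1 K g) (A1 K f) \<ast>\<^bsub>cmd K\<^esub> on2 QC (id2 (cmd (mndi K)) (A1 K ?h)) = Mon2 (Lx ?h) (Lx ?h) (id2 K (und1 (Lx ?h)))"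
      unfolding Q2id[OF h] using L(2)[OF h] split_ty(1)[OF mnd1_mndi1[OF Yx(1)[OF h]]] by simp
    moreover have "pcmp (emJ Es) (Lx g) (Lx f) = id2 K (on1 FA ?h)"
      using co_J_pcmp[OF L(1)[OF f] L(1)[OF g]] co_J1_cmp[OF L(1)[OF f] L(1)[OF g]] L(3,4)[OF f] L(3,4)[OF g] fg by (simp add: FA_sel(2) Lh)
    ultimately show ?thesis unfolding FA_sel(4) using J2id[OF h] by simp
  qed
  show ?thesis
    unfolding represents_entw_mod_def using 0 1 2 3 4 5 6 rep_2cell by blast
qed

end

section \<open>The second composite\<close>

lemma mnd_psfun_sel:
  "on0 (mnd_psfun A B F) T = Mon (on0 F (mob T)) (on1 F (mcar T))
     (on2 F (mmult T) \<ast>\<^bsub>B\<^esub> inv2 B (pcmp F (mcar T) (mcar T))) (on2 F (munit T) \<ast>\<^bsub>B\<^esub> inv2 B (punt F (mob T)))"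
  "on1 (mnd_psfun A B F) X = Mon1 (on0 (mnd_psfun A B F) (src1 X)) (on0 (mnd_psfun A B F) (trg1 X)) (on1 F (und1 X))
     (pcmp F (und1 X) (mcar (src1 X)) \<ast>\<^bsub>B\<^esub> on2 F (str1 X) \<ast>\<^bsub>B\<^esub> inv2 B (pcmp F (mcar (trg1 X)) (und1 X)))"
  "on2 (mnd_psfun A B F) x = Mon2 (on1 (mnd_psfun A B F) (src2 x)) (on1 (mnd_psfun A B F) (trg2 x)) (on2 F (und2 x))"
  "pcmp (mnd_psfun A B F) Y X = Mon2 (on1 (mnd_psfun A B F) (cmp_mon1 A Y X))
      (cmp_mon1 B (on1 (mnd_psfun A B F) Y) (on1 (mnd_psfun A B F) X)) (pcmp F (und1 Y) (und1 X))"
  "punt (mnd_psfun A B F) T = Mon2 (on1 (mnd_psfun A B F) (id_mon1 A T)) (id_mon1 B (on0 (mnd_psfun A B F) T)) (punt F (mob T))"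
  by (simp_all add: mnd_psfun_def Let_def)

lemma cmd_psfun_sel01:
  "on0 (cmd_psfun A B F) T = Mon (on0 F (mob T)) (on1 F (mcar T))
     (pcmp F (mcar T) (mcar T) \<ast>\<^bsub>B\<^esub> on2 F (mmult T)) (punt F (mob T) \<ast>\<^bsub>B\<^esub> on2 F (munit T))"
  "on1 (cmd_psfun A B F) X = Mon1 (on0 (cmd_psfun A B F) (src1 X)) (on0 (cmd_psfun A B F) (trg1 X)) (on1 F (und1 X))
     (pcmp F (mcar (trg1 X)) (und1 X) \<ast>\<^bsub>B\<^esub> on2 F (str1 X) \<ast>\<^bsub>B\<^esub> inv2 B (pcmp F (und1 X) (mcar (src1 X))))"
  by (simp_all add: cmd_psfun_def Let_def)

lemma vop_psfun_sel:
  "on0 (vop_psfun B F) = on0 F" "on1 (vop_psfun B F) = on1 F" "on2 (vop_psfun B F) = on2 F"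
  "pcmp (vop_psfun B F) g f = inv2 B (pcmp F g f)" "punt (vop_psfun B F) x = inv2 B (punt F x)"
  by (simp_all add: vop_psfun_def)

context two_category
begin

lemma inv2_vop: "inv2 (vop K) = inv2 K"
proof -
  have "inverse_2cells (vop K) = inverse_2cells K" by (auto simp: inverse_2cells_def fun_eq_iff)
  then show ?thesis by (simp add: inv2_def fun_eq_iff)
qed

lemma inv2_ty:
  assumes "inverse_2cells K x y"
  shows "inv2 K x \<in> twos K" "s2 K (inv2 K x) = t2 K x" "t2 K (inv2 K x) = s2 K x" "inv2 K (inv2 K x) = x"
proof -
  have "inverse_2cells K y x" using assms by (auto simp: inverse_2cells_def hom2_iff)
  then show "inv2 K x \<in> twos K" "s2 K (inv2 K x) = t2 K x" "t2 K (inv2 K x) = s2 K x" "inv2 K (inv2 K x) = x"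
    using assms by (simp_all add: inv2_eq[OF assms] inv2_eq) (simp_all add: inverse_2cells_def hom2_iff)
qed

lemma inv2_id2: "f \<in> ones K \<Longrightarrow> inv2 K (id2 K f) = id2 K f"
  by (intro inv2_eq) (simp add: inverse_2cells_def hom2_iff)

lemma entw_mod_vop:
  assumes x: "is_entw0 K x"
  shows "entw_mod (vop K) (sw0 x) M k r \<longleftrightarrow> entw_mod K x M r k"
proof (cases "umod K (ent_mon x) M r \<and> umod (vop K) (ent_com x) M k")
  case True
  then have "M \<in> ones K" "t1 K M = mob (ent_mon x)" "r \<in> twos K" "s2 K r = mcar (ent_mon x) \<cdot> M" "t2 K r = M"
    "k \<in> twos K" "s2 K k = M" "t2 K k = mcar (ent_com x) \<cdot> M"
    by (simp_all add: umod_def nmod_def hom2_iff)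
  with True entw0_ty(2-11)[OF x] show ?thesis by (simp add: entw_mod_def)
qed (auto simp: entw_mod_def)

end

context em_pair
begin

text \<open>The action on monads of the pseudo-functor \<open>Q_star\<close> belonging to the
  2-category \<open>vop K\<close>: there \<open>cmdp\<close> is \<open>vop (mndi K)\<close>, and the
  opposite in which \<open>Q\<close> is formed is \<open>K\<close> again.\<close>

abbreviation "QM \<equiv> mnd_psfun (vop (mndi K)) (vop K) (vop_psfun K (Q K E S))"

text \<open>\<open>vop_psfun\<close> inverts the coherence cells and \<open>mnd_psfun\<close>
  inverts them once more; the double inverse cancels and leaves the multiplication and unit of the
  comonad \<open>Dx x\<close>.\<close>

lemma QM_A0:
  assumes x: "is_entw0 K x"
  shows "on0 QM (A0 K x) = Dx x"
proof -
  note X = X_mndi1'[OF x]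
  have st: "src1 (mcar (A0 K x)) = ent_mon x" "trg1 (mcar (A0 K x)) = ent_mon x" by (simp_all add: mcar_A0)
  have m: "mob (A0 K x) = ent_mon x" by (cases x) (simp add: A0_def Let_def)
  have J: "J0 (ent_mon x) \<in> obs K" using entw0_ty(12)[OF x] by (rule J0_obs)
  obtain g where g: "inverse_2cells K (Q_cmp K E S (mcar (A0 K x)) (mcar (A0 K x))) g"
    using Q_cmp(3)[OF X X] st by auto
  show ?thesis
    using J by (simp add: Dx_def cmd_psfun_sel01 mnd_psfun_sel vop_psfun_sel inv2_vop inv2_ty(4)[OF g] m inv2_id2)
qed

text \<open>Of the two coherence cells around the structure cell, one gets inverted twice and so
  reappears unchanged, and the other is inverted once, exactly as in
  \<open>cmd_psfun\<close>.\<close>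

lemma QM_A1:
  assumes f: "is_entw1 K f"
  shows "on1 QM (A1 K f) = Lx f"
proof -
  let ?x = "esrc1 f" and ?y = "etrg1 f"
  let ?X = "mcar (A0 K ?x)" and ?X' = "mcar (A0 K ?y)" and ?Y = "Yx f"
  note x = entw1_parts(1)[OF f] and y = entw1_parts(2)[OF f]
  note X = X_mndi1'[OF x] and X' = X_mndi1'[OF y] and Y = Yx(1)[OF f, THEN mnd1_mndi1]
  have st: "src1 ?X = ent_mon ?x" "trg1 ?X = ent_mon ?x" "src1 ?X' = ent_mon ?y" "trg1 ?X' = ent_mon ?y" by (simp_all add: mcar_A0)
  have A: "src1 (A1 K f) = A0 K ?x" "trg1 (A1 K f) = A0 K ?y" "und1 (A1 K f) = ?Y" by (simp_all add: Yx_def A1_eq)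
  have B: "is_mndi2 K (str1 (A1 K f))" "src2 (str1 (A1 K f)) = cmp_mon1 K ?Y ?X" "trg2 (str1 (A1 K f)) = cmp_mon1 K ?X' ?Y"
  proof -
    have "is_mnd1 (vop (mndi K)) (A1 K f)" using f by (simp add: is_entw1_def)
    then show "is_mndi2 K (str1 (A1 K f))" by (simp add: is_mnd1_iff is_mndi1_iff hom2_iff)
    show "src2 (str1 (A1 K f)) = cmp_mon1 K ?Y ?X" "trg2 (str1 (A1 K f)) = cmp_mon1 K ?X' ?Y"
      by (simp_all add: Yx_def A1_eq)
  qed
  obtain g where g: "inverse_2cells K (Q_cmp K E S ?Y ?X) g" using Q_cmp(3)[OF X Y] st Yx(2) by auto
  obtain h where h: "inverse_2cells K (Q_cmp K E S ?X' ?Y) h" using Q_cmp(3)[OF Y X'] st Yx(3) by auto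
  note c1 = Q_cmp(1)[OF X Y, unfolded st Yx(2), OF refl, unfolded hom2_iff]
  note c2 = Q_cmp(1)[OF Y X', unfolded st Yx(3), OF refl, unfolded hom2_iff]
  note b = Q2(1)[OF B(1), unfolded B(2,3) hom2_iff]
  note ty = c1 c2 b inv2_ty(1-3)[OF g] inv2_ty(1-3)[OF h]
  show ?thesis
    by (intro mon1.expand) (simp add: Lx_def cmd_psfun_sel01(2) mnd_psfun_sel(2) vop_psfun_sel QM_A0[OF x] QM_A0[OF y] Dx_def[symmetric] A
      inv2_vop inv2_ty(4)[OF h] ty)
qed

text \<open>This is \<open>J Mnd(Q\<^sub>*) B\<close> of the vertical opposite 2-category.\<close>

definition GA where
  "GA = comp_psfun (vop K) (emJ Es) (comp_psfun (mnd (vop K)) QM (B_fun (vop K)))"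

lemma GA_sel:
  "on0 GA x = on0 (emJ Es) (on0 QM (B0 (vop K) x))" "on1 GA f = on1 (emJ Es) (on1 QM (B1 (vop K) f))"
  "on2 GA w = on2 (emJ Es) (on2 QM (B2 (vop K) w))"
  "pcmp GA g f = on2 (emJ Es) (on2 QM (id2 (mnd (vop (mndi K))) (B1 (vop K) (cmp_entw1 (vop K) g f))) \<ast>\<^bsub>cmd K\<^esub> pcmp QM (B1 (vop K) g) (B1 (vop K) f))
     \<ast> pcmp (emJ Es) (on1 QM (B1 (vop K) g)) (on1 QM (B1 (vop K) f))"
  "punt GA x = on2 (emJ Es) (on2 QM (id2 (mnd (vop (mndi K))) (B1 (vop K) (id1 (entw (vop K)) x))) \<ast>\<^bsub>cmd K\<^esub> punt QM (B0 (vop K) x))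
     \<ast> punt (emJ Es) (on0 QM (B0 (vop K) x))"
  by (simp_all add: GA_def comp_psfun_def B_fun_def strict_psfun_def cmdp_eq)

lemma GA_sw:
  "is_entw0 K x \<Longrightarrow> on0 GA (sw0 x) = on0 FA x" "is_entw1 K f \<Longrightarrow> on1 GA (sw1 f) = on1 FA f"
  "is_entw2 K w \<Longrightarrow> on2 GA (sw2 w) = on2 FA w"
proof -
  show "is_entw0 K x \<Longrightarrow> on0 GA (sw0 x) = on0 FA x" by (simp add: GA_sel(1) A_vop FA_sel(1) QM_A0)
  show "is_entw1 K f \<Longrightarrow> on1 GA (sw1 f) = on1 FA f" by (simp add: GA_sel(2) A_vop FA_sel(2) QM_A1)
  assume w: "is_entw2 K w"
  have "src2 (A2 K w) = A1 K (etrg2 w)" "trg2 (A2 K w) = A1 K (esrc2 w)" by (simp_all add: A2_eq)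
  then show "on2 GA (sw2 w) = on2 FA w"
    using QM_A1 entw2_ty(1,2)[OF w]
    by (simp add: GA_sel(3) A_vop FA_sel(3) mnd_psfun_sel(3) cmd_psfun_sel(1) vop_psfun_sel) (simp add: Lx_def)
qed

text \<open>The coherence cells of \<open>Q\<close> that enter are identities, and an identity is
  its own inverse; so inverting them in \<open>vop_psfun\<close> leaves them unchanged.\<close>

lemma GA_strict:
  assumes f: "is_entw1 K f" and g: "is_entw1 K g" and fg: "etrg1 f = esrc1 g"
  shows "pcmp GA (sw1 g) (sw1 f) = id2 K (on1 GA (cmp_entw1 (vop K) (sw1 g) (sw1 f)))"
proof -
  interpret N: two_category "entw K" by (rule two_category_entw)
  let ?h = "cmp_entw1 K g f"
  have h: "is_entw1 K ?h" using N.cmp1_typ(1)[of f g] assms by simp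
  have sw: "cmp_entw1 (vop K) (sw1 g) (sw1 f) = sw1 ?h" by (simp add: sw1_def cmp_entw1_def)
  note L = Lx_facts and Lh = Lx_cmp[OF f g fg h]
  have u: "und1 (Lx ?h) \<in> ones K" "id2 K (und1 (Lx ?h)) \<in> twos K"
    using L(2)[OF h] split_ty(1)[OF mnd1_mndi1[OF Yx(1)[OF h]]] by simp_all
  have c: "cmp_mon1 (vop (mndi K)) (A1 K g) (A1 K f) = A1 K ?h" using A1_cmp[OF f g fg] by simp
  have 1: "pcmp QM (A1 K g) (A1 K f) = Mon2 (Lx ?h) (Lx ?h) (id2 K (und1 (Lx ?h)))"
    unfolding mnd_psfun_sel(4) c vop_psfun_sel Q_sel Yx_def[symmetric] Lh[symmetric] QM_A1[OF h] QM_A1[OF f] QM_A1[OF g]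
      Q_cmp_Yx[OF f g fg h] inv2_id2[OF u(1)] by simp
  have 2: "on2 QM (id2 (mnd (vop (mndi K))) (A1 K ?h)) = Mon2 (Lx ?h) (Lx ?h) (id2 K (und1 (Lx ?h)))"
    using Q2_Yx[OF h] by (simp add: mnd_psfun_sel(3) QM_A1[OF h] vop_psfun_sel Yx_def[symmetric])
  have 3: "pcmp (emJ Es) (Lx g) (Lx f) = id2 K (on1 FA ?h)"
    using co_J_pcmp[OF L(1)[OF f] L(1)[OF g]] co_J1_cmp[OF L(1)[OF f] L(1)[OF g]] L(3,4)[OF f] L(3,4)[OF g] fg by (simp add: FA_sel(2) Lh)
  have 4: "on2 (emJ Es) (Mon2 (Lx ?h) (Lx ?h) (id2 K (und1 (Lx ?h)))) = id2 K (on1 FA ?h)" "on1 FA ?h \<in> ones K"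
    using co_J2_id[OF L(1)[OF h]] co_J1(1)[OF L(1)[OF h]] by (simp_all add: FA_sel(2) hom1_iff)
  show ?thesis
    unfolding GA_sel(4) sw A_vop QM_A1[OF f] QM_A1[OF g] 1 2 3 GA_sw(2)[OF h] using u 4 by simp
qed

lemma GA_strict_id:
  assumes x: "is_entw0 K x"
  shows "punt GA (sw0 x) = id2 K (id1 K (on0 FA x))" "on1 GA (id1 (entw (vop K)) (sw0 x)) = id1 K (on0 FA x)"
proof -
  interpret N: two_category "entw K" by (rule two_category_entw)
  define i where "i = id1 (entw K) x"
  have i: "is_entw1 K i" using N.id1_typ(1)[of x] x by (simp add: i_def)
  have Ai: "A1 K i = id_mon1 (mndi K) (A0 K x)" and Li: "Lx i = id_mon1 K (Dx x)"
    using A1_id[OF x] Lx_id[OF x] i by (simp_all only: i_def)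
  have sw: "id1 (entw (vop K)) (sw0 x) = sw1 i" using entw0_ty(1)[OF x] by (simp add: sw1_def i_def)
  interpret x: ent_em K E S Es "ent_mon x" "ent_com x" "ent_law x" "Xx x" "Dx x" by (rule ent_em_at[OF x])
  have m: "mob (A0 K x) = ent_mon x" by (cases x) (simp add: A0_def Let_def)
  have J: "id1 K (J0 (ent_mon x)) \<in> ones K" "id1 K (on0 FA x) \<in> ones K" using x.DT by (simp_all add: FA_sel(1))
  have u: "und1 (Lx i) = id1 K (J0 (ent_mon x))" using x.D_sel by (simp add: Li)
  have F1: "on1 FA i = id1 K (on0 FA x)" using co_J1_id[OF x.D_comonad] by (simp add: FA_sel Li id_mon1_vop)
  then show "on1 GA (id1 (entw (vop K)) (sw0 x)) = id1 K (on0 FA x)" by (simp only: sw GA_sw(2)[OF i])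
  have 1: "punt QM (A0 K x) = Mon2 (Lx i) (Lx i) (id2 K (und1 (Lx i)))"
    unfolding mnd_psfun_sel(5) id_mon1_vop Ai[symmetric] QM_A1[OF i] QM_A0[OF x] vop_psfun_sel Q_sel m inv2_id2[OF J(1)] u[symmetric] using J(1) x.D_sel by (simp add: Li inv2_id2)
  have 2: "on2 QM (id2 (mnd (vop (mndi K))) (A1 K i)) = Mon2 (Lx i) (Lx i) (id2 K (und1 (Lx i)))"
    using Q2_Yx[OF i] by (simp add: mnd_psfun_sel(3) QM_A1[OF i] vop_psfun_sel Yx_def[symmetric])
  have 3: "punt (emJ Es) (Dx x) = id2 K (id1 K (on0 FA x))" using co_J_punt[OF x.D_comonad] by (simp add: FA_sel(1))
  have 4: "on2 (emJ Es) (Mon2 (Lx i) (Lx i) (id2 K (und1 (Lx i)))) = id2 K (id1 K (on0 FA x))"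
    using co_J2_id[OF Lx_facts(1)[OF i]] F1 by (simp add: FA_sel(2))
  show "punt GA (sw0 x) = id2 K (id1 K (on0 FA x))"
    unfolding GA_sel(5) sw A_vop QM_A0[OF x] 1 2 3 using J 4 u by simp
qed

text \<open>Transport of \<open>FA_rep\<close> along the swapping maps, with action and coaction
  exchanged. It concerns the second composite of \<open>vop K\<close>; used at \<open>vop K\<close>
  in place of \<open>K\<close>, it becomes a statement about the second composite of
  \<open>K\<close>.\<close>

lemma GA_rep: "represents_entw_mod (vop K) GA (\<lambda>x. Vx (sw0 x)) (\<lambda>x. kx (sw0 x)) (\<lambda>x. Rx (sw0 x))"
proof -
  interpret N: two_category "entw K" by (rule two_category_entw)
  interpret F: entw_mod_represented K FA Vx Rx kx by unfold_locales (rule FA_rep N.two_category_axioms)+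
  note vop = is_entw0_vop[OF two_category_axioms] is_entw1_vop[OF two_category_axioms] is_entw2_vop[OF two_category_axioms]
  have 0: "on0 GA (sw0 x) \<in> obs K \<and> Vx x \<in> hom1 K (on0 GA (sw0 x)) (mob (ent_com x)) \<and> entw_mod (vop K) (sw0 x) (Vx x) (kx x) (Rx x)
      \<and> punt GA (sw0 x) = id2 K (id1 K (on0 GA (sw0 x))) \<and> on1 GA (id1 (entw (vop K)) (sw0 x)) = id1 K (on0 GA (sw0 x))"
    if x: "is_entw0 K x" for x
    using F.rep0[OF x] GA_strict_id[OF x] entw_mod_vop[OF x] entw0_ty(1)[OF x] by (simp add: GA_sw(1)[OF x] hom1_iff del: entw_sel(8))
  have 1: "\<exists>z \<in> hom1 K (s1 K M) (on0 GA (sw0 x)). Vx x \<cdot> z = M \<and> kx x \<triangleleft> z = r \<and> Rx x \<triangleleft> z = n"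
    if "is_entw0 K x" "entw_mod (vop K) (sw0 x) M r n" for x M r n
    using F.rep_ex[of x M n r] that by (auto simp add: entw_mod_vop GA_sw(1))
  have 2: "z = z'" if "is_entw0 K x" "z \<in> hom1 K l (on0 GA (sw0 x))" "z' \<in> hom1 K l (on0 GA (sw0 x))"
      "Vx x \<cdot> z = Vx x \<cdot> z'" "kx x \<triangleleft> z = kx x \<triangleleft> z'" "Rx x \<triangleleft> z = Rx x \<triangleleft> z'" for x l z z'
    by (rule F.rep_uniq1[of x]) (use that in \<open>simp_all add: GA_sw(1) hom1_iff\<close>)
  have 3: "y = y'" if "is_entw0 K x" "y \<in> twos K" "y' \<in> twos K" "t2 K y = t2 K y'" "s2 K y = s2 K y'" "t1 K (t2 K y') = on0 GA (sw0 x)"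
      "Vx x \<triangleright> y = Vx x \<triangleright> y'" for x y y'
    by (rule F.rep_uniq2[of x]) (use that parallel[of y'] in \<open>simp_all add: GA_sw(1)\<close>)
  have 4: "on1 GA (sw1 f) \<in> hom1 K (on0 GA (sw0 (esrc1 f))) (on0 GA (sw0 (etrg1 f))) \<and>
        Vx (etrg1 f) \<cdot> on1 GA (sw1 f) = eund1 f \<cdot> Vx (esrc1 f) \<and>
        kx (etrg1 f) \<triangleleft> on1 GA (sw1 f) = (ebeta f \<triangleleft> Vx (esrc1 f)) \<ast> (eund1 f \<triangleright> kx (esrc1 f)) \<and>
        Rx (etrg1 f) \<triangleleft> on1 GA (sw1 f) = (eund1 f \<triangleright> Rx (esrc1 f)) \<ast> (ealpha f \<triangleleft> Vx (esrc1 f))" if f: "is_entw1 K f" for f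
    using F.rep1[OF f] by (simp add: GA_sw(1)[OF entw1_parts(1)[OF f]] GA_sw(1)[OF entw1_parts(2)[OF f]] GA_sw(2)[OF f] hom1_iff)
  have 5: "on2 GA (sw2 w) \<in> hom2 K (on1 GA (sw1 (esrc2 w))) (on1 GA (sw1 (etrg2 w))) \<and>
        Vx (etrg1 (etrg2 w)) \<triangleright> on2 GA (sw2 w) = eund2 w \<triangleleft> Vx (esrc1 (etrg2 w))" if w: "is_entw2 K w" for w
    using F.rep2[OF w] by (simp add: GA_sw(2)[OF entw2_ty(1)[OF w]] GA_sw(2)[OF entw2_ty(2)[OF w]] GA_sw(3)[OF w] entw2_ty(3,4)[OF w] hom2_iff)
  have v0: "is_entw0 K (sw0 x) \<and> sw0 (sw0 x) = x" if "is_entw0 (vop K) x" for x using that vop(1)[of "sw0 x"] by simp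
  have v1: "is_entw1 K (sw1 f) \<and> sw1 (sw1 f) = f" if "is_entw1 (vop K) f" for f using that vop(2)[of "sw1 f"] by simp
  have v2: "is_entw2 K (sw2 w) \<and> sw2 (sw2 w) = w" if "is_entw2 (vop K) w" for w using that vop(3)[of "sw2 w"] by simp
  have 0: "on0 GA x \<in> obs K \<and> Vx (sw0 x) \<in> hom1 K (on0 GA x) (mob (ent_mon x)) \<and> entw_mod (vop K) x (Vx (sw0 x)) (kx (sw0 x)) (Rx (sw0 x))
      \<and> punt GA x = id2 K (id1 K (on0 GA x)) \<and> on1 GA (id1 (entw (vop K)) x) = id1 K (on0 GA x)" if "is_entw0 (vop K) x" for x
    using 0[of "sw0 x"] v0[OF that] by simp
  have 1: "\<exists>z \<in> hom1 K (s1 K M) (on0 GA x). Vx (sw0 x) \<cdot> z = M \<and> kx (sw0 x) \<triangleleft> z = r \<and> Rx (sw0 x) \<triangleleft> z = n"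
    if "is_entw0 (vop K) x" "entw_mod (vop K) x M r n" for x M r n
    using 1[of "sw0 x"] v0[OF that(1)] that by simp
  have 2: "z = z'" if "is_entw0 (vop K) x" "z \<in> hom1 K l (on0 GA x)" "z' \<in> hom1 K l (on0 GA x)"
      "Vx (sw0 x) \<cdot> z = Vx (sw0 x) \<cdot> z'" "kx (sw0 x) \<triangleleft> z = kx (sw0 x) \<triangleleft> z'" "Rx (sw0 x) \<triangleleft> z = Rx (sw0 x) \<triangleleft> z'" for x l z z'
    using 2[of "sw0 x"] v0[OF that(1)] that by simp
  have 3: "y = y'" if "is_entw0 (vop K) x" "y \<in> twos K" "y' \<in> twos K" "t2 K y = t2 K y'" "s2 K y = s2 K y'" "t1 K (t2 K y') = on0 GA x"
      "Vx (sw0 x) \<triangleright> y = Vx (sw0 x) \<triangleright> y'" for x y y'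
    using 3[of "sw0 x"] v0[OF that(1)] that by simp
  have 4: "on1 GA f \<in> hom1 K (on0 GA (esrc1 f)) (on0 GA (etrg1 f)) \<and>
        Vx (sw0 (etrg1 f)) \<cdot> on1 GA f = eund1 f \<cdot> Vx (sw0 (esrc1 f)) \<and>
        kx (sw0 (etrg1 f)) \<triangleleft> on1 GA f = (ealpha f \<triangleleft> Vx (sw0 (esrc1 f))) \<ast> (eund1 f \<triangleright> kx (sw0 (esrc1 f))) \<and>
        Rx (sw0 (etrg1 f)) \<triangleleft> on1 GA f = (eund1 f \<triangleright> Rx (sw0 (esrc1 f))) \<ast> (ebeta f \<triangleleft> Vx (sw0 (esrc1 f)))" if "is_entw1 (vop K) f" for f
    using 4[of "sw1 f"] v1[OF that] by simp
  have 5: "on2 GA w \<in> hom2 K (on1 GA (etrg2 w)) (on1 GA (esrc2 w)) \<and>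
        Vx (sw0 (etrg1 (esrc2 w))) \<triangleright> on2 GA w = eund2 w \<triangleleft> Vx (sw0 (esrc1 (esrc2 w)))" if "is_entw2 (vop K) w" for w
    using 5[of "sw2 w"] v2[OF that] by simp
  have 6: "pcmp GA g f = id2 K (on1 GA (cmp_entw1 (vop K) g f))" if "is_entw1 (vop K) f" "is_entw1 (vop K) g" "etrg1 f = esrc1 g" for f g
    using GA_strict[of "sw1 f" "sw1 g"] v1[OF that(1)] v1[OF that(2)] that(3) by simp
  show ?thesis
    unfolding represents_entw_mod_def vop_sel vop_hom using 0 1 2 3 4 5 6 by blast
qed

end

section \<open>Both composites as representations of the same modules\<close>

theorem theorem2p2:
  fixes K :: "('o, 'm, 'c) two_cat"
    and E Es :: "('o, 'm, 'c) em"
    and S Ss :: "('o, 'm, 'c) mon1 \<Rightarrow> ('m, 'c) splitting"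
  assumes "two_category K"
    and "em_for_monads K E"
    and "em_for_comonads K Es"
    and "idempotent_2cells_split K"
    and "splitting_choice K E S"
    and "splitting_choice (vop K) Es Ss"
  shows "pseudo_naturally_equivalent (entw K) K
           (comp_psfun K (emJ Es)
             (comp_psfun (cmd K) (cmd_psfun (mndi K) K (Q K E S)) (A_fun K)))
           (comp_psfun K (emJ E)
             (comp_psfun (mnd K) (mnd_psfun (cmdp K) K (Q_star K Es Ss)) (B_fun K)))
       \<and> (\<forall>T C \<psi>. weak_entwining K T C \<psi> \<longrightarrow>
           equivalent_objects K
             (on0 (emJ E) (on0 (mnd_psfun (cmdp K) K (Q_star K Es Ss)) (B0 K (Entw0 T C \<psi>))))
             (on0 (emJ Es) (on0 (cmd_psfun (mndi K) K (Q K E S)) (A0 K (Entw0 T C \<psi>)))))"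
proof -
  interpret em_pair K E S Es
    by (intro em_pair.intro em_split.intro em_monads.intro em_monads_axioms.intro em_split_axioms.intro
      em_comonads.intro em_comonads_axioms.intro assms)
  \<comment> \<open>In \<open>vop K\<close> the data for monads and for comonads exchange roles,
    with \<open>Ss\<close> now supplying the splittings. As \<open>vop\<close> is an involution,
    \<open>v.GA\<close> is formed in \<open>K\<close> itself and is the second composite of the
    claim.\<close>
  have "em_pair (vop K) Es Ss E"
    by (intro em_pair.intro em_split.intro em_monads_vop em_split_axioms.intro em_comonads.intro em_comonads_axioms.intro
      two_category_vop em_for_monads_vop assms)
  then interpret v: em_pair "vop K" Es Ss E .
  define G where "G = comp_psfun K (emJ E) (comp_psfun (mnd K) (mnd_psfun (cmdp K) K (Q_star K Es Ss)) (B_fun K))"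
  have G: "v.GA = G" unfolding v.GA_def G_def by (simp add: cmdp_eq Q_star_def)
  interpret two_entw_mod_represented K FA Vx Rx kx G "\<lambda>x. v.Vx (sw0 x)" "\<lambda>x. v.kx (sw0 x)" "\<lambda>x. v.Rx (sw0 x)"
    using FA_rep v.GA_rep[unfolded G] two_category_entw
    by (intro two_entw_mod_represented.intro entw_mod_represented.intro entw_mod_represented_axioms.intro) (simp_all add: two_category_axioms)
  \<comment> \<open>The pointwise claim names the object of the second composite first, so it uses
    the comparison in the opposite direction.\<close>
  interpret sw: two_entw_mod_represented K G "\<lambda>x. v.Vx (sw0 x)" "\<lambda>x. v.kx (sw0 x)" "\<lambda>x. v.Rx (sw0 x)" FA Vx Rx kx
    by (rule swapped)
  have "equivalent_objects K (on0 G (Entw0 T C \<psi>)) (on0 FA (Entw0 T C \<psi>))" if "weak_entwining K T C \<psi>" for T C \<psi>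
    using that by (intro sw.equivalent_at) (simp add: is_entw0_def)
  with equivalent show ?thesis
    unfolding FA_def G_def by (simp add: comp_psfun_def A_fun_def B_fun_def strict_psfun_def)
qed

end
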